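(* Let $\Omega\subset\mathbb{R}^N$ be a bounded open set, and let $\mu=\mu^+-\mu^-$, $\bar s$, $\kappa\ge0$, $s_\sharp$ be as in the context, with $1<p<\frac N{s_\sharp}$, $\lambda>0$ and $q\in(1,p^*_{s_\sharp})$. Let $\theta_0\in(0,1)$ and set $$c^*:=\frac{s_\sharp}{N}\big((1-\theta_0)\mathcal{S}(p)\big)^{\frac{N}{s_\sharp p}}-|\Omega|\Big(\frac{s_\sharp}{N}\Big)^{-\frac{q}{p^*_{s_\sharp}-q}}\Big[\lambda\Big(\frac1q-\frac1p\Big)\Big]^{\frac{p^*_{s_\sharp}}{p^*_{s_\sharp}-q}}\quad\text{when } q\in(1,p),$$ $$c^*:=\frac{s_\sharp}{N}\big((1-\theta_0)\mathcal{S}(p)\big)^{\frac{N}{s_\sharp p}}\quad\text{when } q\in[p,p^*_{s_\sharp}).$$ Then there exists $\kappa_0=\kappa_0(N,\Omega,p,s_\sharp,\theta_0)>0$ such that for any $\kappa\in[0,\kappa_0]$ and any $c\in(0,c^* )$, the functional $\mathcal{I}_\lambda$ satisfies the Palais–Smale condition at level $c$.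
   Context: Standing assumptions: $\bar s\in(0,1]$, $\kappa\ge0$; $\mu=\mu^+-\mu^-$ with $\mu^\pm$ nonnegative finite Borel measures on $[0,1]$ satisfying $\mu^+([\bar s,1])>0$, $\mu^-|_{[\bar s,1]}=0$, $\mu^-([0,\bar s])\le\kappa\,\mu^+([\bar s,1])$; $s_\sharp\in[\bar s,1]$ satisfies $\mu^+([s_\sharp,1])>0$; $p^*_{s_\sharp}=\frac{Np}{N-s_\sharp p}$. The assertion "for any $\kappa\in[0,\kappa_0]$" means: whenever these conditions hold with such a $\kappa$. $C_{N,s,p}=\frac{\frac{sp}{2}(1-s)2^{2s-1}}{\pi^{(N-1)/2}}\frac{\Gamma(\frac{N+ps}{2})}{\Gamma(\frac{p+1}{2})\Gamma(2-s)}$. For measurable $u:\mathbb{R}^N\to\mathbb{R}$: $[u]_{0,p}=\|u\|_{L^p(\mathbb{R}^N)}$; $[u]_{s,p}=\big(C_{N,s,p}\iint_{\mathbb{R}^{2N}}\frac{|u(x)-u(y)|^p}{|x-y|^{N+sp}}dx\,dy\big)^{1/p}$ for $s\in(0,1)$; $[u]_{1,p}=\|\nabla u\|_{L^p(\mathbb{R}^N)}$. $X_p(\Omega)$ is the Banach space of measurable $u:\mathbb{R}^N\to\mathbb{R}$ with $u=0$ in $\mathbb{R}^N\setminus\Omega$ and $\rho_p(u)=\big(\int_{[0,1]}[u]_{s,p}^p\,d\mu^+(s)\big)^{1/p}<\infty$, with norm $\rho_p$; it embeds continuously into $L^{p^*_{s_\sharp}}(\Omega)$. The best Sobolev constant is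 $\mathcal{S}(p)=\inf\{\int_{[0,1]}[u]_{s,p}^p\,d\mu^+(s): u\in X_p(\Omega),\ \|u\|_{L^{p^*_{s_\sharp}}(\Omega)}=1\}$. The functional $\mathcal{I}_\lambda:X_p(\Omega)\to\mathbb{R}$ is $\mathcal{I}_\lambda(u)=\frac1p\rho_p(u)^p-\frac1p\int_{[0,\bar s]}[u]_{s,p}^p\,d\mu^-(s)-\frac\lambda q\int_\Omega|u|^q\,dx-\frac1{p^*_{s_\sharp}}\int_\Omega|u|^{p^*_{s_\sharp}}\,dx$. It satisfies the Palais–Smale condition at level $c$ if every sequence $(u_n)\subset X_p(\Omega)$ with $\mathcal{I}_\lambda(u_n)\to c$ and $\mathcal{I}_\lambda'(u_n)\to0$ in the dual of $X_p(\Omega)$ has a subsequence converging strongly in $X_p(\Omega)$. *)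

theory Defs
  imports "HOL-Analysis.Analysis"
begin

text \<open>The Euclidean space of dimension \<open>N\<close> is a type \<open>'a :: euclidean_space\<close> with \<open>N = DIM('a)\<close>.
  Functions are not quotiented by a.e. equality; all functionals below are invariant under it.\<close>

section \<open>Weak gradients\<close>

primrec Ck_fun :: "nat \<Rightarrow> ('a::euclidean_space \<Rightarrow> real) \<Rightarrow> bool" where
  "Ck_fun 0 f \<longleftrightarrow> continuous_on UNIV f"
| "Ck_fun (Suc k) f \<longleftrightarrow>
     (\<forall>x. f differentiable (at x)) \<and>
     (\<forall>b\<in>Basis. Ck_fun k (\<lambda>x. frechet_derivative f (at x) b))"

definition test_fun :: "('a::euclidean_space \<Rightarrow> real) \<Rightarrow> bool" where
  "test_fun \<phi> \<longleftrightarrow> (\<forall>k. Ck_fun k \<phi>) \<and> compact (closure {x. \<phi> x \<noteq> 0})"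

definition weak_gradient :: "('a::euclidean_space \<Rightarrow> real) \<Rightarrow> ('a \<Rightarrow> 'a) \<Rightarrow> bool" where
  "weak_gradient u g \<longleftrightarrow>
     u \<in> borel_measurable lebesgue \<and> g \<in> borel_measurable lebesgue \<and>
     (\<forall>K. compact K \<longrightarrow> set_integrable lebesgue K u \<and> set_integrable lebesgue K g) \<and>
     (\<forall>\<phi>. test_fun \<phi> \<longrightarrow> (\<forall>b\<in>Basis.
        (LINT x|lebesgue. u x * frechet_derivative \<phi> (at x) b)
          = - (LINT x|lebesgue. (g x \<bullet> b) * \<phi> x)))"

section \<open>The seminorms and the space\<close>

definition frac_const :: "real \<Rightarrow> real \<Rightarrow> real \<Rightarrow> real" where
  "frac_const N s p =
     (s * p / 2 * (1 - s) * 2 powr (2 * s - 1)) / (pi powr ((N - 1) / 2))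
     * (Gamma ((N + p * s) / 2) / (Gamma ((p + 1) / 2) * Gamma (2 - s)))"

text \<open>\<open>seminorm_pow p s u\<close> is the \<open>p\<close>-th power of the seminorm of order \<open>s \<in> [0,1]\<close>, the only
  form in which these seminorms are used.  For \<open>s = 1\<close> the weak gradient is a.e. unique, so the
  infimum is over at most one value; it is \<open>\<infinity>\<close> when there is no weak gradient.\<close>

definition seminorm_pow :: "real \<Rightarrow> real \<Rightarrow> ('a::euclidean_space \<Rightarrow> real) \<Rightarrow> ennreal" where
  "seminorm_pow p s u =
     (if s = 0 then (\<integral>\<^sup>+x. ennreal (\<bar>u x\<bar> powr p) \<partial>lebesgue)
      else if s = 1 then
        (INF g\<in>{g. weak_gradient u g}. \<integral>\<^sup>+x. ennreal (norm (g x) powr p) \<partial>lebesgue)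
      else
        ennreal (frac_const (real DIM('a)) s p) *
        (\<integral>\<^sup>+z. ennreal (\<bar>u (fst z) - u (snd z)\<bar> powr p
                   / norm (fst z - snd z) powr (real DIM('a) + s * p))
           \<partial>(lebesgue :: ('a \<times> 'a) measure)))"

definition finite_borel_on_unit :: "real measure \<Rightarrow> bool" where
  "finite_borel_on_unit M \<longleftrightarrow> finite_measure M \<and> sets M = sets (restrict_space borel {0..1})"

definition rho :: "real measure \<Rightarrow> real \<Rightarrow> ('a::euclidean_space \<Rightarrow> real) \<Rightarrow> real" where
  "rho \<mu>p p u = enn2real (\<integral>\<^sup>+s. seminorm_pow p s u \<partial>\<mu>p) powr (1 / p)"

definition Xp :: "real measure \<Rightarrow> 'a::euclidean_space set \<Rightarrow> real \<Rightarrow> ('a \<Rightarrow> real) set" where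
  "Xp \<mu>p \<Omega> p =
     {u. u \<in> borel_measurable lebesgue \<and> (AE x in lebesgue. x \<notin> \<Omega> \<longrightarrow> u x = 0)
         \<and> (\<integral>\<^sup>+s. seminorm_pow p s u \<partial>\<mu>p) < \<infinity>}"

definition crit_exp :: "real \<Rightarrow> real \<Rightarrow> real \<Rightarrow> real" where
  "crit_exp N s p = N * p / (N - s * p)"

text \<open>If \<open>\<Omega>\<close> is empty, the infimum below is over the empty set and has an unspecified value.\<close>

definition best_sobolev :: "real measure \<Rightarrow> 'a::euclidean_space set \<Rightarrow> real \<Rightarrow> real \<Rightarrow> real" where
  "best_sobolev \<mu>p \<Omega> p ssharp =
     (let r = crit_exp (real DIM('a)) ssharp p in
      Inf {enn2real (\<integral>\<^sup>+s. seminorm_pow p s u \<partial>\<mu>p) | u.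
             u \<in> Xp \<mu>p \<Omega> p \<and> (LINT x:\<Omega>|lebesgue. \<bar>u x\<bar> powr r) powr (1 / r) = 1})"

section \<open>The functional and the Palais-Smale condition\<close>

definition I_functional ::
  "real measure \<Rightarrow> real measure \<Rightarrow> real \<Rightarrow> real \<Rightarrow> 'a::euclidean_space set \<Rightarrow> real \<Rightarrow> real \<Rightarrow> real
    \<Rightarrow> ('a \<Rightarrow> real) \<Rightarrow> real" where
  "I_functional \<mu>p \<mu>m sbar ssharp \<Omega> p q lam u =
     (let r = crit_exp (real DIM('a)) ssharp p in
        1 / p * rho \<mu>p p u powr p
      - 1 / p * enn2real (\<integral>\<^sup>+s\<in>{0..sbar}. seminorm_pow p s u \<partial>\<mu>m)
      - lam / q * (LINT x:\<Omega>|lebesgue. \<bar>u x\<bar> powr q)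
      - 1 / r * (LINT x:\<Omega>|lebesgue. \<bar>u x\<bar> powr r))"

text \<open>Since \<open>X\<close> with norm \<open>nrm\<close> is a set of functions and not a type, duals and Frechet
  derivatives are spelled out relative to the carrier \<open>X\<close>.\<close>

definition dual_elem ::
  "('a \<Rightarrow> real) set \<Rightarrow> (('a \<Rightarrow> real) \<Rightarrow> real) \<Rightarrow> (('a \<Rightarrow> real) \<Rightarrow> real) \<Rightarrow> bool" where
  "dual_elem X nrm L \<longleftrightarrow>
     (\<forall>u\<in>X. \<forall>v\<in>X. L (\<lambda>x. u x + v x) = L u + L v) \<and>
     (\<forall>a. \<forall>u\<in>X. L (\<lambda>x. a * u x) = a * L u) \<and>
     (\<exists>B. \<forall>u\<in>X. \<bar>L u\<bar> \<le> B * nrm u)"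

definition dual_norm ::
  "('a \<Rightarrow> real) set \<Rightarrow> (('a \<Rightarrow> real) \<Rightarrow> real) \<Rightarrow> (('a \<Rightarrow> real) \<Rightarrow> real) \<Rightarrow> real" where
  "dual_norm X nrm L = (SUP v\<in>{v\<in>X. nrm v \<le> 1}. \<bar>L v\<bar>)"

definition frechet_deriv_in ::
  "('a \<Rightarrow> real) set \<Rightarrow> (('a \<Rightarrow> real) \<Rightarrow> real) \<Rightarrow> (('a \<Rightarrow> real) \<Rightarrow> real)
    \<Rightarrow> ('a \<Rightarrow> real) \<Rightarrow> (('a \<Rightarrow> real) \<Rightarrow> real) \<Rightarrow> bool" where
  "frechet_deriv_in X nrm J u L \<longleftrightarrow>
     dual_elem X nrm L \<and>
     (\<forall>\<epsilon>>0. \<exists>\<delta>>0. \<forall>v\<in>X. nrm v < \<delta> \<longrightarrow>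
        \<bar>J (\<lambda>x. u x + v x) - J u - L v\<bar> \<le> \<epsilon> * nrm v)"

definition palais_smale_at ::
  "('a \<Rightarrow> real) set \<Rightarrow> (('a \<Rightarrow> real) \<Rightarrow> real) \<Rightarrow> (('a \<Rightarrow> real) \<Rightarrow> real) \<Rightarrow> real \<Rightarrow> bool" where
  "palais_smale_at X nrm J c \<longleftrightarrow>
     (\<forall>u. (\<forall>n. u n \<in> X) \<and> (\<lambda>n. J (u n)) \<longlonglongrightarrow> c \<and>
          (\<exists>L. (\<forall>n. frechet_deriv_in X nrm J (u n) (L n)) \<and> (\<lambda>n. dual_norm X nrm (L n)) \<longlonglongrightarrow> 0)
        \<longrightarrow> (\<exists>(k :: nat \<Rightarrow> nat) w. strict_mono k \<and> w \<in> X \<and>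
               (\<lambda>n. nrm (\<lambda>x. u (k n) x - w x)) \<longlonglongrightarrow> 0))"

definition c_star ::
  "real measure \<Rightarrow> 'a::euclidean_space set \<Rightarrow> real \<Rightarrow> real \<Rightarrow> real \<Rightarrow> real \<Rightarrow> real \<Rightarrow> real" where
  "c_star \<mu>p \<Omega> p ssharp \<theta>0 q lam =
     (let N = real DIM('a);
          r = crit_exp N ssharp p;
          c0 = ssharp / N * ((1 - \<theta>0) * best_sobolev \<mu>p \<Omega> p ssharp) powr (N / (ssharp * p))
      in if q < p
         then c0 - measure lebesgue \<Omega> * (ssharp / N) powr (- (q / (r - q)))
                   * (lam * (1 / q - 1 / p)) powr (r / (r - q))
         else c0)"

end

theory Submission
  imports Defs "HOL-Computational_Algebra.Polynomial" "HOL-Library.Diagonal_Subsequence"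
begin

text \<open>The total energy of \<open>u\<close> is the \<open>p\<close>-th power of the norm of a single vector-valued map \<open>dmap u\<close> in an
  \<open>L\<^sup>p\<close> space, so the functional and its derivative are integrals of \<open>norm v powr p\<close> and of the flux
  \<open>norm v powr (p - 2) *\<^sub>R v\<close> at \<open>v = dmap u z\<close>.  Cut into dyadic shells, the Gagliardo energy of order
  \<open>s\<close> becomes an Abel mean of a monotone sequence; as these means are monotone in \<open>s\<close>, the energies of order
  \<open>s \<le> s'\<close> satisfy \<open>seminorm_pow p s u \<le> C * seminorm_pow p s' u\<close> with \<open>C\<close> independent of \<open>s\<close>, \<open>s'\<close>.
  Hence for \<open>\<kappa> \<le> 1 / (2 * C)\<close> the negative part of the measure takes up at most half of the energy, and by
  interpolation it vanishes along bounded sequences that tend to zero in \<open>L\<^sup>p\<close>.  A Palais-Smale sequence is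
  bounded and converges almost everywhere along a subsequence; testing with \<open>arctan (u m - u n)\<close> gives the
  same for \<open>dmap (u n)\<close>.  The Brezis-Lieb lemma then transfers the equation to the remainder
  \<open>u n - w\<close>, whose energy tends either to zero or to a value that the Sobolev inequality bounds below by the
  critical level.\<close>

section \<open>The duality map of the $p$-energy\<close>

text \<open>\<open>\<kappa>0\<close> is chosen before either measure, so the comparison of seminorms
  has to be uniform up to the orders 0 and 1, where \<open>frac_const\<close> vanishes like
  \<open>s * (1 - s)\<close>. The factor \<open>1 - x\<close> of an Abel mean absorbs
  \<open>1 - s\<close>, and the sum over far shells absorbs \<open>s\<close>.

  A bounded energy does not let limits pass through the nonlinear flux; almost everywhere
  convergence of \<open>dmap\<close> does. For orders below 1 it follows from that of the functions,
  and only an atom at 1 asks for convergence of gradients. The obstacle there is the critical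
  integral, which is not compact. A bounded test function tames it: its higher powers are controlled
  by the first power, hence by an \<open>L\<^sup>1\<close> distance.

  Functions in \<open>Xp\<close> are only Lebesgue measurable, with zero values outside
  \<open>\<Omega>\<close> almost everywhere, whereas \<open>dmap\<close> asks for Borel functions;
  the argument runs on representatives and returns to \<open>Xp\<close> at the end. A divergent
  integral has the default value 0, so a bound on an integral yields integrability only after
  truncation, again by \<open>arctan\<close>.\<close>

definition pflux :: "real \<Rightarrow> 'e::euclidean_space \<Rightarrow> 'e" where
  "pflux p v = norm v powr (p - 2) *\<^sub>R v"

lemma pflux_0 [simp]: "pflux p 0 = 0"
  by (simp add: pflux_def)

lemma norm_pflux: "norm (pflux p v) = norm v powr (p - 1)"
proof (cases "v = 0")
  case False
  then have "norm v powr (p - 2) * norm v powr 1 = norm v powr (p - 1)"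
    by (subst powr_add [symmetric]) simp
  then show ?thesis using False by (simp add: pflux_def)
qed (simp add: pflux_def)

lemma pflux_inner_self: "pflux p v \<bullet> v = norm v powr p"
proof (cases "v = 0")
  case False
  then have "norm v powr (p - 2) * norm v powr 2 = norm v powr p"
    by (subst powr_add [symmetric]) simp
  moreover have "norm v powr 2 = v \<bullet> v"
    using False by (simp add: powr_numeral power2_norm_eq_inner)
  ultimately show ?thesis by (simp add: pflux_def)
qed simp

lemma powr_p_mult: "x powr (p - 1) * x = x powr p" if "x \<ge> 0" for x p :: real
proof (cases "x = 0")
  case False
  then have "x powr (p - 1) * x powr 1 = x powr p" using that by (subst powr_add [symmetric]) simp
  then show ?thesis using that False by simp
qed simp

lemma pflux_inner_le: "pflux p a \<bullet> b \<le> norm a powr (p - 1) * norm b"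
  by (metis norm_cauchy_schwarz norm_pflux)

lemma abs_pflux_inner_le: "\<bar>pflux p a \<bullet> b\<bar> \<le> norm a powr (p - 1) * norm b"
  by (metis Cauchy_Schwarz_ineq2 norm_pflux)

text \<open>For \<open>p < 2\<close> the factor \<open>norm v powr (p - 2)\<close> is unbounded near
  0; continuity there comes from the exponent \<open>p - 1 > 0\<close> of the norm of the whole
  vector.\<close>

lemma continuous_on_pflux:
  assumes "p > 1"
  shows "continuous_on UNIV (pflux p :: 'e::euclidean_space \<Rightarrow> 'e)"
proof -
  have "isCont (pflux p) x" for x :: 'e
  proof (cases "x = 0")
    case True
    have "((\<lambda>v::'e. norm v powr (p - 1)) \<longlongrightarrow> 0) (at 0)"
      using assms tendsto_norm_zero [OF tendsto_ident_at, of 0]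
      by (intro tendsto_eq_intros tendsto_zero_powrI) auto
    then have "((\<lambda>v::'e. norm (pflux p v)) \<longlongrightarrow> 0) (at 0)"
      by (simp add: norm_pflux)
    then show ?thesis
      using True tendsto_norm_zero_cancel by (auto simp: isCont_def)
  next
    case False
    then show ?thesis unfolding pflux_def by (intro continuous_intros) auto
  qed
  then show ?thesis by (simp add: continuous_at_imp_continuous_on)
qed

lemma borel_measurable_pflux [measurable]:
  assumes "p > 1" shows "(pflux p :: 'e::euclidean_space \<Rightarrow> 'e) \<in> borel_measurable borel"
  using continuous_on_pflux [OF assms] by (rule borel_measurable_continuous_onI)

lemma powr_less_mono_p: "p > 1 \<Longrightarrow> 0 \<le> x \<Longrightarrow> x < y \<Longrightarrow> x powr (p - 1) < y powr (p - 1)" for x y p :: real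
  by (intro powr_less_mono2) auto

text \<open>Cauchy-Schwarz in the two mixed terms reduces the gap to its value on the norms, a
  product of two factors of equal sign when \<open>p > 1\<close>.\<close>

lemma pflux_mono_lower:
  "(pflux p a - pflux p b) \<bullet> (a - b) \<ge> (norm a powr (p - 1) - norm b powr (p - 1)) * (norm a - norm b)"
proof -
  have "(pflux p a - pflux p b) \<bullet> (a - b) =
      norm a powr p + norm b powr p - pflux p a \<bullet> b - pflux p b \<bullet> a"
    by (simp add: inner_diff_left inner_diff_right pflux_inner_self)
  also have "\<dots> \<ge> norm a powr p + norm b powr p - norm a powr (p - 1) * norm b - norm b powr (p - 1) * norm a"
    using pflux_inner_le [of p a b] pflux_inner_le [of p b a] by simp
  also have "norm a powr p + norm b powr p - norm a powr (p - 1) * norm b - norm b powr (p - 1) * norm a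
     = (norm a powr (p - 1) - norm b powr (p - 1)) * (norm a - norm b)"
    using powr_p_mult [of "norm a" p] powr_p_mult [of "norm b" p] by (simp add: algebra_simps)
  finally show ?thesis .
qed

text \<open>The bound by norms is positive unless the norms agree. In that case both fluxes carry
  the same positive scalar, and the gap is this scalar times the square of
  \<open>norm (a - b)\<close>.\<close>

lemma pflux_strict_mono:
  assumes "p > 1" "a \<noteq> b"
  shows "(pflux p a - pflux p b) \<bullet> (a - b) > 0"
proof (cases "norm a = norm b")
  case True
  have "(pflux p a - pflux p b) \<bullet> (a - b) = norm a powr (p - 2) * (norm (a - b))\<^sup>2"
    by (simp add: pflux_def True power2_norm_eq_inner inner_diff_left inner_diff_right algebra_simps)
  moreover have "norm a > 0" using assms True by auto
  ultimately show ?thesis using assms by simp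
next
  case False
  have "(norm a powr (p - 1) - norm b powr (p - 1)) * (norm a - norm b) > 0"
  proof (cases "norm a < norm b")
    case True
    then show ?thesis using powr_less_mono_p [OF assms(1) _ True] by (simp add: mult_neg_neg)
  next
    case F: False
    have "norm b < norm a" using F False by simp
    from powr_less_mono_p [OF assms(1) _ this] this show ?thesis by simp
  qed
  then show ?thesis using pflux_mono_lower [where p=p and a=a and b=b] by linarith
qed

lemma pflux_mono:
  assumes "p > 1" shows "(pflux p a - pflux p b) \<bullet> (a - b) \<ge> 0"
  using pflux_strict_mono [OF assms, of a b] by (cases "a = b") auto

section \<open>Convexity and growth inequalities for powers of the norm\<close>

lemma powr_tangent:
  fixes x y p :: real
  assumes "p > 1" "x \<ge> 0" "y \<ge> 0"
  shows "y powr p \<ge> x powr p + p * x powr (p - 1) * (y - x)"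
proof -
  have "y * x powr (p - 1) \<le> y powr p / p + (x powr (p - 1)) powr (p / (p - 1)) / (p / (p - 1))"
    using assms by (intro Youngs_inequality) (auto simp: field_simps)
  also have "(x powr (p - 1)) powr (p / (p - 1)) = x powr p"
    using assms by (simp add: powr_powr)
  finally have "p * (y * x powr (p - 1)) \<le> p * (y powr p / p + x powr p / (p / (p - 1)))"
    using assms by (intro mult_left_mono) auto
  also have "\<dots> = y powr p + (p - 1) * x powr p" using assms by (simp add: field_simps)
  finally have "y powr p \<ge> p * (y * x powr (p - 1)) - (p - 1) * x powr p" by simp
  then show ?thesis using powr_p_mult [of x p] assms by (simp add: algebra_simps)
qed

lemma norm_powr_tangent:
  fixes a b :: "'e::euclidean_space"
  assumes "p > 1"
  shows "norm b powr p \<ge> norm a powr p + p * (pflux p a \<bullet> (b - a))"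
proof -
  have "pflux p a \<bullet> (b - a) \<le> norm a powr (p - 1) * norm b - norm a powr p"
    using pflux_inner_le [of p a b] by (simp add: inner_diff_right pflux_inner_self)
  also have "\<dots> = norm a powr (p - 1) * (norm b - norm a)"
    using powr_p_mult [of "norm a" p] by (simp add: algebra_simps)
  finally have "p * (pflux p a \<bullet> (b - a)) \<le> p * (norm a powr (p - 1) * (norm b - norm a))"
    using assms by (intro mult_left_mono) auto
  then show ?thesis using powr_tangent [OF assms, of "norm a" "norm b"] by (simp add: mult.assoc)
qed

text \<open>The tangent inequality at both ends of the segment: the increment of the convex function
  lies between its two end derivatives. \<open>Lp_gateaux\<close> integrates this sandwich.\<close>

lemma norm_powr_add_bounds:
  fixes a b :: "'e::euclidean_space"
  assumes "p > 1"
  shows "p * (pflux p a \<bullet> b) \<le> norm (a + b) powr p - norm a powr p"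
    and "norm (a + b) powr p - norm a powr p \<le> p * (pflux p (a + b) \<bullet> b)"
  using norm_powr_tangent [OF assms, of a "a + b"] norm_powr_tangent [OF assms, of "a + b" a]
  by (auto simp: inner_minus_right)

lemma abs_norm_powr_add_le:
  fixes a b :: "'e::euclidean_space"
  assumes "p > 1"
  shows "\<bar>norm (a + b) powr p - norm a powr p\<bar> \<le> p * (norm a + norm b) powr (p - 1) * norm b"
proof -
  have "pflux p (a + b) \<bullet> b \<le> norm (a + b) powr (p - 1) * norm b" by (rule pflux_inner_le)
  also have "\<dots> \<le> (norm a + norm b) powr (p - 1) * norm b"
    using assms by (intro mult_right_mono powr_mono2 norm_triangle_ineq) auto
  finally have 1: "p * (pflux p (a + b) \<bullet> b) \<le> p * ((norm a + norm b) powr (p - 1) * norm b)"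
    using assms by (intro mult_left_mono) auto
  have "- (pflux p a \<bullet> b) \<le> norm a powr (p - 1) * norm b"
    using abs_pflux_inner_le [of p a b] by linarith
  also have "\<dots> \<le> (norm a + norm b) powr (p - 1) * norm b"
    using assms by (intro mult_right_mono powr_mono2) auto
  finally have 2: "p * (- (pflux p a \<bullet> b)) \<le> p * ((norm a + norm b) powr (p - 1) * norm b)"
    using assms by (intro mult_left_mono) auto
  show ?thesis using 1 2 norm_powr_add_bounds [OF assms, of a b] by (simp add: abs_le_iff mult.assoc)
qed

lemma powr_add_le:
  fixes x y p :: real
  assumes "p \<ge> 0" "x \<ge> 0" "y \<ge> 0"
  shows "(x + y) powr p \<le> 2 powr p * (x powr p + y powr p)"
proof -
  have "(x + y) powr p \<le> (2 * max x y) powr p" using assms by (intro powr_mono2) auto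
  also have "\<dots> = 2 powr p * max x y powr p" using assms by (simp add: powr_mult)
  also have "\<dots> \<le> 2 powr p * (x powr p + y powr p)" using assms by (intro mult_left_mono) (auto simp: max_def)
  finally show ?thesis .
qed

lemma norm_powr_add_le: "p \<ge> 0 \<Longrightarrow> norm (a + b) powr p \<le> 2 powr p * (norm a powr p + norm b powr p)"
  for a b :: "'e::real_normed_vector"
  using powr_add_le [of p "norm a" "norm b"] powr_mono2 [of p "norm (a + b)" "norm a + norm b"]
    norm_triangle_ineq [of a b] by simp

lemma norm_powr_diff_le: "p \<ge> 0 \<Longrightarrow> norm (a - b) powr p \<le> 2 powr p * (norm a powr p + norm b powr p)"
  for a b :: "'e::real_normed_vector"
  using norm_powr_add_le [of p a "- b"] by simp

text \<open>Below \<open>y = \<epsilon> * x\<close> the first term suffices; above it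
  \<open>x\<close> is at most \<open>y / \<epsilon>\<close>, which produces the constant
  \<open>(1 / \<epsilon>) powr (p - 1)\<close>.\<close>

lemma young_eps:
  fixes p \<epsilon> :: real
  assumes "p > 1" "\<epsilon> > 0"
  shows "\<exists>C\<ge>0. \<forall>x\<ge>0. \<forall>y\<ge>0. x powr (p - 1) * y \<le> \<epsilon> * x powr p + C * y powr p"
proof (intro exI [where x="(1 / \<epsilon>) powr (p - 1)"] conjI allI impI)
  fix x y :: real assume xy: "x \<ge> 0" "y \<ge> 0"
  show "x powr (p - 1) * y \<le> \<epsilon> * x powr p + (1 / \<epsilon>) powr (p - 1) * y powr p"
  proof (cases "y \<le> \<epsilon> * x")
    case True
    then have "x powr (p - 1) * y \<le> x powr (p - 1) * (\<epsilon> * x)" by (intro mult_left_mono) auto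
    also have "\<dots> = \<epsilon> * x powr p" using powr_p_mult [of x p] xy by simp
    finally show ?thesis by (smt (verit) mult_nonneg_nonneg powr_ge_zero)
  next
    case False
    then have "x \<le> (1 / \<epsilon>) * y" using assms by (simp add: field_simps)
    then have "x powr (p - 1) * y \<le> ((1 / \<epsilon>) * y) powr (p - 1) * y"
      using assms xy by (intro mult_right_mono powr_mono2) auto
    also have "\<dots> = (1 / \<epsilon>) powr (p - 1) * (y powr (p - 1) * y)"
      using assms xy by (simp only: powr_mult mult.assoc)
    also have "\<dots> = (1 / \<epsilon>) powr (p - 1) * y powr p" using powr_p_mult [of y p] xy by simp
    finally show ?thesis using assms by (smt (verit) mult_nonneg_nonneg powr_ge_zero)
  qed
qed simp

lemma brezis_lieb_pointwise:
  fixes p \<epsilon> :: real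
  assumes "p > 1" "\<epsilon> > 0"
  shows "\<exists>C\<ge>0. \<forall>a b::'e::euclidean_space.
    \<bar>norm (a + b) powr p - norm a powr p\<bar> \<le> \<epsilon> * norm a powr p + C * norm b powr p"
proof -
  \<comment> \<open>The divisor cancels the factor \<open>p\<close> of the mean value bound and the
    \<open>2 powr p\<close> from expanding \<open>(norm a + norm b) powr p\<close>.\<close>
  define e where "e = \<epsilon> / (p * 2 powr p)"
  have e: "e > 0" using assms by (simp add: e_def)
  obtain C where C: "C \<ge> 0" "\<And>x y. x \<ge> 0 \<Longrightarrow> y \<ge> 0 \<Longrightarrow> x powr (p - 1) * y \<le> e * x powr p + C * y powr p"
    using young_eps [OF assms(1) e] by auto
  show ?thesis
  proof (intro exI [where x="\<epsilon> + p * C"] conjI allI)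
    fix a b :: 'e
    have "\<bar>norm (a + b) powr p - norm a powr p\<bar> \<le> p * ((norm a + norm b) powr (p - 1) * norm b)"
      using abs_norm_powr_add_le [OF assms(1), of a b] by (simp add: mult.assoc)
    also have "\<dots> \<le> p * (e * (norm a + norm b) powr p + C * norm b powr p)"
      using assms by (intro mult_left_mono C) auto
    also have "\<dots> \<le> p * (e * (2 powr p * (norm a powr p + norm b powr p)) + C * norm b powr p)"
      using assms e by (intro mult_left_mono add_right_mono powr_add_le) auto
    also have "\<dots> = \<epsilon> * norm a powr p + (\<epsilon> + p * C) * norm b powr p"
      using assms by (simp add: e_def field_simps)
    finally show "\<bar>norm (a + b) powr p - norm a powr p\<bar> \<le> \<epsilon> * norm a powr p + (\<epsilon> + p * C) * norm b powr p" .
  qed (use assms C in auto)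
qed

text \<open>The two powers balance at \<open>x = (1 / \<epsilon>) powr (1 / (r - q))\<close>: up to
  there the constant bounds \<open>x powr q\<close>, beyond it the higher power dominates.\<close>

lemma powr_le_eps:
  fixes q r \<epsilon> :: real
  assumes "0 < q" "q < r" "\<epsilon> > 0"
  shows "\<exists>C\<ge>0. \<forall>x\<ge>0. x powr q \<le> \<epsilon> * x powr r + C"
proof (intro exI [where x="(1 / \<epsilon>) powr (q / (r - q))"] conjI allI impI)
  fix x :: real assume x: "x \<ge> 0"
  let ?t = "(1 / \<epsilon>) powr (1 / (r - q))"
  show "x powr q \<le> \<epsilon> * x powr r + (1 / \<epsilon>) powr (q / (r - q))"
  proof (cases "x \<le> ?t")
    case True
    then have "x powr q \<le> ?t powr q" using assms x by (intro powr_mono2) auto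
    also have "\<dots> = (1 / \<epsilon>) powr (q / (r - q))" by (simp add: powr_powr)
    finally show ?thesis using assms by (smt (verit) mult_nonneg_nonneg powr_ge_zero)
  next
    case False
    then have xp: "x > 0" using powr_ge_zero [of "1/\<epsilon>" "1/(r-q)"] by linarith
    have "1 / \<epsilon> = ?t powr (r - q)" using assms by (simp add: powr_powr)
    also have "\<dots> \<le> x powr (r - q)" using assms False by (intro powr_mono2) auto
    finally have "1 \<le> \<epsilon> * x powr (r - q)" using assms by (simp add: field_simps)
    then have "x powr q * 1 \<le> x powr q * (\<epsilon> * x powr (r - q))" by (intro mult_left_mono) auto
    also have "\<dots> = \<epsilon> * x powr r" using xp by (simp add: powr_add [symmetric] mult.left_commute)
    finally show ?thesis using powr_ge_zero [of "1/\<epsilon>" "q/(r-q)"] by linarith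
  qed
qed simp

text \<open>By compactness: when \<open>norm (a - b)\<close> exceeds the first term on the right, \<open>a\<close> and \<open>b\<close> range
  over a bounded set away from the diagonal, where the monotonicity gap has a positive minimum.\<close>

lemma norm_diff_le_pflux_gap:
  fixes p \<epsilon> :: real
  assumes p: "p > 1" and eps: "\<epsilon> > 0"
  shows "\<exists>C\<ge>0. \<forall>a b::'e::euclidean_space.
    norm (a - b) \<le> \<epsilon> * (1 + norm a powr p + norm b powr p) + C * ((pflux p a - pflux p b) \<bullet> (a - b))"
proof -
  obtain R where R: "R \<ge> 0" "\<And>x. x \<ge> 0 \<Longrightarrow> x powr 1 \<le> \<epsilon> / 2 * x powr p + R"
    using powr_le_eps [of 1 p "\<epsilon>/2"] p eps by auto
  \<comment> \<open>On the exceptional pairs the superlinear terms are at most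
    \<open>norm a + norm b\<close>, and half of them plus \<open>2 * R\<close> bounds the same sum;
    hence \<open>norm a + norm b \<le> 4 * R\<close>.\<close>
  define B where "B = 4 * R"
  define K where "K = {z::'e \<times> 'e. z \<in> cball 0 B \<times> cball 0 B \<and> norm (fst z - snd z) \<ge> \<epsilon>}"
  have bd: "(a, b) \<in> K" if ab: "norm (a - b) > \<epsilon> * (1 + norm a powr p + norm b powr p)" for a b :: 'e
  proof -
    have "\<epsilon> * (1 + norm a powr p + norm b powr p) \<le> norm a + norm b"
      using ab norm_triangle_ineq4 [of a b] by linarith
    then have "\<epsilon> + \<epsilon> * norm a powr p + \<epsilon> * norm b powr p \<le> norm a + norm b" by (simp add: distrib_left)
    moreover have "norm a \<le> \<epsilon> / 2 * norm a powr p + R" "norm b \<le> \<epsilon> / 2 * norm b powr p + R"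
      using R(2) [of "norm a"] R(2) [of "norm b"] by auto
    ultimately have "norm a + norm b \<le> B" using eps unfolding B_def by (simp add: field_simps)
    then have "norm a \<le> B" "norm b \<le> B" using norm_ge_zero [of a] norm_ge_zero [of b] by linarith+
    moreover have "norm (a - b) \<ge> \<epsilon>"
    proof -
      have "\<epsilon> * 1 \<le> \<epsilon> * (1 + norm a powr p + norm b powr p)" using eps by (intro mult_left_mono) auto
      then show ?thesis using ab by linarith
    qed
    ultimately show ?thesis by (simp add: K_def)
  qed
  have "compact K"
  proof -
    have "K = (cball 0 B \<times> cball 0 B) \<inter> {z. \<epsilon> \<le> norm (fst z - snd z)}" by (auto simp: K_def)
    moreover have "closed {z::'e \<times> 'e. \<epsilon> \<le> norm (fst z - snd z)}"
      by (intro closed_Collect_le continuous_intros)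
    ultimately show ?thesis by (simp add: compact_Int_closed compact_Times)
  qed
  let ?E = "\<lambda>z::'e \<times> 'e. (pflux p (fst z) - pflux p (snd z)) \<bullet> (fst z - snd z)"
  have cont: "continuous_on K ?E"
    by (intro continuous_intros continuous_on_compose2 [OF continuous_on_pflux [OF p]]) auto
  have pos: "?E z > 0" if "z \<in> K" for z
    using that eps pflux_strict_mono [OF p, of "fst z" "snd z"] by (fastforce simp: K_def)
  obtain \<delta> where \<delta>: "\<delta> > 0" "\<And>z. z \<in> K \<Longrightarrow> ?E z \<ge> \<delta>"
  proof (cases "K = {}")
    case True
    then show ?thesis using that [of 1] by auto
  next
    case False
    then obtain z where z: "z \<in> K" "\<And>y. y \<in> K \<Longrightarrow> ?E z \<le> ?E y"
      using continuous_attains_inf [OF \<open>compact K\<close> False cont] by auto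
    then show ?thesis using that [of "?E z"] pos by auto
  qed
  have B0: "B \<ge> 0" using R by (simp add: B_def)
  show ?thesis
  proof (intro exI [where x="2 * B / \<delta>"] conjI allI)
    fix a b :: 'e
    have gap: "(pflux p a - pflux p b) \<bullet> (a - b) \<ge> 0" by (rule pflux_mono [OF p])
    show "norm (a - b) \<le> \<epsilon> * (1 + norm a powr p + norm b powr p)
        + 2 * B / \<delta> * ((pflux p a - pflux p b) \<bullet> (a - b))"
    proof (cases "norm (a - b) > \<epsilon> * (1 + norm a powr p + norm b powr p)")
      case True
      then have k: "(a, b) \<in> K" by (rule bd)
      then have "norm (a - b) \<le> 2 * B" using norm_triangle_ineq4 [of a b] by (auto simp: K_def)
      also have "\<dots> = 2 * B / \<delta> * \<delta>" using \<delta> by simp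
      also have "\<dots> \<le> 2 * B / \<delta> * ((pflux p a - pflux p b) \<bullet> (a - b))"
        using \<delta>(2) [OF k] B0 \<delta>(1) by (intro mult_left_mono) auto
      finally show ?thesis using eps by (smt (verit) mult_nonneg_nonneg powr_ge_zero)
    next
      case False
      moreover have "2 * B / \<delta> * ((pflux p a - pflux p b) \<bullet> (a - b)) \<ge> 0"
        using B0 \<delta>(1) gap by (intro mult_nonneg_nonneg divide_nonneg_nonneg) auto
      ultimately show ?thesis by linarith
    qed
  qed (use B0 \<delta> in auto)
qed

section \<open>Functions with integrable $p$-th power\<close>

definition Lp_fun :: "'m measure \<Rightarrow> real \<Rightarrow> ('m \<Rightarrow> 'e::euclidean_space) \<Rightarrow> bool" where
  "Lp_fun M p f \<longleftrightarrow> f \<in> borel_measurable M \<and> integrable M (\<lambda>x. norm (f x) powr p)"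

lemma Lp_funD:
  assumes "Lp_fun M p f"
  shows "f \<in> borel_measurable M" "integrable M (\<lambda>x. norm (f x) powr p)"
  using assms by (auto simp: Lp_fun_def)

lemma Lp_fun_bound:
  assumes "f \<in> borel_measurable M" "integrable M K" "AE x in M. norm (f x) powr p \<le> K x"
  shows "Lp_fun M p f"
  unfolding Lp_fun_def using assms
  by (auto intro!: Bochner_Integration.integrable_bound [OF assms(2)] elim: eventually_mono)

lemma Lp_fun_add:
  assumes "p \<ge> 0" "Lp_fun M p f" "Lp_fun M p g"
  shows "Lp_fun M p (\<lambda>x. f x + g x)"
proof (rule Lp_fun_bound)
  show "integrable M (\<lambda>x. 2 powr p * (norm (f x) powr p + norm (g x) powr p))"
    using assms by (auto simp: Lp_fun_def)
qed (use assms norm_powr_add_le in \<open>auto simp: Lp_fun_def\<close>)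

lemma Lp_fun_scaleR:
  assumes "Lp_fun M p f" shows "Lp_fun M p (\<lambda>x. c *\<^sub>R f x)"
  using assms by (auto simp: Lp_fun_def powr_mult)

lemma Lp_fun_diff:
  assumes "p \<ge> 0" "Lp_fun M p f" "Lp_fun M p g"
  shows "Lp_fun M p (\<lambda>x. f x - g x)"
  using Lp_fun_add [OF assms(1,2) Lp_fun_scaleR [OF assms(3), of "-1"]] by simp

lemma powr_mixed_le:
  fixes x y p :: real
  assumes "p > 1" "x \<ge> 0" "y \<ge> 0"
  shows "x powr (p - 1) * y \<le> x powr p + y powr p"
proof -
  have "x powr (p - 1) * y \<le> max x y powr (p - 1) * max x y"
    using assms by (intro mult_mono powr_mono2) auto
  also have "\<dots> = max x y powr p" using assms by (intro powr_p_mult) auto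
  also have "\<dots> \<le> x powr p + y powr p" by (auto simp: max_def)
  finally show ?thesis .
qed

lemma Lp_fun_pairing:
  assumes "p > 1" "Lp_fun M p f" "Lp_fun M p g"
  shows "integrable M (\<lambda>x. pflux p (f x) \<bullet> g x)"
    and "integrable M (\<lambda>x. norm (f x) powr (p - 1) * norm (g x))"
proof -
  have [measurable]: "f \<in> borel_measurable M" "g \<in> borel_measurable M"
    and i: "integrable M (\<lambda>x. norm (f x) powr p + norm (g x) powr p)"
    using assms by (auto simp: Lp_fun_def)
  have [measurable]: "(\<lambda>x. pflux p (f x)) \<in> borel_measurable M"
    using borel_measurable_pflux [OF assms(1)] by measurable
  show 1: "integrable M (\<lambda>x. norm (f x) powr (p - 1) * norm (g x))"
    using powr_mixed_le [OF assms(1)] by (intro Bochner_Integration.integrable_bound [OF i] AE_I2) auto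
  show "integrable M (\<lambda>x. pflux p (f x) \<bullet> g x)"
    using abs_pflux_inner_le by (intro Bochner_Integration.integrable_bound [OF 1] AE_I2) auto
qed

section \<open>Limit theorems under almost everywhere convergence\<close>

lemma vanishing_integral:
  fixes F H :: "nat \<Rightarrow> 'm \<Rightarrow> real"
  assumes [measurable]: "\<And>n. F n \<in> borel_measurable M"
    and lim: "AE x in M. (\<lambda>n. F n x) \<longlonglongrightarrow> 0"
    and H: "\<And>n. integrable M (H n)" "\<And>n x. H n x \<ge> 0" "\<And>n. integral\<^sup>L M (H n) \<le> B"
    and bound: "\<And>\<epsilon>::real. \<epsilon> > 0 \<Longrightarrow> \<exists>K. integrable M K \<and> (\<forall>n. AE x in M. \<bar>F n x\<bar> \<le> \<epsilon> * H n x + K x)"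
  shows "\<And>n. integrable M (F n)" and "(\<lambda>n. \<integral>x. \<bar>F n x\<bar> \<partial>M) \<longlonglongrightarrow> 0"
proof -
  show int: "integrable M (F n)" for n
  proof -
    obtain K where K: "integrable M K" "\<And>n. AE x in M. \<bar>F n x\<bar> \<le> 1 * H n x + K x"
      using bound [of 1] by auto
    have i: "integrable M (\<lambda>x. H n x + \<bar>K x\<bar>)" using H(1) K(1) by auto
    show ?thesis
      by (rule Bochner_Integration.integrable_bound [OF i]) (use K(2) [of n] in \<open>auto elim!: eventually_mono\<close>)
  qed
  have "0 \<le> integral\<^sup>L M (H 0)" using H(2) by (intro integral_nonneg_AE AE_I2)
  then have B0: "B \<ge> 0" using H(3) [of 0] by linarith
  show "(\<lambda>n. \<integral>x. \<bar>F n x\<bar> \<partial>M) \<longlonglongrightarrow> 0"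
  proof (rule LIMSEQ_I)
    fix r :: real assume r: "r > 0"
    define \<epsilon> where "\<epsilon> = r / (2 * (B + 1))"
    have e: "\<epsilon> > 0" using r B0 by (simp add: \<epsilon>_def)
    have eB: "\<epsilon> * B \<le> r / 2" using r B0 by (simp add: \<epsilon>_def field_simps)
    obtain K where K: "integrable M K" "\<And>n. AE x in M. \<bar>F n x\<bar> \<le> \<epsilon> * H n x + K x"
      using bound [OF e] by auto
    \<comment> \<open>Dominated convergence with a majorant that contains
      \<open>\<epsilon> * H n\<close>, a family bounded in mean but not convergent. The excess
      \<open>G n\<close> over it is dominated by \<open>\<bar>K\<bar>\<close> and vanishes in the
      limit, while the rest integrates to at most \<open>\<epsilon> * B\<close>.\<close>
    define G where "G n x = max 0 (\<bar>F n x\<bar> - \<epsilon> * H n x)" for n x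
    have [measurable]: "H n \<in> borel_measurable M" "K \<in> borel_measurable M" for n using H K by auto
    have [measurable]: "G n \<in> borel_measurable M" for n unfolding G_def by measurable
    have "(\<lambda>n. \<integral>x. G n x \<partial>M) \<longlonglongrightarrow> (\<integral>x. 0 \<partial>M)"
    proof (rule integral_dominated_convergence)
      show "integrable M (\<lambda>x. \<bar>K x\<bar>)" using K by auto
      show "AE x in M. (\<lambda>n. G n x) \<longlonglongrightarrow> 0"
        using lim
      proof eventually_elim
        case (elim x)
        have "(\<lambda>n. \<bar>F n x\<bar>) \<longlonglongrightarrow> 0" using elim by (rule tendsto_rabs_zero)
        then show ?case
          by (rule tendsto_sandwich [rotated -1])
            (use e H(2) in \<open>auto simp: G_def tendsto_const\<close>)
      qed
      show "AE x in M. norm (G n x) \<le> \<bar>K x\<bar>" for n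
        using K(2) [of n] by eventually_elim (auto simp: G_def)
    qed auto
    then obtain N where N: "\<And>n. n \<ge> N \<Longrightarrow> \<bar>\<integral>x. G n x \<partial>M\<bar> < r / 2"
      using LIMSEQ_D [of _ 0 "r/2"] r by fastforce
    show "\<exists>N. \<forall>n\<ge>N. norm ((\<integral>x. \<bar>F n x\<bar> \<partial>M) - 0) < r"
    proof (intro exI allI impI)
      fix n assume "n \<ge> N"
      have iG: "integrable M (G n)" unfolding G_def using int H(1) by auto
      have "(\<integral>x. \<bar>F n x\<bar> \<partial>M) \<le> (\<integral>x. \<epsilon> * H n x + G n x \<partial>M)"
        using int H(1) iG by (intro integral_mono) (auto simp: G_def)
      also have "\<dots> = \<epsilon> * integral\<^sup>L M (H n) + integral\<^sup>L M (G n)" using H(1) iG by simp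
      also have "\<dots> < \<epsilon> * B + r / 2"
        using N [OF \<open>n \<ge> N\<close>] H(3) [of n] e by (intro add_le_less_mono mult_left_mono) auto
      finally show "norm ((\<integral>x. \<bar>F n x\<bar> \<partial>M) - 0) < r" using eB by simp
    qed
  qed
qed

lemma vanishing_integral':
  assumes "\<And>n. integrable M (F n)" "(\<lambda>n. \<integral>x. \<bar>F n x\<bar> \<partial>M) \<longlonglongrightarrow> (0::real)"
  shows "(\<lambda>n. \<integral>x. F n x \<partial>M) \<longlonglongrightarrow> 0"
  by (rule Lim_null_comparison [OF always_eventually assms(2)]) (simp add: integral_abs_bound)

text \<open>Fatou's lemma. It takes the place of weak lower semicontinuity and gives integrability
  of the limit at the same time.\<close>

lemma Lp_fun_limit:
  assumes "\<And>n. Lp_fun M p (f n)" "\<And>n. (\<integral>x. norm (f n x) powr p \<partial>M) \<le> B"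
    and [measurable]: "g \<in> borel_measurable M" and lim: "AE x in M. (\<lambda>n. f n x) \<longlonglongrightarrow> g x" and p: "p > 0"
  shows "Lp_fun M p g" "(\<integral>x. norm (g x) powr p \<partial>M) \<le> B"
proof -
  have [measurable]: "f n \<in> borel_measurable M" for n using assms(1) by (rule Lp_funD)
  have "0 \<le> (\<integral>x. norm (f 0 x) powr p \<partial>M)" by (intro integral_nonneg_AE) auto
  then have B0: "B \<ge> 0" using assms(2) [of 0] by linarith
  have "(\<integral>\<^sup>+x. ennreal (norm (g x) powr p) \<partial>M) = (\<integral>\<^sup>+x. liminf (\<lambda>n. ennreal (norm (f n x) powr p)) \<partial>M)"
    using lim
  proof (intro nn_integral_cong_AE, eventually_elim)
    case (elim x)
    have "(\<lambda>n. ennreal (norm (f n x) powr p)) \<longlonglongrightarrow> ennreal (norm (g x) powr p)"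
      using elim p by (intro tendsto_intros tendsto_ennrealI) (auto intro!: tendsto_powr2 tendsto_intros)
    from lim_imp_Liminf [OF trivial_limit_sequentially this] show ?case by simp
  qed
  also have "\<dots> \<le> liminf (\<lambda>n. \<integral>\<^sup>+x. ennreal (norm (f n x) powr p) \<partial>M)"
    by (intro nn_integral_liminf) auto
  also have "\<dots> = liminf (\<lambda>n. ennreal (\<integral>x. norm (f n x) powr p \<partial>M))"
    using Lp_funD(2) [OF assms(1)] by (subst nn_integral_eq_integral) auto
  also have "\<dots> \<le> liminf (\<lambda>n. ennreal B)" using assms(2) by (intro Liminf_mono) (auto intro!: ennreal_leI always_eventually)
  also have "\<dots> = ennreal B" by (simp add: Liminf_const)
  finally have le: "(\<integral>\<^sup>+x. ennreal (norm (g x) powr p) \<partial>M) \<le> ennreal B" .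
  then show g: "Lp_fun M p g"
    unfolding Lp_fun_def by (auto intro!: integrableI_bounded simp: le_less_trans)
  show "(\<integral>x. norm (g x) powr p \<partial>M) \<le> B"
    using le Lp_funD(2) [OF g] B0 by (simp add: nn_integral_eq_integral ennreal_le_iff)
qed

text \<open>The defect of the integrands tends to 0 pointwise, and
  \<open>brezis_lieb_pointwise\<close> bounds it by an \<open>\<epsilon>\<close> multiple of the
  bounded family \<open>norm (f n x - g x) powr p\<close> plus a fixed multiple of
  \<open>norm (g x) powr p\<close>.\<close>

lemma brezis_lieb:
  assumes p: "p > 1" and f: "\<And>n. Lp_fun M p (f n)" "\<And>n. (\<integral>x. norm (f n x) powr p \<partial>M) \<le> B"
    and g: "Lp_fun M p g" and lim: "AE x in M. (\<lambda>n. f n x) \<longlonglongrightarrow> g x"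
  shows "(\<lambda>n. (\<integral>x. norm (f n x) powr p \<partial>M) - (\<integral>x. norm (f n x - g x) powr p \<partial>M))
    \<longlonglongrightarrow> (\<integral>x. norm (g x) powr p \<partial>M)"
proof -
  have [measurable]: "f n \<in> borel_measurable M" "g \<in> borel_measurable M" for n
    using f(1) g by (auto simp: Lp_fun_def)
  have p0: "p \<ge> 0" using p by simp
  note d = Lp_fun_diff [OF p0 f(1) g]
  note ints = Lp_funD(2) [OF f(1)] Lp_funD(2) [OF g] Lp_funD(2) [OF d]
  define F where "F n x = norm (f n x) powr p - norm (f n x - g x) powr p - norm (g x) powr p" for n x
  define H where "H n x = norm (f n x - g x) powr p" for n x
  have "(\<lambda>n. \<integral>x. F n x \<partial>M) \<longlonglongrightarrow> 0"
  proof (rule vanishing_integral', goal_cases)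
    case 1 then show ?case using ints by (auto simp: F_def)
  next
    case 2
    show ?case
    proof (rule vanishing_integral(2) [where H = H and B = "2 powr p * (B + (\<integral>x. norm (g x) powr p \<partial>M))"])
      show "F n \<in> borel_measurable M" for n unfolding F_def by measurable
      show "AE x in M. (\<lambda>n. F n x) \<longlonglongrightarrow> 0"
        using lim
      proof eventually_elim
        case (elim x)
        have "(\<lambda>n. F n x) \<longlonglongrightarrow> norm (g x) powr p - norm (g x - g x) powr p - norm (g x) powr p"
          unfolding F_def using p by (intro tendsto_intros elim tendsto_powr2) auto
        then show ?case by simp
      qed
      show "integrable M (H n)" for n unfolding H_def by (rule ints)
      show "H n x \<ge> 0" for n x by (simp add: H_def)
      show "integral\<^sup>L M (H n) \<le> 2 powr p * (B + (\<integral>x. norm (g x) powr p \<partial>M))" for n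
      proof -
        have "integral\<^sup>L M (H n) \<le> (\<integral>x. 2 powr p * (norm (f n x) powr p + norm (g x) powr p) \<partial>M)"
          unfolding H_def using p by (intro integral_mono ints) (auto intro!: ints norm_powr_diff_le)
        also have "\<dots> = 2 powr p * ((\<integral>x. norm (f n x) powr p \<partial>M) + (\<integral>x. norm (g x) powr p \<partial>M))"
          using ints by simp
        finally show ?thesis using f(2) [of n] by (smt (verit) mult_left_mono powr_ge_zero)
      qed
      fix \<epsilon> :: real assume "\<epsilon> > 0"
      then obtain C where C: "C \<ge> 0" "\<And>a b::'b. \<bar>norm (a + b) powr p - norm a powr p\<bar> \<le> \<epsilon> * norm a powr p + C * norm b powr p"
        using brezis_lieb_pointwise [OF p] by meson
      show "\<exists>K. integrable M K \<and> (\<forall>n. AE x in M. \<bar>F n x\<bar> \<le> \<epsilon> * H n x + K x)"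
      proof (intro exI conjI allI AE_I2)
        show "integrable M (\<lambda>x. (C + 1) * norm (g x) powr p)" using ints by auto
        show "\<bar>F n x\<bar> \<le> \<epsilon> * H n x + (C + 1) * norm (g x) powr p" for n x
        proof -
          have "norm (f n x) powr p = norm (f n x - g x + g x) powr p" by simp
          with C(2) [of "f n x - g x" "g x"] powr_ge_zero [of "norm (g x)" p] show ?thesis
            unfolding F_def H_def distrib_right by linarith
        qed
      qed
    qed
  qed
  moreover have "(\<integral>x. F n x \<partial>M) = (\<integral>x. norm (f n x) powr p \<partial>M) - (\<integral>x. norm (f n x - g x) powr p \<partial>M)
      - (\<integral>x. norm (g x) powr p \<partial>M)" for n
    unfolding F_def using ints by simp
  ultimately show ?thesis using LIM_zero_cancel by auto
qed

text \<open>Weak convergence of fluxes from almost everywhere convergence and a norm bound: Young's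
  inequality leaves an \<open>\<epsilon>\<close> multiple of the bounded family and moves the factor
  \<open>h\<close> into a fixed integrable function.\<close>

lemma pflux_pairing_tendsto:
  assumes p: "p > 1" and f: "\<And>n. Lp_fun M p (f n)" "\<And>n. (\<integral>x. norm (f n x) powr p \<partial>M) \<le> B"
    and g: "Lp_fun M p g" and lim: "AE x in M. (\<lambda>n. f n x) \<longlonglongrightarrow> g x" and h: "Lp_fun M p h"
  shows "(\<lambda>n. \<integral>x. pflux p (f n x) \<bullet> h x \<partial>M) \<longlonglongrightarrow> (\<integral>x. pflux p (g x) \<bullet> h x \<partial>M)"
proof -
  have [measurable]: "f n \<in> borel_measurable M" "g \<in> borel_measurable M" "h \<in> borel_measurable M" for n
    using f(1) g h by (auto simp: Lp_fun_def)
  note [measurable] = borel_measurable_pflux [OF p]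
  note ints = Lp_fun_pairing(1) [OF p f(1) h] Lp_fun_pairing(1) [OF p g h]
  define F where "F n x = pflux p (f n x) \<bullet> h x - pflux p (g x) \<bullet> h x" for n x
  have "(\<lambda>n. \<integral>x. F n x \<partial>M) \<longlonglongrightarrow> 0"
  proof (rule vanishing_integral', goal_cases)
    case 1 then show ?case using ints by (auto simp: F_def)
  next
    case 2
    show ?case
    proof (rule vanishing_integral(2) [where H = "\<lambda>n x. norm (f n x) powr p" and B = B])
      show "F n \<in> borel_measurable M" for n unfolding F_def by measurable
      show "AE x in M. (\<lambda>n. F n x) \<longlonglongrightarrow> 0"
        using lim
      proof eventually_elim
        case (elim x)
        have "(\<lambda>n. pflux p (f n x)) \<longlonglongrightarrow> pflux p (g x)"
          using elim continuous_on_pflux [OF p] by (rule_tac continuous_on_tendsto_compose) auto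
        then have "(\<lambda>n. F n x) \<longlonglongrightarrow> pflux p (g x) \<bullet> h x - pflux p (g x) \<bullet> h x"
          unfolding F_def by (intro tendsto_intros)
        then show ?case by simp
      qed
      show "integrable M (\<lambda>x. norm (f n x) powr p)" for n using f by (auto simp: Lp_fun_def)
      show "(\<integral>x. norm (f n x) powr p \<partial>M) \<le> B" for n by (rule f)
      fix \<epsilon> :: real assume "\<epsilon> > 0"
      then obtain C where C: "C \<ge> 0" "\<And>x y. x \<ge> 0 \<Longrightarrow> y \<ge> 0 \<Longrightarrow> x powr (p - 1) * y \<le> \<epsilon> * x powr p + C * y powr p"
        using young_eps [OF p] by meson
      show "\<exists>K. integrable M K \<and> (\<forall>n. AE x in M. \<bar>F n x\<bar> \<le> \<epsilon> * norm (f n x) powr p + K x)"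
      proof (intro exI conjI allI AE_I2)
        show "integrable M (\<lambda>x. C * norm (h x) powr p + norm (g x) powr (p - 1) * norm (h x))"
          using h Lp_fun_pairing(2) [OF p g h] by (auto simp: Lp_fun_def)
        show "\<bar>F n x\<bar> \<le> \<epsilon> * norm (f n x) powr p + (C * norm (h x) powr p + norm (g x) powr (p - 1) * norm (h x))" for n x
          using C(2) [of "norm (f n x)" "norm (h x)"] abs_pflux_inner_le [of p "f n x" "h x"]
            abs_pflux_inner_le [of p "g x" "h x"] by (auto simp: F_def)
      qed
    qed auto
  qed
  moreover have "(\<integral>x. F n x \<partial>M) = (\<integral>x. pflux p (f n x) \<bullet> h x \<partial>M) - (\<integral>x. pflux p (g x) \<bullet> h x \<partial>M)" for n
    unfolding F_def using ints by simp
  ultimately show ?thesis using LIM_zero_cancel by auto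
qed

text \<open>By convexity the difference quotient lies between the pairings at \<open>f\<close> and
  at \<open>f + t n *\<^sub>R h\<close>, and the latter converge by
  \<open>pflux_pairing_tendsto\<close>. No pointwise differentiation under the integral is
  involved.\<close>

lemma Lp_gateaux:
  fixes f h :: "'m \<Rightarrow> 'e::euclidean_space"
  assumes p: "p > 1" and f: "Lp_fun M p f" and h: "Lp_fun M p h"
    and t: "\<And>n. t n > 0" "\<And>n. t n \<le> 1" "t \<longlonglongrightarrow> 0"
  shows "(\<lambda>n. ((\<integral>x. norm (f x + t n *\<^sub>R h x) powr p \<partial>M) - (\<integral>x. norm (f x) powr p \<partial>M)) / t n)
    \<longlonglongrightarrow> p * (\<integral>x. pflux p (f x) \<bullet> h x \<partial>M)"
proof (rule tendsto_sandwich)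
  have p0: "p \<ge> 0" using p by simp
  define v where "v n x = f x + t n *\<^sub>R h x" for n x
  have th: "Lp_fun M p (\<lambda>x. t n *\<^sub>R h x)" for n by (rule Lp_fun_scaleR [OF h])
  have v: "Lp_fun M p (v n)" for n unfolding v_def [abs_def] by (rule Lp_fun_add [OF p0 f th])
  have d: "(\<integral>x. norm (v n x) powr p - norm (f x) powr p \<partial>M) = (\<integral>x. norm (v n x) powr p \<partial>M) - (\<integral>x. norm (f x) powr p \<partial>M)" for n
    using Lp_funD(2) [OF v] Lp_funD(2) [OF f] by simp
  have le: "p * (t n * (pflux p (f x) \<bullet> h x)) \<le> norm (v n x) powr p - norm (f x) powr p"
    "norm (v n x) powr p - norm (f x) powr p \<le> p * (t n * (pflux p (v n x) \<bullet> h x))" for n x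
    using norm_powr_add_bounds [OF p, of "f x" "t n *\<^sub>R h x"] by (auto simp: v_def)
  have "(\<integral>x. p * (t n * (pflux p (f x) \<bullet> h x)) \<partial>M) \<le> (\<integral>x. norm (v n x) powr p - norm (f x) powr p \<partial>M)" for n
    using le(1) Lp_fun_pairing(1) [OF p f h] Lp_funD(2) [OF v] Lp_funD(2) [OF f] by (intro integral_mono) auto
  then show "\<forall>\<^sub>F n in sequentially. p * (\<integral>x. pflux p (f x) \<bullet> h x \<partial>M) \<le> ((\<integral>x. norm (f x + t n *\<^sub>R h x) powr p \<partial>M) - (\<integral>x. norm (f x) powr p \<partial>M)) / t n"
    unfolding d using t(1) by (intro always_eventually allI) (simp add: v_def pos_le_divide_eq mult_ac)
  have "(\<integral>x. norm (v n x) powr p - norm (f x) powr p \<partial>M) \<le> (\<integral>x. p * (t n * (pflux p (v n x) \<bullet> h x)) \<partial>M)" for n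
    using le(2) Lp_fun_pairing(1) [OF p v h] Lp_funD(2) [OF v] Lp_funD(2) [OF f] by (intro integral_mono) auto
  then show "\<forall>\<^sub>F n in sequentially. ((\<integral>x. norm (f x + t n *\<^sub>R h x) powr p \<partial>M) - (\<integral>x. norm (f x) powr p \<partial>M)) / t n \<le> p * (\<integral>x. pflux p (v n x) \<bullet> h x \<partial>M)"
    unfolding d using t(1) by (intro always_eventually allI) (simp add: v_def pos_divide_le_eq mult_ac)
  have vB: "(\<integral>x. norm (v n x) powr p \<partial>M) \<le> (\<integral>x. 2 powr p * (norm (f x) powr p + norm (h x) powr p) \<partial>M)" for n
  proof (intro integral_mono Lp_funD(2) [OF v])
    show "norm (v n x) powr p \<le> 2 powr p * (norm (f x) powr p + norm (h x) powr p)" for x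
    proof -
      have "norm (t n *\<^sub>R h x) powr p \<le> norm (h x) powr p"
        using t(1,2) [of n] p0 by (intro powr_mono2) (auto simp: mult_left_le_one_le)
      then show ?thesis using norm_powr_add_le [OF p0, of "f x" "t n *\<^sub>R h x"] unfolding v_def
        by (rule_tac order_trans [OF _ mult_left_mono]) auto
    qed
  qed (use Lp_funD(2) [OF f] Lp_funD(2) [OF h] in auto)
  have "AE x in M. (\<lambda>n. v n x) \<longlonglongrightarrow> f x"
  proof (intro AE_I2)
    fix x
    have "(\<lambda>n. v n x) \<longlonglongrightarrow> f x + 0 *\<^sub>R h x" unfolding v_def by (intro tendsto_intros t)
    then show "(\<lambda>n. v n x) \<longlonglongrightarrow> f x" by simp
  qed
  from pflux_pairing_tendsto [OF p v vB f this h]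
  show "(\<lambda>n. p * (\<integral>x. pflux p (v n x) \<bullet> h x \<partial>M)) \<longlonglongrightarrow> p * (\<integral>x. pflux p (f x) \<bullet> h x \<partial>M)"
    by (intro tendsto_intros)
qed auto

text \<open>On a set of finite measure a bound on the power \<open>r\<close> makes every lower power
  uniformly integrable. This is the source of compactness for all subcritical terms.\<close>

lemma integral_powr_lower_tendsto_0:
  fixes f :: "nat \<Rightarrow> 'm \<Rightarrow> real"
  assumes q: "0 < q" "q < r" and A: "A \<in> sets M" "emeasure M A < \<infinity>"
    and f: "\<And>n. Lp_fun M r (f n)" "\<And>n. (\<integral>x. \<bar>f n x\<bar> powr r \<partial>M) \<le> B"
    and supp: "\<And>n x. x \<notin> A \<Longrightarrow> f n x = 0" and lim: "AE x in M. (\<lambda>n. f n x) \<longlonglongrightarrow> 0"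
  shows "\<And>n. Lp_fun M q (f n)" "(\<lambda>n. \<integral>x. \<bar>f n x\<bar> powr q \<partial>M) \<longlonglongrightarrow> 0"
proof -
  have [measurable]: "f n \<in> borel_measurable M" for n using f(1) by (rule Lp_funD)
  have *: "\<exists>K. integrable M K \<and> (\<forall>n. AE x in M. \<bar>\<bar>f n x\<bar> powr q\<bar> \<le> \<epsilon> * \<bar>f n x\<bar> powr r + K x)"
    if "\<epsilon> > 0" for \<epsilon>
  proof -
    obtain C where C: "C \<ge> 0" "\<And>x. x \<ge> 0 \<Longrightarrow> x powr q \<le> \<epsilon> * x powr r + C"
      using powr_le_eps [OF q \<open>\<epsilon> > 0\<close>] by auto
    show ?thesis
    proof (intro exI conjI allI AE_I2)
      show "integrable M (\<lambda>x. C * indicator A x)" using A by auto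
      show "\<bar>\<bar>f n x\<bar> powr q\<bar> \<le> \<epsilon> * \<bar>f n x\<bar> powr r + C * indicator A x" for n x
        using C(2) [of "\<bar>f n x\<bar>"] supp [of x n] by (auto simp: indicator_def)
    qed
  qed
  have L: "AE x in M. (\<lambda>n. \<bar>f n x\<bar> powr q) \<longlonglongrightarrow> 0"
    using lim by eventually_elim (use q in \<open>auto intro!: tendsto_zero_powrI tendsto_rabs_zero\<close>)
  have H: "integrable M (\<lambda>x. \<bar>f n x\<bar> powr r)" for n using Lp_funD(2) [OF f(1)] by simp
  show "Lp_fun M q (f n)" for n
    unfolding Lp_fun_def using vanishing_integral(1) [of "\<lambda>n x. \<bar>f n x\<bar> powr q", OF _ L H _ f(2) *] by simp
  show "(\<lambda>n. \<integral>x. \<bar>f n x\<bar> powr q \<partial>M) \<longlonglongrightarrow> 0"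
    using vanishing_integral(2) [of "\<lambda>n x. \<bar>f n x\<bar> powr q", OF _ L H _ f(2) *] by simp
qed

lemma Lp_fun_lower:
  fixes f :: "'m \<Rightarrow> real"
  assumes q: "0 < q" "q < r" and A: "A \<in> sets M" "emeasure M A < \<infinity>"
    and f: "Lp_fun M r f" and supp: "\<And>x. x \<notin> A \<Longrightarrow> f x = 0"
  shows "Lp_fun M q f"
proof -
  obtain C where C: "C \<ge> 0" "\<And>x. x \<ge> 0 \<Longrightarrow> x powr q \<le> 1 * x powr r + C"
    using powr_le_eps [OF q zero_less_one] by auto
  show ?thesis
  proof (rule Lp_fun_bound)
    show "integrable M (\<lambda>x. \<bar>f x\<bar> powr r + C * indicator A x)" using A f by (auto simp: Lp_fun_def)
    show "AE x in M. norm (f x) powr q \<le> \<bar>f x\<bar> powr r + C * indicator A x"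
      using C(2) supp by (intro AE_I2) (auto simp: indicator_def split: if_splits)
  qed (use f in \<open>auto simp: Lp_fun_def\<close>)
qed

abbreviation "power_integral r u \<equiv> \<integral>x. \<bar>u x\<bar> powr r \<partial>lborel"
abbreviation "nn_power_integral r u \<equiv> \<integral>\<^sup>+x. ennreal (norm (u x) powr r) \<partial>lborel"

abbreviation "fder \<phi> x \<equiv> frechet_derivative \<phi> (at x)"

section \<open>Smooth test functions\<close>

text \<open>The polynomial factor in \<open>1 / t\<close> makes the family closed under
  differentiation, so that one limit at 0 settles all orders of smoothness.\<close>

definition flat_exp :: "real poly \<Rightarrow> real \<Rightarrow> real" where
  "flat_exp P t = (if t > 0 then poly P (1 / t) * exp (- (1 / t)) else 0)"

lemma poly_exp_tendsto_0: "((\<lambda>x. poly P x * exp (- x)) \<longlongrightarrow> (0::real)) at_top"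
proof -
  have "((\<lambda>x. \<Sum>i\<le>degree P. coeff P i * (x ^ i / exp x)) \<longlongrightarrow> (\<Sum>i\<le>degree P. coeff P i * 0)) at_top"
    by (intro tendsto_sum tendsto_mult tendsto_const tendsto_power_div_exp_0)
  then show ?thesis
    by (simp add: poly_altdef exp_minus divide_inverse sum_distrib_right mult.assoc)
qed

lemma flat_exp_tendsto_0: "((\<lambda>t. poly P (1 / t) * exp (- (1 / t))) \<longlongrightarrow> 0) (at_right (0::real))"
proof -
  have "filterlim (\<lambda>t::real. 1 / t) at_top (at_right 0)"
    using filterlim_inverse_at_top_right by (simp add: inverse_eq_divide)
  then show ?thesis by (rule filterlim_compose [OF poly_exp_tendsto_0])
qed

text \<open>The derivative of \<open>P (1 / t) * exp (- 1 / t)\<close> is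
  \<open>(P - P') (1 / t) * exp (- 1 / t)\<close> times \<open>1 / t\<close> squared, and the factor
  \<open>[:0, 0, 1:]\<close> is this square.\<close>

definition flat_deriv :: "real poly \<Rightarrow> real poly" where
  "flat_deriv P = [:0, 0, 1:] * (P - pderiv P)"

lemma flat_exp_DERIV: "(flat_exp P has_real_derivative flat_exp (flat_deriv P) t) (at t)"
proof (cases "t = 0")
  case False
  show ?thesis
  proof (cases "t > 0")
    case True
    have "((\<lambda>t. poly P (1 / t) * exp (- (1 / t))) has_real_derivative flat_exp (flat_deriv P) t) (at t)"
      using True unfolding flat_exp_def flat_deriv_def
      by (auto intro!: derivative_eq_intros simp: field_simps power2_eq_square)
    then show ?thesis
      by (rule has_field_derivative_transform_within_open [of _ _ _ "{0<..}"])
        (use True in \<open>auto simp: flat_exp_def\<close>)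
  next
    case False
    then have "t < 0" using \<open>t \<noteq> 0\<close> by simp
    have "((\<lambda>t. 0) has_real_derivative flat_exp (flat_deriv P) t) (at t)"
      using False unfolding flat_exp_def by auto
    then show ?thesis
      by (rule has_field_derivative_transform_within_open [of _ _ _ "{..<0}"])
        (use \<open>t < 0\<close> in \<open>auto simp: flat_exp_def\<close>)
  qed
next
  case True
  \<comment> \<open>Division by \<open>h\<close> multiplies the polynomial by \<open>1 / h\<close>,
    so the quotient from the right is again a flat exponential.\<close>
  have r: "((\<lambda>h. flat_exp P h / h) \<longlongrightarrow> 0) (at_right 0)"
  proof (rule Lim_transform_eventually)
    show "((\<lambda>t. poly ([:0, 1:] * P) (1 / t) * exp (- (1 / t))) \<longlongrightarrow> 0) (at_right (0::real))"
      by (rule flat_exp_tendsto_0)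
    show "\<forall>\<^sub>F x in at_right 0. poly ([:0, 1:] * P) (1 / x) * exp (- (1 / x)) = flat_exp P x / x"
      unfolding eventually_at_right_field by (auto simp: flat_exp_def intro!: exI [of _ 1])
  qed
  have l: "((\<lambda>h. flat_exp P h / h) \<longlongrightarrow> 0) (at_left 0)"
  proof (rule Lim_transform_eventually)
    show "((\<lambda>t. 0::real) \<longlongrightarrow> 0) (at_left (0::real))" by simp
    show "\<forall>\<^sub>F x in at_left 0. 0 = flat_exp P x / x"
      unfolding eventually_at_left_field by (auto simp: flat_exp_def intro!: exI [of _ "-1"])
  qed
  have "((\<lambda>h. (flat_exp P (0 + h) - flat_exp P 0) / h) \<longlongrightarrow> 0) (at 0)"
    using filterlim_split_at [OF l r] by (simp add: flat_exp_def [of P 0])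
  then show ?thesis
    using True by (simp add: DERIV_def flat_exp_def [of _ 0])
qed

text \<open>\<open>Ck_fun\<close> descends through directional derivatives, so a class that is
  stable under them reaches every order by one induction on \<open>k\<close>.\<close>

inductive_set smooth_class :: "('a::euclidean_space \<Rightarrow> real) set" where
  sm_const: "(\<lambda>x. c) \<in> smooth_class"
| sm_flat: "(\<lambda>x. flat_exp P (\<alpha> * (x \<bullet> b) + \<beta>)) \<in> smooth_class"
| sm_add: "f \<in> smooth_class \<Longrightarrow> g \<in> smooth_class \<Longrightarrow> (\<lambda>x. f x + g x) \<in> smooth_class"
| sm_mult: "f \<in> smooth_class \<Longrightarrow> g \<in> smooth_class \<Longrightarrow> (\<lambda>x. f x * g x) \<in> smooth_class"

lemma smooth_class_derivative:
  "f \<in> smooth_class \<Longrightarrow> \<exists>F. (\<forall>x. (f has_derivative F x) (at x)) \<and> (\<forall>h. (\<lambda>x. F x h) \<in> smooth_class)"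
proof (induction rule: smooth_class.induct)
  case (sm_const c)
  show ?case by (intro exI [of _ "\<lambda>x h. 0"]) (auto intro: smooth_class.intros)
next
  case (sm_flat P \<alpha> b \<beta>)
  show ?case
  proof (intro exI [of _ "\<lambda>x h. (\<alpha> * (h \<bullet> b)) * flat_exp (flat_deriv P) (\<alpha> * (x \<bullet> b) + \<beta>)"] conjI allI)
    fix x
    have "((\<lambda>x. \<alpha> * (x \<bullet> b) + \<beta>) has_derivative (\<lambda>h. \<alpha> * (h \<bullet> b))) (at x)"
      by (auto intro!: derivative_eq_intros)
    from has_derivative_compose [OF this flat_exp_DERIV [unfolded has_field_derivative_def], of P]
    show "((\<lambda>x. flat_exp P (\<alpha> * (x \<bullet> b) + \<beta>)) has_derivative
        (\<lambda>h. (\<alpha> * (h \<bullet> b)) * flat_exp (flat_deriv P) (\<alpha> * (x \<bullet> b) + \<beta>))) (at x)"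
      by (simp add: mult.commute)
  qed (intro smooth_class.intros)
next
  case (sm_add f g)
  then obtain F G where "\<forall>x. (f has_derivative F x) (at x)" "\<forall>h. (\<lambda>x. F x h) \<in> smooth_class"
    "\<forall>x. (g has_derivative G x) (at x)" "\<forall>h. (\<lambda>x. G x h) \<in> smooth_class" by auto
  then show ?case
    by (intro exI [of _ "\<lambda>x h. F x h + G x h"]) (auto intro!: smooth_class.intros derivative_intros)
next
  case (sm_mult f g)
  then obtain F G where "\<forall>x. (f has_derivative F x) (at x)" "\<forall>h. (\<lambda>x. F x h) \<in> smooth_class"
    "\<forall>x. (g has_derivative G x) (at x)" "\<forall>h. (\<lambda>x. G x h) \<in> smooth_class" by auto
  then show ?case
    using sm_mult.hyps
    by (intro exI [of _ "\<lambda>x h. f x * G x h + F x h * g x"]) (auto intro!: smooth_class.intros derivative_intros)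
qed

lemma smooth_class_Ck: "f \<in> smooth_class \<Longrightarrow> Ck_fun k f"
proof (induction k arbitrary: f)
  case 0
  obtain F where "\<forall>x. (f has_derivative F x) (at x)" using smooth_class_derivative [OF 0] by auto
  then show ?case by (auto intro: has_derivative_continuous simp: continuous_on_eq_continuous_at)
next
  case (Suc k)
  obtain F where F: "\<forall>x. (f has_derivative F x) (at x)" "\<forall>h. (\<lambda>x. F x h) \<in> smooth_class"
    using smooth_class_derivative [OF Suc.prems] by auto
  then have "fder f x = F x" for x by (metis frechet_derivative_at)
  then show ?case using F Suc.IH by (auto simp: differentiable_def)
qed

lemma smooth_class_prod: "finite I \<Longrightarrow> (\<And>i. i \<in> I \<Longrightarrow> f i \<in> smooth_class) \<Longrightarrow> (\<lambda>x. \<Prod>i\<in>I. f i x) \<in> smooth_class"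
  by (induction I rule: finite_induct) (auto intro: smooth_class.intros)

text \<open>Inside the box every factor is \<open>exp (- 1 / (n * d))\<close> with \<open>d\<close>
  the distance to a face in one coordinate; it tends to 1 as \<open>n\<close> grows, and the product
  tends to the indicator of the open box.\<close>

definition box_bump :: "'a \<Rightarrow> 'a \<Rightarrow> real \<Rightarrow> 'a::euclidean_space \<Rightarrow> real" where
  "box_bump a c n x = (\<Prod>b\<in>Basis. flat_exp 1 (n * (x \<bullet> b) + - (n * (a \<bullet> b))) * flat_exp 1 ((- n) * (x \<bullet> b) + n * (c \<bullet> b)))"

lemma flat_exp_1_bounds: "0 \<le> flat_exp 1 t" "flat_exp 1 t \<le> 1"
  by (auto simp: flat_exp_def)

lemma box_bump_bounds: "0 \<le> box_bump a c n x" "box_bump a c n x \<le> 1"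
  unfolding box_bump_def
  by (auto intro!: prod_nonneg prod_le_1 mult_nonneg_nonneg mult_le_one flat_exp_1_bounds)

lemma box_bump_outside:
  assumes "n > 0" "x \<notin> box a c" shows "box_bump a c n x = 0"
proof -
  obtain b where b: "b \<in> Basis" "x \<bullet> b \<le> a \<bullet> b \<or> c \<bullet> b \<le> x \<bullet> b"
    using assms by (auto simp: mem_box not_less)
  then have "n * (x \<bullet> b) + - (n * (a \<bullet> b)) \<le> 0 \<or> (- n) * (x \<bullet> b) + n * (c \<bullet> b) \<le> 0"
    using assms(1) by auto
  then have "flat_exp 1 (n * (x \<bullet> b) + - (n * (a \<bullet> b))) * flat_exp 1 ((- n) * (x \<bullet> b) + n * (c \<bullet> b)) = 0"
    by (auto simp: flat_exp_def)
  then show ?thesis unfolding box_bump_def using b(1) by (intro prod_zero) auto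
qed

lemma test_fun_box_bump:
  assumes "n > 0" shows "test_fun (box_bump a c n)"
proof -
  have "box_bump a c n \<in> smooth_class"
    unfolding box_bump_def by (intro smooth_class_prod sm_mult sm_flat) auto
  moreover have "compact (closure {x. box_bump a c n x \<noteq> 0})"
  proof -
    have "{x. box_bump a c n x \<noteq> 0} \<subseteq> box a c" using box_bump_outside [OF assms] by blast
    then have "bounded {x. box_bump a c n x \<noteq> 0}" using bounded_box bounded_subset by blast
    then show ?thesis by (simp add: compact_closure)
  qed
  ultimately show ?thesis by (simp add: test_fun_def smooth_class_Ck)
qed

lemma box_bump_tendsto: "(\<lambda>n. box_bump a c (real (Suc n)) x) \<longlonglongrightarrow> indicat_real (box a c) x"
proof (cases "x \<in> box a c")
  case False
  then show ?thesis by (simp add: box_bump_outside)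
next
  case True
  have lim: "(\<lambda>n. flat_exp 1 (real (Suc n) * d)) \<longlonglongrightarrow> 1" if "d > 0" for d :: real
  proof -
    have "(\<lambda>n. exp (- (1 / d) * (1 / real (Suc n)))) \<longlonglongrightarrow> exp (- (1 / d) * 0)"
      by (intro tendsto_intros LIMSEQ_Suc lim_1_over_n)
    then show ?thesis using that by (simp add: flat_exp_def mult.commute)
  qed
  have "(\<lambda>n. box_bump a c (real (Suc n)) x) \<longlonglongrightarrow> (\<Prod>b\<in>(Basis::'a set). 1 * 1)"
    unfolding box_bump_def
  proof (intro tendsto_prod tendsto_mult)
    fix b :: 'a assume b: "b \<in> Basis"
    have "(\<lambda>n. flat_exp 1 (real (Suc n) * (x \<bullet> b - a \<bullet> b))) \<longlonglongrightarrow> 1"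
      "(\<lambda>n. flat_exp 1 (real (Suc n) * (c \<bullet> b - x \<bullet> b))) \<longlonglongrightarrow> 1"
      by (rule lim, use True b in \<open>simp add: mem_box\<close>)+
    then show "(\<lambda>n. flat_exp 1 (real (Suc n) * (x \<bullet> b) + - (real (Suc n) * (a \<bullet> b)))) \<longlonglongrightarrow> 1"
      "(\<lambda>n. flat_exp 1 ((- real (Suc n)) * (x \<bullet> b) + real (Suc n) * (c \<bullet> b))) \<longlonglongrightarrow> 1"
      by (simp_all add: algebra_simps)
  qed
  then show ?thesis using True by simp
qed

section \<open>The fundamental lemma of the calculus of variations\<close>

text \<open>The positive and the negative part of \<open>f\<close> are densities of finite measures
  that agree on open boxes. Boxes are stable under intersection and generate the Borel sets, so the
  measures coincide.\<close>

lemma AE_zero_if_box_integrals_zero: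
  fixes f :: "'a::euclidean_space \<Rightarrow> real"
  assumes f: "integrable lborel f" and box: "\<And>a c. (\<integral>x. indicat_real (box a c) x * f x \<partial>lborel) = 0"
  shows "AE x in lborel. f x = 0"
proof -
  note [measurable] = borel_measurable_integrable [OF f]
  define M where "M g = density lborel (\<lambda>x. ennreal (g x))" for g :: "'a \<Rightarrow> real"
  have fin: "(\<integral>\<^sup>+x. ennreal (g x) * indicator A x \<partial>lborel) \<noteq> top" if "g = f \<or> g = (\<lambda>x. - f x)" "A \<in> sets borel" for g A
  proof -
    have "(\<integral>\<^sup>+x. ennreal (g x) * indicator A x \<partial>lborel) \<le> (\<integral>\<^sup>+x. ennreal (norm (f x)) \<partial>lborel)"
      using that(1) by (intro nn_integral_mono) (auto simp: indicator_def ennreal_leI)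
    also have "\<dots> < top" using f by (simp add: integrable_iff_bounded)
    finally show ?thesis by simp
  qed
  have boxeq: "emeasure (M f) (box a c) = emeasure (M (\<lambda>x. - f x)) (box a c)" for a c
  proof -
    define h where "h x = indicat_real (box a c) x * f x" for x
    have bm [measurable]: "box a c \<in> sets borel" by simp
    have "integrable lborel h" using integrable_mult_indicator [of "box a c" lborel f] f by (simp add: h_def [abs_def])
    then have "integral\<^sup>L lborel h = enn2real (\<integral>\<^sup>+x. ennreal (h x) \<partial>lborel) - enn2real (\<integral>\<^sup>+x. ennreal (- h x) \<partial>lborel)"
      by (rule real_lebesgue_integral_def)
    moreover have "ennreal (h x) = ennreal (f x) * indicator (box a c) x" "ennreal (- h x) = ennreal (- f x) * indicator (box a c) x" for x
      by (auto simp: h_def indicator_def)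
    ultimately have "enn2real (emeasure (M f) (box a c)) = enn2real (emeasure (M (\<lambda>x. - f x)) (box a c))"
      using box [of a c] by (simp add: h_def [symmetric] M_def emeasure_density)
    then have "ennreal (enn2real (emeasure (M f) (box a c))) = ennreal (enn2real (emeasure (M (\<lambda>x. - f x)) (box a c)))"
      by (rule arg_cong)
    moreover have "emeasure (M f) (box a c) < top" "emeasure (M (\<lambda>x. - f x)) (box a c) < top"
      using fin by (simp_all add: M_def emeasure_density less_top)
    ultimately show ?thesis by (simp only: ennreal_enn2real)
  qed
  have "M f = M (\<lambda>x. - f x)"
  proof (rule measure_eqI_generator_eq [where E = "range (\<lambda>(a, b). box a b :: 'a set)" and \<Omega> = UNIV and A = "\<lambda>n. box (- (real n *\<^sub>R One)) (real n *\<^sub>R One)"])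
    show "Int_stable (range (\<lambda>(a, b). box a b :: 'a set))" by (auto simp: Int_stable_def box_Int_box)
    show "sets (M f) = sigma_sets UNIV (range (\<lambda>(a, b). box a b))" "sets (M (\<lambda>x. - f x)) = sigma_sets UNIV (range (\<lambda>(a, b). box a b))"
      by (simp_all add: M_def borel_eq_box)
    show "(\<Union>n. box (- (real n *\<^sub>R One)) (real n *\<^sub>R One)) = (UNIV :: 'a set)" by (rule UN_box_eq_UNIV)
    show "emeasure (M f) (box (- (real n *\<^sub>R One)) (real n *\<^sub>R One)) \<noteq> \<infinity>" for n
      using fin [of f] by (simp add: M_def emeasure_density)
  qed (use boxeq in auto)
  then have "AE x in lborel. ennreal (f x) = ennreal (- f x)"
    by (intro sigma_finite_measure.density_unique [OF sigma_finite_lborel]) (auto simp: M_def)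
  then show ?thesis
  proof eventually_elim
    case (elim x)
    then show ?case by (cases "f x \<ge> 0") (auto simp: ennreal_neg dest: sym)
  qed
qed

text \<open>Bumps that tend to the indicator of a box inside \<open>S\<close> show that
  \<open>f\<close> has integral 0 over every such box; countably many boxes fill
  \<open>S\<close>.\<close>

lemma fundamental_lemma_variations:
  fixes f :: "'a::euclidean_space \<Rightarrow> real"
  assumes [measurable]: "f \<in> borel_measurable borel" and S: "open S"
    and loc: "\<And>K. compact K \<Longrightarrow> set_integrable lborel K f"
    and test: "\<And>\<phi>. test_fun \<phi> \<Longrightarrow> (\<And>x. x \<notin> S \<Longrightarrow> \<phi> x = 0) \<Longrightarrow> (\<integral>x. f x * \<phi> x \<partial>lborel) = 0"
  shows "AE x in lborel. x \<in> S \<longrightarrow> f x = 0"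
proof -
  have ib: "integrable lborel (\<lambda>x. indicat_real (box a c) x * f x)" for a c
  proof (rule Bochner_Integration.integrable_bound)
    show "integrable lborel (\<lambda>x. indicat_real (cbox a c) x * f x)"
      using loc [of "cbox a c"] by (simp add: set_integrable_def)
    show "AE x in lborel. norm (indicat_real (box a c) x * f x) \<le> norm (indicat_real (cbox a c) x * f x)"
      using box_subset_cbox by (intro AE_I2) (auto simp: indicator_def)
  qed auto
  have box0: "(\<integral>x. indicat_real (box a c) x * f x \<partial>lborel) = 0" if sub: "box a c \<subseteq> S" for a c
  proof -
    have m: "box_bump a c (real (Suc n)) \<in> borel_measurable borel" for n
    proof -
      have "continuous_on UNIV (box_bump a c (real (Suc n)))"
        using test_fun_box_bump [of "real (Suc n)" a c] unfolding test_fun_def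
        by (metis Ck_fun.simps(1) of_nat_0_less_iff zero_less_Suc)
      then show ?thesis by (rule borel_measurable_continuous_onI)
    qed
    have "(\<lambda>n. \<integral>x. f x * box_bump a c (real (Suc n)) x \<partial>lborel) \<longlonglongrightarrow> (\<integral>x. indicat_real (box a c) x * f x \<partial>lborel)"
    proof (rule integral_dominated_convergence)
      show "integrable lborel (\<lambda>x. \<bar>indicat_real (box a c) x * f x\<bar>)" using ib by auto
      show "AE x in lborel. (\<lambda>n. f x * box_bump a c (real (Suc n)) x) \<longlonglongrightarrow> indicat_real (box a c) x * f x"
        by (intro AE_I2) (use tendsto_mult [OF box_bump_tendsto tendsto_const] in \<open>simp add: mult.commute\<close>)
      show "AE x in lborel. norm (f x * box_bump a c (real (Suc n)) x) \<le> \<bar>indicat_real (box a c) x * f x\<bar>" for n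
      proof (intro AE_I2)
        fix x
        show "norm (f x * box_bump a c (real (Suc n)) x) \<le> \<bar>indicat_real (box a c) x * f x\<bar>"
          using box_bump_bounds [of a c "real (Suc n)" x] box_bump_outside [of "real (Suc n)" x a c]
          by (cases "x \<in> box a c") (auto simp: abs_mult mult_left_le)
      qed
    qed (use m in auto)
    moreover have "(\<integral>x. f x * box_bump a c (real (Suc n)) x \<partial>lborel) = 0" for n
      using sub by (intro test test_fun_box_bump box_bump_outside) auto
    ultimately show ?thesis by (simp add: LIMSEQ_const_iff)
  qed
  have AE_box: "AE x in lborel. x \<in> box a c \<longrightarrow> f x = 0" if sub: "box a c \<subseteq> S" for a c
  proof -
    have "AE x in lborel. indicat_real (box a c) x * f x = 0"
    proof (rule AE_zero_if_box_integrals_zero [OF ib])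
      fix a' c'
      have "(\<lambda>x. indicat_real (box a' c') x * (indicat_real (box a c) x * f x)) = (\<lambda>x. indicat_real (box a' c' \<inter> box a c) x * f x)"
        by (auto simp: indicator_def)
      moreover have "box a' c' \<inter> box a c \<subseteq> S" using sub by blast
      ultimately show "(\<integral>x. indicat_real (box a' c') x * (indicat_real (box a c) x * f x) \<partial>lborel) = 0"
        using box0 by (simp only: box_Int_box)
    qed
    then show ?thesis by eventually_elim (auto simp: indicator_def)
  qed
  obtain \<D> where D: "countable \<D>" "\<D> \<subseteq> Pow S" "\<And>X. X \<in> \<D> \<Longrightarrow> \<exists>a b. X = box a b" "\<Union>\<D> = S"
    by (rule open_countable_Union_open_box [OF S]) (rule that)
  have "AE x in lborel. \<forall>X\<in>\<D>. x \<in> X \<longrightarrow> f x = 0"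
  proof (subst AE_ball_countable [OF D(1)], rule ballI)
    fix X assume "X \<in> \<D>"
    then obtain a c where "X = box a c" "X \<subseteq> S" using D(2,3) by blast
    then show "AE x in lborel. x \<in> X \<longrightarrow> f x = 0" using AE_box by simp
  qed
  then show ?thesis
    by eventually_elim (unfold D(4) [symmetric], blast)
qed

lemma frechet_derivative_zero:
  assumes "open U" "x \<in> U" "\<And>y. y \<in> U \<Longrightarrow> f y = 0" shows "fder f x = (\<lambda>h. 0)"
proof -
  have "(f has_derivative (\<lambda>h. 0)) (at x)"
    by (rule has_derivative_transform_within_open [of "\<lambda>x. 0" _ _ UNIV U]) (use assms in auto)
  then show ?thesis by (metis frechet_derivative_at)
qed

lemma derivative_expand:
  fixes f :: "'a::euclidean_space \<Rightarrow> real"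
  assumes "(f has_derivative F) (at x)"
  shows "F h = (\<Sum>b\<in>Basis. (h \<bullet> b) * F b)"
proof -
  have lin: "linear F" using assms has_derivative_linear by blast
  have "F h = F (\<Sum>b\<in>Basis. (h \<bullet> b) *\<^sub>R b)" by (simp add: euclidean_representation)
  then show ?thesis by (simp add: linear_sum [OF lin] linear_scale [OF lin])
qed

text \<open>Outside the compact closure of the support everything vanishes, so continuity bounds
  \<open>\<phi>\<close> and its partial derivatives; the mean value inequality adds the Lipschitz
  constant.\<close>

lemma test_fun_bounds:
  fixes \<phi> :: "'a::euclidean_space \<Rightarrow> real"
  assumes "test_fun \<phi>"
  obtains C L where "C \<ge> 0" "L \<ge> 0" "\<And>x. \<bar>\<phi> x\<bar> \<le> C"
    "\<And>x h. \<bar>fder \<phi> x h\<bar> \<le> L * norm h"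
    "\<And>x y. \<bar>\<phi> x - \<phi> y\<bar> \<le> L * norm (x - y)"
    "continuous_on UNIV \<phi>" "\<And>h. continuous_on UNIV (\<lambda>x. fder \<phi> x h)"
    "\<And>x. (\<phi> has_derivative fder \<phi> x) (at x)"
proof -
  have Ck: "Ck_fun k \<phi>" for k using assms by (simp add: test_fun_def)
  have der: "(\<phi> has_derivative fder \<phi> x) (at x)" for x
    using Ck [of "Suc 0"] by (auto simp: frechet_derivative_works)
  have cb: "continuous_on UNIV (\<lambda>x. fder \<phi> x b)" if "b \<in> Basis" for b
    using Ck [of "Suc 0"] that by auto
  have c: "continuous_on UNIV \<phi>" using Ck [of 0] by simp
  let ?K = "closure {x. \<phi> x \<noteq> 0}"
  have K: "compact ?K" using assms by (simp add: test_fun_def)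
  have out: "\<phi> x = 0" if "x \<notin> ?K" for x
    using that closure_subset [of "{x. \<phi> x \<noteq> 0}"] by blast
  have out': "fder \<phi> x = (\<lambda>h. 0)" if "x \<notin> ?K" for x
  proof (rule frechet_derivative_zero)
    show "open (- ?K)" by (rule open_Compl [OF closed_closure])
    show "x \<in> - ?K" using that by blast
    show "\<phi> y = 0" if "y \<in> - ?K" for y using that by (intro out) blast
  qed
  have bdd: "\<exists>C\<ge>0. \<forall>x. \<bar>f x\<bar> \<le> C" if "continuous_on UNIV f" "\<And>x. x \<notin> ?K \<Longrightarrow> f x = 0" for f :: "'a \<Rightarrow> real"
  proof -
    have "bounded (f ` ?K)"
      using K that(1) by (meson compact_continuous_image compact_imp_bounded continuous_on_subset subset_UNIV)
    then obtain C where C: "\<And>x. x \<in> ?K \<Longrightarrow> \<bar>f x\<bar> \<le> C" by (auto simp: bounded_iff)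
    have "\<bar>f x\<bar> \<le> max C 0" for x
    proof (cases "x \<in> ?K")
      case True
      from C [OF this] show ?thesis by linarith
    next
      case False
      from that(2) [OF this] show ?thesis by simp
    qed
    then show ?thesis by (intro exI [of _ "max C 0"]) simp
  qed
  obtain C where C: "C \<ge> 0" "\<And>x. \<bar>\<phi> x\<bar> \<le> C" using bdd [OF c out] by auto
  have "\<exists>M. \<forall>b\<in>Basis. M b \<ge> 0 \<and> (\<forall>x. \<bar>fder \<phi> x b\<bar> \<le> M b)"
  proof (intro bchoice ballI)
    fix b :: 'a assume b: "b \<in> Basis"
    show "\<exists>y\<ge>0. \<forall>x. \<bar>fder \<phi> x b\<bar> \<le> y"
      by (rule bdd [OF cb [OF b]]) (simp add: out')
  qed
  then obtain M where M: "\<And>b. b \<in> Basis \<Longrightarrow> M b \<ge> 0" "\<And>b x. b \<in> Basis \<Longrightarrow> \<bar>fder \<phi> x b\<bar> \<le> M b"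
    by auto
  define L where "L = (\<Sum>b\<in>(Basis::'a set). M b)"
  have L0: "L \<ge> 0" unfolding L_def using M by (intro sum_nonneg) auto
  have L: "\<bar>fder \<phi> x h\<bar> \<le> L * norm h" for x h
  proof -
    have "\<bar>fder \<phi> x h\<bar> \<le> (\<Sum>b\<in>Basis. \<bar>(h \<bullet> b) * fder \<phi> x b\<bar>)"
      by (subst derivative_expand [OF der]) (rule sum_abs)
    also have "\<dots> \<le> (\<Sum>b\<in>Basis. norm h * M b)"
      unfolding abs_mult using M Basis_le_norm by (intro sum_mono mult_mono) auto
    finally show ?thesis by (simp add: L_def sum_distrib_left mult.commute)
  qed
  have lip: "\<bar>\<phi> x - \<phi> y\<bar> \<le> L * norm (x - y)" for x y
  proof -
    have "onorm (fder \<phi> x) \<le> L" for x by (rule onorm_le) (simp add: L)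
    then show ?thesis
      using differentiable_bound [of UNIV \<phi> "\<lambda>x. fder \<phi> x" L x y] der by auto
  qed
  have ch: "continuous_on UNIV (\<lambda>x. fder \<phi> x h)" for h
    by (subst derivative_expand [OF der]) (intro continuous_intros cb)
  show ?thesis by (rule that [OF C(1) L0 C(2) L lip c ch der])
qed

lemma test_fun_measurable:
  assumes "test_fun \<phi>"
  shows "\<phi> \<in> borel_measurable borel" "(\<lambda>x. fder \<phi> x h) \<in> borel_measurable borel"
  using test_fun_bounds [OF assms] by (metis borel_measurable_continuous_onI)+

lemma frechet_derivative_shift:
  assumes "f differentiable at (x - h)"
  shows "((\<lambda>x. f (x - h)) has_derivative frechet_derivative f (at (x - h))) (at x)"
    and "frechet_derivative (\<lambda>x. f (x - h)) (at x) = frechet_derivative f (at (x - h))"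
proof -
  have "((\<lambda>x. x - h) has_derivative (\<lambda>k. k)) (at x)" by (auto intro!: derivative_eq_intros)
  from has_derivative_compose [OF this assms [unfolded frechet_derivative_works]]
  show *: "((\<lambda>x. f (x - h)) has_derivative frechet_derivative f (at (x - h))) (at x)" by simp
  then show "frechet_derivative (\<lambda>x. f (x - h)) (at x) = frechet_derivative f (at (x - h))"
    by (metis frechet_derivative_at)
qed

lemma Ck_fun_shift: "Ck_fun k f \<Longrightarrow> Ck_fun k (\<lambda>x. f (x - h))"
proof (induction k arbitrary: f)
  case 0
  then show ?case by (auto intro!: continuous_on_compose2 [of UNIV f] continuous_intros)
next
  case (Suc k)
  then have d: "f differentiable at x" for x by simp
  have "(\<lambda>x. f (x - h)) differentiable at x" for x
    using frechet_derivative_shift(1) [OF d] unfolding differentiable_def by blast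
  moreover have "\<forall>b\<in>Basis. Ck_fun k (\<lambda>x. fder f x b)" using Suc.prems by simp
  then have "\<forall>b\<in>Basis. Ck_fun k (\<lambda>x. frechet_derivative f (at (x - h)) b)"
    using Suc.IH by blast
  ultimately show ?case by (simp add: frechet_derivative_shift(2) [OF d])
qed

lemma test_fun_shift:
  assumes "test_fun \<phi>" shows "test_fun (\<lambda>x. \<phi> (x - h))"
proof -
  have eq: "{x. \<phi> (x - h) \<noteq> 0} = (\<lambda>x. h + x) ` {x. \<phi> x \<noteq> 0}"
    by (auto simp: image_iff) (metis add.commute diff_add_cancel)
  have "bounded {x. \<phi> x \<noteq> 0}" using assms by (simp add: test_fun_def)
  then have "bounded {x. \<phi> (x - h) \<noteq> 0}" unfolding eq by (rule bounded_translation)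
  then show ?thesis using assms Ck_fun_shift by (auto simp: test_fun_def)
qed

section \<open>Translations and averages over segments\<close>

lemma lborel_shift: "lborel = distr lborel borel (\<lambda>x. x + h)" for h :: "'a::euclidean_space"
proof -
  have "(\<lambda>x. x + h) = (+) h" by (auto simp: add.commute)
  then show ?thesis using lborel_distr_plus [of h] by simp
qed

lemma nn_integral_lborel_shift:
  "f \<in> borel_measurable borel \<Longrightarrow> (\<integral>\<^sup>+x. f (x + h) \<partial>lborel) = (\<integral>\<^sup>+x. f x \<partial>lborel)" for h :: "'a::euclidean_space"
  by (subst (2) lborel_shift [of h]) (simp add: nn_integral_distr)

lemma integral_lborel_shift:
  fixes f :: "'a::euclidean_space \<Rightarrow> 'b::{banach, second_countable_topology}"
  shows "f \<in> borel_measurable borel \<Longrightarrow> (\<integral>x. f (x + h) \<partial>lborel) = (\<integral>x. f x \<partial>lborel)"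
  by (subst (2) lborel_shift [of h]) (simp add: integral_distr)

lemma integrable_lborel_shift:
  fixes f :: "'a::euclidean_space \<Rightarrow> 'b::{banach, second_countable_topology}"
  assumes "integrable lborel f" shows "integrable lborel (\<lambda>x. f (x + h))"
proof -
  have "integrable (distr lborel borel (\<lambda>x. x + h)) f" using assms lborel_shift [of h] by simp
  then show ?thesis by (subst (asm) integrable_distr_eq) (use assms in auto)
qed

text \<open>A density on the whole line and not a restriction to \<open>{0..1}\<close>, so that all
  Borel functions of the parameter stay measurable.\<close>

definition unit_leb :: "real measure" where
  "unit_leb = density lborel (\<lambda>t. ennreal (indicator {0..1} t))"

lemma sets_unit_leb [simp, measurable_cong]: "sets unit_leb = sets borel"
  and space_unit_leb [simp]: "space unit_leb = UNIV"
  by (auto simp: unit_leb_def)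

lemma emeasure_unit_leb_UNIV: "emeasure unit_leb UNIV = 1"
  by (simp add: unit_leb_def emeasure_density ennreal_indicator)

interpretation unit_leb: finite_measure unit_leb
  by (rule finite_measureI) (simp add: emeasure_unit_leb_UNIV)

interpretation lborel_unit: pair_sigma_finite lborel unit_leb ..

lemma measure_unit_leb_UNIV [simp]: "measure unit_leb UNIV = 1"
  by (simp add: measure_def emeasure_unit_leb_UNIV)

lemma integral_unit_leb:
  fixes f :: "real \<Rightarrow> real"
  assumes "f \<in> borel_measurable borel"
  shows "(\<integral>t. f t \<partial>unit_leb) = (\<integral>t. f t * indicator {0..1} t \<partial>lborel)"
  unfolding unit_leb_def using assms by (subst integral_density) (auto simp: mult.commute)

lemma AE_unit_leb: "AE t in unit_leb. 0 \<le> t \<and> t \<le> 1"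
  unfolding unit_leb_def by (subst AE_density) (auto simp: indicator_def)

text \<open>Tonelli's theorem, then translation invariance for each fixed \<open>t\<close>:
  averaging over segments does not change the integral.\<close>

lemma nn_integral_segment:
  fixes f :: "real \<Rightarrow> 'a::euclidean_space \<Rightarrow> ennreal" and h :: 'a
  assumes [measurable]: "case_prod f \<in> borel_measurable (borel \<Otimes>\<^sub>M borel)"
  shows "(\<integral>\<^sup>+x. (\<integral>\<^sup>+t. f t (x + t *\<^sub>R h) \<partial>unit_leb) \<partial>lborel) = (\<integral>\<^sup>+t. (\<integral>\<^sup>+x. f t x \<partial>lborel) \<partial>unit_leb)"
proof -
  have "(\<lambda>(t, x). f t x) \<in> borel_measurable (borel \<Otimes>\<^sub>M borel)" using assms by simp
  have m: "(\<lambda>(x, t). f t (x + t *\<^sub>R h)) \<in> borel_measurable (lborel \<Otimes>\<^sub>M unit_leb)"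
    by measurable
  have "(\<integral>\<^sup>+x. (\<integral>\<^sup>+t. f t (x + t *\<^sub>R h) \<partial>unit_leb) \<partial>lborel) = (\<integral>\<^sup>+t. (\<integral>\<^sup>+x. f t (x + t *\<^sub>R h) \<partial>lborel) \<partial>unit_leb)"
    using lborel_unit.Fubini [OF m] by simp
  also have "\<dots> = (\<integral>\<^sup>+t. (\<integral>\<^sup>+x. f t x \<partial>lborel) \<partial>unit_leb)"
  proof (rule nn_integral_cong)
    fix t
    have "f t \<in> borel_measurable borel" by measurable
    then show "(\<integral>\<^sup>+x. f t (x + t *\<^sub>R h) \<partial>lborel) = (\<integral>\<^sup>+x. f t x \<partial>lborel)" by (rule nn_integral_lborel_shift)
  qed
  finally show ?thesis .
qed

lemma integrable_segment:
  fixes f :: "'a::euclidean_space \<Rightarrow> 'b::{banach, second_countable_topology}"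
  assumes f: "integrable lborel f"
  shows "integrable (lborel \<Otimes>\<^sub>M unit_leb) (\<lambda>(x, t). f (x + t *\<^sub>R h))"
proof -
  have [measurable]: "f \<in> borel_measurable borel" using f by auto
  show ?thesis
  proof (rule integrableI_bounded)
    have "(\<integral>\<^sup>+z. ennreal (norm (case z of (x, t) \<Rightarrow> f (x + t *\<^sub>R h))) \<partial>(lborel \<Otimes>\<^sub>M unit_leb))
      = (\<integral>\<^sup>+x. (\<integral>\<^sup>+t. ennreal (norm (f (x + t *\<^sub>R h))) \<partial>unit_leb) \<partial>lborel)"
      by (subst unit_leb.nn_integral_fst [symmetric]) auto
    also have "\<dots> = (\<integral>\<^sup>+t. (\<integral>\<^sup>+x. ennreal (norm (f x)) \<partial>lborel) \<partial>unit_leb)"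
      by (rule nn_integral_segment [of "\<lambda>t x. ennreal (norm (f x))"]) measurable
    also have "\<dots> = (\<integral>\<^sup>+x. ennreal (norm (f x)) \<partial>lborel)" by (simp add: emeasure_unit_leb_UNIV)
    also have "\<dots> < \<infinity>" using f by (simp add: integrable_iff_bounded)
    finally show "(\<integral>\<^sup>+z. ennreal (norm (case z of (x, t) \<Rightarrow> f (x + t *\<^sub>R h))) \<partial>(lborel \<Otimes>\<^sub>M unit_leb)) < \<infinity>" .
  qed measurable
qed

text \<open>Jensen's inequality. For \<open>p > 1\<close> integrate the tangent of the power at the
  mean \<open>a\<close>; its linear term has integral 0.\<close>

lemma integral_unit_leb_le_powr:
  fixes f :: "real \<Rightarrow> real"
  assumes f: "f \<in> borel_measurable borel" "\<And>t. f t \<ge> 0" "integrable unit_leb f" and p: "p \<ge> 1"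
  shows "ennreal ((\<integral>t. f t \<partial>unit_leb) powr p) \<le> (\<integral>\<^sup>+t. ennreal (f t powr p) \<partial>unit_leb)"
proof (cases "p = 1")
  case True
  have "(\<integral>\<^sup>+t. ennreal (f t powr p) \<partial>unit_leb) = ennreal (\<integral>t. f t \<partial>unit_leb)"
    using True f by (simp add: nn_integral_eq_integral)
  moreover have "(\<integral>t. f t \<partial>unit_leb) \<ge> 0" using f by simp
  ultimately show ?thesis using True by simp
next
  case False
  then have p: "p > 1" using p by simp
  note [measurable] = f(1)
  show ?thesis
  proof (cases "(\<integral>\<^sup>+t. ennreal (f t powr p) \<partial>unit_leb) = \<infinity>")
    case True
    then show ?thesis by simp
  next
    case False
    have i: "integrable unit_leb (\<lambda>t. f t powr p)"
    proof (rule integrableI_bounded)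
      show "(\<lambda>t. f t powr p) \<in> borel_measurable unit_leb" by measurable
    qed (use False in \<open>auto simp: less_top\<close>)
    define a where "a = (\<integral>t. f t \<partial>unit_leb)"
    have a0: "a \<ge> 0" unfolding a_def using f by simp
    have "(\<integral>t. a powr p + p * a powr (p - 1) * (f t - a) \<partial>unit_leb) \<le> (\<integral>t. f t powr p \<partial>unit_leb)"
      using powr_tangent [OF p a0 f(2)] f(3) i by (intro integral_mono) auto
    moreover have "(\<integral>t. a powr p + p * a powr (p - 1) * (f t - a) \<partial>unit_leb) = a powr p"
      using f(3) by (simp add: a_def)
    ultimately have "a powr p \<le> (\<integral>t. f t powr p \<partial>unit_leb)" by simp
    then show ?thesis using i by (simp add: nn_integral_eq_integral a_def ennreal_leI)
  qed
qed

section \<open>Weak gradients of integrable functions\<close>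

text \<open>The working form of \<open>weak_gradient\<close> for functions of bounded support:
  global integrability makes Fubini's theorem available, and arbitrary directions \<open>h\<close>
  fit translations. \<open>weak_gradient_imp_wgrad\<close> and
  \<open>wgrad_imp_weak_gradient\<close> connect the two notions.\<close>

definition wgrad :: "('a::euclidean_space \<Rightarrow> real) \<Rightarrow> ('a \<Rightarrow> 'a) \<Rightarrow> bool" where
  "wgrad u g \<longleftrightarrow> integrable lborel u \<and> integrable lborel g \<and>
    (\<forall>\<phi>. test_fun \<phi> \<longrightarrow> (\<forall>h. (\<integral>x. u x * fder \<phi> x h \<partial>lborel)
       = - (\<integral>x. (g x \<bullet> h) * \<phi> x \<partial>lborel)))"

lemma integrable_mult_bounded:
  fixes f m :: "'a \<Rightarrow> real"
  assumes "integrable M f" "m \<in> borel_measurable M" "\<And>x. \<bar>m x\<bar> \<le> C"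
  shows "integrable M (\<lambda>x. f x * m x)" "integrable M (\<lambda>x. m x * f x)"
proof -
  show *: "integrable M (\<lambda>x. f x * m x)"
  proof (rule Bochner_Integration.integrable_bound)
    show "integrable M (\<lambda>x. C * f x)" using assms by simp
    show "AE x in M. norm (f x * m x) \<le> norm (C * f x)"
      using order_trans [OF assms(3) abs_ge_self]
      by (intro AE_I2) (simp add: abs_mult mult.commute [of "\<bar>f _\<bar>"] mult_right_mono)
  qed (use assms in auto)
  then show "integrable M (\<lambda>x. m x * f x)" by (simp add: mult.commute)
qed

lemma test_integrable:
  fixes f :: "'a::euclidean_space \<Rightarrow> real"
  assumes "test_fun \<phi>" "integrable lborel f"
  shows "integrable lborel (\<lambda>x. f x * \<phi> x)" "integrable lborel (\<lambda>x. f x * fder \<phi> x h)"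
proof -
  obtain C L where *: "\<And>x. \<bar>\<phi> x\<bar> \<le> C" "\<And>x h. \<bar>fder \<phi> x h\<bar> \<le> L * norm h"
    using test_fun_bounds [OF assms(1)] by metis
  show "integrable lborel (\<lambda>x. f x * \<phi> x)" "integrable lborel (\<lambda>x. f x * fder \<phi> x h)"
    using integrable_mult_bounded(1) [OF assms(2) _ *(1)] integrable_mult_bounded(1) [OF assms(2) _ *(2)]
      test_fun_measurable [OF assms(1)] by auto
qed

lemma wgradD:
  assumes "wgrad u g"
  shows "integrable lborel u" "integrable lborel g" "u \<in> borel_measurable borel" "g \<in> borel_measurable borel"
    "test_fun \<phi> \<Longrightarrow> (\<integral>x. u x * fder \<phi> x h \<partial>lborel) = - (\<integral>x. (g x \<bullet> h) * \<phi> x \<partial>lborel)"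
  using assms by (auto simp: wgrad_def)

lemma wgrad_add:
  assumes "wgrad u g" "wgrad u' g'" shows "wgrad (\<lambda>x. u x + u' x) (\<lambda>x. g x + g' x)"
proof -
  have "(\<integral>x. (u x + u' x) * fder \<phi> x h \<partial>lborel) = - (\<integral>x. ((g x + g' x) \<bullet> h) * \<phi> x \<partial>lborel)"
    if t: "test_fun \<phi>" for \<phi> h
    using wgradD(5) [OF assms(1) t, of h] wgradD(5) [OF assms(2) t, of h]
      test_integrable [OF t wgradD(1) [OF assms(1)]] test_integrable [OF t wgradD(1) [OF assms(2)]]
      test_integrable(1) [OF t, of "\<lambda>x. g x \<bullet> h"] test_integrable(1) [OF t, of "\<lambda>x. g' x \<bullet> h"]
      wgradD(2) [OF assms(1)] wgradD(2) [OF assms(2)]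
    by (simp add: distrib_right inner_add_left)
  then show ?thesis using assms by (auto simp: wgrad_def)
qed

lemma wgrad_scale:
  assumes "wgrad u g" shows "wgrad (\<lambda>x. c * u x) (\<lambda>x. c *\<^sub>R g x)"
  using assms by (auto simp: wgrad_def mult.assoc)

lemma wgrad_diff:
  assumes "wgrad u g" "wgrad u' g'" shows "wgrad (\<lambda>x. u x - u' x) (\<lambda>x. g x - g' x)"
  using wgrad_add [OF assms(1) wgrad_scale [OF assms(2), of "-1"]] by simp

lemma AE_zero_componentwise:
  fixes g :: "'b \<Rightarrow> 'a::euclidean_space"
  assumes "\<And>b. b \<in> Basis \<Longrightarrow> AE x in M. P x \<longrightarrow> g x \<bullet> b = 0"
  shows "AE x in M. P x \<longrightarrow> g x = 0"
proof -
  have "AE x in M. \<forall>b\<in>Basis. P x \<longrightarrow> g x \<bullet> b = 0"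
    using assms by (intro AE_finite_allI) auto
  then show ?thesis by eventually_elim (auto intro: euclidean_eqI)
qed

lemma wgrad_zero_unique:
  assumes w: "wgrad u g" and "AE x in lborel. u x = 0" shows "AE x in lborel. g x = 0"
proof -
  note [measurable] = wgradD(4) [OF w]
  have "AE x in lborel. True \<longrightarrow> g x = 0"
  proof (rule AE_zero_componentwise)
    fix b :: 'a assume "b \<in> Basis"
    have i: "integrable lborel (\<lambda>x. g x \<bullet> b)" using wgradD(2) [OF w] by auto
    have "AE x in lborel. x \<in> UNIV \<longrightarrow> g x \<bullet> b = 0"
    proof (rule fundamental_lemma_variations)
      fix K :: "'a set" assume "compact K"
      then show "set_integrable lborel K (\<lambda>x. g x \<bullet> b)"
        using i unfolding set_integrable_def by (intro integrable_mult_indicator) (auto simp: compact_imp_closed)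
    next
      fix \<phi> :: "'a \<Rightarrow> real" assume t: "test_fun \<phi>"
      have "(\<integral>x. u x * fder \<phi> x b \<partial>lborel) = (\<integral>x. 0 \<partial>(lborel::'a measure))"
        using assms(2) wgradD(3) [OF w] test_fun_measurable [OF t]
        by (intro integral_cong_AE) (auto elim!: eventually_mono)
      then show "(\<integral>x. (g x \<bullet> b) * \<phi> x \<partial>lborel) = 0" using wgradD(5) [OF w t, of b] by simp
    qed auto
    then show "AE x in lborel. True \<longrightarrow> g x \<bullet> b = 0" by simp
  qed
  then show ?thesis by simp
qed

lemma wgrad_unique:
  assumes "wgrad u g" "wgrad u' g'" "AE x in lborel. u x = u' x" shows "AE x in lborel. g x = g' x"
proof -
  have "AE x in lborel. u x - u' x = 0" using assms(3) by eventually_elim simp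
  from wgrad_zero_unique [OF wgrad_diff [OF assms(1,2)] this] show ?thesis by eventually_elim simp
qed

lemma line_derivative:
  fixes \<phi> :: "'a::euclidean_space \<Rightarrow> real"
  assumes "\<And>x. (\<phi> has_derivative \<phi>' x) (at x)"
  shows "((\<lambda>r. \<phi> (x - r *\<^sub>R h)) has_real_derivative - \<phi>' (x - s *\<^sub>R h) h) (at s)"
proof -
  have "((\<lambda>t. x - t *\<^sub>R h) has_derivative (\<lambda>t. - (t *\<^sub>R h))) (at s)" by (auto intro!: derivative_eq_intros)
  from has_derivative_compose [OF this assms]
  have "((\<lambda>t. \<phi> (x - t *\<^sub>R h)) has_derivative (\<lambda>t. \<phi>' (x - s *\<^sub>R h) (- (t *\<^sub>R h)))) (at s)" .
  moreover have "linear (\<phi>' (x - s *\<^sub>R h))" using assms has_derivative_linear by blast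
  ultimately have "((\<lambda>t. \<phi> (x - t *\<^sub>R h)) has_derivative (\<lambda>t. - \<phi>' (x - s *\<^sub>R h) h * t)) (at s)"
    by (simp add: linear_neg linear_scale mult.commute)
  then show ?thesis unfolding has_field_derivative_def .
qed

lemma mvt_real:
  fixes T T' :: "real \<Rightarrow> real"
  assumes der: "\<And>t. (T has_real_derivative T' t) (at t)"
  shows "\<exists>\<xi>. T b - T a = T' \<xi> * (b - a) \<and> \<bar>\<xi> - a\<bar> \<le> \<bar>b - a\<bar>"
proof (cases a b rule: linorder_cases)
  case less
  then obtain z where "a < z" "z < b" "T b - T a = (b - a) * T' z" using MVT2 [OF less, of T T'] der by blast
  then show ?thesis by (intro exI [of _ z]) auto
next
  case greater
  then obtain z where "b < z" "z < a" "T a - T b = (a - b) * T' z" using MVT2 [OF greater, of T T'] der by blast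
  then show ?thesis by (intro exI [of _ z]) (auto simp: algebra_simps)
qed auto

text \<open>Difference quotients of \<open>u\<close> are averages of \<open>g\<close> over segments, tested against \<open>\<phi>\<close>: apply the
  definition of \<open>wgrad\<close> to the translates of \<open>\<phi>\<close>.\<close>

lemma wgrad_segment:
  assumes w: "wgrad u g"
  shows "AE x in lborel. integrable unit_leb (\<lambda>t. g (x + t *\<^sub>R h))"
    and "AE x in lborel. u (x + h) - u x = (\<integral>t. g (x + t *\<^sub>R h) \<bullet> h \<partial>unit_leb)"
proof -
  note [measurable] = wgradD(3,4) [OF w]
  note iu = wgradD(1) [OF w] and ig = wgradD(2) [OF w]
  have seg: "integrable (lborel \<Otimes>\<^sub>M unit_leb) (\<lambda>(x, t). g (x + t *\<^sub>R h))" by (rule integrable_segment [OF ig])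
  show "AE x in lborel. integrable unit_leb (\<lambda>t. g (x + t *\<^sub>R h))"
    using lborel_unit.AE_integrable_fst [OF seg] by simp
  have "integrable lborel (\<lambda>x. g x \<bullet> h)" using ig by auto
  then have seg': "integrable (lborel \<Otimes>\<^sub>M unit_leb) (\<lambda>(x, t). g (x + t *\<^sub>R h) \<bullet> h)"
    by (rule integrable_segment)
  define A where "A x = (\<integral>t. g (x + t *\<^sub>R h) \<bullet> h \<partial>unit_leb)" for x
  have iA: "integrable lborel A" unfolding A_def using lborel_unit.integrable_fst [OF seg'] by simp
  have [measurable]: "A \<in> borel_measurable borel" using iA by auto
  define f where "f x = u (x + h) - u x - A x" for x
  have fi: "integrable lborel f" unfolding f_def using iu iA integrable_lborel_shift [OF iu] by auto
  have "AE x in lborel. x \<in> UNIV \<longrightarrow> f x = 0"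
  proof (rule fundamental_lemma_variations)
    show "f \<in> borel_measurable borel" using fi by auto
    fix K :: "'a set" assume "compact K"
    then show "set_integrable lborel K f"
      using fi unfolding set_integrable_def by (intro integrable_mult_indicator) (auto simp: compact_imp_closed)
  next
    fix \<phi> :: "'a \<Rightarrow> real" assume t: "test_fun \<phi>"
    note [measurable] = test_fun_measurable [OF t]
    obtain C L where B: "\<And>x. \<bar>\<phi> x\<bar> \<le> C" "\<And>x h. \<bar>fder \<phi> x h\<bar> \<le> L * norm h"
      "\<And>h. continuous_on UNIV (\<lambda>x. fder \<phi> x h)"
      "\<And>x. (\<phi> has_derivative fder \<phi> x) (at x)"
      using test_fun_bounds [OF t] by metis
    have i1: "integrable lborel (\<lambda>x. u (x + h) * \<phi> x)" "integrable lborel (\<lambda>x. u x * \<phi> x)" "integrable lborel (\<lambda>x. A x * \<phi> x)"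
      using test_integrable(1) [OF t] iu iA integrable_lborel_shift [OF iu] by auto
    have i2: "integrable lborel (\<lambda>x. u x * \<phi> (x - h))"
      using test_integrable(1) [OF test_fun_shift [OF t] iu] .
    \<comment> \<open>The translation moves from \<open>u\<close> to \<open>\<phi>\<close>, where
      the fundamental theorem of calculus along the segment turns the difference into an average of
      directional derivatives of translates.\<close>
    have diff: "\<phi> (x - h) - \<phi> x = - (\<integral>t. frechet_derivative \<phi> (at (x - t *\<^sub>R h)) h \<partial>unit_leb)" for x
    proof -
      have "(\<integral>t. (- frechet_derivative \<phi> (at (x - t *\<^sub>R h)) h) * indicator {0..1} t \<partial>lborel) = \<phi> (x - 1 *\<^sub>R h) - \<phi> (x - 0 *\<^sub>R h)"
      proof (rule integral_FTC_Icc_real)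
        fix s :: real
        show "((\<lambda>t. \<phi> (x - t *\<^sub>R h)) has_real_derivative - frechet_derivative \<phi> (at (x - s *\<^sub>R h)) h) (at s)"
          by (rule line_derivative [OF B(4)])
        have "continuous_on UNIV (\<lambda>t::real. x - t *\<^sub>R h)" by (intro continuous_intros)
        from continuous_on_compose2 [OF B(3) this]
        have "continuous_on UNIV (\<lambda>t. - frechet_derivative \<phi> (at (x - t *\<^sub>R h)) h)"
          by (intro continuous_on_minus) simp
        then show "isCont (\<lambda>t. - frechet_derivative \<phi> (at (x - t *\<^sub>R h)) h) s"
          by (simp add: continuous_on_eq_continuous_at)
      qed simp
      then show ?thesis by (simp add: integral_unit_leb)
    qed
    define Z where "Z = (\<lambda>(x, t). u x * frechet_derivative \<phi> (at (x - t *\<^sub>R h)) h)"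
    have Zm: "Z \<in> borel_measurable (lborel \<Otimes>\<^sub>M unit_leb)"
      unfolding Z_def by measurable
    have Zi: "integrable (lborel \<Otimes>\<^sub>M unit_leb) Z"
    proof (rule Bochner_Integration.integrable_bound)
      have "integrable (lborel \<Otimes>\<^sub>M unit_leb) (\<lambda>(x, t). u (x + t *\<^sub>R 0))" by (rule integrable_segment [OF iu])
      then show "integrable (lborel \<Otimes>\<^sub>M unit_leb) (\<lambda>z. (L * norm h) * (case z of (x, t) \<Rightarrow> u x))" by simp
      show "AE z in lborel \<Otimes>\<^sub>M unit_leb. norm (Z z) \<le> norm ((L * norm h) * (case z of (x, t) \<Rightarrow> u x))"
      proof (intro AE_I2)
        fix z :: "'a \<times> real"
        have "\<bar>u (fst z)\<bar> * \<bar>frechet_derivative \<phi> (at (fst z - snd z *\<^sub>R h)) h\<bar> \<le> \<bar>u (fst z)\<bar> * \<bar>L * norm h\<bar>"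
          using B(2) by (intro mult_left_mono order_trans [OF B(2) abs_ge_self]) auto
        then show "norm (Z z) \<le> norm ((L * norm h) * (case z of (x, t) \<Rightarrow> u x))"
          by (simp add: Z_def split_beta abs_mult mult_ac)
      qed
    qed (rule Zm)
    define Y where "Y = (\<lambda>(x, t). (g (x + t *\<^sub>R h) \<bullet> h) * \<phi> x)"
    have Yi: "integrable (lborel \<Otimes>\<^sub>M unit_leb) Y"
      using integrable_mult_bounded(1) [OF seg', of "\<lambda>(x, t). \<phi> x" C] B(1)
      by (simp add: Y_def case_prod_beta')
    have "(\<integral>x. f x * \<phi> x \<partial>lborel) = (\<integral>x. u (x + h) * \<phi> x \<partial>lborel) - (\<integral>x. u x * \<phi> x \<partial>lborel) - (\<integral>x. A x * \<phi> x \<partial>lborel)"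
      using i1 by (simp add: f_def left_diff_distrib)
    also have "(\<integral>x. u (x + h) * \<phi> x \<partial>lborel) = (\<integral>x. u x * \<phi> (x - h) \<partial>lborel)"
      using integral_lborel_shift [of "\<lambda>x. u x * \<phi> (x - h)" h] by simp
    also have "\<dots> - (\<integral>x. u x * \<phi> x \<partial>lborel) = (\<integral>x. u x * (\<phi> (x - h) - \<phi> x) \<partial>lborel)"
      using i1 i2 by (simp add: right_diff_distrib)
    also have "\<dots> = - (\<integral>x. (\<integral>t. Z (x, t) \<partial>unit_leb) \<partial>lborel)"
      by (simp add: diff Z_def)
    also have "(\<integral>x. (\<integral>t. Z (x, t) \<partial>unit_leb) \<partial>lborel) = (\<integral>t. (\<integral>x. Z (x, t) \<partial>lborel) \<partial>unit_leb)"
      using lborel_unit.Fubini_integral [of "\<lambda>x t. Z (x, t)"] Zi by simp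
    also have "\<dots> = (\<integral>t. - (\<integral>x. Y (x, t) \<partial>lborel) \<partial>unit_leb)"
    proof (intro Bochner_Integration.integral_cong refl)
      fix s :: real
      have d: "\<phi> differentiable at x" for x using B(4) by (auto simp: differentiable_def)
      have "(\<integral>x. Z (x, s) \<partial>lborel) = - (\<integral>x. (g x \<bullet> h) * \<phi> (x - s *\<^sub>R h) \<partial>lborel)"
        using wgradD(5) [OF w test_fun_shift [OF t, of "s *\<^sub>R h"], of h]
        by (simp add: Z_def frechet_derivative_shift(2) [OF d])
      also have "(\<integral>x. (g x \<bullet> h) * \<phi> (x - s *\<^sub>R h) \<partial>lborel) = (\<integral>x. Y (x, s) \<partial>lborel)"
        using integral_lborel_shift [of "\<lambda>x. (g x \<bullet> h) * \<phi> (x - s *\<^sub>R h)" "s *\<^sub>R h"] by (simp add: Y_def)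
      finally show "(\<integral>x. Z (x, s) \<partial>lborel) = - (\<integral>x. Y (x, s) \<partial>lborel)" .
    qed
    also have "\<dots> = - (\<integral>t. (\<integral>x. Y (x, t) \<partial>lborel) \<partial>unit_leb)" by simp
    also have "(\<integral>t. (\<integral>x. Y (x, t) \<partial>lborel) \<partial>unit_leb) = (\<integral>x. (\<integral>t. Y (x, t) \<partial>unit_leb) \<partial>lborel)"
      using lborel_unit.Fubini_integral [of "\<lambda>x t. Y (x, t)"] Yi by simp
    also have "\<dots> = (\<integral>x. A x * \<phi> x \<partial>lborel)" by (simp add: Y_def A_def)
    finally show "(\<integral>x. f x * \<phi> x \<partial>lborel) = 0" by simp
  qed auto
  then show "AE x in lborel. u (x + h) - u x = (\<integral>t. g (x + t *\<^sub>R h) \<bullet> h \<partial>unit_leb)"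
    by eventually_elim (simp add: f_def A_def)
qed

text \<open>Jensen's inequality for the segment average of \<open>g\<close>, then
  \<open>nn_integral_segment\<close>. The case \<open>p = 1\<close> is included for the sake of the
  chain rule.\<close>

lemma wgrad_translation_bound:
  assumes w: "wgrad u g" and p: "p \<ge> 1"
  shows "(\<integral>\<^sup>+x. ennreal (\<bar>u (x + h) - u x\<bar> powr p) \<partial>lborel)
    \<le> ennreal (norm h powr p) * nn_power_integral p g"
proof -
  note [measurable] = wgradD(3,4) [OF w]
  have "AE x in lborel. ennreal (\<bar>u (x + h) - u x\<bar> powr p)
    \<le> (\<integral>\<^sup>+t. ennreal (norm h powr p) * ennreal (norm (g (x + t *\<^sub>R h)) powr p) \<partial>unit_leb)"
    using wgrad_segment(1) [OF w, where h = h] wgrad_segment(2) [OF w, where h = h]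
  proof eventually_elim
    case (elim x)
    have i: "integrable unit_leb (\<lambda>t. norm (g (x + t *\<^sub>R h)))" using elim by auto
    have "\<bar>u (x + h) - u x\<bar> \<le> (\<integral>t. \<bar>g (x + t *\<^sub>R h) \<bullet> h\<bar> \<partial>unit_leb)"
      using elim(2) integral_abs_bound [of unit_leb "\<lambda>t. g (x + t *\<^sub>R h) \<bullet> h"] by simp
    also have "\<dots> \<le> (\<integral>t. norm (g (x + t *\<^sub>R h)) * norm h \<partial>unit_leb)"
      using i elim(1) by (intro integral_mono Cauchy_Schwarz_ineq2) auto
    finally have "\<bar>u (x + h) - u x\<bar> \<le> (\<integral>t. norm (g (x + t *\<^sub>R h)) * norm h \<partial>unit_leb)" .
    then have le: "\<bar>u (x + h) - u x\<bar> \<le> norm h * (\<integral>t. norm (g (x + t *\<^sub>R h)) \<partial>unit_leb)"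
      by (simp add: mult.commute)
    then have "\<bar>u (x + h) - u x\<bar> powr p \<le> (norm h * (\<integral>t. norm (g (x + t *\<^sub>R h)) \<partial>unit_leb)) powr p"
      using p by (intro powr_mono2 le) auto
    also have "\<dots> = norm h powr p * (\<integral>t. norm (g (x + t *\<^sub>R h)) \<partial>unit_leb) powr p"
      by (intro powr_mult)
    finally have "ennreal (\<bar>u (x + h) - u x\<bar> powr p) \<le> ennreal (norm h powr p) * ennreal ((\<integral>t. norm (g (x + t *\<^sub>R h)) \<partial>unit_leb) powr p)"
      by (simp add: ennreal_mult [symmetric] ennreal_leI)
    also have "\<dots> \<le> ennreal (norm h powr p) * (\<integral>\<^sup>+t. ennreal (norm (g (x + t *\<^sub>R h)) powr p) \<partial>unit_leb)"
      using i p by (intro mult_left_mono integral_unit_leb_le_powr) auto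
    also have "\<dots> = (\<integral>\<^sup>+t. ennreal (norm h powr p) * ennreal (norm (g (x + t *\<^sub>R h)) powr p) \<partial>unit_leb)"
      by (subst nn_integral_cmult) auto
    finally show ?case .
  qed
  then have "(\<integral>\<^sup>+x. ennreal (\<bar>u (x + h) - u x\<bar> powr p) \<partial>lborel)
    \<le> (\<integral>\<^sup>+x. (\<integral>\<^sup>+t. ennreal (norm h powr p) * ennreal (norm (g (x + t *\<^sub>R h)) powr p) \<partial>unit_leb) \<partial>lborel)"
    by (rule nn_integral_mono_AE)
  also have "\<dots> = (\<integral>\<^sup>+t. (\<integral>\<^sup>+x. ennreal (norm h powr p) * ennreal (norm (g x) powr p) \<partial>lborel) \<partial>unit_leb)"
    by (rule nn_integral_segment [of "\<lambda>t x. ennreal (norm h powr p) * ennreal (norm (g x) powr p)"]) measurable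
  also have "\<dots> = ennreal (norm h powr p) * nn_power_integral p g"
    by (subst nn_integral_cmult) (auto simp: emeasure_unit_leb_UNIV)
  finally show ?thesis .
qed

section \<open>The chain rule for weak gradients\<close>

lemma difference_quotient_tendsto:
  fixes T T' :: "real \<Rightarrow> real"
  assumes der: "\<And>t. (T has_real_derivative T' t) (at t)" and T': "isCont T' c"
    and ab: "a \<longlonglongrightarrow> c" "b \<longlonglongrightarrow> c"
  shows "(\<lambda>n. if b n = a n then T' (a n) else (T (b n) - T (a n)) / (b n - a n)) \<longlonglongrightarrow> T' c"
proof -
  \<comment> \<open>By the mean value theorem each slope is a value of \<open>T'\<close> at distance
    at most \<open>\<bar>b n - a n\<bar>\<close> from \<open>a n\<close>; the value
    \<open>T' (a n)\<close> at coincidence keeps this true.\<close>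
  define D where "D n = (if b n = a n then T' (a n) else (T (b n) - T (a n)) / (b n - a n))" for n
  have "\<exists>\<xi>. D n = T' \<xi> \<and> \<bar>\<xi> - a n\<bar> \<le> \<bar>b n - a n\<bar>" for n
    using mvt_real [OF der, of "b n" "a n"] by (auto simp: D_def)
  then obtain \<xi> where \<xi>: "\<And>n. D n = T' (\<xi> n)" "\<And>n. \<bar>\<xi> n - a n\<bar> \<le> \<bar>b n - a n\<bar>" by metis
  have "(\<lambda>n. \<bar>b n - a n\<bar>) \<longlonglongrightarrow> 0" using tendsto_rabs_zero [OF LIM_zero [OF tendsto_diff [OF ab(2,1)]]] by simp
  then have "(\<lambda>n. \<xi> n - a n) \<longlonglongrightarrow> 0"
    by (rule Lim_null_comparison [rotated]) (use \<xi>(2) in auto)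
  from tendsto_add [OF this ab(1)] have "\<xi> \<longlonglongrightarrow> c" by simp
  then show ?thesis unfolding D_def [symmetric] \<xi>(1) by (rule isCont_tendsto_compose [OF T'])
qed

text \<open>The difference quotient of \<open>T \<circ> u\<close> at \<open>x\<close> is a slope of \<open>T\<close> times the average of \<open>g\<close> over the
  segment from \<open>x\<close> to \<open>x + s *\<^sub>R h\<close>.  Moving the translation from \<open>g\<close> to the other factors leaves an
  integrand dominated by a multiple of \<open>norm (g x)\<close>, which converges almost everywhere along a subsequence.\<close>

lemma wgrad_chain:
  fixes u :: "'a::euclidean_space \<Rightarrow> real"
  assumes w: "wgrad u g" and der: "\<And>t. (T has_real_derivative T' t) (at t)"
    and T'1: "\<And>t. \<bar>T' t\<bar> \<le> 1" and T'c: "continuous_on UNIV T'" and T0: "T 0 = 0"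
  shows "wgrad (\<lambda>x. T (u x)) (\<lambda>x. T' (u x) *\<^sub>R g x)"
proof -
  let ?P = "lborel \<Otimes>\<^sub>M unit_leb :: ('a \<times> real) measure"
  note iu = wgradD(1) [OF w] and ig = wgradD(2) [OF w]
  have "continuous_on UNIV T" using der by (meson DERIV_isCont continuous_at_imp_continuous_on)
  then have Tm: "T \<in> borel_measurable borel" "T' \<in> borel_measurable borel"
    using T'c by (auto intro: borel_measurable_continuous_onI)
  note [measurable] = wgradD(3,4) [OF w] Tm
  have Tle: "\<bar>T b\<bar> \<le> \<bar>b\<bar>" for b
    using mvt_real [OF der, of b 0] T0 T'1 by (auto simp: abs_mult mult_left_le_one_le)
  have iG: "integrable lborel (\<lambda>x. T' (u x) *\<^sub>R g x)"
    by (rule Bochner_Integration.integrable_bound [OF ig]) (use T'1 in \<open>auto simp: mult_left_le_one_le\<close>)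
  have iw: "integrable lborel (\<lambda>x. T (u x))" by (rule Bochner_Integration.integrable_bound [OF iu]) (use Tle in auto)
  define s where "s n = 1 / real (Suc n)" for n
  have s0: "s n > 0" for n by (simp add: s_def)
  have sl: "s \<longlonglongrightarrow> 0" unfolding s_def using LIMSEQ_Suc [OF lim_1_over_n] by simp
  have "(\<integral>x. T (u x) * fder \<phi> x h \<partial>lborel) = - (\<integral>x. (T' (u x) *\<^sub>R g x \<bullet> h) * \<phi> x \<partial>lborel)"
    if t: "test_fun \<phi>" for \<phi> h
  proof -
    note [measurable] = test_fun_measurable [OF t]
    obtain C L where CL: "C \<ge> 0" "L \<ge> 0" "\<And>x. \<bar>\<phi> x\<bar> \<le> C" "\<And>x y. \<bar>\<phi> x - \<phi> y\<bar> \<le> L * norm (x - y)"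
        "\<And>x. (\<phi> has_derivative fder \<phi> x) (at x)"
      using test_fun_bounds [OF t] by metis
    define I where "I = (\<integral>x. (T' (u x) *\<^sub>R g x \<bullet> h) * \<phi> x \<partial>lborel)"
    define J where "J = (\<integral>x. T (u x) * fder \<phi> x h \<partial>lborel)"
    \<comment> \<open>\<open>Q n\<close> is evaluated twice: with the translation on
      \<open>\<phi>\<close> its limit is \<open>- J\<close>, and with the segment representation of
      \<open>u\<close> its limit along a subsequence is \<open>I\<close>.\<close>
    define Q where "Q n = (\<integral>x. T (u x) * ((\<phi> (x - s n *\<^sub>R h) - \<phi> x) / s n) \<partial>lborel)" for n
    have "Q \<longlonglongrightarrow> (\<integral>x. T (u x) * (- fder \<phi> x h) \<partial>lborel)"
      unfolding Q_def [abs_def]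
    proof (rule integral_dominated_convergence)
      show "integrable lborel (\<lambda>x. \<bar>T (u x)\<bar> * (L * norm h))" using iw by auto
      show "AE x in lborel. norm (T (u x) * ((\<phi> (x - s n *\<^sub>R h) - \<phi> x) / s n)) \<le> \<bar>T (u x)\<bar> * (L * norm h)" for n
      proof (intro AE_I2)
        fix x
        have "\<bar>(\<phi> (x - s n *\<^sub>R h) - \<phi> x) / s n\<bar> \<le> L * norm h"
          using CL(4) [of "x - s n *\<^sub>R h" x] s0 [of n] by (simp add: pos_divide_le_eq mult_ac)
        then show "norm (T (u x) * ((\<phi> (x - s n *\<^sub>R h) - \<phi> x) / s n)) \<le> \<bar>T (u x)\<bar> * (L * norm h)"
          unfolding real_norm_def abs_mult by (intro mult_left_mono) auto
      qed
      show "AE x in lborel. (\<lambda>n. T (u x) * ((\<phi> (x - s n *\<^sub>R h) - \<phi> x) / s n)) \<longlonglongrightarrow> T (u x) * (- fder \<phi> x h)"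
      proof (intro AE_I2 tendsto_mult tendsto_const)
        fix x
        have "((\<lambda>r. (\<phi> (x - r *\<^sub>R h) - \<phi> x) / r) \<longlongrightarrow> - fder \<phi> x h) (at 0)"
          using line_derivative [OF CL(5), of x h 0] by (simp add: DERIV_def)
        then show "(\<lambda>n. (\<phi> (x - s n *\<^sub>R h) - \<phi> x) / s n) \<longlonglongrightarrow> - fder \<phi> x h"
          by (rule filterlim_compose) (use sl s0 in \<open>auto simp: filterlim_at less_imp_neq [THEN not_sym]\<close>)
      qed
    qed measurable
    then have QJ: "Q \<longlonglongrightarrow> - J" by (simp add: J_def)
    define \<tau> where "\<tau> n x = (if u (x + s n *\<^sub>R h) = u x then T' (u x)
      else (T (u (x + s n *\<^sub>R h)) - T (u x)) / (u (x + s n *\<^sub>R h) - u x))" for n x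
    have [measurable]: "\<tau> n \<in> borel_measurable borel" for n unfolding \<tau>_def by measurable
    have \<tau>: "\<tau> n x * (u (x + s n *\<^sub>R h) - u x) = T (u (x + s n *\<^sub>R h)) - T (u x)" "\<bar>\<tau> n x\<bar> \<le> 1" for n x
    proof -
      obtain \<xi> where "T (u (x + s n *\<^sub>R h)) - T (u x) = T' \<xi> * (u (x + s n *\<^sub>R h) - u x)"
        using mvt_real [OF der] by blast
      then show "\<tau> n x * (u (x + s n *\<^sub>R h) - u x) = T (u (x + s n *\<^sub>R h)) - T (u x)" "\<bar>\<tau> n x\<bar> \<le> 1"
        using T'1 by (auto simp: \<tau>_def)
    qed
    define F where "F n z = \<phi> (fst z - snd z *\<^sub>R (s n *\<^sub>R h)) * \<tau> n (fst z - snd z *\<^sub>R (s n *\<^sub>R h)) * (g (fst z) \<bullet> h)" for n z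
    have [measurable]: "F n \<in> borel_measurable ?P" for n unfolding F_def by measurable
    have fac: "\<bar>\<phi> x * \<tau> n x\<bar> \<le> C * 1" for x n unfolding abs_mult by (intro mult_mono CL \<tau>) auto
    have ig': "integrable ?P (\<lambda>z. norm (g (fst z)))"
      using integrable_segment [OF ig, of 0] by (auto simp: case_prod_beta')
    have Fle: "norm (F n z) \<le> C * norm h * norm (g (fst z))" for n z
    proof -
      have "norm (F n z) \<le> (C * 1) * (norm (g (fst z)) * norm h)"
        unfolding F_def real_norm_def abs_mult [of _ "g (fst z) \<bullet> h"]
        by (intro mult_mono fac Cauchy_Schwarz_ineq2) (use CL in auto)
      then show ?thesis by (simp add: mult_ac)
    qed
    have iF: "integrable ?P (F n)" for n
      by (rule Bochner_Integration.integrable_bound [OF integrable_mult_right [OF ig', of "C * norm h"]])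
        (use Fle CL in \<open>auto simp: abs_mult\<close>)
    have QF: "Q n = (\<integral>z. F n z \<partial>?P)" for n
    proof -
      let ?h = "s n *\<^sub>R h"
      define A where "A x t = \<phi> x * \<tau> n x * (g (x + t *\<^sub>R ?h) \<bullet> h)" for x t
      have "integrable ?P (\<lambda>z. g (fst z + snd z *\<^sub>R ?h) \<bullet> h)"
        using integrable_segment [OF ig, of ?h] by (auto simp: case_prod_beta')
      then have iA: "integrable ?P (case_prod A)"
        using integrable_mult_bounded(2) [of ?P _ "\<lambda>z. \<phi> (fst z) * \<tau> n (fst z)" "C * 1"] fac
        by (simp add: A_def case_prod_beta')
      have "Q n = ((\<integral>x. T (u x) * \<phi> (x - ?h) \<partial>lborel) - (\<integral>x. T (u x) * \<phi> x \<partial>lborel)) / s n"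
        unfolding Q_def using test_integrable(1) [OF t iw] test_integrable(1) [OF test_fun_shift [OF t] iw]
        by (simp add: right_diff_distrib)
      also have "(\<integral>x. T (u x) * \<phi> (x - ?h) \<partial>lborel) = (\<integral>x. T (u (x + ?h)) * \<phi> x \<partial>lborel)"
        using integral_lborel_shift [of "\<lambda>x. T (u x) * \<phi> (x - ?h)" ?h] by simp
      also have "(\<dots> - (\<integral>x. T (u x) * \<phi> x \<partial>lborel)) / s n = (\<integral>x. (T (u (x + ?h)) - T (u x)) * \<phi> x / s n \<partial>lborel)"
        using test_integrable(1) [OF t iw] test_integrable(1) [OF t integrable_lborel_shift [OF iw]]
        by (simp add: left_diff_distrib)
      also have "\<dots> = (\<integral>x. (\<integral>t. A x t \<partial>unit_leb) \<partial>lborel)"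
      proof (rule integral_cong_AE)
        show "AE x in lborel. (T (u (x + ?h)) - T (u x)) * \<phi> x / s n = (\<integral>t. A x t \<partial>unit_leb)"
          using wgrad_segment(2) [OF w, of ?h]
        proof eventually_elim
          case (elim x)
          then have "u (x + ?h) - u x = s n * (\<integral>t. g (x + t *\<^sub>R ?h) \<bullet> h \<partial>unit_leb)" by simp
          then show ?case using s0 [of n] \<tau>(1) [of n x, symmetric] by (simp add: A_def)
        qed
        show "(\<lambda>x. \<integral>t. A x t \<partial>unit_leb) \<in> borel_measurable lborel" using lborel_unit.integrable_fst [OF iA] by simp
      qed measurable
      also have "\<dots> = (\<integral>t. (\<integral>x. A x t \<partial>lborel) \<partial>unit_leb)" using lborel_unit.Fubini_integral [OF iA] by simp
      also have "\<dots> = (\<integral>t. (\<integral>x. F n (x, t) \<partial>lborel) \<partial>unit_leb)"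
      proof (rule Bochner_Integration.integral_cong [OF refl])
        fix t :: real
        have "(\<lambda>x. A x t) \<in> borel_measurable borel" unfolding A_def by measurable
        from integral_lborel_shift [OF this, of "- (t *\<^sub>R ?h)"]
        show "(\<integral>x. A x t \<partial>lborel) = (\<integral>x. F n (x, t) \<partial>lborel)" by (simp add: A_def F_def)
      qed
      also have "\<dots> = (\<integral>z. F n z \<partial>?P)" using lborel_unit.integral_snd [of "\<lambda>x t. F n (x, t)"] iF by simp
      finally show ?thesis .
    qed
    \<comment> \<open>After the shift the slope involves \<open>u\<close> at distance
      \<open>t * s n\<close> behind and \<open>(1 - t) * s n\<close> ahead of the point, in units of
      \<open>h\<close>. Both increments vanish in mean by the translation bound with
      \<open>p = 1\<close>, hence almost everywhere along a subsequence.\<close>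
    define \<Delta> where "\<Delta> n z = \<bar>u (fst z + (- (snd z * s n)) *\<^sub>R h) - u (fst z)\<bar> + \<bar>u (fst z + ((1 - snd z) * s n) *\<^sub>R h) - u (fst z)\<bar>" for n z
    have [measurable]: "\<Delta> n \<in> borel_measurable ?P" for n unfolding \<Delta>_def by measurable
    define \<gamma> where "\<gamma> = norm h * (\<integral>x. norm (g x) \<partial>lborel)"
    have \<gamma>: "\<gamma> \<ge> 0" by (simp add: \<gamma>_def)
    have \<Delta>1: "(\<integral>\<^sup>+z. ennreal (\<Delta> n z) \<partial>?P) \<le> ennreal (s n * (2 * \<gamma>))" for n
    proof -
      have tr: "(\<integral>\<^sup>+x. ennreal \<bar>u (x + a *\<^sub>R h) - u x\<bar> \<partial>lborel) \<le> ennreal (s n * \<gamma>)" if "\<bar>a\<bar> \<le> s n" for a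
      proof -
        have "(\<integral>\<^sup>+x. ennreal \<bar>u (x + a *\<^sub>R h) - u x\<bar> \<partial>lborel) \<le> ennreal (\<bar>a\<bar> * \<gamma>)"
          using wgrad_translation_bound [OF w order_refl, of "a *\<^sub>R h"] ig
          by (simp add: nn_integral_eq_integral \<gamma>_def ennreal_mult mult.assoc)
        also have "\<dots> \<le> ennreal (s n * \<gamma>)" using that \<gamma> by (intro ennreal_leI mult_right_mono) auto
        finally show ?thesis .
      qed
      have "(\<integral>\<^sup>+z. ennreal (\<Delta> n z) \<partial>?P) = (\<integral>\<^sup>+t. (\<integral>\<^sup>+x. ennreal (\<Delta> n (x, t)) \<partial>lborel) \<partial>unit_leb)"
        by (rule lborel_unit.nn_integral_snd [symmetric, of "\<lambda>z. ennreal (\<Delta> n z)"]) measurable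
      also have "\<dots> \<le> (\<integral>\<^sup>+t. ennreal (s n * (2 * \<gamma>)) \<partial>unit_leb)"
      proof (rule nn_integral_mono_AE)
        show "AE t in unit_leb. (\<integral>\<^sup>+x. ennreal (\<Delta> n (x, t)) \<partial>lborel) \<le> ennreal (s n * (2 * \<gamma>))"
          using AE_unit_leb
        proof eventually_elim
          case (elim t)
          have "(\<integral>\<^sup>+x. ennreal (\<Delta> n (x, t)) \<partial>lborel) = (\<integral>\<^sup>+x. ennreal \<bar>u (x + (- (t * s n)) *\<^sub>R h) - u x\<bar> \<partial>lborel)
            + (\<integral>\<^sup>+x. ennreal \<bar>u (x + ((1 - t) * s n) *\<^sub>R h) - u x\<bar> \<partial>lborel)"
            by (subst nn_integral_add [symmetric]) (auto simp: \<Delta>_def)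
          also have "\<dots> \<le> ennreal (s n * \<gamma>) + ennreal (s n * \<gamma>)"
            using elim s0 [of n] by (intro add_mono tr) (auto simp: abs_mult mult_left_le_one_le)
          finally show ?case using \<gamma> s0 [of n] by (simp add: ennreal_plus [symmetric] mult_ac del: ennreal_plus)
        qed
      qed
      finally show ?thesis by (simp add: emeasure_unit_leb_UNIV)
    qed
    have i\<Delta>: "integrable ?P (\<Delta> n)" for n
      by (rule integrableI_nonneg) (use le_less_trans [OF \<Delta>1 ennreal_less_top] in \<open>auto simp: \<Delta>_def\<close>)
    have "(\<lambda>n. \<integral>z. norm (\<Delta> n z) \<partial>?P) \<longlonglongrightarrow> 0"
    proof (rule Lim_null_comparison [OF _ tendsto_mult_left_zero [OF sl, of "2 * \<gamma>"]], intro always_eventually allI)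
      fix n
      have "norm (\<Delta> n z) = \<Delta> n z" "\<Delta> n z \<ge> 0" for z by (simp_all add: \<Delta>_def)
      then have "ennreal (\<integral>z. norm (\<Delta> n z) \<partial>?P) \<le> ennreal (s n * (2 * \<gamma>))"
        using \<Delta>1 [of n] nn_integral_eq_integral [OF i\<Delta> [of n]] by simp
      then show "norm (\<integral>z. norm (\<Delta> n z) \<partial>?P) \<le> s n * (2 * \<gamma>)"
        using \<gamma> s0 [of n] by (subst (asm) ennreal_le_iff) auto
    qed
    then obtain k where k: "strict_mono k" and kl: "AE z in ?P. (\<lambda>n. \<Delta> (k n) z) \<longlonglongrightarrow> 0"
      using tendsto_L1_AE_subseq [of ?P \<Delta>, OF i\<Delta>] by blast
    have sk: "(\<lambda>n. s (k n)) \<longlonglongrightarrow> 0" using LIMSEQ_subseq_LIMSEQ [OF sl k] by (simp add: o_def)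
    have "(\<lambda>n. \<integral>z. F (k n) z \<partial>?P) \<longlonglongrightarrow> (\<integral>z. (T' (u (fst z)) *\<^sub>R g (fst z) \<bullet> h) * \<phi> (fst z) \<partial>?P)"
    proof (rule integral_dominated_convergence)
      show "integrable ?P (\<lambda>z. C * norm h * norm (g (fst z)))" using ig' by simp
      show "AE z in ?P. (\<lambda>n. F (k n) z) \<longlonglongrightarrow> (T' (u (fst z)) *\<^sub>R g (fst z) \<bullet> h) * \<phi> (fst z)"
        using kl
      proof eventually_elim
        case (elim z)
        let ?y = "\<lambda>n. fst z - snd z *\<^sub>R (s (k n) *\<^sub>R h)"
        have y: "?y n = fst z + (- (snd z * s (k n))) *\<^sub>R h" "?y n + s (k n) *\<^sub>R h = fst z + ((1 - snd z) * s (k n)) *\<^sub>R h" for n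
          by (simp_all add: left_diff_distrib scaleR_left_diff_distrib)
        have "(\<lambda>n. u (?y n) - u (fst z)) \<longlonglongrightarrow> 0"
          unfolding y(1) by (rule Lim_null_comparison [OF _ elim]) (simp add: \<Delta>_def)
        moreover have "(\<lambda>n. u (?y n + s (k n) *\<^sub>R h) - u (fst z)) \<longlonglongrightarrow> 0"
          unfolding y(2) by (rule Lim_null_comparison [OF _ elim]) (simp add: \<Delta>_def)
        ultimately have "(\<lambda>n. u (?y n)) \<longlonglongrightarrow> u (fst z)" "(\<lambda>n. u (?y n + s (k n) *\<^sub>R h)) \<longlonglongrightarrow> u (fst z)"
          by (auto intro: LIM_zero_cancel)
        from difference_quotient_tendsto [OF der continuous_on_interior [OF T'c] this]
        have \<tau>l: "(\<lambda>n. \<tau> (k n) (?y n)) \<longlonglongrightarrow> T' (u (fst z))" unfolding \<tau>_def by simp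
        have "(\<lambda>n. ?y n) \<longlonglongrightarrow> fst z - snd z *\<^sub>R (0 *\<^sub>R h)" by (intro tendsto_intros sk)
        then have "(\<lambda>n. \<phi> (?y n)) \<longlonglongrightarrow> \<phi> (fst z)"
          by (intro isCont_tendsto_compose [OF has_derivative_continuous [OF CL(5)]]) simp
        from tendsto_mult [OF tendsto_mult [OF this \<tau>l] tendsto_const [of "g (fst z) \<bullet> h"]]
        show ?case by (simp add: F_def mult_ac)
      qed
      show "AE z in ?P. norm (F (k n) z) \<le> C * norm h * norm (g (fst z))" for n using Fle by (intro AE_I2)
    qed measurable
    also have "(\<integral>z. (T' (u (fst z)) *\<^sub>R g (fst z) \<bullet> h) * \<phi> (fst z) \<partial>?P) = I"
    proof -
      have "integrable lborel (\<lambda>x. (T' (u x) *\<^sub>R g x \<bullet> h) * \<phi> x)"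
        by (rule test_integrable(1) [OF t integrable_inner_left [OF iG]])
      from integrable_segment [OF this, of 0] show ?thesis
        using lborel_unit.integral_fst [of "\<lambda>x t. (T' (u x) *\<^sub>R g x \<bullet> h) * \<phi> x"] by (simp add: I_def case_prod_beta')
    qed
    finally have "(\<lambda>n. Q (k n)) \<longlonglongrightarrow> I" by (simp add: QF)
    moreover have "(\<lambda>n. Q (k n)) \<longlonglongrightarrow> - J" using LIMSEQ_subseq_LIMSEQ [OF QJ k] by (simp add: o_def)
    ultimately have "I = - J" by (rule LIMSEQ_unique)
    then show ?thesis by (simp add: I_def J_def)
  qed
  then show ?thesis using iw iG by (auto simp: wgrad_def)
qed

lemma wgrad_arctan:
  assumes w: "wgrad u g" and k: "k > 0"
  shows "wgrad (\<lambda>x. k * arctan (u x / k)) (\<lambda>x. (1 / (1 + (u x / k)\<^sup>2)) *\<^sub>R g x)"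
proof (rule wgrad_chain [OF w])
  show "((\<lambda>t. k * arctan (t / k)) has_real_derivative 1 / (1 + (t / k)\<^sup>2)) (at t)" for t
    using k by (auto intro!: derivative_eq_intros simp: inverse_eq_divide)
  have pos: "1 + (t / k)\<^sup>2 > 0" for t by (simp add: add_pos_nonneg)
  then show "\<bar>1 / (1 + (t / k)\<^sup>2)\<bar> \<le> 1" for t by (simp add: divide_le_eq_1)
  show "continuous_on UNIV (\<lambda>t. 1 / (1 + (t / k)\<^sup>2))"
    using pos k by (intro continuous_intros) (auto simp: less_imp_neq [THEN not_sym])
qed simp

text \<open>Test functions and their derivatives are bounded, so convergence in mean passes to the
  limit on both sides of the defining identity.\<close>

lemma wgrad_closed:
  assumes w: "\<And>n. wgrad (u n) (g n)" and iv: "integrable lborel v" and ik: "integrable lborel k"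
    and u: "(\<lambda>n. \<integral>x. \<bar>u n x - v x\<bar> \<partial>lborel) \<longlonglongrightarrow> 0" and g: "(\<lambda>n. \<integral>x. norm (g n x - k x) \<partial>lborel) \<longlonglongrightarrow> 0"
  shows "wgrad v k"
  unfolding wgrad_def
proof (intro conjI iv ik allI impI)
  fix \<phi> :: "'a \<Rightarrow> real" and h assume t: "test_fun \<phi>"
  note [measurable] = test_fun_measurable [OF t]
  obtain C L where CL: "C \<ge> 0" "L \<ge> 0" "\<And>x. \<bar>\<phi> x\<bar> \<le> C" "\<And>x h. \<bar>fder \<phi> x h\<bar> \<le> L * norm h"
    using test_fun_bounds [OF t] by metis
  have lim: "(\<lambda>n. \<integral>x. f n x * m x \<partial>lborel) \<longlonglongrightarrow> (\<integral>x. f0 x * m x \<partial>lborel)"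
    if f: "\<And>n. integrable lborel (f n)" "integrable lborel f0" and l: "(\<lambda>n. \<integral>x. \<bar>f n x - f0 x\<bar> \<partial>lborel) \<longlonglongrightarrow> 0"
      and m: "m \<in> borel_measurable borel" "\<And>x. \<bar>m x\<bar> \<le> B" "B \<ge> 0" for f :: "nat \<Rightarrow> 'a \<Rightarrow> real" and f0 m B
  proof -
    have i: "integrable lborel (\<lambda>x. f n x * m x)" "integrable lborel (\<lambda>x. f0 x * m x)" for n
      using integrable_mult_bounded(1) [OF f(1) _ m(2)] integrable_mult_bounded(1) [OF f(2) _ m(2)] m(1) by auto
    have "(\<lambda>n. B * (\<integral>x. \<bar>f n x - f0 x\<bar> \<partial>lborel)) \<longlonglongrightarrow> 0" using tendsto_mult_right_zero [OF l] .
    then have "(\<lambda>n. (\<integral>x. f n x * m x \<partial>lborel) - (\<integral>x. f0 x * m x \<partial>lborel)) \<longlonglongrightarrow> 0"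
    proof (rule Lim_null_comparison [rotated], intro always_eventually allI)
      fix n
      have "norm ((\<integral>x. f n x * m x \<partial>lborel) - (\<integral>x. f0 x * m x \<partial>lborel)) = \<bar>\<integral>x. f n x * m x - f0 x * m x \<partial>lborel\<bar>"
        using i by simp
      also have "\<dots> \<le> (\<integral>x. \<bar>f n x * m x - f0 x * m x\<bar> \<partial>lborel)" by (rule integral_abs_bound)
      also have "\<dots> \<le> (\<integral>x. B * \<bar>f n x - f0 x\<bar> \<partial>lborel)"
      proof (rule integral_mono)
        show "\<bar>f n x * m x - f0 x * m x\<bar> \<le> B * \<bar>f n x - f0 x\<bar>" for x
          using m(2) [of x] by (simp add: left_diff_distrib [symmetric] abs_mult mult.commute [of B] mult_left_mono)
      qed (use i f in auto)
      finally show "norm ((\<integral>x. f n x * m x \<partial>lborel) - (\<integral>x. f0 x * m x \<partial>lborel)) \<le> B * (\<integral>x. \<bar>f n x - f0 x\<bar> \<partial>lborel)"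
        by simp
    qed
    then show ?thesis by (rule LIM_zero_cancel)
  qed
  have 1: "(\<lambda>n. \<integral>x. u n x * fder \<phi> x h \<partial>lborel) \<longlonglongrightarrow> (\<integral>x. v x * fder \<phi> x h \<partial>lborel)"
    by (rule lim [OF wgradD(1) [OF w] iv u _ CL(4)]) (use CL in auto)
  have gh: "(\<lambda>n. \<integral>x. \<bar>g n x \<bullet> h - k x \<bullet> h\<bar> \<partial>lborel) \<longlonglongrightarrow> 0"
  proof (rule Lim_null_comparison [OF _ tendsto_mult_right_zero [OF g, of "norm h"]], intro always_eventually allI)
    fix n
    have "(\<integral>x. \<bar>g n x \<bullet> h - k x \<bullet> h\<bar> \<partial>lborel) \<le> (\<integral>x. norm h * norm (g n x - k x) \<partial>lborel)"
      using wgradD(2) [OF w, of n] ik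
      by (intro integral_mono) (auto simp: inner_diff_left [symmetric] Cauchy_Schwarz_ineq2 mult.commute [of "norm h"])
    then show "norm (\<integral>x. \<bar>g n x \<bullet> h - k x \<bullet> h\<bar> \<partial>lborel) \<le> norm h * (\<integral>x. norm (g n x - k x) \<partial>lborel)" by simp
  qed
  have "(\<lambda>n. \<integral>x. (g n x \<bullet> h) * \<phi> x \<partial>lborel) \<longlonglongrightarrow> (\<integral>x. (k x \<bullet> h) * \<phi> x \<partial>lborel)"
    by (rule lim [OF _ _ gh _ CL(3)]) (use wgradD(2) [OF w] ik CL in auto)
  then have "(\<lambda>n. - (\<integral>x. (g n x \<bullet> h) * \<phi> x \<partial>lborel)) \<longlonglongrightarrow> - (\<integral>x. (k x \<bullet> h) * \<phi> x \<partial>lborel)"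
    by (rule tendsto_minus)
  moreover have "- (\<integral>x. (g n x \<bullet> h) * \<phi> x \<partial>lborel) = (\<integral>x. u n x * fder \<phi> x h \<partial>lborel)" for n
    using wgradD(5) [OF w t, of n h] by simp
  ultimately have 2: "(\<lambda>n. \<integral>x. u n x * fder \<phi> x h \<partial>lborel) \<longlonglongrightarrow> - (\<integral>x. (k x \<bullet> h) * \<phi> x \<partial>lborel)"
    by simp
  show "(\<integral>x. v x * fder \<phi> x h \<partial>lborel) = - (\<integral>x. (k x \<bullet> h) * \<phi> x \<partial>lborel)"
    by (rule LIMSEQ_unique [OF 1 2])
qed

section \<open>Borel representatives\<close>

lemma AE_lborel_fst_snd:
  fixes P :: "'a::euclidean_space \<Rightarrow> bool"
  assumes "AE x in lborel. P x"
  shows "AE z in (lborel :: ('a \<times> 'a) measure). P (fst z)" "AE z in (lborel :: ('a \<times> 'a) measure). P (snd z)"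
proof -
  obtain N where N: "N \<in> null_sets lborel" "{x. \<not> P x} \<subseteq> N"
    using assms by (auto simp: eventually_ae_filter)
  then have [measurable]: "N \<in> sets borel" by auto
  have n: "AE x in lborel. x \<notin> N" using AE_not_in [OF N(1)] .
  have "AE z in (lborel \<Otimes>\<^sub>M lborel :: ('a \<times> 'a) measure). fst z \<notin> N"
  proof (rule lborel_pair.AE_pair_measure)
    show "{z \<in> space (lborel \<Otimes>\<^sub>M lborel). fst z \<notin> N} \<in> sets (lborel \<Otimes>\<^sub>M lborel)" by measurable
  qed (use n in \<open>auto elim: eventually_mono\<close>)
  then show "AE z in (lborel :: ('a \<times> 'a) measure). P (fst z)"
    unfolding lborel_prod by eventually_elim (use N in auto)
  have "AE z in (lborel \<Otimes>\<^sub>M lborel :: ('a \<times> 'a) measure). snd z \<notin> N"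
  proof (rule lborel_pair.AE_pair_measure)
    show "{z \<in> space (lborel \<Otimes>\<^sub>M lborel). snd z \<notin> N} \<in> sets (lborel \<Otimes>\<^sub>M lborel)" by measurable
  qed (use n in auto)
  then show "AE z in (lborel :: ('a \<times> 'a) measure). P (snd z)"
    unfolding lborel_prod by eventually_elim (use N in auto)
qed

lemma weak_gradient_cong:
  assumes "AE x in lebesgue. u x = v x" "u \<in> borel_measurable lebesgue" "v \<in> borel_measurable lebesgue"
  shows "weak_gradient u g \<longleftrightarrow> weak_gradient v g"
proof -
  have "set_integrable lebesgue K u \<longleftrightarrow> set_integrable lebesgue K v" if "compact K" for K
    unfolding set_integrable_def
  proof (rule integrable_cong_AE)
    have "K \<in> sets lebesgue" using that by (simp add: compact_imp_closed)
    then show "(\<lambda>x. indicator K x *\<^sub>R u x) \<in> borel_measurable lebesgue" "(\<lambda>x. indicator K x *\<^sub>R v x) \<in> borel_measurable lebesgue"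
      using assms(2,3) by measurable
    show "AE x in lebesgue. indicator K x *\<^sub>R u x = indicator K x *\<^sub>R v x"
      using assms(1) by eventually_elim simp
  qed
  moreover have "(LINT x|lebesgue. u x * fder \<phi> x b) = (LINT x|lebesgue. v x * fder \<phi> x b)"
    if "test_fun \<phi>" for \<phi> b
  proof (rule integral_cong_AE)
    have "(\<lambda>x. fder \<phi> x b) \<in> borel_measurable lebesgue"
      using test_fun_measurable(2) [OF that] measurable_completion by (metis measurable_lborel2)
    then show "(\<lambda>x. u x * fder \<phi> x b) \<in> borel_measurable lebesgue"
      "(\<lambda>x. v x * fder \<phi> x b) \<in> borel_measurable lebesgue"
      using assms(2,3) by measurable
    show "AE x in lebesgue. u x * fder \<phi> x b = v x * fder \<phi> x b"
      using assms(1) by eventually_elim simp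
  qed
  ultimately show ?thesis using assms(2,3) unfolding weak_gradient_def by simp
qed

text \<open>This licenses the passage to Borel representatives. On the product the exceptional pairs
  lie in two null strips.\<close>

lemma seminorm_pow_cong:
  fixes u v :: "'a::euclidean_space \<Rightarrow> real"
  assumes ae: "AE x in lebesgue. u x = v x" and m: "u \<in> borel_measurable lebesgue" "v \<in> borel_measurable lebesgue"
  shows "seminorm_pow p s u = seminorm_pow p s v"
proof -
  have 0: "(\<integral>\<^sup>+x. ennreal (\<bar>u x\<bar> powr p) \<partial>lebesgue) = (\<integral>\<^sup>+x. ennreal (\<bar>v x\<bar> powr p) \<partial>lebesgue)"
    by (rule nn_integral_cong_AE) (use ae in \<open>eventually_elim, simp\<close>)
  have ae': "AE x in lborel. u x = v x" using ae by (simp add: AE_completion_iff)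
  have "AE z in (lborel :: ('a \<times> 'a) measure). u (fst z) - u (snd z) = v (fst z) - v (snd z)"
    using AE_lborel_fst_snd [OF ae'] by eventually_elim simp
  then have "AE z in (lebesgue :: ('a \<times> 'a) measure). u (fst z) - u (snd z) = v (fst z) - v (snd z)"
    by (rule AE_completion)
  then have 1: "(\<integral>\<^sup>+z. ennreal (\<bar>u (fst z) - u (snd z)\<bar> powr p / norm (fst z - snd z) powr (real DIM('a) + s * p)) \<partial>lebesgue)
    = (\<integral>\<^sup>+z. ennreal (\<bar>v (fst z) - v (snd z)\<bar> powr p / norm (fst z - snd z) powr (real DIM('a) + s * p)) \<partial>lebesgue)"
    by (rule nn_integral_cong_AE [OF eventually_mono]) simp
  have "weak_gradient u = weak_gradient v" using weak_gradient_cong [OF ae m] by (intro ext)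
  then show ?thesis unfolding seminorm_pow_def by (simp add: 0 1)
qed

lemma lebesgue_ex_borel:
  fixes g :: "'a::euclidean_space \<Rightarrow> 'b::euclidean_space"
  assumes "g \<in> borel_measurable lebesgue"
  shows "\<exists>g'\<in>borel_measurable borel. AE x in lborel. g x = g' x"
proof -
  have "\<exists>r. r \<in> borel_measurable lborel \<and> (AE x in lborel. g x \<bullet> b = r x)" for b
  proof -
    have "(\<lambda>x. g x \<bullet> b) \<in> borel_measurable lebesgue" using assms by measurable
    from completion_ex_borel_measurable_real [OF this] show ?thesis by auto
  qed
  then have "\<exists>r. \<forall>b. r b \<in> borel_measurable lborel \<and> (AE x in lborel. g x \<bullet> b = r b x)"
    by (intro choice allI)
  then obtain r where r: "\<And>b. r b \<in> borel_measurable lborel" "\<And>b. AE x in lborel. g x \<bullet> b = r b x" by blast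
  have [measurable]: "r b \<in> borel_measurable borel" for b using r(1) [of b] by simp
  have "AE x in lborel. \<forall>b\<in>Basis. g x \<bullet> b = r b x" using r(2) by (intro AE_finite_allI) auto
  then have "AE x in lborel. g x = (\<Sum>b\<in>Basis. r b x *\<^sub>R b)"
  proof eventually_elim
    case (elim x)
    have "g x = (\<Sum>b\<in>Basis. (g x \<bullet> b) *\<^sub>R b)" by (simp add: euclidean_representation)
    also have "\<dots> = (\<Sum>b\<in>Basis. r b x *\<^sub>R b)" using elim by (intro sum.cong) auto
    finally show ?case .
  qed
  moreover have "(\<lambda>x. \<Sum>b\<in>Basis. r b x *\<^sub>R b) \<in> borel_measurable borel"
    by measurable
  ultimately show ?thesis by (rule bexI [where x = "\<lambda>x. \<Sum>b\<in>Basis. r b x *\<^sub>R b"])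
qed

lemma borel_imp_lebesgue_measurable: "f \<in> borel_measurable borel \<Longrightarrow> f \<in> borel_measurable lebesgue"
  by (metis measurable_completion measurable_lborel2)

text \<open>A test function that vanishes on the closed ball has zero derivative throughout the open
  ball, and \<open>u\<close> vanishes elsewhere; so the fundamental lemma applies to each component
  of \<open>k\<close> on the complement.\<close>

lemma gradient_support:
  fixes u :: "'a::euclidean_space \<Rightarrow> real"
  assumes [measurable]: "k \<in> borel_measurable borel" and loc: "\<And>K. compact K \<Longrightarrow> set_integrable lborel K k"
    and out: "\<And>x. x \<notin> ball 0 R \<Longrightarrow> u x = 0"
    and eq: "\<And>\<phi> b. test_fun \<phi> \<Longrightarrow> b \<in> Basis \<Longrightarrow>
      (\<integral>x. u x * fder \<phi> x b \<partial>lborel) = - (\<integral>x. (k x \<bullet> b) * \<phi> x \<partial>lborel)"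
  shows "AE x in lborel. x \<in> - cball 0 R \<longrightarrow> k x = 0"
proof (rule AE_zero_componentwise)
  fix b :: 'a assume b: "b \<in> Basis"
  show "AE x in lborel. x \<in> - cball 0 R \<longrightarrow> k x \<bullet> b = 0"
  proof (rule fundamental_lemma_variations)
    fix K :: "'a set" assume K: "compact K"
    have "integrable lborel (\<lambda>x. (indicator K x *\<^sub>R k x) \<bullet> b)"
      using loc [OF K] unfolding set_integrable_def by (intro integrable_inner_left) auto
    then show "set_integrable lborel K (\<lambda>x. k x \<bullet> b)" by (simp add: set_integrable_def)
  next
    fix \<phi> :: "'a \<Rightarrow> real" assume t: "test_fun \<phi>" and z: "\<And>x. x \<notin> - cball 0 R \<Longrightarrow> \<phi> x = 0"
    have "u x * fder \<phi> x b = 0" for x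
    proof (cases "x \<in> ball 0 R")
      case True
      then have "fder \<phi> x = (\<lambda>h. 0)"
        by (intro frechet_derivative_zero [of "ball 0 R"]) (use z in auto)
      then show ?thesis by simp
    qed (simp add: out)
    then have "(\<integral>x. u x * fder \<phi> x b \<partial>lborel) = 0" by (simp only: Bochner_Integration.integral_zero)
    then show "(\<integral>x. k x \<bullet> b * \<phi> x \<partial>lborel) = 0" using eq [OF t b] by simp
  qed auto
qed

lemma wgrad_support:
  assumes w: "wgrad u g" and out: "\<And>x. x \<notin> ball 0 R \<Longrightarrow> u x = 0"
  shows "AE x in lborel. x \<in> - cball 0 R \<longrightarrow> g x = 0"
proof (rule gradient_support [OF wgradD(4) [OF w] _ out wgradD(5) [OF w]])
  show "set_integrable lborel K g" if "compact K" for K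
    using wgradD(2) [OF w] that unfolding set_integrable_def by (intro integrable_mult_indicator) (auto simp: compact_imp_closed)
qed

text \<open>A weak gradient is only locally integrable. Since \<open>u\<close> vanishes outside a
  ball, the gradient vanishes almost everywhere outside the closed ball, so a Borel version cut off
  there is integrable and still serves as gradient.\<close>

lemma weak_gradient_imp_wgrad:
  assumes [measurable]: "u \<in> borel_measurable borel" and out: "\<And>x. x \<notin> ball 0 R \<Longrightarrow> u x = 0"
    and wg: "weak_gradient u g"
  shows "\<exists>g'. wgrad u g' \<and> (AE x in lborel. g x = g' x)"
proof -
  have gm: "g \<in> borel_measurable lebesgue" using wg by (simp add: weak_gradient_def)
  from lebesgue_ex_borel [OF this]
  obtain k where [measurable]: "k \<in> borel_measurable borel" and k: "AE x in lborel. g x = k x" by auto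
  have loc: "set_integrable lborel K u \<and> set_integrable lborel K k" if K: "compact K" for K
  proof
    have [measurable]: "K \<in> sets borel" using K by (simp add: compact_imp_closed)
    have "set_integrable lebesgue K u" using wg K by (auto simp: weak_gradient_def)
    then show "set_integrable lborel K u"
      unfolding set_integrable_def by (subst (asm) integrable_completion) auto
    have "integrable lebesgue (\<lambda>x. indicator K x *\<^sub>R g x)"
      using wg K by (auto simp: weak_gradient_def set_integrable_def)
    moreover have "integrable lebesgue (\<lambda>x. indicator K x *\<^sub>R g x) \<longleftrightarrow> integrable lebesgue (\<lambda>x. indicator K x *\<^sub>R k x)"
    proof (rule integrable_cong_AE)
      have "K \<in> sets lebesgue" using K by (simp add: compact_imp_closed)
      then show "(\<lambda>x. indicator K x *\<^sub>R g x) \<in> borel_measurable lebesgue" using gm by measurable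
      show "(\<lambda>x. indicator K x *\<^sub>R k x) \<in> borel_measurable lebesgue"
        by (rule borel_imp_lebesgue_measurable) measurable
      show "AE x in lebesgue. indicator K x *\<^sub>R g x = indicator K x *\<^sub>R k x"
        using AE_completion [OF k] by eventually_elim simp
    qed
    ultimately show "set_integrable lborel K k"
      unfolding set_integrable_def by (subst (asm) (2) integrable_completion) auto
  qed
  have eq: "(\<integral>x. u x * fder \<phi> x b \<partial>lborel) = - (\<integral>x. (k x \<bullet> b) * \<phi> x \<partial>lborel)"
    if t: "test_fun \<phi>" and b: "b \<in> Basis" for \<phi> b
  proof -
    note [measurable] = test_fun_measurable [OF t]
    have "(LINT x|lebesgue. u x * fder \<phi> x b) = - (LINT x|lebesgue. (g x \<bullet> b) * \<phi> x)"
      using wg t b by (auto simp: weak_gradient_def)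
    also have "(LINT x|lebesgue. (g x \<bullet> b) * \<phi> x) = (LINT x|lebesgue. (k x \<bullet> b) * \<phi> x)"
    proof (rule integral_cong_AE)
      show "(\<lambda>x. (g x \<bullet> b) * \<phi> x) \<in> borel_measurable lebesgue"
        using gm borel_imp_lebesgue_measurable [OF test_fun_measurable(1) [OF t]] by measurable
      show "(\<lambda>x. (k x \<bullet> b) * \<phi> x) \<in> borel_measurable lebesgue" by (rule borel_imp_lebesgue_measurable) measurable
      show "AE x in lebesgue. (g x \<bullet> b) * \<phi> x = (k x \<bullet> b) * \<phi> x"
        using AE_completion [OF k] by eventually_elim simp
    qed
    finally show ?thesis by (simp add: integral_completion)
  qed
  have zero: "AE x in lborel. x \<in> - cball 0 R \<longrightarrow> k x = 0"
    using gradient_support [of k R u] loc eq out by simp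
  define g' where "g' x = indicator (cball 0 R) x *\<^sub>R k x" for x
  have [measurable]: "g' \<in> borel_measurable borel"
    unfolding g'_def by (intro borel_measurable_scaleR borel_measurable_indicator) auto
  have kg: "AE x in lborel. k x = g' x"
    using zero by eventually_elim (auto simp: g'_def indicator_def)
  have ig: "integrable lborel g'" using loc [of "cball 0 R"] by (simp add: g'_def [abs_def] set_integrable_def)
  have iu: "integrable lborel u"
  proof -
    have "u = (\<lambda>x. indicator (cball 0 R) x *\<^sub>R u x)" using out by (fastforce simp: indicator_def fun_eq_iff)
    then show ?thesis using loc [of "cball 0 R"] by (simp add: set_integrable_def)
  qed
  have "(\<integral>x. u x * fder \<phi> x h \<partial>lborel) = - (\<integral>x. (g' x \<bullet> h) * \<phi> x \<partial>lborel)"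
    if t: "test_fun \<phi>" for \<phi> h
  proof -
    note [measurable] = test_fun_measurable [OF t]
    have der: "(\<phi> has_derivative fder \<phi> x) (at x)" for x using test_fun_bounds [OF t] by metis
    have i: "integrable lborel (\<lambda>x. u x * fder \<phi> x b)" "integrable lborel (\<lambda>x. (g' x \<bullet> b) * \<phi> x)" for b
      using test_integrable(2) [OF t iu] test_integrable(1) [OF t, of "\<lambda>x. g' x \<bullet> b"] ig by auto
    have eqb: "(\<integral>x. u x * fder \<phi> x b \<partial>lborel) = - (\<integral>x. (g' x \<bullet> b) * \<phi> x \<partial>lborel)" if b: "b \<in> Basis" for b
      unfolding eq [OF t b] using kg by (intro arg_cong [of _ _ uminus] integral_cong_AE) (auto elim!: eventually_mono)
    have "(\<integral>x. u x * fder \<phi> x h \<partial>lborel)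
      = (\<integral>x. (\<Sum>b\<in>Basis. (h \<bullet> b) * (u x * fder \<phi> x b)) \<partial>lborel)"
      by (subst derivative_expand [OF der]) (simp add: sum_distrib_left mult.left_commute)
    also have "\<dots> = (\<Sum>b\<in>Basis. (h \<bullet> b) * (\<integral>x. u x * fder \<phi> x b \<partial>lborel))"
      using i by (subst Bochner_Integration.integral_sum) auto
    also have "\<dots> = (\<Sum>b\<in>Basis. - ((h \<bullet> b) * (\<integral>x. (g' x \<bullet> b) * \<phi> x \<partial>lborel)))"
      by (intro sum.cong) (simp_all add: eqb)
    also have "\<dots> = - (\<integral>x. (\<Sum>b\<in>Basis. (h \<bullet> b) * ((g' x \<bullet> b) * \<phi> x)) \<partial>lborel)"
      using i by (subst Bochner_Integration.integral_sum) (auto simp: sum_negf)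
    also have "(\<lambda>x. \<Sum>b\<in>Basis. (h \<bullet> b) * ((g' x \<bullet> b) * \<phi> x)) = (\<lambda>x. (g' x \<bullet> h) * \<phi> x)"
    proof
      fix x
      show "(\<Sum>b\<in>Basis. (h \<bullet> b) * ((g' x \<bullet> b) * \<phi> x)) = (g' x \<bullet> h) * \<phi> x"
        by (subst euclidean_inner [of "g' x" h]) (simp add: sum_distrib_right sum_distrib_left mult_ac)
    qed
    finally show ?thesis .
  qed
  then have "wgrad u g'" using iu ig by (simp add: wgrad_def)
  moreover have "AE x in lborel. g x = g' x" using k kg by eventually_elim simp
  ultimately show ?thesis by blast
qed

lemma wgrad_imp_weak_gradient:
  assumes w: "wgrad u g" shows "weak_gradient u g"
  unfolding weak_gradient_def
proof (intro conjI allI impI ballI)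
  note [measurable] = wgradD(3,4) [OF w]
  show "u \<in> borel_measurable lebesgue" "g \<in> borel_measurable lebesgue"
    by (rule borel_imp_lebesgue_measurable, measurable)+
  fix K :: "'a set" assume "compact K"
  then have K: "K \<in> sets lebesgue" by (simp add: compact_imp_closed)
  show "set_integrable lebesgue K u" "set_integrable lebesgue K g"
    unfolding set_integrable_def using wgradD(1,2) [OF w] K
    by (intro integrable_mult_indicator; simp add: integrable_completion)+
next
  note [measurable] = wgradD(3,4) [OF w]
  fix \<phi> :: "'a \<Rightarrow> real" and b :: 'a assume t: "test_fun \<phi>"
  note [measurable] = test_fun_measurable [OF t]
  show "(LINT x|lebesgue. u x * fder \<phi> x b) = - (LINT x|lebesgue. (g x \<bullet> b) * \<phi> x)"
    using wgradD(5) [OF w t, of b] by (simp add: integral_completion)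
qed

text \<open>Weak gradients agree almost everywhere, so the infimum is over a constant family. It is
  finite only for a nonempty family, because the infimum over the empty set is infinite.\<close>

lemma seminorm_pow_1:
  assumes u: "u \<in> borel_measurable borel" "\<And>x. x \<notin> ball 0 R \<Longrightarrow> u x = 0"
  shows "wgrad u g \<Longrightarrow> seminorm_pow p 1 u = nn_power_integral p g"
    and "seminorm_pow p 1 u < \<infinity> \<Longrightarrow> \<exists>g. wgrad u g"
proof -
  assume w: "wgrad u g"
  have "(\<integral>\<^sup>+x. ennreal (norm (k x) powr p) \<partial>lebesgue) = nn_power_integral p g"
    if k: "weak_gradient u k" for k
  proof -
    obtain g' where g': "wgrad u g'" "AE x in lborel. k x = g' x"
      using weak_gradient_imp_wgrad [OF u k] by blast
    have "AE x in lborel. g' x = g x" by (rule wgrad_unique [OF g'(1) w]) simp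
    then have "AE x in lborel. ennreal (norm (k x) powr p) = ennreal (norm (g x) powr p)"
      using g'(2) by eventually_elim simp
    then show ?thesis by (simp add: nn_integral_completion nn_integral_cong_AE)
  qed
  moreover have "weak_gradient u g" by (rule wgrad_imp_weak_gradient [OF w])
  ultimately have "(INF k\<in>{k. weak_gradient u k}. \<integral>\<^sup>+x. ennreal (norm (k x) powr p) \<partial>lebesgue)
     = (INF k\<in>{k. weak_gradient u k}. nn_power_integral p g)"
    by (intro INF_cong) auto
  also have "\<dots> = nn_power_integral p g"
    using \<open>weak_gradient u g\<close> by (subst cINF_const) auto
  finally show "seminorm_pow p 1 u = nn_power_integral p g"
    by (simp add: seminorm_pow_def)
next
  assume "seminorm_pow p 1 u < \<infinity>"
  then have "{g. weak_gradient u g} \<noteq> {}" unfolding seminorm_pow_def by (cases "Collect (weak_gradient u) = {}") auto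
  then show "\<exists>g. wgrad u g" using weak_gradient_imp_wgrad [OF u] by blast
qed

lemma seminorm_pow_0:
  "seminorm_pow p 0 u = (\<integral>\<^sup>+x. ennreal (\<bar>u x\<bar> powr p) \<partial>lborel)"
  by (simp add: seminorm_pow_def nn_integral_completion)

lemma seminorm_pow_fractional:
  fixes u :: "'a::euclidean_space \<Rightarrow> real"
  assumes [measurable]: "u \<in> borel_measurable borel" and s: "0 < s" "s < 1"
  shows "seminorm_pow p s u = ennreal (frac_const (real DIM('a)) s p) *
      (\<integral>\<^sup>+x. (\<integral>\<^sup>+y. ennreal (\<bar>u x - u y\<bar> powr p / norm (x - y) powr (real DIM('a) + s * p)) \<partial>lborel) \<partial>lborel)"
proof -
  have "(\<integral>\<^sup>+z. ennreal (\<bar>u (fst z) - u (snd z)\<bar> powr p / norm (fst z - snd z) powr (real DIM('a) + s * p)) \<partial>(lborel :: ('a \<times> 'a) measure))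
    = (\<integral>\<^sup>+x. (\<integral>\<^sup>+y. ennreal (\<bar>u x - u y\<bar> powr p / norm (x - y) powr (real DIM('a) + s * p)) \<partial>lborel) \<partial>lborel)"
    by (subst lborel_prod [symmetric], subst lborel.nn_integral_fst [symmetric]) (auto simp: split_beta)
  then show ?thesis using s by (simp add: seminorm_pow_def nn_integral_completion)
qed

section \<open>Gagliardo energies and dyadic shells\<close>

definition Lpow :: "real \<Rightarrow> ('a::euclidean_space \<Rightarrow> real) \<Rightarrow> ennreal" where
  "Lpow p u = (\<integral>\<^sup>+x. ennreal (\<bar>u x\<bar> powr p) \<partial>lborel)"

definition incr :: "real \<Rightarrow> ('a::euclidean_space \<Rightarrow> real) \<Rightarrow> 'a \<Rightarrow> ennreal" where
  "incr p u h = (\<integral>\<^sup>+x. ennreal (\<bar>u (x + h) - u x\<bar> powr p) \<partial>lborel)"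

abbreviation "riesz a (h :: 'a::euclidean_space) \<equiv> ennreal (norm h powr - (real DIM('a) + a))"
abbreviation "riesz0 (h :: 'a::euclidean_space) \<equiv> ennreal (norm h powr - real DIM('a))"

definition gagliardo :: "real \<Rightarrow> real \<Rightarrow> ('a::euclidean_space \<Rightarrow> real) \<Rightarrow> ennreal" where
  "gagliardo p s u = (\<integral>\<^sup>+x. (\<integral>\<^sup>+y. ennreal (\<bar>u x - u y\<bar> powr p / norm (x - y) powr (real DIM('a) + s * p)) \<partial>lborel) \<partial>lborel)"

lemma borel_measurable_incr [measurable]:
  assumes [measurable]: "u \<in> borel_measurable borel"
  shows "incr p u \<in> borel_measurable borel"
proof -
  have "(\<lambda>h. \<integral>\<^sup>+x. ennreal (\<bar>u (x + h) - u x\<bar> powr p) \<partial>lborel) \<in> borel_measurable borel"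
    by measurable
  then show ?thesis by (simp add: incr_def [abs_def])
qed

text \<open>Substitute \<open>y = x + h\<close> and exchange the integrals: the order
  \<open>s\<close> then enters only through a kernel in \<open>h\<close>.\<close>

lemma gagliardo_incr:
  fixes u :: "'a::euclidean_space \<Rightarrow> real"
  assumes [measurable]: "u \<in> borel_measurable borel"
  shows "gagliardo p s u = (\<integral>\<^sup>+h. incr p u h * riesz (s * p) h \<partial>lborel)"
proof -
  define e where "e = real DIM('a) + s * p"
  have "gagliardo p s u = (\<integral>\<^sup>+x. (\<integral>\<^sup>+h. ennreal (\<bar>u (x + h) - u x\<bar> powr p) * ennreal (norm h powr - e) \<partial>lborel) \<partial>lborel)"
    unfolding gagliardo_def e_def [symmetric]
  proof (rule nn_integral_cong)
    fix x :: 'a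
    have "(\<integral>\<^sup>+y. ennreal (\<bar>u x - u y\<bar> powr p / norm (x - y) powr e) \<partial>lborel)
      = (\<integral>\<^sup>+h. ennreal (\<bar>u x - u (h + x)\<bar> powr p / norm (x - (h + x)) powr e) \<partial>lborel)"
      by (rule nn_integral_lborel_shift [symmetric]) measurable
    also have "\<dots> = (\<integral>\<^sup>+h. ennreal (\<bar>u (x + h) - u x\<bar> powr p) * ennreal (norm h powr - e) \<partial>lborel)"
      by (intro nn_integral_cong) (simp add: ennreal_mult [symmetric] powr_minus divide_inverse add.commute abs_minus_commute)
    finally show "(\<integral>\<^sup>+y. ennreal (\<bar>u x - u y\<bar> powr p / norm (x - y) powr e) \<partial>lborel)
      = (\<integral>\<^sup>+h. ennreal (\<bar>u (x + h) - u x\<bar> powr p) * ennreal (norm h powr - e) \<partial>lborel)" .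
  qed
  also have "\<dots> = (\<integral>\<^sup>+h. (\<integral>\<^sup>+x. ennreal (\<bar>u (x + h) - u x\<bar> powr p) * ennreal (norm h powr - e) \<partial>lborel) \<partial>lborel)"
    by (rule lborel_pair.Fubini' [symmetric]) measurable
  also have "\<dots> = (\<integral>\<^sup>+h. incr p u h * ennreal (norm h powr - e) \<partial>lborel)"
    unfolding incr_def by (intro nn_integral_cong nn_integral_multc) measurable
  finally show ?thesis unfolding e_def .
qed

lemma ennreal_double: "a \<ge> 0 \<Longrightarrow> ennreal a * (X + X) = ennreal (a * 2) * X"
  by (simp add: ennreal_mult mult_2 [symmetric] mult.assoc)

text \<open>A step of length \<open>2 *\<^sub>R h\<close> is two steps of length \<open>h\<close>,
  and midpoint convexity gives exactly the factor \<open>2 powr p\<close>. The monotonicity in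
  \<open>incseq_dyadic\<close> rests on this exact factor.\<close>

lemma incr_double:
  assumes [measurable]: "u \<in> borel_measurable borel" and p: "p > 1"
  shows "incr p u (2 *\<^sub>R h) \<le> ennreal (2 powr p) * incr p u h"
proof -
  have conv: "(a + b) powr p \<le> 2 powr (p - 1) * (a powr p + b powr p)" if ab: "a \<ge> 0" "b \<ge> 0" for a b :: real
  proof -
    define m where "m = (a + b) / 2"
    have m0: "m \<ge> 0" using ab by (simp add: m_def)
    have "m powr p + p * m powr (p - 1) * (a - m) \<le> a powr p" "m powr p + p * m powr (p - 1) * (b - m) \<le> b powr p"
      using powr_tangent [OF p m0] ab by auto
    then have "2 * m powr p + p * m powr (p - 1) * ((a - m) + (b - m)) \<le> a powr p + b powr p"
      unfolding distrib_left by linarith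
    moreover have "(a - m) + (b - m) = 0" by (simp add: m_def)
    ultimately have "2 * m powr p \<le> a powr p + b powr p" by simp
    then have le: "2 powr (p - 1) * (2 * m powr p) \<le> 2 powr (p - 1) * (a powr p + b powr p)"
      by (rule mult_left_mono) simp
    have "a + b = 2 * m" by (simp add: m_def)
    then have "(a + b) powr p = 2 powr (p - 1) * (2 * m powr p)"
      using m0 powr_p_mult [of 2 p] by (simp add: powr_mult mult.assoc [symmetric])
    then show ?thesis using le by simp
  qed
  have "incr p u (2 *\<^sub>R h) \<le> (\<integral>\<^sup>+x. ennreal (2 powr (p - 1)) * (ennreal (\<bar>u ((x + h) + h) - u (x + h)\<bar> powr p) + ennreal (\<bar>u (x + h) - u x\<bar> powr p)) \<partial>lborel)"
    unfolding incr_def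
  proof (rule nn_integral_mono)
    fix x
    have "\<bar>u (x + 2 *\<^sub>R h) - u x\<bar> powr p \<le> (\<bar>u ((x + h) + h) - u (x + h)\<bar> + \<bar>u (x + h) - u x\<bar>) powr p"
      using p by (intro powr_mono2) (auto simp: scaleR_2 add.assoc)
    also have "\<dots> \<le> 2 powr (p - 1) * (\<bar>u ((x + h) + h) - u (x + h)\<bar> powr p + \<bar>u (x + h) - u x\<bar> powr p)"
      by (rule conv) auto
    finally show "ennreal (\<bar>u (x + 2 *\<^sub>R h) - u x\<bar> powr p) \<le> ennreal (2 powr (p - 1)) * (ennreal (\<bar>u ((x + h) + h) - u (x + h)\<bar> powr p) + ennreal (\<bar>u (x + h) - u x\<bar> powr p))"
      by (simp add: ennreal_plus [symmetric] ennreal_mult [symmetric] ennreal_leI del: ennreal_plus)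
  qed
  also have "\<dots> = ennreal (2 powr (p - 1)) * ((\<integral>\<^sup>+x. ennreal (\<bar>u ((x + h) + h) - u (x + h)\<bar> powr p) \<partial>lborel) + incr p u h)"
    by (subst nn_integral_cmult, measurable, subst nn_integral_add, measurable) (simp add: incr_def)
  also have "(\<integral>\<^sup>+x. ennreal (\<bar>u ((x + h) + h) - u (x + h)\<bar> powr p) \<partial>lborel) = incr p u h"
    unfolding incr_def by (rule nn_integral_lborel_shift [of "\<lambda>x. ennreal (\<bar>u (x + h) - u x\<bar> powr p)"]) measurable
  also have "ennreal (2 powr (p - 1)) * (incr p u h + incr p u h) = ennreal (2 powr p) * incr p u h"
    using powr_p_mult [of 2 p] by (simp add: ennreal_double)
  finally show ?thesis .
qed

lemma incr_le_Lpow: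
  assumes [measurable]: "u \<in> borel_measurable borel" and p: "p > 1"
  shows "incr p u h \<le> ennreal (2 powr (p + 1)) * Lpow p u"
proof -
  have "incr p u h \<le> (\<integral>\<^sup>+x. ennreal (2 powr p) * (ennreal (\<bar>u (x + h)\<bar> powr p) + ennreal (\<bar>u x\<bar> powr p)) \<partial>lborel)"
    unfolding incr_def
  proof (rule nn_integral_mono)
    fix x
    show "ennreal (\<bar>u (x + h) - u x\<bar> powr p) \<le> ennreal (2 powr p) * (ennreal (\<bar>u (x + h)\<bar> powr p) + ennreal (\<bar>u x\<bar> powr p))"
      using norm_powr_diff_le [of p "u (x + h)" "u x"] p
      by (simp add: ennreal_plus [symmetric] ennreal_mult [symmetric] ennreal_leI del: ennreal_plus)
  qed
  also have "\<dots> = ennreal (2 powr p) * ((\<integral>\<^sup>+x. ennreal (\<bar>u (x + h)\<bar> powr p) \<partial>lborel) + Lpow p u)"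
    by (subst nn_integral_cmult, measurable, subst nn_integral_add, measurable) (simp add: Lpow_def)
  also have "(\<integral>\<^sup>+x. ennreal (\<bar>u (x + h)\<bar> powr p) \<partial>lborel) = Lpow p u"
    unfolding Lpow_def by (rule nn_integral_lborel_shift [of "\<lambda>x. ennreal (\<bar>u x\<bar> powr p)"]) measurable
  also have "ennreal (2 powr p) * (Lpow p u + Lpow p u) = ennreal (2 powr (p + 1)) * Lpow p u"
    by (simp add: ennreal_double powr_add)
  finally show ?thesis .
qed

text \<open>A shift of length at least \<open>2 * R\<close> separates the supports of
  \<open>u\<close> and of its translate, so nothing cancels in the increment.\<close>

lemma Lpow_le_incr:
  assumes [measurable]: "u \<in> borel_measurable borel" and out: "\<And>x. x \<notin> ball 0 R \<Longrightarrow> u x = 0" and h: "norm h \<ge> 2 * R"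
  shows "Lpow p u \<le> incr p u h"
  unfolding Lpow_def incr_def
proof (rule nn_integral_mono)
  fix x
  show "ennreal (\<bar>u x\<bar> powr p) \<le> ennreal (\<bar>u (x + h) - u x\<bar> powr p)"
  proof (cases "x \<in> ball 0 R")
    case True
    have "norm h \<le> norm (x + h) + norm x" using norm_triangle_ineq4 [of "x + h" x] by simp
    then have "u (x + h) = 0" using True h by (intro out) auto
    then show ?thesis by simp
  qed (simp add: out)
qed

section \<open>Dyadic shells and the scale invariant kernel\<close>

definition shell :: "real \<Rightarrow> 'a::euclidean_space set" where
  "shell r = {h. r \<le> norm h \<and> norm h < 2 * r}"

lemma shell_measurable [measurable]: "shell r \<in> sets borel"
  unfolding shell_def by measurable

lemma nn_integral_lborel_scale:
  fixes f :: "'a::euclidean_space \<Rightarrow> ennreal"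
  assumes [measurable]: "f \<in> borel_measurable borel" and c: "c > 0"
  shows "(\<integral>\<^sup>+x. f x \<partial>lborel) = ennreal (c ^ DIM('a)) * (\<integral>\<^sup>+x. f (c *\<^sub>R x) \<partial>lborel)"
proof -
  have "(lborel :: 'a measure) = density (distr lborel borel (\<lambda>x. 0 + c *\<^sub>R x)) (\<lambda>_. ennreal (\<bar>c\<bar> ^ DIM('a)))"
    using lborel_affine [of c 0] c by simp
  then have "(\<integral>\<^sup>+x. f x \<partial>lborel) = (\<integral>\<^sup>+x. f x \<partial>density (distr lborel borel (\<lambda>x. 0 + c *\<^sub>R x)) (\<lambda>_. ennreal (\<bar>c\<bar> ^ DIM('a))))"
    by simp
  also have "\<dots> = (\<integral>\<^sup>+x. ennreal (\<bar>c\<bar> ^ DIM('a)) * f x \<partial>distr lborel borel (\<lambda>x. 0 + c *\<^sub>R x))"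
    by (subst nn_integral_density) auto
  also have "\<dots> = (\<integral>\<^sup>+x. ennreal (\<bar>c\<bar> ^ DIM('a)) * f (c *\<^sub>R x) \<partial>lborel)"
    by (subst nn_integral_distr) auto
  also have "\<dots> = ennreal (\<bar>c\<bar> ^ DIM('a)) * (\<integral>\<^sup>+x. f (c *\<^sub>R x) \<partial>lborel)"
    by (rule nn_integral_cmult) measurable
  finally show ?thesis using c by simp
qed

text \<open>The measure with density \<open>riesz0\<close> is invariant under dilations: the
  Jacobian \<open>c ^ DIM('a)\<close> cancels the homogeneity of the kernel.\<close>

lemma shell_scale:
  fixes F :: "'a::euclidean_space \<Rightarrow> ennreal"
  assumes [measurable]: "F \<in> borel_measurable borel" and c: "c > 0"
  shows "(\<integral>\<^sup>+h. F h * riesz0 h * indicator (shell (c * r)) h \<partial>lborel)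
     = (\<integral>\<^sup>+h. F (c *\<^sub>R h) * riesz0 h * indicator (shell r) h \<partial>lborel)"
proof -
  have "(\<integral>\<^sup>+h. F h * riesz0 h * indicator (shell (c * r)) h \<partial>lborel)
    = ennreal (c ^ DIM('a)) * (\<integral>\<^sup>+h. F (c *\<^sub>R h) * ennreal (norm (c *\<^sub>R h) powr - real DIM('a)) * indicator (shell (c * r)) (c *\<^sub>R h) \<partial>lborel)"
    by (rule nn_integral_lborel_scale [OF _ c]) measurable
  also have "\<dots> = (\<integral>\<^sup>+h. ennreal (c ^ DIM('a)) * (F (c *\<^sub>R h) * ennreal (norm (c *\<^sub>R h) powr - real DIM('a)) * indicator (shell (c * r)) (c *\<^sub>R h)) \<partial>lborel)"
    by (rule nn_integral_cmult [symmetric]) measurable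
  also have "\<dots> = (\<integral>\<^sup>+h. F (c *\<^sub>R h) * riesz0 h * indicator (shell r) h \<partial>lborel)"
  proof (rule nn_integral_cong)
    fix h :: 'a
    have "c ^ DIM('a) * norm (c *\<^sub>R h) powr - real DIM('a) = norm h powr - real DIM('a)"
    proof -
      have "c ^ DIM('a) * c powr - real DIM('a) = 1"
        using c by (simp add: powr_minus powr_realpow)
      then show ?thesis using c by (simp add: powr_mult mult.assoc [symmetric])
    qed
    then have "ennreal (c ^ DIM('a)) * ennreal (norm (c *\<^sub>R h) powr - real DIM('a)) = riesz0 h"
      using c by (simp add: ennreal_mult [symmetric])
    moreover have "indicator (shell (c * r)) (c *\<^sub>R h) = (indicator (shell r) h :: ennreal)"
      using c by (simp add: shell_def indicator_def mult.left_commute)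
    ultimately show "ennreal (c ^ DIM('a)) * (F (c *\<^sub>R h) * ennreal (norm (c *\<^sub>R h) powr - real DIM('a)) * indicator (shell (c * r)) (c *\<^sub>R h))
       = F (c *\<^sub>R h) * riesz0 h * indicator (shell r) h"
      by (metis (no_types, opaque_lifting) mult.assoc mult.left_commute)
  qed
  finally show ?thesis .
qed

definition shell_mass :: "'a::euclidean_space itself \<Rightarrow> ennreal" where
  "shell_mass _ = (\<integral>\<^sup>+h. riesz0 h * indicator (shell 1) h \<partial>(lborel :: 'a measure))"

lemma shell_mass_eq:
  assumes "r > 0"
  shows "(\<integral>\<^sup>+h. riesz0 h * indicator (shell r) h \<partial>(lborel :: 'a::euclidean_space measure)) = shell_mass TYPE('a)"
  using shell_scale [of "\<lambda>h::'a. 1" r 1] assms by (simp add: shell_mass_def)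

lemma shell_mass_pos: "shell_mass TYPE('a::euclidean_space) > 0"
proof -
  let ?f = "\<lambda>h::'a. riesz0 h * indicator (shell 1) h"
  have "\<not> (AE h in lborel. ?f h = 0)"
  proof
    assume "AE h in lborel. ?f h = 0"
    then have ae: "AE h in lborel. h \<notin> (shell 1 :: 'a set)"
      by eventually_elim (auto simp: shell_def indicator_def split: if_splits)
    define U where "U = {h::'a. 1 < norm h \<and> norm h < 2}"
    have "open U" unfolding U_def by (intro open_Collect_conj open_Collect_less continuous_intros)
    moreover obtain b :: 'a where "b \<in> Basis" using nonempty_Basis by blast
    then have "(3/2) *\<^sub>R b \<in> U" by (simp add: U_def)
    then have "U \<noteq> {}" by blast
    ultimately have "\<not> negligible U" by (rule open_not_negligible)
    moreover have "AE h in lborel. h \<notin> U" using ae by eventually_elim (auto simp: U_def shell_def)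
    then have "AE h in lebesgue. h \<notin> U" by (rule AE_completion)
    then have "U \<in> null_sets lebesgue"
      using \<open>open U\<close> by (subst AE_iff_null_sets) auto
    then have "negligible U" by (simp add: negligible_iff_null_sets)
    ultimately show False by simp
  qed
  then show ?thesis unfolding shell_mass_def
    by (subst zero_less_iff_neq_zero, subst nn_integral_0_iff_AE) auto
qed

lemma shell_mass_finite: "shell_mass TYPE('a::euclidean_space) < \<infinity>"
proof -
  have "shell_mass TYPE('a) \<le> (\<integral>\<^sup>+h. indicator (ball 0 2) h \<partial>(lborel :: 'a measure))"
    unfolding shell_mass_def
  proof (rule nn_integral_mono)
    fix h :: 'a
    have "norm h powr - real DIM('a) \<le> 1" if "1 \<le> norm h"
      using powr_mono2' [of "- real DIM('a)" 1 "norm h"] that by simp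
    then show "riesz0 h * indicator (shell 1) h \<le> indicator (ball 0 2) h"
      by (auto simp: shell_def indicator_def ennreal_le_1)
  qed
  also have "\<dots> = emeasure lborel (ball (0::'a) 2)" by simp
  also have "\<dots> < \<infinity>" by (rule emeasure_lborel_ball_finite)
  finally show ?thesis .
qed

lemma nn_integral_shells:
  fixes F :: "'a::euclidean_space \<Rightarrow> ennreal"
  assumes [measurable]: "F \<in> borel_measurable borel"
    and disj: "\<And>k l. k < l \<Longrightarrow> shell (r k) \<inter> shell (r l) = ({} :: 'a set)" and un: "(\<Union>k. shell (r k)) = A"
  shows "(\<integral>\<^sup>+h. F h * indicator A h \<partial>lborel) = (\<Sum>k. \<integral>\<^sup>+h. F h * indicator (shell (r k)) h \<partial>lborel)"
proof -
  have "disjoint_family (\<lambda>k. shell (r k) :: 'a set)"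
    using disj unfolding disjoint_family_on_def by (metis Int_commute linorder_neqE_nat)
  then have "(\<integral>\<^sup>+h. F h * indicator A h \<partial>lborel) = (\<integral>\<^sup>+h. (\<Sum>k. F h * indicator (shell (r k)) h) \<partial>lborel)"
    unfolding un [symmetric] by (intro nn_integral_cong) (simp add: suminf_indicator)
  also have "\<dots> = (\<Sum>k. \<integral>\<^sup>+h. F h * indicator (shell (r k)) h \<partial>lborel)"
    by (rule nn_integral_suminf) measurable
  finally show ?thesis .
qed

lemma nn_integral_shells_near:
  fixes F :: "'a::euclidean_space \<Rightarrow> ennreal"
  assumes [measurable]: "F \<in> borel_measurable borel" and D: "D > 0"
  shows "(\<integral>\<^sup>+h. F h * indicator {h. 0 < norm h \<and> norm h < 2 * D} h \<partial>lborel)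
    = (\<Sum>k. \<integral>\<^sup>+h. F h * indicator (shell (D * (1/2) ^ k)) h \<partial>lborel)"
proof (rule nn_integral_shells [OF assms(1)])
  fix k l :: nat assume "k < l"
  then have "(1/2::real) ^ l \<le> (1/2) ^ Suc k" by (intro power_decreasing) auto
  then have "2 * (D * (1/2) ^ l) \<le> D * (1/2) ^ k" using D by (simp add: mult.left_commute)
  then show "shell (D * (1/2) ^ k) \<inter> shell (D * (1/2) ^ l) = ({} :: 'a set)" by (force simp: shell_def)
next
  show "(\<Union>k. shell (D * (1/2) ^ k)) = {h::'a. 0 < norm h \<and> norm h < 2 * D}"
  proof (intro equalityI subsetI)
    fix h :: 'a assume "h \<in> (\<Union>k. shell (D * (1/2) ^ k))"
    then obtain k where k: "D * (1/2) ^ k \<le> norm h" "norm h < 2 * (D * (1/2) ^ k)" by (auto simp: shell_def)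
    have "D * (1/2) ^ k > 0" "D * (1/2) ^ k \<le> D * 1" using D by (auto intro!: mult_left_mono simp: power_le_one)
    then show "h \<in> {h. 0 < norm h \<and> norm h < 2 * D}" using k by auto
  next
    fix h :: 'a assume h: "h \<in> {h. 0 < norm h \<and> norm h < 2 * D}"
    define t where "t = norm h / D"
    have t: "0 < t" "t < 2" using h D by (auto simp: t_def field_simps)
    obtain n where "(1/2::real) ^ n < t" using real_arch_pow_inv [OF t(1), of "1/2"] by auto
    then have "(1/2::real) ^ n \<le> t" by simp
    from ex_least_nat_le [of "\<lambda>n. (1/2::real) ^ n \<le> t", OF this]
    obtain k where k: "(1/2) ^ k \<le> t" "\<And>i. i < k \<Longrightarrow> \<not> (1/2) ^ i \<le> t" by auto
    have "t < 2 * (1/2) ^ k"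
    proof (cases k)
      case 0 then show ?thesis using t by simp
    next
      case (Suc j) then show ?thesis using k(2) [of j] by simp
    qed
    then have "h \<in> shell (D * (1/2) ^ k)" using k(1) D by (simp add: shell_def t_def field_simps)
    then show "h \<in> (\<Union>k. shell (D * (1/2) ^ k))" by blast
  qed
qed

lemma nn_integral_shells_far:
  fixes F :: "'a::euclidean_space \<Rightarrow> ennreal"
  assumes [measurable]: "F \<in> borel_measurable borel" and D: "D > 0"
  shows "(\<integral>\<^sup>+h. F h * indicator {h. D \<le> norm h} h \<partial>lborel)
    = (\<Sum>k. \<integral>\<^sup>+h. F h * indicator (shell (D * 2 ^ k)) h \<partial>lborel)"
proof (rule nn_integral_shells [OF assms(1)])
  fix k l :: nat assume "k < l"
  then have "(2::real) ^ l \<ge> 2 ^ Suc k" by (intro power_increasing) auto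
  then have "2 * (D * 2 ^ k) \<le> D * 2 ^ l" using D by (simp add: mult.left_commute)
  then show "shell (D * 2 ^ k) \<inter> shell (D * 2 ^ l) = ({} :: 'a set)" by (force simp: shell_def)
next
  show "(\<Union>k. shell (D * 2 ^ k)) = {h::'a. D \<le> norm h}"
  proof (intro equalityI subsetI)
    fix h :: 'a assume "h \<in> (\<Union>k. shell (D * 2 ^ k))"
    then obtain k where k: "D * 2 ^ k \<le> norm h" by (auto simp: shell_def)
    have "D * 1 \<le> D * 2 ^ k" using D by (intro mult_left_mono) auto
    then show "h \<in> {h. D \<le> norm h}" using k by auto
  next
    fix h :: 'a assume h: "h \<in> {h. D \<le> norm h}"
    define t where "t = norm h / D"
    have t: "t \<ge> 1" using h D by (auto simp: t_def field_simps)
    obtain n where "t < 2 ^ n" using real_arch_pow [of 2 t] by auto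
    from ex_least_nat_le [of "\<lambda>n. t < 2 ^ n", OF this]
    obtain k where k: "t < 2 ^ k" "\<And>i. i < k \<Longrightarrow> \<not> t < 2 ^ i" by auto
    then obtain j where j: "k = Suc j" using t by (cases k) auto
    have "h \<in> shell (D * 2 ^ j)" using k(1) k(2) [of j] D j by (simp add: shell_def t_def field_simps)
    then show "h \<in> (\<Union>k. shell (D * 2 ^ k))" by blast
  qed
qed

text \<open>Abel summation: \<open>(1 - x) * (\<Sum>k. x ^ k * b k)\<close> is a power series in \<open>x\<close> whose coefficients are
  the increments of \<open>b\<close>, hence it is monotone in \<open>x\<close>.\<close>

lemma abel_mean_mono:
  fixes b :: "nat \<Rightarrow> ennreal"
  assumes b: "incseq b" and x: "0 \<le> x" "x \<le> y" "y < 1"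
  shows "ennreal (1 - x) * (\<Sum>k. ennreal (x ^ k) * b k) \<le> ennreal (1 - y) * (\<Sum>k. ennreal (y ^ k) * b k)"
proof -
  let ?S = "\<lambda>x. \<Sum>k. ennreal (x ^ k) * b k"
  let ?Q = "\<lambda>x. b 0 + (\<Sum>k. ennreal (x ^ Suc k) * (b (Suc k) - b k))"
  have bs: "b (Suc k) = b k + (b (Suc k) - b k)" for k
    using b by (metis add_diff_inverse_ennreal incseq_SucD)
  have S: "?S x = ?Q x + ennreal x * ?S x" if "0 \<le> x" for x
  proof -
    have "?S x = b 0 + (\<Sum>k. ennreal (x ^ Suc k) * b (Suc k))"
      using suminf_offset [of "\<lambda>k. ennreal (x ^ k) * b k" 1] by (simp add: summableI)
    also have "(\<lambda>k. ennreal (x ^ Suc k) * b (Suc k)) = (\<lambda>k. ennreal (x ^ Suc k) * (b (Suc k) - b k) + ennreal x * (ennreal (x ^ k) * b k))"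
    proof
      fix k
      have "ennreal (x ^ Suc k) * b (Suc k) = ennreal (x ^ Suc k) * (b (Suc k) - b k) + ennreal (x ^ Suc k) * b k"
        by (subst bs) (simp add: distrib_left add.commute)
      then show "ennreal (x ^ Suc k) * b (Suc k) = ennreal (x ^ Suc k) * (b (Suc k) - b k) + ennreal x * (ennreal (x ^ k) * b k)"
        using that by (simp add: ennreal_mult mult.assoc)
    qed
    also have "(\<Sum>k. ennreal (x ^ Suc k) * (b (Suc k) - b k) + ennreal x * (ennreal (x ^ k) * b k))
      = (\<Sum>k. ennreal (x ^ Suc k) * (b (Suc k) - b k)) + ennreal x * ?S x"
      by (subst suminf_add [symmetric]) (auto simp: ennreal_suminf_cmult)
    finally show ?thesis by (simp add: add.assoc)
  qed
  \<comment> \<open>Both sides are compared after adding \<open>x * ?S x\<close>; cancelling this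
    term is legitimate only while the sum is finite.\<close>
  have SQ: "ennreal (1 - x) * ?S x = ?Q x" if "0 \<le> x" "x < 1" "?S x < \<infinity>" for x
  proof -
    have "?S x = ennreal (1 - x) * ?S x + ennreal x * ?S x"
      using that by (simp add: distrib_right [symmetric] ennreal_plus [symmetric] del: ennreal_plus)
    moreover have "ennreal x * ?S x < \<infinity>" using that by (simp add: ennreal_mult_less_top)
    ultimately show ?thesis using S [OF that(1)]
      by (metis (no_types, lifting) add.commute ennreal_add_left_cancel infinity_ennreal_def less_irrefl)
  qed
  show ?thesis
  proof (cases "?S y < \<infinity>")
    case True
    have "?S x \<le> ?S y"
      using x by (intro suminf_le mult_right_mono ennreal_leI power_mono) auto
    then have "?S x < \<infinity>" using True by (rule le_less_trans)
    moreover have "?Q x \<le> ?Q y"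
      using x by (intro add_left_mono suminf_le mult_right_mono ennreal_leI power_mono) auto
    ultimately show ?thesis using SQ [of x] SQ [of y] True x by auto
  next
    case False
    then have "ennreal (1 - y) * ?S y = \<infinity>" using x by (simp add: ennreal_mult_eq_top_iff less_top [symmetric])
    then show ?thesis by simp
  qed
qed

lemma suminf_geometric_ennreal:
  assumes "0 \<le> x" "x < 1"
  shows "(\<Sum>k. ennreal (x ^ k)) = ennreal (1 / (1 - x))"
  using assms by (subst suminf_ennreal2) (auto simp: suminf_geometric summable_geometric)

lemma abel_mean_bounds:
  fixes b :: "nat \<Rightarrow> ennreal"
  assumes x: "0 \<le> x" "x < 1"
  shows "(\<And>k. b k \<le> B) \<Longrightarrow> ennreal (1 - x) * (\<Sum>k. ennreal (x ^ k) * b k) \<le> B"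
    and "incseq b \<Longrightarrow> b 0 \<le> ennreal (1 - x) * (\<Sum>k. ennreal (x ^ k) * b k)"
proof -
  have const: "ennreal (1 - x) * (\<Sum>k. ennreal (x ^ k) * B) = B" for B
  proof -
    have "(\<Sum>k. ennreal (x ^ k) * B) = ennreal (1 / (1 - x)) * B"
      using suminf_geometric_ennreal [OF x] by (subst ennreal_suminf_multc) simp
    then show ?thesis using x by (simp add: mult.assoc [symmetric] ennreal_mult [symmetric])
  qed
  {
    assume "\<And>k. b k \<le> B"
    then have "ennreal (1 - x) * (\<Sum>k. ennreal (x ^ k) * b k) \<le> ennreal (1 - x) * (\<Sum>k. ennreal (x ^ k) * B)"
      by (intro mult_left_mono suminf_le) auto
    then show "ennreal (1 - x) * (\<Sum>k. ennreal (x ^ k) * b k) \<le> B" by (simp only: const)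
  next
    assume "incseq b"
    then have "ennreal (1 - x) * (\<Sum>k. ennreal (x ^ k) * b 0) \<le> ennreal (1 - x) * (\<Sum>k. ennreal (x ^ k) * b k)"
      by (intro mult_left_mono suminf_le) (auto simp: incseq_def)
    then show "b 0 \<le> ennreal (1 - x) * (\<Sum>k. ennreal (x ^ k) * b k)" by (simp only: const)
  }
qed

section \<open>Near and far parts of the Gagliardo energy as sums over shells\<close>

definition shell_energy :: "real \<Rightarrow> ('a::euclidean_space \<Rightarrow> real) \<Rightarrow> real \<Rightarrow> ennreal" where
  "shell_energy p u r = (\<integral>\<^sup>+h. incr p u h * riesz0 h * indicator (shell r) h \<partial>lborel)"

text \<open>The weight offsets the decay of increments of a function with gradient at scale
  \<open>D / 2 ^ k\<close>. The near part of order \<open>s\<close> is comparable to the power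
  series with these coefficients at \<open>2 powr - (p * (1 - s))\<close>, so a larger order means a
  ratio closer to 1.\<close>

definition dyadic :: "real \<Rightarrow> ('a::euclidean_space \<Rightarrow> real) \<Rightarrow> real \<Rightarrow> nat \<Rightarrow> ennreal" where
  "dyadic p u D k = ennreal (2 powr (p * real k)) * shell_energy p u (D * (1/2) ^ k)"

definition near_part :: "real \<Rightarrow> real \<Rightarrow> ('a::euclidean_space \<Rightarrow> real) \<Rightarrow> real \<Rightarrow> ennreal" where
  "near_part p s u D = (\<integral>\<^sup>+h. incr p u h * riesz (s * p) h * indicator {h. 0 < norm h \<and> norm h < 2 * D} h \<partial>lborel)"

definition far_part :: "real \<Rightarrow> real \<Rightarrow> ('a::euclidean_space \<Rightarrow> real) \<Rightarrow> real \<Rightarrow> ennreal" where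
  "far_part p s u D = (\<integral>\<^sup>+h. incr p u h * riesz (s * p) h * indicator {h. D \<le> norm h} h \<partial>lborel)"

text \<open>The near part with parameter \<open>D\<close> reaches to \<open>2 * D\<close>, the outer
  radius of its first shell, hence the argument of the far part. The origin contributes nothing
  because \<open>0 powr a = 0\<close>.\<close>

lemma gagliardo_split:
  assumes [measurable]: "u \<in> borel_measurable borel" and D: "D > 0"
  shows "gagliardo p s u = near_part p s u D + far_part p s u (2 * D)"
  unfolding gagliardo_incr [OF assms(1)] near_part_def far_part_def
  by (subst nn_integral_add [symmetric], measurable, rule nn_integral_cong) (use D in \<open>auto simp: indicator_def\<close>)

lemma shell_energy_half:
  assumes [measurable]: "u \<in> borel_measurable borel" and p: "p > 1"
  shows "shell_energy p u (2 * r) \<le> ennreal (2 powr p) * shell_energy p u r"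
proof -
  have "shell_energy p u (2 * r) = (\<integral>\<^sup>+h. incr p u (2 *\<^sub>R h) * riesz0 h * indicator (shell r) h \<partial>lborel)"
    unfolding shell_energy_def by (rule shell_scale [OF borel_measurable_incr [OF assms(1)]]) simp
  also have "\<dots> \<le> (\<integral>\<^sup>+h. ennreal (2 powr p) * (incr p u h * riesz0 h * indicator (shell r) h) \<partial>lborel)"
    using incr_double [OF assms] by (intro nn_integral_mono) (simp add: mult.assoc [symmetric] mult_right_mono)
  also have "\<dots> = ennreal (2 powr p) * shell_energy p u r"
    unfolding shell_energy_def by (rule nn_integral_cmult) measurable
  finally show ?thesis .
qed

lemma incseq_dyadic:
  assumes "u \<in> borel_measurable borel" "p > 1"
  shows "incseq (dyadic p u D)"
proof (rule incseq_SucI)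
  fix k
  have "shell_energy p u (D * (1/2) ^ k) \<le> ennreal (2 powr p) * shell_energy p u (D * (1/2) ^ Suc k)"
    using shell_energy_half [OF assms, of "D * (1/2) ^ Suc k"] by simp
  then have "dyadic p u D k \<le> ennreal (2 powr (p * real k)) * (ennreal (2 powr p) * shell_energy p u (D * (1/2) ^ Suc k))"
    unfolding dyadic_def by (intro mult_left_mono) auto
  also have "\<dots> = dyadic p u D (Suc k)"
    unfolding dyadic_def mult.assoc [symmetric]
    by (subst ennreal_mult [symmetric]) (auto simp: powr_add [symmetric] algebra_simps)
  finally show "dyadic p u D k \<le> dyadic p u D (Suc k)" .
qed

text \<open>Each estimate of \<open>incr\<close> is constant on the shell, so integrating it against
  the scale invariant kernel produces \<open>shell_mass\<close>, whatever the radius.\<close>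

lemma shell_energy_bounds:
  fixes u :: "'a::euclidean_space \<Rightarrow> real"
  assumes [measurable]: "u \<in> borel_measurable borel" and p: "p > 1" and r: "r > 0"
  shows "shell_energy p u r \<le> ennreal (2 powr (p + 1)) * (Lpow p u * shell_mass TYPE('a))"
    and "(\<And>x. x \<notin> ball 0 R \<Longrightarrow> u x = 0) \<Longrightarrow> r \<ge> 2 * R \<Longrightarrow> Lpow p u * shell_mass TYPE('a) \<le> shell_energy p u r"
    and "wgrad u g \<Longrightarrow> shell_energy p u r \<le> ennreal ((2 * r) powr p) * (nn_power_integral p g * shell_mass TYPE('a))"
proof -
  let ?K = "\<lambda>h::'a. riesz0 h * indicator (shell r) h"
  have E: "shell_energy p u r = (\<integral>\<^sup>+h. incr p u h * ?K h \<partial>lborel)" by (simp add: shell_energy_def mult.assoc)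
  have K: "(\<integral>\<^sup>+h. c * ?K h \<partial>lborel) = c * shell_mass TYPE('a)" for c
    by (subst nn_integral_cmult, measurable) (simp only: shell_mass_eq [OF r])
  have "shell_energy p u r \<le> (\<integral>\<^sup>+h. (ennreal (2 powr (p + 1)) * Lpow p u) * ?K h \<partial>lborel)"
    unfolding E using incr_le_Lpow [OF assms(1) p] by (intro nn_integral_mono mult_right_mono) auto
  then show "shell_energy p u r \<le> ennreal (2 powr (p + 1)) * (Lpow p u * shell_mass TYPE('a))"
    unfolding K by (simp only: mult.assoc)
  show "Lpow p u * shell_mass TYPE('a) \<le> shell_energy p u r" if "\<And>x. x \<notin> ball 0 R \<Longrightarrow> u x = 0" "r \<ge> 2 * R"
  proof -
    have "(\<integral>\<^sup>+h. Lpow p u * ?K h \<partial>lborel) \<le> shell_energy p u r"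
      unfolding E
    proof (rule nn_integral_mono)
      fix h :: 'a
      show "Lpow p u * ?K h \<le> incr p u h * ?K h"
      proof (cases "h \<in> shell r")
        case True
        then have "Lpow p u \<le> incr p u h" using that(2) by (intro Lpow_le_incr [OF assms(1) that(1)]) (auto simp: shell_def)
        then show ?thesis by (rule mult_right_mono) simp
      qed simp
    qed
    then show ?thesis by (simp only: K)
  qed
  show "shell_energy p u r \<le> ennreal ((2 * r) powr p) * (nn_power_integral p g * shell_mass TYPE('a))" if w: "wgrad u g"
  proof -
    let ?G = "\<integral>\<^sup>+x. ennreal (norm (g x) powr p) \<partial>lborel"
    have "shell_energy p u r \<le> (\<integral>\<^sup>+h. (ennreal ((2 * r) powr p) * ?G) * ?K h \<partial>lborel)"
      unfolding E
    proof (rule nn_integral_mono)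
      fix h :: 'a
      show "incr p u h * ?K h \<le> (ennreal ((2 * r) powr p) * ?G) * ?K h"
      proof (cases "h \<in> shell r")
        case True
        have "incr p u h \<le> ennreal (norm h powr p) * ?G"
          unfolding incr_def using p by (intro wgrad_translation_bound [OF w]) auto
        also have "\<dots> \<le> ennreal ((2 * r) powr p) * ?G"
          using True p by (intro mult_right_mono ennreal_leI powr_mono2) (auto simp: shell_def)
        finally show ?thesis by (rule mult_right_mono) simp
      qed simp
    qed
    then show ?thesis unfolding K by (simp only: mult.assoc)
  qed
qed

lemma kernel_shell_bounds:
  fixes u :: "'a::euclidean_space \<Rightarrow> real"
  assumes [measurable]: "u \<in> borel_measurable borel" and a: "a \<ge> 0" and r: "r > 0"
  shows "(\<integral>\<^sup>+h. incr p u h * riesz a h * indicator (shell r) h \<partial>lborel)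
      \<le> ennreal (r powr - a) * shell_energy p u r"
    and "ennreal ((2 * r) powr - a) * shell_energy p u r
      \<le> (\<integral>\<^sup>+h. incr p u h * riesz a h * indicator (shell r) h \<partial>lborel)"
proof -
  let ?K = "\<lambda>h::'a. incr p u h * riesz0 h * indicator (shell r) h"
  have E: "c * shell_energy p u r = (\<integral>\<^sup>+h. c * ?K h \<partial>lborel)" for c
    unfolding shell_energy_def by (rule nn_integral_cmult [symmetric]) measurable
  have split: "incr p u h * riesz a h * indicator (shell r) h = ennreal (norm h powr - a) * ?K h" for h
  proof -
    have "norm h powr - (real DIM('a) + a) = norm h powr - a * norm h powr - real DIM('a)"
      by (simp add: powr_add [symmetric] algebra_simps)
    then show ?thesis by (simp add: ennreal_mult mult_ac)
  qed
  have le: "norm h powr - a \<le> r powr - a" "(2 * r) powr - a \<le> norm h powr - a" if "h \<in> shell r" for h :: 'a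
    using that r a by (auto simp: shell_def intro!: powr_mono2')
  show "(\<integral>\<^sup>+h. incr p u h * riesz a h * indicator (shell r) h \<partial>lborel)
      \<le> ennreal (r powr - a) * shell_energy p u r"
    unfolding E split
  proof (rule nn_integral_mono)
    fix h :: 'a
    show "ennreal (norm h powr - a) * ?K h \<le> ennreal (r powr - a) * ?K h"
      using le(1) [of h] by (cases "h \<in> shell r") (auto intro!: mult_right_mono ennreal_leI)
  qed
  show "ennreal ((2 * r) powr - a) * shell_energy p u r
      \<le> (\<integral>\<^sup>+h. incr p u h * riesz a h * indicator (shell r) h \<partial>lborel)"
    unfolding E split
  proof (rule nn_integral_mono)
    fix h :: 'a
    show "ennreal ((2 * r) powr - a) * ?K h \<le> ennreal (norm h powr - a) * ?K h"
      using le(2) [of h] by (cases "h \<in> shell r") (auto intro!: mult_right_mono ennreal_leI)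
  qed
qed

lemma half_power_powr: fixes D a :: real shows "D > 0 \<Longrightarrow> (D * (1/2) ^ k) powr - a = D powr - a * 2 powr (a * real k)"
proof -
  have "(1/2::real) ^ k = 2 powr - real k"
    by (simp add: powr_minus powr_realpow power_one_over inverse_eq_divide)
  then show "(D * (1/2) ^ k) powr - a = D powr - a * 2 powr (a * real k)"
    by (simp add: powr_mult powr_powr mult.commute)
qed

lemma double_power_powr: fixes D a :: real shows "D > 0 \<Longrightarrow> (D * 2 ^ k) powr - a = D powr - a * (2 powr - a) ^ k"
proof -
  have "(2::real) ^ k = 2 powr real k" by (simp add: powr_realpow)
  moreover have "(2 powr - a) ^ k = (2 powr - a) powr real k" by (simp add: powr_realpow)
  ultimately show "(D * 2 ^ k) powr - a = D powr - a * (2 powr - a) ^ k"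
    by (simp add: powr_mult powr_powr mult.commute)
qed

text \<open>On the shell of radius \<open>D * (1/2) ^ k\<close> the kernel of order \<open>s\<close>
  is \<open>riesz0\<close> times a factor comparable to \<open>2 powr (s * p * k)\<close>, which is
  \<open>x ^ k * 2 powr (p * k)\<close>. The constants are free of \<open>s\<close> because
  \<open>D \<ge> 1\<close> and \<open>0 \<le> s * p \<le> p\<close>.\<close>

lemma near_part_bounds:
  assumes [measurable]: "u \<in> borel_measurable borel" and p: "p > 1" and D: "D \<ge> 1" and s: "0 < s" "s < 1"
    and x: "x = 2 powr - (p * (1 - s))"
  shows "near_part p s u D \<le> (\<Sum>k. ennreal (x ^ k) * dyadic p u D k)"
    and "(\<Sum>k. ennreal (x ^ k) * dyadic p u D k) \<le> ennreal ((2 * D) powr p) * near_part p s u D"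
proof -
  let ?I = "\<lambda>k. \<integral>\<^sup>+h. incr p u h * riesz (s * p) h * indicator (shell (D * (1/2) ^ k)) h \<partial>lborel"
  have sum: "near_part p s u D = (\<Sum>k. ?I k)"
    unfolding near_part_def using D by (intro nn_integral_shells_near) auto
  have rk: "D * (1/2) ^ k > 0" for k using D by simp
  have xk: "x ^ k * 2 powr (p * real k) = 2 powr (s * p * real k)" for k
  proof -
    have "x ^ k = 2 powr (- (p * (1 - s)) * real k)" using x by (simp add: powr_powr flip: powr_realpow)
    then show ?thesis by (simp add: powr_add [symmetric] algebra_simps)
  qed
  have dy: "ennreal (x ^ k) * dyadic p u D k = ennreal (2 powr (s * p * real k)) * shell_energy p u (D * (1/2) ^ k)" for k
    unfolding dyadic_def mult.assoc [symmetric] by (subst ennreal_mult [symmetric]) (simp_all only: xk, simp_all add: x)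
  have sp: "s * p \<ge> 0" "s * p \<le> p" using s p by (auto simp: mult_left_le_one_le)
  have Dle: "D powr - (s * p) \<le> 1" using powr_mono2' [of "- (s * p)" 1 D] sp D by simp
  show "near_part p s u D \<le> (\<Sum>k. ennreal (x ^ k) * dyadic p u D k)"
    unfolding sum
  proof (rule suminf_le)
    fix k
    have "?I k \<le> ennreal ((D * (1/2) ^ k) powr - (s * p)) * shell_energy p u (D * (1/2) ^ k)"
      using sp by (intro kernel_shell_bounds(1) [OF assms(1) _ rk]) auto
    also have "\<dots> \<le> ennreal (2 powr (s * p * real k)) * shell_energy p u (D * (1/2) ^ k)"
    proof (intro mult_right_mono ennreal_leI)
      show "(D * (1/2) ^ k) powr - (s * p) \<le> 2 powr (s * p * real k)"
        using D Dle mult_right_mono [OF Dle, of "2 powr (s * p * real k)"] by (subst half_power_powr) auto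
    qed simp
    finally show "?I k \<le> ennreal (x ^ k) * dyadic p u D k" by (simp only: dy)
  qed auto
  have "(\<Sum>k. ennreal (x ^ k) * dyadic p u D k) \<le> (\<Sum>k. ennreal ((2 * D) powr p) * ?I k)"
  proof (rule suminf_le)
    fix k
    have "2 powr (s * p * real k) = (2 * D) powr (s * p) * (2 * (D * (1/2) ^ k)) powr - (s * p)"
    proof -
      have "(2 * (D * (1/2) ^ k)) powr - (s * p) = (2 * D) powr - (s * p) * 2 powr (s * p * real k)"
        using half_power_powr [of "2 * D" k "s * p"] D by (simp add: mult.assoc)
      moreover have "(2 * D) powr (s * p) * (2 * D) powr - (s * p) = 1" using D by (simp add: powr_minus)
      ultimately show ?thesis by (simp add: mult.assoc [symmetric])
    qed
    also have "\<dots> \<le> (2 * D) powr p * (2 * (D * (1/2) ^ k)) powr - (s * p)"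
      using D sp by (intro mult_right_mono powr_mono) auto
    finally have "ennreal (2 powr (s * p * real k)) * shell_energy p u (D * (1/2) ^ k)
       \<le> ennreal ((2 * D) powr p * (2 * (D * (1/2) ^ k)) powr - (s * p)) * shell_energy p u (D * (1/2) ^ k)"
      by (intro mult_right_mono ennreal_leI) auto
    also have "\<dots> = ennreal ((2 * D) powr p) * (ennreal ((2 * (D * (1/2) ^ k)) powr - (s * p)) * shell_energy p u (D * (1/2) ^ k))"
      by (simp add: ennreal_mult mult.assoc)
    also have "\<dots> \<le> ennreal ((2 * D) powr p) * ?I k"
      using sp by (intro mult_left_mono kernel_shell_bounds(2) [OF assms(1) _ rk]) auto
    finally show "ennreal (x ^ k) * dyadic p u D k \<le> ennreal ((2 * D) powr p) * ?I k" by (simp only: dy)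
  qed auto
  then show "(\<Sum>k. ennreal (x ^ k) * dyadic p u D k) \<le> ennreal ((2 * D) powr p) * near_part p s u D"
    unfolding sum by (simp only: ennreal_suminf_cmult)
qed

text \<open>The shell energies are controlled by the \<open>L\<^sup>p\<close> norm, so the sums are
  geometric with ratio \<open>2 powr - (s * p)\<close>. The factor
  \<open>1 / (1 - 2 powr - (s * p))\<close> is kept explicit: it grows like \<open>1 / s\<close> and
  has to cancel against the weight \<open>s * (1 - s)\<close>.\<close>

lemma far_part_bounds:
  fixes u :: "'a::euclidean_space \<Rightarrow> real"
  assumes [measurable]: "u \<in> borel_measurable borel" and p: "p > 1" and D: "D > 0" and s: "0 < s"
  shows "far_part p s u D \<le> ennreal (2 powr (p + 1) * D powr - (s * p) / (1 - 2 powr - (s * p))) * (Lpow p u * shell_mass TYPE('a))"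
    and "(\<And>x. x \<notin> ball 0 R \<Longrightarrow> u x = 0) \<Longrightarrow> D \<ge> 2 * R \<Longrightarrow>
      Lpow p u * shell_mass TYPE('a) \<le> ennreal ((1 - 2 powr - (s * p)) * (2 * D) powr (s * p)) * far_part p s u D"
proof -
  let ?I = "\<lambda>k. \<integral>\<^sup>+h. incr p u h * riesz (s * p) h * indicator (shell (D * 2 ^ k)) h \<partial>lborel"
  have sum: "far_part p s u D = (\<Sum>k. ?I k)"
    unfolding far_part_def using D by (intro nn_integral_shells_far) auto
  have rk: "D * 2 ^ k > 0" for k using D by simp
  define z where "z = 2 powr - (s * p)"
  have "s * p > 0" using s p by simp
  then have z: "0 \<le> z" "z < 1" using powr_less_mono [of "- (s * p)" 0 2] by (auto simp: z_def)
  have sp: "s * p \<ge> 0" using s p by simp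
  let ?X = "Lpow p u * shell_mass TYPE('a)"
  have "far_part p s u D \<le> (\<Sum>k. ennreal (z ^ k) * (ennreal (2 powr (p + 1) * D powr - (s * p)) * ?X))"
    unfolding sum
  proof (rule suminf_le)
    fix k
    have "?I k \<le> ennreal ((D * 2 ^ k) powr - (s * p)) * shell_energy p u (D * 2 ^ k)"
      by (rule kernel_shell_bounds(1) [OF assms(1) sp rk])
    also have "\<dots> \<le> ennreal ((D * 2 ^ k) powr - (s * p)) * (ennreal (2 powr (p + 1)) * ?X)"
      by (intro mult_left_mono shell_energy_bounds(1) [OF assms(1) p rk]) auto
    also have "\<dots> = ennreal (z ^ k) * (ennreal (2 powr (p + 1) * D powr - (s * p)) * ?X)"
    proof -
      have "(D * 2 ^ k) powr - (s * p) = D powr - (s * p) * z ^ k" using D by (simp add: double_power_powr z_def)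
      then show ?thesis using z by (simp add: ennreal_mult mult_ac)
    qed
    finally show "?I k \<le> ennreal (z ^ k) * (ennreal (2 powr (p + 1) * D powr - (s * p)) * ?X)" .
  qed auto
  also have "\<dots> = ennreal (1 / (1 - z)) * (ennreal (2 powr (p + 1) * D powr - (s * p)) * ?X)"
    using suminf_geometric_ennreal [OF z] by (subst ennreal_suminf_multc) simp
  also have "\<dots> = ennreal (2 powr (p + 1) * D powr - (s * p) / (1 - z)) * ?X"
    unfolding mult.assoc [symmetric] using z by (subst ennreal_mult [symmetric]) auto
  finally show "far_part p s u D \<le> ennreal (2 powr (p + 1) * D powr - (s * p) / (1 - 2 powr - (s * p))) * ?X"
    by (simp only: z_def)
  show "?X \<le> ennreal ((1 - 2 powr - (s * p)) * (2 * D) powr (s * p)) * far_part p s u D"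
    if out: "\<And>x. x \<notin> ball 0 R \<Longrightarrow> u x = 0" and DR: "D \<ge> 2 * R"
  proof -
    have "(\<Sum>k. ennreal (z ^ k) * (ennreal ((2 * D) powr - (s * p)) * ?X)) \<le> far_part p s u D"
      unfolding sum
    proof (rule suminf_le)
      fix k
      have "(2 * (D * 2 ^ k)) powr - (s * p) = (2 * D) powr - (s * p) * z ^ k"
        using double_power_powr [of "2 * D" k "s * p"] D by (simp add: z_def mult.assoc)
      then have "ennreal (z ^ k) * (ennreal ((2 * D) powr - (s * p)) * ?X) = ennreal ((2 * (D * 2 ^ k)) powr - (s * p)) * ?X"
        using z by (simp add: ennreal_mult mult_ac)
      also have "\<dots> \<le> ennreal ((2 * (D * 2 ^ k)) powr - (s * p)) * shell_energy p u (D * 2 ^ k)"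
      proof (intro mult_left_mono shell_energy_bounds(2) [OF assms(1) p rk out])
        have "D * 1 \<le> D * 2 ^ k" using D by (intro mult_left_mono) auto
        then show "2 * R \<le> D * 2 ^ k" using DR by simp
      qed auto
      also have "\<dots> \<le> ?I k" by (rule kernel_shell_bounds(2) [OF assms(1) sp rk])
      finally show "ennreal (z ^ k) * (ennreal ((2 * D) powr - (s * p)) * ?X) \<le> ?I k" .
    qed auto
    then have le: "ennreal (1 / (1 - z)) * (ennreal ((2 * D) powr - (s * p)) * ?X) \<le> far_part p s u D"
      using suminf_geometric_ennreal [OF z] by (subst (asm) ennreal_suminf_multc) simp
    have "?X = ennreal ((1 - z) * (2 * D) powr (s * p)) * (ennreal (1 / (1 - z)) * (ennreal ((2 * D) powr - (s * p)) * ?X))"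
    proof -
      have "(1 - z) * (2 * D) powr (s * p) * (1 / (1 - z)) * (2 * D) powr - (s * p) = 1"
        using z D by (simp add: powr_minus)
      then have "ennreal ((1 - z) * (2 * D) powr (s * p)) * ennreal (1 / (1 - z)) * ennreal ((2 * D) powr - (s * p)) = 1"
        using z by (simp add: ennreal_mult [symmetric] del: ennreal_1)
      then show ?thesis by (simp add: mult.assoc [symmetric])
    qed
    also have "\<dots> \<le> ennreal ((1 - z) * (2 * D) powr (s * p)) * far_part p s u D"
      by (intro mult_left_mono le) auto
    finally show ?thesis by (simp only: z_def)
  qed
qed

text \<open>The function \<open>1 - 2 powr - (p * t)\<close> of \<open>t\<close> is concave and
  vanishes at 0: its chord up to \<open>t = 1\<close> lies below it, by the weighted mean
  inequality, and its tangent at 0, of slope \<open>p * ln 2 < p\<close>, lies above.\<close>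

lemma two_powr_bounds:
  fixes p t :: real
  assumes "p > 0" "0 \<le> t" "t \<le> 1"
  shows "(1 - 2 powr - p) * t \<le> 1 - 2 powr - (p * t)" "1 - 2 powr - (p * t) \<le> p * t"
proof -
  have "(2 powr - p) powr t * 1 powr (1 - t) \<le> t * 2 powr - p + (1 - t) * 1"
    using assms by (intro Youngs_inequality_0) auto
  then show "(1 - 2 powr - p) * t \<le> 1 - 2 powr - (p * t)" by (simp add: powr_powr algebra_simps)
  have "2 powr - (p * t) = exp (- (p * t) * ln 2)" by (simp add: powr_def)
  moreover have "1 + (- (p * t) * ln 2) \<le> exp (- (p * t) * ln 2)" by (rule exp_ge_add_one_self)
  moreover have "(p * t) * ln 2 \<le> (p * t) * 1" using assms ln_2_less_1 by (intro mult_left_mono) auto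
  ultimately show "1 - 2 powr - (p * t) \<le> p * t" by simp
qed

lemma ennreal_mult_chain:
  assumes "X \<le> ennreal a * Y" "Y \<le> ennreal b * Z" "0 \<le> a" "0 \<le> b" "a * b \<le> c"
  shows "X \<le> ennreal c * Z"
proof -
  have "X \<le> ennreal a * (ennreal b * Z)" using assms(1) mult_left_mono [OF assms(2), of "ennreal a"] by (auto intro: order_trans)
  also have "\<dots> = ennreal (a * b) * Z" using assms by (simp add: ennreal_mult mult.assoc)
  also have "\<dots> \<le> ennreal c * Z" using assms by (intro mult_right_mono ennreal_leI) auto
  finally show ?thesis .
qed

section \<open>Comparison of Gagliardo energies with constants uniform in the order\<close>

context
  fixes p R D c0 :: real
  assumes p: "p > 1" and R: "R \<ge> 1 / 2" and D_def: "D = 2 * R" and c0_def: "c0 = 1 - 2 powr - p"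
begin

text \<open>\<open>D = 2 * R\<close> makes the shell of radius \<open>D\<close> consist of shifts
  that separate supports, as \<open>Lpow_le_dyadic_0\<close> uses, and \<open>R \<ge> 1 / 2\<close>
  gives the normalisation \<open>D \<ge> 1\<close>. The number \<open>c0\<close> is the slope of the
  chord in \<open>two_powr_bounds\<close>.\<close>

lemma D1: "D \<ge> 1" and c0: "0 < c0" "c0 \<le> 1"
proof -
  show "D \<ge> 1" using R D_def by simp
  have "2 powr - p < 2 powr (0::real)" using p by (intro powr_less_mono) auto
  then show "0 < c0" "c0 \<le> 1" by (auto simp: c0_def)
qed

lemma shift_ratio:
  assumes "0 < s" "s \<le> s'" "s' < 1"
  shows "0 \<le> 2 powr - (p * (1 - s))" "2 powr - (p * (1 - s)) \<le> 2 powr - (p * (1 - s'))" "2 powr - (p * (1 - s')) < 1"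
proof -
  show "2 powr - (p * (1 - s)) \<le> 2 powr - (p * (1 - s'))" using assms p by (intro powr_mono) auto
  have "2 powr - (p * (1 - s')) < 2 powr (0::real)" using assms p by (intro powr_less_mono) auto
  then show "2 powr - (p * (1 - s')) < 1" by simp
qed simp

text \<open>The factor \<open>1 - s\<close> of the weight turns the power series into an Abel mean,
  since \<open>c0 * (1 - s) \<le> 1 - x\<close>; the factor \<open>s\<close> is left over and is
  monotone.\<close>

lemma near_le_abel:
  assumes u: "u \<in> borel_measurable borel" and s: "0 < s" "s < 1" and x: "x = 2 powr - (p * (1 - s))"
  shows "ennreal (s * (1 - s)) * near_part p s u D \<le> ennreal (s / c0) * (ennreal (1 - x) * (\<Sum>k. ennreal (x ^ k) * dyadic p u D k))"
proof -
  have "s * (1 - s) \<le> s / c0 * (1 - x)"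
  proof -
    have "c0 * (1 - s) \<le> 1 - x" using two_powr_bounds(1) [of p "1 - s"] p s by (simp add: c0_def x)
    then have "s / c0 * (c0 * (1 - s)) \<le> s / c0 * (1 - x)" using c0 s by (intro mult_left_mono) auto
    then show ?thesis using c0 by simp
  qed
  then have "ennreal (s * (1 - s)) * near_part p s u D \<le> ennreal (s / c0 * (1 - x)) * (\<Sum>k. ennreal (x ^ k) * dyadic p u D k)"
    by (intro mult_mono [OF ennreal_leI near_part_bounds(1) [OF u p D1 s x]]) auto
  also have "\<dots> = ennreal (s / c0) * (ennreal (1 - x) * (\<Sum>k. ennreal (x ^ k) * dyadic p u D k))"
    using shift_ratio [OF s(1) order_refl s(2)] s c0
    by (subst ennreal_mult) (simp_all only: mult.assoc, simp_all add: x)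
  finally show ?thesis .
qed

lemma abel_le_near:
  assumes u: "u \<in> borel_measurable borel" and s: "0 < s" "s < 1" and x: "x = 2 powr - (p * (1 - s))"
  shows "ennreal (1 - x) * (\<Sum>k. ennreal (x ^ k) * dyadic p u D k) \<le> ennreal (p * (1 - s) * (2 * D) powr p) * near_part p s u D"
proof (rule ennreal_mult_chain)
  show "ennreal (1 - x) * (\<Sum>k. ennreal (x ^ k) * dyadic p u D k) \<le> ennreal (p * (1 - s)) * (\<Sum>k. ennreal (x ^ k) * dyadic p u D k)"
    using two_powr_bounds(2) [of p "1 - s"] p s by (intro mult_right_mono ennreal_leI) (auto simp: x)
  show "(\<Sum>k. ennreal (x ^ k) * dyadic p u D k) \<le> ennreal ((2 * D) powr p) * near_part p s u D"
    by (rule near_part_bounds(2) [OF u p D1 s x])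
qed (use p s in auto)

text \<open>The sum over far shells is at most of size \<open>1 / (c0 * s)\<close>, and the factor
  \<open>s\<close> of the weight cancels it.\<close>

lemma far_le_Lpow:
  fixes u :: "'a::euclidean_space \<Rightarrow> real"
  assumes u: "u \<in> borel_measurable borel" and s: "0 < s" "s < 1"
  shows "ennreal (s * (1 - s)) * far_part p s u (2 * D) \<le> ennreal (2 powr (p + 1) / c0) * (Lpow p u * shell_mass TYPE('a))"
proof -
  have lower: "c0 * s \<le> 1 - 2 powr - (s * p)"
    using two_powr_bounds(1) [of p s] p s by (simp add: c0_def mult.commute)
  have Dle: "(2 * D) powr - (s * p) \<le> 1" using powr_mono2' [of "- (s * p)" 1 "2 * D"] s p D1 by simp
  have pos: "c0 * s > 0" using c0 s by simp
  have "ennreal (s * (1 - s)) * far_part p s u (2 * D)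
    \<le> ennreal (s * (1 - s)) * (ennreal (2 powr (p + 1) * (2 * D) powr - (s * p) / (1 - 2 powr - (s * p))) * (Lpow p u * shell_mass TYPE('a)))"
    using D1 by (intro mult_left_mono far_part_bounds(1) [OF u p _ s(1)]) auto
  also have "\<dots> = ennreal (s * (1 - s) * (2 powr (p + 1) * (2 * D) powr - (s * p) / (1 - 2 powr - (s * p)))) * (Lpow p u * shell_mass TYPE('a))"
    using s pos lower by (subst ennreal_mult) (auto simp: mult.assoc intro!: divide_nonneg_pos)
  also have "\<dots> \<le> ennreal (2 powr (p + 1) / c0) * (Lpow p u * shell_mass TYPE('a))"
  proof (intro mult_right_mono ennreal_leI)
    have "s * (1 - s) * (2 powr (p + 1) * (2 * D) powr - (s * p) / (1 - 2 powr - (s * p)))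
      \<le> s * (1 - s) * (2 powr (p + 1) * 1 / (c0 * s))"
      using s Dle pos lower by (intro mult_left_mono frac_le mult_left_mono) auto
    also have "\<dots> = (1 - s) * (2 powr (p + 1) / c0)" using s c0 by (simp add: field_simps)
    also have "\<dots> \<le> 1 * (2 powr (p + 1) / c0)" using s c0 by (intro mult_right_mono) auto
    finally show "s * (1 - s) * (2 powr (p + 1) * (2 * D) powr - (s * p) / (1 - 2 powr - (s * p))) \<le> 2 powr (p + 1) / c0" by simp
  qed simp
  finally show ?thesis .
qed

lemma Lpow_le_dyadic_0:
  fixes u :: "'a::euclidean_space \<Rightarrow> real"
  assumes u: "u \<in> borel_measurable borel" and out: "\<And>x. x \<notin> ball 0 R \<Longrightarrow> u x = 0"
  shows "Lpow p u * shell_mass TYPE('a) \<le> dyadic p u D 0"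
  using shell_energy_bounds(2) [OF u p _ out, of D] D1 D_def by (simp add: dyadic_def)

text \<open>The near part gives the bound with weight \<open>1 - s\<close>, the far part with weight
  \<open>s\<close>; the split at \<open>1 / 2\<close> supplies the missing factor at the cost of a
  2.\<close>

lemma Lpow_le_gagliardo:
  fixes u :: "'a::euclidean_space \<Rightarrow> real"
  assumes u: "u \<in> borel_measurable borel" and out: "\<And>x. x \<notin> ball 0 R \<Longrightarrow> u x = 0" and s: "0 < s" "s < 1"
  shows "Lpow p u * shell_mass TYPE('a) \<le> ennreal (2 * p * (4 * D) powr p * (s * (1 - s))) * gagliardo p s u"
proof -
  have D0: "D > 0" using D1 by simp
  have g: "near_part p s u D \<le> gagliardo p s u" "far_part p s u (2 * D) \<le> gagliardo p s u"
    unfolding gagliardo_split [OF u D0] by auto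
  define x where "x = 2 powr - (p * (1 - s))"
  have ml: "(2 * D) powr p \<le> (4 * D) powr p" using p D1 by (intro powr_mono2) auto
  show ?thesis
  proof (cases "s \<ge> 1 / 2")
    case True
    have "Lpow p u * shell_mass TYPE('a) \<le> ennreal (1 - x) * (\<Sum>k. ennreal (x ^ k) * dyadic p u D k)"
      using abel_mean_bounds(2) [OF _ _ incseq_dyadic [OF u p], of x D] Lpow_le_dyadic_0 [OF u out] shift_ratio [OF s(1) order_refl s(2)]
      by (auto simp: x_def intro: order_trans)
    also have "\<dots> \<le> ennreal (p * (1 - s) * (2 * D) powr p) * near_part p s u D"
      by (rule abel_le_near [OF u s x_def])
    also have "\<dots> \<le> ennreal (2 * p * (4 * D) powr p * (s * (1 - s))) * gagliardo p s u"
    proof (rule mult_mono [OF ennreal_leI g(1)])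
      have "p * (1 - s) * (2 * D) powr p * 1 \<le> p * (1 - s) * (4 * D) powr p * (2 * s)"
        using p s True ml by (intro mult_mono mult_nonneg_nonneg) auto
      then show "p * (1 - s) * (2 * D) powr p \<le> 2 * p * (4 * D) powr p * (s * (1 - s))" by (simp add: mult_ac)
    qed auto
    finally show ?thesis .
  next
    case False
    have "Lpow p u * shell_mass TYPE('a) \<le> ennreal ((1 - 2 powr - (s * p)) * (2 * (2 * D)) powr (s * p)) * far_part p s u (2 * D)"
      using D1 D_def R by (intro far_part_bounds(2) [OF u p _ s(1) out]) auto
    also have "\<dots> \<le> ennreal (2 * p * (4 * D) powr p * (s * (1 - s))) * gagliardo p s u"
    proof (rule mult_mono [OF ennreal_leI g(2)])
      have 1: "1 - 2 powr - (s * p) \<le> p * s" using two_powr_bounds(2) [of p s] p s by (simp add: mult.commute)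
      have 2: "(4 * D) powr (s * p) \<le> (4 * D) powr p" using s p D1 by (intro powr_mono) (auto simp: mult_left_le_one_le)
      have "(1 - 2 powr - (s * p)) * (4 * D) powr (s * p) \<le> (p * s) * (4 * D) powr p"
        using 1 2 p s by (intro mult_mono) auto
      also have "\<dots> \<le> (p * s) * (4 * D) powr p * (2 * (1 - s))"
        using p s False mult_left_mono [of 1 "2 * (1 - s)" "(p * s) * (4 * D) powr p"] by simp
      finally show "(1 - 2 powr - (s * p)) * (2 * (2 * D)) powr (s * p) \<le> 2 * p * (4 * D) powr p * (s * (1 - s))"
        by (simp add: algebra_simps)
    qed auto
    finally show ?thesis .
  qed
qed

text \<open>Near parts compare because Abel means increase with the ratio; far parts compare through
  \<open>Lpow\<close>, which the energy of order \<open>s'\<close> controls.\<close>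

lemma gagliardo_comparison:
  assumes u: "u \<in> borel_measurable borel" and out: "\<And>x. x \<notin> ball 0 R \<Longrightarrow> u x = 0" and s: "0 < s" "s \<le> s'" "s' < 1"
  shows "ennreal (s * (1 - s)) * gagliardo p s u
    \<le> ennreal ((p * (2 * D) powr p / c0 + 2 powr (p + 1) / c0 * (2 * p * (4 * D) powr p)) * (s' * (1 - s'))) * gagliardo p s' u"
proof -
  have D0: "D > 0" using D1 by simp
  define x where "x = 2 powr - (p * (1 - s))"
  define y where "y = 2 powr - (p * (1 - s'))"
  have s1: "s < 1" "0 < s'" using s by auto
  have g: "near_part p s' u D \<le> gagliardo p s' u"
    unfolding gagliardo_split [OF u D0] by auto
  have "ennreal (s * (1 - s)) * near_part p s u D \<le> ennreal (s / c0) * (ennreal (1 - x) * (\<Sum>k. ennreal (x ^ k) * dyadic p u D k))"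
    by (rule near_le_abel [OF u s(1) s1(1) x_def])
  also have "\<dots> \<le> ennreal (s / c0) * (ennreal (1 - y) * (\<Sum>k. ennreal (y ^ k) * dyadic p u D k))"
    using shift_ratio [OF s] by (intro mult_left_mono abel_mean_mono [OF incseq_dyadic [OF u p]]) (auto simp: x_def y_def)
  finally have 1: "ennreal (s * (1 - s)) * near_part p s u D \<le> ennreal (s / c0) * (ennreal (1 - y) * (\<Sum>k. ennreal (y ^ k) * dyadic p u D k))" .
  have "ennreal (s * (1 - s)) * near_part p s u D \<le> ennreal (p * (2 * D) powr p / c0 * (s' * (1 - s'))) * near_part p s' u D"
  proof (rule ennreal_mult_chain [OF 1 abel_le_near [OF u s1(2) s(3) y_def]])
    have "s / c0 * (p * (1 - s') * (2 * D) powr p) \<le> s' / c0 * (p * (1 - s') * (2 * D) powr p)"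
      using s c0 p by (intro mult_right_mono divide_right_mono) auto
    then show "s / c0 * (p * (1 - s') * (2 * D) powr p) \<le> p * (2 * D) powr p / c0 * (s' * (1 - s'))"
      by (simp add: mult_ac)
  qed (use s p c0 in auto)
  also have "\<dots> \<le> ennreal (p * (2 * D) powr p / c0 * (s' * (1 - s'))) * gagliardo p s' u"
    by (intro mult_left_mono g) auto
  finally have N: "ennreal (s * (1 - s)) * near_part p s u D \<le> ennreal (p * (2 * D) powr p / c0 * (s' * (1 - s'))) * gagliardo p s' u" .
  have F: "ennreal (s * (1 - s)) * far_part p s u (2 * D) \<le> ennreal (2 powr (p + 1) / c0 * (2 * p * (4 * D) powr p) * (s' * (1 - s'))) * gagliardo p s' u"
    by (rule ennreal_mult_chain [OF far_le_Lpow [OF u s(1) s1(1)] Lpow_le_gagliardo [OF u out s1(2) s(3)]])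
      (use s p c0 in \<open>auto simp: mult_ac\<close>)
  have "ennreal (s * (1 - s)) * gagliardo p s u = ennreal (s * (1 - s)) * near_part p s u D + ennreal (s * (1 - s)) * far_part p s u (2 * D)"
    by (simp add: gagliardo_split [OF u D0] distrib_left)
  also have "\<dots> \<le> ennreal (p * (2 * D) powr p / c0 * (s' * (1 - s'))) * gagliardo p s' u
     + ennreal (2 powr (p + 1) / c0 * (2 * p * (4 * D) powr p) * (s' * (1 - s'))) * gagliardo p s' u"
    by (rule add_mono [OF N F])
  also have "\<dots> = ennreal ((p * (2 * D) powr p / c0 + 2 powr (p + 1) / c0 * (2 * p * (4 * D) powr p)) * (s' * (1 - s'))) * gagliardo p s' u"
    using p c0 s by (subst distrib_right [symmetric], subst ennreal_plus [symmetric]) (auto simp: distrib_right)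
  finally show ?thesis .
qed

text \<open>The weight \<open>2 powr (p * k)\<close> cancels the decay of increments exactly, so the
  increasing sequence is bounded by the gradient, and its Abel means are too.\<close>

lemma dyadic_le_wgrad:
  fixes u :: "'a::euclidean_space \<Rightarrow> real"
  assumes u: "u \<in> borel_measurable borel" and w: "wgrad u g"
  shows "dyadic p u D k \<le> ennreal ((2 * D) powr p) * (nn_power_integral p g * shell_mass TYPE('a))"
  unfolding dyadic_def
proof (rule ennreal_mult_chain [OF order_refl])
  show "shell_energy p u (D * (1/2) ^ k) \<le> ennreal ((2 * (D * (1/2) ^ k)) powr p) * (nn_power_integral p g * shell_mass TYPE('a))"
    using D1 by (intro shell_energy_bounds(3) [OF u p _ w]) auto
  have "(2 * D * (1/2) ^ k) powr p = (2 * D) powr p * 2 powr (- p * real k)"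
    using half_power_powr [of "2 * D" k "- p"] D1 by simp
  moreover have "2 powr (p * real k) * 2 powr (- p * real k) = 1" by (simp add: powr_add [symmetric])
  ultimately show "2 powr (p * real k) * (2 * (D * (1/2) ^ k)) powr p \<le> (2 * D) powr p"
    by (simp add: mult.assoc mult.left_commute)
qed auto

lemma gagliardo_le_wgrad:
  fixes u :: "'a::euclidean_space \<Rightarrow> real"
  assumes u: "u \<in> borel_measurable borel" and out: "\<And>x. x \<notin> ball 0 R \<Longrightarrow> u x = 0" and s: "0 < s" "s < 1" and w: "wgrad u g"
  shows "ennreal (s * (1 - s)) * gagliardo p s u
    \<le> ennreal ((2 * D) powr p / c0 + 2 powr (p + 1) / c0 * (2 * D) powr p) * (nn_power_integral p g * shell_mass TYPE('a))"
proof -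
  let ?G = "nn_power_integral p g * shell_mass TYPE('a)"
  have D0: "D > 0" using D1 by simp
  define x where "x = 2 powr - (p * (1 - s))"
  have ab: "ennreal (1 - x) * (\<Sum>k. ennreal (x ^ k) * dyadic p u D k) \<le> ennreal ((2 * D) powr p) * ?G"
    using shift_ratio [OF s(1) order_refl s(2)] by (intro abel_mean_bounds(1) dyadic_le_wgrad [OF u w]) (auto simp: x_def)
  have N: "ennreal (s * (1 - s)) * near_part p s u D \<le> ennreal ((2 * D) powr p / c0) * ?G"
  proof (rule ennreal_mult_chain [OF near_le_abel [OF u s x_def] ab])
    show "s / c0 * (2 * D) powr p \<le> (2 * D) powr p / c0"
      using s c0 mult_right_mono [of s 1 "(2 * D) powr p / c0"] by simp
  qed (use s c0 in auto)
  have L: "Lpow p u * shell_mass TYPE('a) \<le> ennreal ((2 * D) powr p) * ?G"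
    by (rule order_trans [OF Lpow_le_dyadic_0 [OF u out] dyadic_le_wgrad [OF u w]])
  have F: "ennreal (s * (1 - s)) * far_part p s u (2 * D) \<le> ennreal (2 powr (p + 1) / c0 * (2 * D) powr p) * ?G"
    by (rule ennreal_mult_chain [OF far_le_Lpow [OF u s] L]) (use c0 in auto)
  have "ennreal (s * (1 - s)) * gagliardo p s u = ennreal (s * (1 - s)) * near_part p s u D + ennreal (s * (1 - s)) * far_part p s u (2 * D)"
    by (simp add: gagliardo_split [OF u D0] distrib_left)
  also have "\<dots> \<le> ennreal ((2 * D) powr p / c0) * ?G + ennreal (2 powr (p + 1) / c0 * (2 * D) powr p) * ?G"
    by (rule add_mono [OF N F])
  also have "\<dots> = ennreal ((2 * D) powr p / c0 + 2 powr (p + 1) / c0 * (2 * D) powr p) * ?G"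
    using c0 by (subst distrib_right [symmetric], subst ennreal_plus [symmetric]) auto
  finally show ?thesis .
qed

end

section \<open>The normalising constant up to the endpoints\<close>

lemma continuous_on_frac_const_quotient:
  assumes p: "p > 1" and N: "N \<ge> 1"
  shows "continuous_on {0..1} (\<lambda>s. (p / 2 * 2 powr (2 * s - 1)) / (pi powr ((N - 1) / 2))
     * (Gamma ((N + p * s) / 2) / (Gamma ((p + 1) / 2) * Gamma (2 - s))))"
proof -
  have G: "Gamma ((p + 1) / 2) > 0" using p by (intro Gamma_real_pos) auto
  have G2: "Gamma (2 - s) > 0" if "s \<in> {0..1}" for s :: real using that by (intro Gamma_real_pos) auto
  have nz: "x \<notin> \<int>\<^sub>\<le>\<^sub>0" if "x > 0" for x :: real using that by (auto elim!: nonpos_Ints_cases)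
  have pos: "(N + p * s) / 2 > 0" "2 - s > 0" if "s \<in> {0..1}" for s :: real
    using that p N by (auto simp: add_pos_nonneg)
  have G': "continuous_on {0<..} (Gamma :: real \<Rightarrow> real)"
    by (rule continuous_on_Gamma) (use nz in auto)
  have 1: "continuous_on {0..1} (\<lambda>s. Gamma ((N + p * s) / 2))"
    by (rule continuous_on_compose2 [OF G']) (intro continuous_intros, simp, use pos(1) in auto)
  have 2: "continuous_on {0..1} (\<lambda>s::real. Gamma (2 - s))"
    by (rule continuous_on_compose2 [OF G']) (intro continuous_intros, use pos(2) in auto)
  have 3: "continuous_on {0..1} (\<lambda>s::real. 2 powr (2 * s - 1))"
    by (intro continuous_intros) auto
  show ?thesis
    by (intro continuous_on_mult continuous_on_divide continuous_on_const 1 2 3)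
      (use G G2 in \<open>auto simp: less_le\<close>)
qed

lemma frac_const_eq:
  "frac_const N s p = s * (1 - s) * ((p / 2 * 2 powr (2 * s - 1)) / (pi powr ((N - 1) / 2))
     * (Gamma ((N + p * s) / 2) / (Gamma ((p + 1) / 2) * Gamma (2 - s))))"
  by (simp add: frac_const_def mult_ac)

text \<open>Without the factor \<open>s * (1 - s)\<close> the constant is continuous and positive on
  the closed interval, so it attains a positive minimum and maximum.\<close>

lemma frac_const_bounds:
  assumes p: "p > 1" and N: "N \<ge> 1"
  obtains c1 c2 where "c1 > 0" "c2 > 0"
    "\<And>s. 0 \<le> s \<Longrightarrow> s \<le> 1 \<Longrightarrow> c1 * (s * (1 - s)) \<le> frac_const N s p"
    "\<And>s. 0 \<le> s \<Longrightarrow> s \<le> 1 \<Longrightarrow> frac_const N s p \<le> c2 * (s * (1 - s))"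
proof -
  let ?\<kappa> = "\<lambda>s. (p / 2 * 2 powr (2 * s - 1)) / (pi powr ((N - 1) / 2))
     * (Gamma ((N + p * s) / 2) / (Gamma ((p + 1) / 2) * Gamma (2 - s)))"
  note cont = continuous_on_frac_const_quotient [OF assms]
  have pos: "?\<kappa> s > 0" if "s \<in> {0..1}" for s
    using that p N by (intro mult_pos_pos divide_pos_pos Gamma_real_pos) (auto simp: add_pos_nonneg)
  obtain a where a: "a \<in> {0..1}" "\<And>s. s \<in> {0..1} \<Longrightarrow> ?\<kappa> a \<le> ?\<kappa> s"
    using continuous_attains_inf [OF compact_Icc _ cont] by auto
  obtain b where b: "b \<in> {0..1}" "\<And>s. s \<in> {0..1} \<Longrightarrow> ?\<kappa> s \<le> ?\<kappa> b"
    using continuous_attains_sup [OF compact_Icc _ cont] by auto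
  show ?thesis
  proof (rule that [of "?\<kappa> a" "?\<kappa> b"])
    show "?\<kappa> a > 0" "?\<kappa> b > 0" by (rule pos [OF a(1)], rule pos [OF b(1)])
    fix s :: real assume s: "0 \<le> s" "s \<le> 1"
    have nonneg: "s * (1 - s) \<ge> 0" and mem: "s \<in> {0..1}" using s by auto
    have eq: "frac_const N s p = ?\<kappa> s * (s * (1 - s))" by (simp only: frac_const_eq mult.commute)
    show "?\<kappa> a * (s * (1 - s)) \<le> frac_const N s p" "frac_const N s p \<le> ?\<kappa> b * (s * (1 - s))"
      unfolding eq by (rule mult_right_mono [OF a(2) [OF mem] nonneg], rule mult_right_mono [OF b(2) [OF mem] nonneg])
  qed
qed

lemma seminorm_pow_gagliardo:
  fixes u :: "'a::euclidean_space \<Rightarrow> real"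
  assumes "u \<in> borel_measurable borel" "0 < s" "s < 1"
  shows "seminorm_pow p s u = ennreal (frac_const (real DIM('a)) s p) * gagliardo p s u"
  unfolding gagliardo_def by (rule seminorm_pow_fractional [OF assms])

text \<open>This constant determines \<open>\<kappa>0\<close>; it depends on the dimension,
  \<open>p\<close> and \<open>R\<close> only. At the endpoints \<open>Lpow\<close> and the gradient
  replace the Gagliardo energy, and for \<open>s' = 1\<close> without finite gradient energy the
  right side is infinite.\<close>

lemma seminorm_comparison:
  fixes p R :: real
  assumes p: "p > 1"
  shows "\<exists>C\<ge>1. \<forall>(u::'a::euclidean_space \<Rightarrow> real) s s'. u \<in> borel_measurable borel \<longrightarrow> (\<forall>x. x \<notin> ball 0 R \<longrightarrow> u x = 0) \<longrightarrow>
    0 \<le> s \<longrightarrow> s \<le> s' \<longrightarrow> s' \<le> 1 \<longrightarrow> seminorm_pow p s u \<le> ennreal C * seminorm_pow p s' u"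
proof -
  define R' where "R' = max R (1/2)"
  have R': "R' \<ge> 1/2" "R \<le> R'" by (auto simp: R'_def)
  define D where "D = 2 * R'"
  define c0 :: real where "c0 = 1 - 2 powr - p"
  note c0 = c0 [OF p R'(1) D_def c0_def]
  define w where "w = enn2real (shell_mass TYPE('a))"
  have w: "ennreal w = shell_mass TYPE('a)" "w > 0"
    using shell_mass_pos [where 'a = 'a] shell_mass_finite [where 'a = 'a]
    by (auto simp: w_def enn2real_positive_iff)
  have "ennreal (1 / w) * ennreal w = 1" using w(2) by (simp add: ennreal_mult [symmetric])
  then have wX: "ennreal (1 / w) * (X * shell_mass TYPE('a)) = X" for X
    by (simp add: w(1) [symmetric] mult.left_commute)
  have N: "real DIM('a) \<ge> 1" by (simp add: Suc_leI)
  obtain c1 c2 where c: "c1 > 0" "c2 > 0"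
    "\<And>s. 0 \<le> s \<Longrightarrow> s \<le> 1 \<Longrightarrow> c1 * (s * (1 - s)) \<le> frac_const (real DIM('a)) s p"
    "\<And>s. 0 \<le> s \<Longrightarrow> s \<le> 1 \<Longrightarrow> frac_const (real DIM('a)) s p \<le> c2 * (s * (1 - s))"
    using frac_const_bounds [OF p N] by metis
  define K1 where "K1 = p * (2 * D) powr p / c0 + 2 powr (p + 1) / c0 * (2 * p * (4 * D) powr p)"
  define K2 where "K2 = (2 * D) powr p / c0 + 2 powr (p + 1) / c0 * (2 * D) powr p"
  define K3 where "K3 = 2 * p * (4 * D) powr p"
  have K0: "K1 \<ge> 0" "K2 \<ge> 0" "K3 \<ge> 0" using p c0 by (auto simp: K1_def K2_def K3_def)
  \<comment> \<open>One summand for each case below: 1 for equal orders, then both orders interior,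
    \<open>s\<close> interior with \<open>s' = 1\<close>, \<open>s = 0\<close> with
    \<open>s'\<close> interior, and the pair 0 and 1.\<close>
  define C where "C = 1 + c2 * K1 / c1 + c2 * K2 * w + K3 / (c1 * w) + (2 * D) powr p"
  have nonneg: "c2 * K1 / c1 \<ge> 0" "c2 * K2 * w \<ge> 0" "K3 / (c1 * w) \<ge> 0" "(2 * D) powr p \<ge> 0"
    using K0 c w by auto
  then have Cge: "C \<ge> 1" "c2 * K1 / c1 \<le> C" "c2 * K2 * w \<le> C" "K3 / (c1 * w) \<le> C" "(2 * D) powr p \<le> C"
    unfolding C_def by linarith+
  show ?thesis
  proof (intro exI [of _ C] conjI allI impI Cge(1))
    fix u :: "'a \<Rightarrow> real" and s s' :: real
    assume u: "u \<in> borel_measurable borel" and out0: "\<forall>x. x \<notin> ball 0 R \<longrightarrow> u x = 0" and s: "0 \<le> s" "s \<le> s'" "s' \<le> 1"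
    have out: "u x = 0" if "x \<notin> ball 0 R'" for x using that out0 R' by auto
    have Lp: "seminorm_pow p 0 u = Lpow p u" by (simp add: seminorm_pow_0 Lpow_def)
    have fg: "ennreal (s' * (1 - s')) * gagliardo p s' u \<le> ennreal (1 / c1) * seminorm_pow p s' u" if s': "0 < s'" "s' < 1"
    proof -
      have "s' * (1 - s') \<le> 1 / c1 * frac_const (real DIM('a)) s' p" using c(1) c(3) [of s'] s' by (simp add: field_simps)
      then have "ennreal (s' * (1 - s')) * gagliardo p s' u \<le> ennreal (1 / c1 * frac_const (real DIM('a)) s' p) * gagliardo p s' u"
        by (intro mult_right_mono ennreal_leI) auto
      also have "\<dots> = ennreal (1 / c1) * seminorm_pow p s' u"
        using c(1) unfolding seminorm_pow_gagliardo [OF u s'] by (subst ennreal_mult') (simp_all only: mult.assoc, simp)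
      finally show ?thesis .
    qed
    have gf: "seminorm_pow p s u \<le> ennreal c2 * (ennreal (s * (1 - s)) * gagliardo p s u)" if "0 < s" "s < 1"
    proof -
      have "seminorm_pow p s u \<le> ennreal (c2 * (s * (1 - s))) * gagliardo p s u"
        unfolding seminorm_pow_gagliardo [OF u that] using c(4) [of s] that by (intro mult_right_mono ennreal_leI) auto
      then show ?thesis using c(2) that by (simp add: ennreal_mult' mult.assoc)
    qed
    consider "s = s'" | "s = 0" "0 < s'" "s' < 1" | "s = 0" "s' = 1" | "0 < s" "s < s'" "s' < 1" | "0 < s" "s < 1" "s' = 1"
      using s by linarith
    then show "seminorm_pow p s u \<le> ennreal C * seminorm_pow p s' u"
    proof cases
      case 1
      have "1 * seminorm_pow p s' u \<le> ennreal C * seminorm_pow p s' u" using Cge by (intro mult_right_mono) auto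
      then show ?thesis using 1 by simp
    next
      case 2
      have "Lpow p u = ennreal (1 / w) * (Lpow p u * shell_mass TYPE('a))" by (simp add: wX)
      also have "\<dots> \<le> ennreal (1 / w) * (ennreal (K3 * (s' * (1 - s'))) * gagliardo p s' u)"
        unfolding K3_def by (intro mult_left_mono Lpow_le_gagliardo [OF p R'(1) D_def c0_def u out 2(2,3)]) auto
      also have "\<dots> = ennreal (K3 / w) * (ennreal (s' * (1 - s')) * gagliardo p s' u)"
        using 2 K0 w by (simp add: ennreal_mult mult.assoc divide_inverse mult.left_commute)
      finally have "Lpow p u \<le> ennreal (K3 / w) * (ennreal (s' * (1 - s')) * gagliardo p s' u)" .
      from ennreal_mult_chain [OF this fg [OF 2(2,3)]] show ?thesis
        using 2 K0 c w Cge Lp by (simp add: mult_ac)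
    next
      case 3
      show ?thesis
      proof (cases "seminorm_pow p 1 u < \<infinity>")
        case False
        then have "ennreal C * seminorm_pow p s' u = \<infinity>" using 3 Cge by (simp add: less_top [symmetric] ennreal_mult_eq_top_iff)
        then show ?thesis by simp
      next
        case True
        then obtain g where g: "wgrad u g" using seminorm_pow_1(2) [OF u out] by blast
        let ?G = "\<integral>\<^sup>+x. ennreal (norm (g x) powr p) \<partial>lborel"
        have "Lpow p u * shell_mass TYPE('a) \<le> ennreal ((2 * D) powr p) * (?G * shell_mass TYPE('a))"
          by (rule order_trans [OF Lpow_le_dyadic_0 [OF p R'(1) D_def c0_def u out] dyadic_le_wgrad [OF p R'(1) D_def c0_def u g]])
        then have "ennreal (1 / w) * (Lpow p u * shell_mass TYPE('a)) \<le> ennreal (1 / w) * (ennreal ((2 * D) powr p) * (?G * shell_mass TYPE('a)))"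
          by (rule mult_left_mono) simp
        then have "Lpow p u \<le> ennreal ((2 * D) powr p) * ?G" by (metis mult.assoc wX)
        also have "\<dots> \<le> ennreal C * ?G" using Cge by (intro mult_right_mono ennreal_leI) auto
        finally show ?thesis using 3 seminorm_pow_1(1) [OF u out g] Lp by simp
      qed
    next
      case 4
      have s1: "s < 1" "0 < s'" using 4 by auto
      have "seminorm_pow p s u \<le> ennreal (c2 * K1) * (ennreal (s' * (1 - s')) * gagliardo p s' u)"
      proof (rule ennreal_mult_chain [OF gf [OF 4(1) s1(1)]])
        have "ennreal (s * (1 - s)) * gagliardo p s u \<le> ennreal (K1 * (s' * (1 - s'))) * gagliardo p s' u"
          unfolding K1_def by (rule gagliardo_comparison [OF p R'(1) D_def c0_def u out 4(1) s(2) 4(3)])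
        then show "ennreal (s * (1 - s)) * gagliardo p s u \<le> ennreal K1 * (ennreal (s' * (1 - s')) * gagliardo p s' u)"
          using K0 4 s1 by (simp add: ennreal_mult mult.assoc)
      qed (use K0 c in auto)
      from ennreal_mult_chain [OF this fg [OF s1(2) 4(3)]] show ?thesis
        using K0 c Cge by simp
    next
      case 5
      show ?thesis
      proof (cases "seminorm_pow p 1 u < \<infinity>")
        case False
        then have "ennreal C * seminorm_pow p s' u = \<infinity>" using 5 Cge by (simp add: less_top [symmetric] ennreal_mult_eq_top_iff)
        then show ?thesis by simp
      next
        case True
        then obtain g where g: "wgrad u g" using seminorm_pow_1(2) [OF u out] by blast
        let ?G = "\<integral>\<^sup>+x. ennreal (norm (g x) powr p) \<partial>lborel"
        have "seminorm_pow p s u \<le> ennreal (c2 * K2 * w) * ?G"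
        proof (rule ennreal_mult_chain [OF gf [OF 5(1,2)]])
          have "ennreal (s * (1 - s)) * gagliardo p s u \<le> ennreal K2 * (?G * shell_mass TYPE('a))"
            unfolding K2_def by (rule gagliardo_le_wgrad [OF p R'(1) D_def c0_def u out 5(1,2) g])
          then show "ennreal (s * (1 - s)) * gagliardo p s u \<le> ennreal (K2 * w) * ?G"
            using K0 w(2) by (simp add: w(1) [symmetric] ennreal_mult mult_ac)
        qed (use K0 c w in auto)
        also have "\<dots> \<le> ennreal C * ?G" using Cge by (intro mult_right_mono ennreal_leI) auto
        finally show ?thesis using 5 seminorm_pow_1(1) [OF u out g] by simp
      qed
    qed
  qed
qed

text \<open>Shifts shorter than \<open>2 * \<delta>\<close> gain the factor
  \<open>(2 * \<delta>) powr e\<close> over the kernel of the higher order \<open>s'\<close>; longer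
  shifts cost a multiple of \<open>Lpow\<close>.\<close>

lemma seminorm_interpolation:
  assumes p: "p > 1" and s: "0 < s" "s < s'" "s' < 1" and B: "B \<ge> 0" and \<epsilon>: "\<epsilon> > 0"
  shows "\<exists>C\<ge>0. \<forall>u::'a::euclidean_space \<Rightarrow> real. u \<in> borel_measurable borel \<longrightarrow> seminorm_pow p s' u \<le> ennreal B \<longrightarrow>
    seminorm_pow p s u \<le> ennreal \<epsilon> + ennreal C * Lpow p u"
proof -
  have N: "real DIM('a) \<ge> 1" by (simp add: Suc_leI)
  obtain c1 c2 where c: "c1 > 0" "c2 > 0"
    "\<And>s. 0 \<le> s \<Longrightarrow> s \<le> 1 \<Longrightarrow> c1 * (s * (1 - s)) \<le> frac_const (real DIM('a)) s p"
    "\<And>s. 0 \<le> s \<Longrightarrow> s \<le> 1 \<Longrightarrow> frac_const (real DIM('a)) s p \<le> c2 * (s * (1 - s))"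
    using frac_const_bounds [OF p N] by metis
  have f1: "frac_const (real DIM('a)) s' p > 0"
    using c(1) c(3) [of s'] s mult_pos_pos [of c1 "s' * (1 - s')"] by (smt (verit) mult_pos_pos)
  have f0: "frac_const (real DIM('a)) s p \<ge> 0"
    using c(1) c(3) [of s] s by (smt (verit) mult_nonneg_nonneg)
  define Q where "Q = frac_const (real DIM('a)) s p / frac_const (real DIM('a)) s' p"
  have Q0: "Q \<ge> 0" using f0 f1 by (simp add: Q_def)
  define e where "e = (s' - s) * p"
  have e: "e > 0" using s p by (simp add: e_def)
  \<comment> \<open>The radius that makes
    \<open>Q * (2 * \<delta>) powr e * B \<le> \<epsilon>\<close>; the added 1 keeps the quotient
    meaningful for \<open>Q * B = 0\<close>.\<close>
  define \<delta> where "\<delta> = (\<epsilon> / (Q * B + 1)) powr (1 / e) / 2"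
  have \<delta>: "\<delta> > 0"
  proof -
    have "Q * B + 1 > 0" using Q0 B by (simp add: add_nonneg_pos)
    then show ?thesis using \<epsilon> by (simp add: \<delta>_def)
  qed
  have QB: "Q * B + 1 > 0" using Q0 B by (simp add: add_nonneg_pos)
  have small: "Q * (2 * \<delta>) powr e * B \<le> \<epsilon>"
  proof -
    have "(2 * \<delta>) powr e = \<epsilon> / (Q * B + 1)" using e \<epsilon> QB by (simp add: \<delta>_def powr_powr)
    then have "Q * (2 * \<delta>) powr e * B = \<epsilon> * ((Q * B) / (Q * B + 1))" by simp
    also have "\<dots> \<le> \<epsilon> * 1" using \<epsilon> Q0 B by (intro mult_left_mono) (auto simp: divide_le_eq_1 add_nonneg_pos)
    finally show ?thesis by simp
  qed
  define w where "w = enn2real (shell_mass TYPE('a))"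
  have w: "ennreal w = shell_mass TYPE('a)" "w \<ge> 0"
    using shell_mass_finite [where 'a = 'a] by (auto simp: w_def)
  define F where "F = 2 powr (p + 1) * (2 * \<delta>) powr - (s * p) / (1 - 2 powr - (s * p))"
  have F0: "F \<ge> 0"
  proof -
    have "2 powr - (s * p) \<le> 2 powr (0::real)" using s p by (intro powr_mono) auto
    then show ?thesis by (simp add: F_def)
  qed
  let ?f = "frac_const (real DIM('a)) s p"
  let ?f' = "frac_const (real DIM('a)) s' p"
  show ?thesis
  proof (intro exI [of _ "?f * F * w"] conjI allI impI)
    show "0 \<le> ?f * F * w" using f0 F0 w by simp
    fix u :: "'a \<Rightarrow> real" assume u [measurable]: "u \<in> borel_measurable borel" and b: "seminorm_pow p s' u \<le> ennreal B"
    have near: "near_part p s u \<delta> \<le> ennreal ((2 * \<delta>) powr e) * gagliardo p s' u"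
    proof -
      have "near_part p s u \<delta> \<le> (\<integral>\<^sup>+h. ennreal ((2 * \<delta>) powr e) * (incr p u h * riesz (s' * p) h) \<partial>lborel)"
        unfolding near_part_def
      proof (rule nn_integral_mono)
        fix h :: 'a
        show "incr p u h * riesz (s * p) h * indicator {h. 0 < norm h \<and> norm h < 2 * \<delta>} h
           \<le> ennreal ((2 * \<delta>) powr e) * (incr p u h * riesz (s' * p) h)"
        proof (cases "0 < norm h \<and> norm h < 2 * \<delta>")
          case True
          have "norm h powr - (real DIM('a) + s * p) = norm h powr e * norm h powr - (real DIM('a) + s' * p)"
            by (simp add: powr_add [symmetric] e_def algebra_simps)
          also have "\<dots> \<le> (2 * \<delta>) powr e * norm h powr - (real DIM('a) + s' * p)"
            using True e by (intro mult_right_mono powr_mono2) auto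
          finally have "riesz (s * p) h \<le> ennreal ((2 * \<delta>) powr e) * riesz (s' * p) h"
            by (simp add: ennreal_mult [symmetric] ennreal_leI)
          then have "incr p u h * riesz (s * p) h \<le> incr p u h * (ennreal ((2 * \<delta>) powr e) * riesz (s' * p) h)"
            by (rule mult_left_mono) simp
          then show ?thesis using True by (simp add: mult_ac)
        qed simp
      qed
      also have "\<dots> = ennreal ((2 * \<delta>) powr e) * gagliardo p s' u"
        unfolding gagliardo_incr [OF u] by (rule nn_integral_cmult) measurable
      finally show ?thesis .
    qed
    have far: "far_part p s u (2 * \<delta>) \<le> ennreal F * (Lpow p u * shell_mass TYPE('a))"
      unfolding F_def using \<delta> by (intro far_part_bounds(1) [OF u p _ s(1)]) auto
    have s1: "s < 1" "0 < s'" using s by auto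
    have "seminorm_pow p s u = ennreal ?f * near_part p s u \<delta> + ennreal ?f * far_part p s u (2 * \<delta>)"
      by (simp add: seminorm_pow_gagliardo [OF u s(1) s1(1)] gagliardo_split [OF u \<delta>] distrib_left)
    also have "\<dots> \<le> ennreal ?f * (ennreal ((2 * \<delta>) powr e) * gagliardo p s' u) + ennreal ?f * (ennreal F * (Lpow p u * shell_mass TYPE('a)))"
      by (intro add_mono mult_left_mono near far) auto
    also have "ennreal ?f * (ennreal F * (Lpow p u * shell_mass TYPE('a))) = ennreal (?f * F * w) * Lpow p u"
      using f0 F0 w(2) by (simp add: w(1) [symmetric] ennreal_mult mult_ac)
    also have "ennreal ?f * (ennreal ((2 * \<delta>) powr e) * gagliardo p s' u) = ennreal (Q * (2 * \<delta>) powr e) * seminorm_pow p s' u"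
    proof -
      have "?f = Q * ?f'" using f1 by (simp add: Q_def)
      then have "ennreal ?f = ennreal Q * ennreal ?f'" using Q0 f1 by (simp add: ennreal_mult)
      then show ?thesis using Q0 by (simp add: seminorm_pow_gagliardo [OF u s1(2) s(3)] ennreal_mult mult_ac)
    qed
    also have "ennreal (Q * (2 * \<delta>) powr e) * seminorm_pow p s' u \<le> ennreal (Q * (2 * \<delta>) powr e) * ennreal B"
      by (intro mult_left_mono b) auto
    also have "\<dots> \<le> ennreal \<epsilon>" using small Q0 B by (simp add: ennreal_mult [symmetric] ennreal_leI)
    finally show "seminorm_pow p s u \<le> ennreal \<epsilon> + ennreal (?f * F * w) * Lpow p u"
      by (simp add: add_right_mono)
  qed
qed

section \<open>Compactness in $L^1$ of sets bounded in a fractional seminorm\<close>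

text \<open>Young's inequality with weight \<open>\<delta> powr \<sigma>\<close>, the scale at which both terms are comparable.\<close>

lemma increment_le_kernel:
  fixes x y :: "'a::euclidean_space"
  assumes p: "p > 1" and \<sigma>: "\<sigma> > 0" and \<delta>: "\<delta> > 0" "norm (x - y) \<le> \<delta>"
  shows "\<bar>w x - w y\<bar> \<le> \<delta> powr \<sigma> + \<delta> powr (real DIM('a) + \<sigma>) * (\<bar>w x - w y\<bar> powr p / norm (x - y) powr (real DIM('a) + \<sigma> * p))"
proof (cases "x = y")
  case False
  then have n: "norm (x - y) > 0" by simp
  define t where "t = \<bar>w x - w y\<bar> / \<delta> powr \<sigma>"
  have "t \<le> 1 + t powr p"
  proof (cases "t \<le> 1")
    case False
    then have "t powr 1 \<le> t powr p" using p by (intro powr_mono) auto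
    then show ?thesis using False by simp
  qed (simp add: add_increasing2)
  then have "\<delta> powr \<sigma> * t \<le> \<delta> powr \<sigma> * (1 + t powr p)" by (intro mult_left_mono) auto
  moreover have "\<delta> powr \<sigma> * t = \<bar>w x - w y\<bar>" using \<delta> by (simp add: t_def)
  moreover have "t powr p = \<bar>w x - w y\<bar> powr p * \<delta> powr - (\<sigma> * p)"
    using \<delta> by (simp add: t_def powr_divide powr_powr powr_minus_divide)
  ultimately have "\<bar>w x - w y\<bar> \<le> \<delta> powr \<sigma> + \<bar>w x - w y\<bar> powr p * (\<delta> powr \<sigma> * \<delta> powr - (\<sigma> * p))"
    by (simp add: distrib_left mult_ac)
  also have "\<delta> powr \<sigma> * \<delta> powr - (\<sigma> * p) = \<delta> powr (real DIM('a) + \<sigma>) * \<delta> powr - (real DIM('a) + \<sigma> * p)"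
    by (simp add: powr_add [symmetric])
  also have "\<bar>w x - w y\<bar> powr p * (\<delta> powr (real DIM('a) + \<sigma>) * \<delta> powr - (real DIM('a) + \<sigma> * p))
     \<le> \<bar>w x - w y\<bar> powr p * (\<delta> powr (real DIM('a) + \<sigma>) * norm (x - y) powr - (real DIM('a) + \<sigma> * p))"
  proof -
    have "0 \<le> \<sigma> * p" using \<sigma> p by simp
    then have "- (real DIM('a) + \<sigma> * p) \<le> 0" using of_nat_0_le_iff [of "DIM('a)"] by linarith
    then show ?thesis using n \<delta> by (intro mult_left_mono powr_mono2') auto
  qed
  also have "\<dots> = \<delta> powr (real DIM('a) + \<sigma>) * (\<bar>w x - w y\<bar> powr p / norm (x - y) powr (real DIM('a) + \<sigma> * p))"
    by (simp only: powr_minus divide_inverse mult_ac)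
  finally show ?thesis by simp
qed simp

text \<open>For \<open>x\<close> in the ball around \<open>z\<close>, compare \<open>w x\<close> with the mean of \<open>w\<close> over that ball.\<close>

lemma L1_norm_ball_estimate:
  fixes w :: "'a::euclidean_space \<Rightarrow> real"
  assumes w: "integrable lborel w" and out: "\<And>x. x \<notin> ball 0 R \<Longrightarrow> w x = 0" and p: "p > 1" and \<sigma>: "\<sigma> > 0" and \<delta>: "\<delta> > 0"
    and Z: "finite Z" "ball 0 R \<subseteq> (\<Union>z\<in>Z. ball z \<delta>)" and R: "R \<ge> 0"
  defines "N \<equiv> DIM('a)" and "v \<equiv> unit_ball_vol (real DIM('a))"
  shows "ennreal (v * \<delta> ^ N) * (\<integral>\<^sup>+x. ennreal \<bar>w x\<bar> \<partial>lborel) \<le>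
    ennreal ((v * (2 * \<delta>) ^ N * (2 * \<delta>) powr \<sigma> + (\<Sum>z\<in>Z. \<bar>\<integral>x. w x * indicator (ball z \<delta>) x \<partial>lborel\<bar>)) * (v * R ^ N))
    + ennreal ((2 * \<delta>) powr (real N + \<sigma>)) * gagliardo p \<sigma> w"
proof -
  have [measurable]: "w \<in> borel_measurable borel" using w by auto
  have v: "v > 0" unfolding v_def by (rule unit_ball_vol_pos) simp
  have bm [measurable]: "ball z s \<in> sets borel" "cball z s \<in> sets borel" for z :: 'a and s by simp_all
  define K where "K x y = ennreal (\<bar>w x - w y\<bar> powr p / norm (x - y) powr (real N + \<sigma> * p))" for x y
  have K1 [measurable]: "K x \<in> borel_measurable borel" for x unfolding K_def [abs_def] by measurable
  have K2 [measurable]: "(\<lambda>x. \<integral>\<^sup>+y. K x y \<partial>lborel) \<in> borel_measurable borel" unfolding K_def by measurable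
  define S where "S = (\<Sum>z\<in>Z. \<bar>\<integral>x. w x * indicator (ball z \<delta>) x \<partial>lborel\<bar>)"
  have S: "S \<ge> 0" unfolding S_def by (intro sum_nonneg) auto
  define b where "b = v * (2 * \<delta>) ^ N * (2 * \<delta>) powr \<sigma> + S"
  have b: "b \<ge> 0" using v \<delta> S by (simp add: b_def)
  have pt: "ennreal (v * \<delta> ^ N) * ennreal \<bar>w x\<bar> \<le> ennreal b + ennreal ((2 * \<delta>) powr (real N + \<sigma>)) * (\<integral>\<^sup>+y. K x y \<partial>lborel)"
    if x: "x \<in> ball 0 R" for x
  proof -
    obtain z where z: "z \<in> Z" "x \<in> ball z \<delta>" using Z x by blast
    let ?Q = "ball z \<delta>"
    have V: "emeasure lborel ?Q = ennreal (v * \<delta> ^ N)" using emeasure_ball [of \<delta> z] \<delta> by (simp add: v_def N_def)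
    have i1: "integrable lborel (\<lambda>y. indicator ?Q y :: real)" using V by (intro integrable_real_indicator) (auto simp: less_top [symmetric])
    have iQ: "integrable lborel (\<lambda>y. w y * indicator ?Q y)"
      using integrable_mult_indicator [of ?Q lborel w] w by (simp add: mult.commute)
    have iw: "integrable lborel (\<lambda>y. (w x - w y) * indicator ?Q y)" using iQ i1 by (simp add: left_diff_distrib)
    have "(v * \<delta> ^ N) * w x = (\<integral>y. (w x - w y) * indicator ?Q y \<partial>lborel) + (\<integral>y. w y * indicator ?Q y \<partial>lborel)"
      using iQ i1 V v \<delta> by (simp add: left_diff_distrib measure_def)
    then have "\<bar>(v * \<delta> ^ N) * w x\<bar> \<le> \<bar>\<integral>y. (w x - w y) * indicator ?Q y \<partial>lborel\<bar> + \<bar>\<integral>y. w y * indicator ?Q y \<partial>lborel\<bar>"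
      by linarith
    also have "\<dots> \<le> (\<integral>y. \<bar>(w x - w y) * indicator ?Q y\<bar> \<partial>lborel) + S"
      unfolding S_def using z(1) Z(1) by (intro add_mono integral_abs_bound member_le_sum) auto
    finally have "ennreal (v * \<delta> ^ N) * ennreal \<bar>w x\<bar> \<le> ennreal ((\<integral>y. \<bar>(w x - w y) * indicator ?Q y\<bar> \<partial>lborel) + S)"
      using v \<delta> by (simp add: ennreal_mult [symmetric] abs_mult ennreal_leI)
    also have "\<dots> = (\<integral>\<^sup>+y. ennreal \<bar>(w x - w y) * indicator ?Q y\<bar> \<partial>lborel) + ennreal S"
      using integrable_abs [OF iw] S by (subst nn_integral_eq_integral) (auto intro!: ennreal_plus integral_nonneg_AE)
    also have "\<dots> \<le> (\<integral>\<^sup>+y. ennreal ((2 * \<delta>) powr \<sigma>) * indicator (cball x (2 * \<delta>)) y + ennreal ((2 * \<delta>) powr (real N + \<sigma>)) * K x y \<partial>lborel) + ennreal S"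
    proof (intro add_right_mono nn_integral_mono)
      fix y
      show "ennreal \<bar>(w x - w y) * indicator ?Q y\<bar> \<le> ennreal ((2 * \<delta>) powr \<sigma>) * indicator (cball x (2 * \<delta>)) y + ennreal ((2 * \<delta>) powr (real N + \<sigma>)) * K x y"
      proof (cases "y \<in> ?Q")
        case True
        have "dist x y \<le> 2 * \<delta>" using True z(2) dist_triangle [of x y z] by (simp add: dist_commute)
        then have "norm (x - y) \<le> 2 * \<delta>" "y \<in> cball x (2 * \<delta>)" by (auto simp: dist_norm)
        with increment_le_kernel [OF p \<sigma> _ this(1), of w] True \<delta>
        show ?thesis
          by (simp add: K_def N_def ennreal_mult' [symmetric] ennreal_plus [symmetric] ennreal_leI del: ennreal_plus)
      qed simp
    qed
    also have "\<dots> = ennreal ((2 * \<delta>) powr \<sigma>) * emeasure lborel (cball x (2 * \<delta>)) + ennreal ((2 * \<delta>) powr (real N + \<sigma>)) * (\<integral>\<^sup>+y. K x y \<partial>lborel) + ennreal S"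
      by (simp add: nn_integral_add nn_integral_cmult)
    also have "ennreal ((2 * \<delta>) powr \<sigma>) * emeasure lborel (cball x (2 * \<delta>)) = ennreal (v * (2 * \<delta>) ^ N * (2 * \<delta>) powr \<sigma>)"
      using emeasure_cball [of "2 * \<delta>" x] \<delta> v by (simp add: v_def N_def ennreal_mult [symmetric] mult.commute)
    also have "\<dots> + ennreal ((2 * \<delta>) powr (real N + \<sigma>)) * (\<integral>\<^sup>+y. K x y \<partial>lborel) + ennreal S = ennreal b + ennreal ((2 * \<delta>) powr (real N + \<sigma>)) * (\<integral>\<^sup>+y. K x y \<partial>lborel)"
      using S v \<delta> by (simp add: b_def add_ac)
    finally show ?thesis .
  qed
  have "ennreal (v * \<delta> ^ N) * (\<integral>\<^sup>+x. ennreal \<bar>w x\<bar> \<partial>lborel) = (\<integral>\<^sup>+x. ennreal (v * \<delta> ^ N) * ennreal \<bar>w x\<bar> \<partial>lborel)"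
    by (rule nn_integral_cmult [symmetric]) measurable
  also have "\<dots> \<le> (\<integral>\<^sup>+x. ennreal b * indicator (ball 0 R) x + ennreal ((2 * \<delta>) powr (real N + \<sigma>)) * (\<integral>\<^sup>+y. K x y \<partial>lborel) \<partial>lborel)"
  proof (rule nn_integral_mono)
    fix x
    show "ennreal (v * \<delta> ^ N) * ennreal \<bar>w x\<bar> \<le> ennreal b * indicator (ball 0 R) x + ennreal ((2 * \<delta>) powr (real N + \<sigma>)) * (\<integral>\<^sup>+y. K x y \<partial>lborel)"
      using pt [of x] out [of x] by (cases "x \<in> ball 0 R") auto
  qed
  also have "\<dots> = ennreal b * emeasure lborel (ball (0::'a) R) + ennreal ((2 * \<delta>) powr (real N + \<sigma>)) * (\<integral>\<^sup>+x. (\<integral>\<^sup>+y. K x y \<partial>lborel) \<partial>lborel)"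
    by (simp add: nn_integral_add nn_integral_cmult)
  finally show ?thesis using emeasure_ball [OF R, of "0::'a"] b v R
    by (simp add: ennreal_mult [symmetric] b_def S_def K_def gagliardo_def v_def N_def)
qed

lemma diagonal_convergent:
  fixes a :: "nat \<Rightarrow> nat \<Rightarrow> real"
  assumes bd: "\<And>k n. \<bar>a k n\<bar> \<le> B"
  shows "\<exists>r. strict_mono r \<and> (\<forall>k. convergent (\<lambda>n. a k (r n)))"
proof -
  interpret subseqs "\<lambda>k s. convergent (\<lambda>n. a k (s n))"
  proof
    fix k and s :: "nat \<Rightarrow> nat" assume "strict_mono s"
    have "bounded (range (\<lambda>n. a k (s n)))" using bd by (auto simp: bounded_iff)
    from bounded_imp_convergent_subsequence [OF this]
    obtain l r where "strict_mono r" "((\<lambda>n. a k (s n)) \<circ> r) \<longlonglongrightarrow> l" by auto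
    then show "\<exists>r'. strict_mono r' \<and> convergent (\<lambda>n. a k ((s \<circ> r') n))"
      by (auto simp: o_def convergent_def)
  qed
  have "convergent (\<lambda>n. a k (diagseq n))" for k
  proof -
    have "convergent (\<lambda>n. a k ((diagseq \<circ> (+) (Suc k)) n))"
    proof (rule diagseq_holds)
      fix r s :: "nat \<Rightarrow> nat" and n assume "strict_mono r" "convergent (\<lambda>i. a n (s i))"
      then show "convergent (\<lambda>i. a n ((s \<circ> r) i))"
        using convergent_subseq_convergent [of "\<lambda>i. a n (s i)" r] by (simp add: o_def)
    qed
    then have "convergent (\<lambda>n. a k (diagseq (n + Suc k)))" by (simp add: o_def add.commute)
    then show ?thesis using convergent_ignore_initial_segment [of "\<lambda>n. a k (diagseq n)" "Suc k"] by simp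
  qed
  then show ?thesis using subseq_diagseq by blast
qed

text \<open>The limit is the pointwise \<open>lim\<close>, not just some function equal to it almost
  everywhere: where all terms vanish it vanishes too, and this keeps supports exact.\<close>

lemma L1_cauchy_AE_limit:
  fixes s :: "nat \<Rightarrow> 'm \<Rightarrow> 'b::{banach, second_countable_topology}"
  assumes s: "\<And>n. integrable M (s n)"
    and c: "\<And>e. e > 0 \<Longrightarrow> \<exists>N. \<forall>i\<ge>N. \<forall>j\<ge>N. (\<integral>x. norm (s i x - s j x) \<partial>M) < e"
  shows "\<exists>r u. strict_mono r \<and> u \<in> borel_measurable M \<and> (AE x in M. (\<lambda>i. s (r i) x) \<longlonglongrightarrow> u x)
    \<and> (\<forall>x. u x = lim (\<lambda>i. s (r i) x))"
proof -
  obtain r where r: "strict_mono r" "AE x in M. Cauchy (\<lambda>i. s (r i) x)"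
    using cauchy_L1_AE_cauchy_subseq [OF s c] by metis
  have "(\<lambda>x. lim (\<lambda>i. s (r i) x)) \<in> borel_measurable M"
    using s by (intro borel_measurable_lim_metric) auto
  moreover have "AE x in M. (\<lambda>i. s (r i) x) \<longlonglongrightarrow> lim (\<lambda>i. s (r i) x)"
    using r(2) by eventually_elim (auto simp: Cauchy_convergent_iff convergent_LIMSEQ_iff)
  ultimately show ?thesis using r(1) by blast
qed

lemma incr_diff_le:
  fixes u v :: "'a::euclidean_space \<Rightarrow> real"
  assumes [measurable]: "u \<in> borel_measurable borel" "v \<in> borel_measurable borel" and p: "p > 1"
  shows "gagliardo p \<sigma> (\<lambda>x. u x - v x) \<le> ennreal (2 powr p) * (gagliardo p \<sigma> u + gagliardo p \<sigma> v)"
proof -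
  have inc: "incr p (\<lambda>x. u x - v x) h \<le> ennreal (2 powr p) * (incr p u h + incr p v h)" for h
  proof -
    have "incr p (\<lambda>x. u x - v x) h \<le> (\<integral>\<^sup>+x. ennreal (2 powr p) * (ennreal (\<bar>u (x + h) - u x\<bar> powr p) + ennreal (\<bar>v (x + h) - v x\<bar> powr p)) \<partial>lborel)"
      unfolding incr_def
    proof (rule nn_integral_mono)
      fix x
      have "\<bar>u (x + h) - v (x + h) - (u x - v x)\<bar> powr p \<le> 2 powr p * (\<bar>u (x + h) - u x\<bar> powr p + \<bar>v (x + h) - v x\<bar> powr p)"
        using norm_powr_diff_le [of p "u (x + h) - u x" "v (x + h) - v x"] p by (simp add: algebra_simps)
      then show "ennreal (\<bar>u (x + h) - v (x + h) - (u x - v x)\<bar> powr p) \<le> ennreal (2 powr p) * (ennreal (\<bar>u (x + h) - u x\<bar> powr p) + ennreal (\<bar>v (x + h) - v x\<bar> powr p))"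
        by (simp add: ennreal_plus [symmetric] ennreal_mult [symmetric] ennreal_leI del: ennreal_plus)
    qed
    also have "\<dots> = ennreal (2 powr p) * (incr p u h + incr p v h)"
      by (subst nn_integral_cmult, measurable, subst nn_integral_add, measurable) (simp add: incr_def)
    finally show ?thesis .
  qed
  let ?k = "\<lambda>h::'a. riesz (\<sigma> * p) h"
  have "gagliardo p \<sigma> (\<lambda>x. u x - v x) \<le> (\<integral>\<^sup>+h. ennreal (2 powr p) * (incr p u h * ?k h + incr p v h * ?k h) \<partial>lborel)"
    unfolding gagliardo_incr [OF borel_measurable_diff [OF assms(1,2)]]
    using inc by (intro nn_integral_mono) (auto simp: distrib_right [symmetric] mult.assoc [symmetric] intro!: mult_right_mono)
  also have "\<dots> = ennreal (2 powr p) * (gagliardo p \<sigma> u + gagliardo p \<sigma> v)"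
    by (subst nn_integral_cmult, measurable, subst nn_integral_add, measurable) (simp add: gagliardo_incr)
  finally show ?thesis .
qed

text \<open>At every scale finitely many balls cover the support. Along a diagonal subsequence all
  of these countably many ball integrals converge, while the fractional energy controls the
  oscillation inside a ball; so the subsequence is Cauchy in mean.\<close>

lemma L1_compactness:
  fixes w :: "nat \<Rightarrow> 'a::euclidean_space \<Rightarrow> real"
  assumes w: "\<And>n. integrable lborel (w n)" and out: "\<And>n x. x \<notin> ball 0 R \<Longrightarrow> w n x = 0" and p: "p > 1" and \<sigma>: "\<sigma> > 0"
    and G: "\<And>n. gagliardo p \<sigma> (w n) \<le> ennreal B" and L1: "\<And>n. (\<integral>x. \<bar>w n x\<bar> \<partial>lborel) \<le> B" and B: "B \<ge> 0"
  shows "\<exists>r u. strict_mono r \<and> u \<in> borel_measurable borel \<and> (AE x in lborel. (\<lambda>i. w (r i) x) \<longlonglongrightarrow> u x)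
    \<and> (\<forall>x. u x = lim (\<lambda>i. w (r i) x))"
proof -
  let ?N = "DIM('a)"
  have [measurable]: "w n \<in> borel_measurable borel" for n using w [of n] by auto
  have bm [measurable]: "ball z s \<in> sets borel" for z :: 'a and s by simp
  define R' where "R' = max R 0"
  have out': "w n x = 0" if "x \<notin> ball 0 R'" for n x using out that by (auto simp: R'_def)
  define v where "v = unit_ball_vol (real ?N)"
  have v: "v > 0" unfolding v_def by (rule unit_ball_vol_pos) simp
  define \<delta> where "\<delta> m = 1 / real (Suc m)" for m
  have \<delta>: "\<delta> m > 0" for m by (simp add: \<delta>_def)
  have "\<forall>m. \<exists>Z. finite Z \<and> ball (0::'a) R' \<subseteq> (\<Union>z\<in>Z. ball z (\<delta> m))"
    using \<delta> compact_cball [of "0::'a" R'] ball_subset_cball unfolding compact_eq_totally_bounded by (meson subset_trans)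
  then obtain Z where Z: "\<And>m. finite (Z m)" "\<And>m. ball (0::'a) R' \<subseteq> (\<Union>z\<in>Z m. ball z (\<delta> m))" by metis
  define P where "P = (\<Union>m. (\<lambda>z. (m, z)) ` Z m)"
  have P: "countable P" unfolding P_def using Z(1) by (intro countable_UN countable_image) (auto intro: countable_finite)
  define c where "c mz n = (\<integral>x. w n x * indicator (ball (snd mz) (\<delta> (fst mz))) x \<partial>lborel)" for mz n
  have iQ: "integrable lborel (\<lambda>x. w n x * indicator (ball z s) x)" for n z s
    using integrable_mult_indicator [of "ball z s" lborel "w n"] w by (simp add: mult.commute)
  have "\<bar>c mz n\<bar> \<le> B" for mz n
  proof -
    have "\<bar>c mz n\<bar> \<le> (\<integral>x. \<bar>w n x * indicator (ball (snd mz) (\<delta> (fst mz))) x\<bar> \<partial>lborel)"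
      unfolding c_def by (rule integral_abs_bound)
    also have "\<dots> \<le> (\<integral>x. \<bar>w n x\<bar> \<partial>lborel)"
      using iQ w by (intro integral_mono) (auto simp: indicator_def)
    finally show ?thesis using L1 [of n] by simp
  qed
  from diagonal_convergent [of "\<lambda>k n. c (from_nat_into P k) n", OF this]
  obtain r where r: "strict_mono r" "\<And>k. convergent (\<lambda>n. c (from_nat_into P k) (r n))" by blast
  have conv: "Cauchy (\<lambda>n. c mz (r n))" if "mz \<in> P" for mz
    using r(2) [of "to_nat_on P mz"] P that by (simp add: Cauchy_convergent_iff)
  define A where "A = 2 ^ ?N * (v * R' ^ ?N + 2 powr p * (2 * B) / v)"
  define S where "S m i j = (\<Sum>z\<in>Z m. \<bar>c (m, z) i - c (m, z) j\<bar>)" for m i j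
  have S0: "S m i j \<ge> 0" for m i j unfolding S_def by (intro sum_nonneg) auto
  have est: "(\<integral>x. norm (w i x - w j x) \<partial>lborel) \<le> (2 * \<delta> m) powr \<sigma> * A + S m i j * (R' ^ ?N / \<delta> m ^ ?N)" for i j m
  proof -
    define I where "I = (\<integral>x. norm (w i x - w j x) \<partial>lborel)"
    have I: "ennreal I = (\<integral>\<^sup>+x. ennreal \<bar>w i x - w j x\<bar> \<partial>lborel)" "I \<ge> 0"
      unfolding I_def using w by (subst nn_integral_eq_integral) auto
    have "gagliardo p \<sigma> (\<lambda>x. w i x - w j x) \<le> ennreal (2 powr p) * (gagliardo p \<sigma> (w i) + gagliardo p \<sigma> (w j))"
      by (rule incr_diff_le [OF _ _ p]) auto
    also have "\<dots> \<le> ennreal (2 powr p) * (ennreal B + ennreal B)" by (intro mult_left_mono add_mono G) auto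
    also have "\<dots> = ennreal (2 powr p * (2 * B))" using B by (simp add: ennreal_plus [symmetric] ennreal_mult [symmetric] del: ennreal_plus)
    finally have Gd: "gagliardo p \<sigma> (\<lambda>x. w i x - w j x) \<le> ennreal (2 powr p * (2 * B))" .
    have Seq: "(\<Sum>z\<in>Z m. \<bar>\<integral>x. (w i x - w j x) * indicator (ball z (\<delta> m)) x \<partial>lborel\<bar>) = S m i j"
      using iQ by (simp add: S_def c_def left_diff_distrib)
    have "ennreal (v * \<delta> m ^ ?N) * ennreal I \<le> ennreal ((v * (2 * \<delta> m) ^ ?N * (2 * \<delta> m) powr \<sigma> + S m i j) * (v * R' ^ ?N))
      + ennreal ((2 * \<delta> m) powr (real ?N + \<sigma>)) * gagliardo p \<sigma> (\<lambda>x. w i x - w j x)"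
      unfolding I(1) v_def Seq [symmetric] using w out'
      by (intro L1_norm_ball_estimate [OF _ _ p \<sigma> \<delta> Z]) (auto simp: R'_def)
    also have "\<dots> \<le> ennreal ((v * (2 * \<delta> m) ^ ?N * (2 * \<delta> m) powr \<sigma> + S m i j) * (v * R' ^ ?N))
      + ennreal ((2 * \<delta> m) powr (real ?N + \<sigma>)) * ennreal (2 powr p * (2 * B))"
      using Gd by (intro add_left_mono mult_left_mono) auto
    finally have "(v * \<delta> m ^ ?N) * I \<le> (v * (2 * \<delta> m) ^ ?N * (2 * \<delta> m) powr \<sigma> + S m i j) * (v * R' ^ ?N)
      + (2 * \<delta> m) powr (real ?N + \<sigma>) * (2 powr p * (2 * B))"
      using v \<delta> [of m] B S0 [of m i j] I(2)
      by (simp add: R'_def ennreal_mult [symmetric] ennreal_plus [symmetric] ennreal_le_iff del: ennreal_plus)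
    also have "(2 * \<delta> m) powr (real ?N + \<sigma>) = 2 ^ ?N * \<delta> m ^ ?N * (2 * \<delta> m) powr \<sigma>"
      using \<delta> [of m] by (simp add: powr_add powr_realpow power_mult_distrib)
    also have "(v * (2 * \<delta> m) ^ ?N * (2 * \<delta> m) powr \<sigma> + S m i j) * (v * R' ^ ?N) + 2 ^ ?N * \<delta> m ^ ?N * (2 * \<delta> m) powr \<sigma> * (2 powr p * (2 * B))
      = (v * \<delta> m ^ ?N) * ((2 * \<delta> m) powr \<sigma> * A + S m i j * (R' ^ ?N / \<delta> m ^ ?N))"
      using v \<delta> [of m] by (simp add: A_def power_mult_distrib field_simps)
    finally show ?thesis using v \<delta> [of m] by (simp add: I_def)
  qed
  have cauchy: "\<exists>N. \<forall>i\<ge>N. \<forall>j\<ge>N. (\<integral>x. norm (w (r i) x - w (r j) x) \<partial>lborel) < e" if e: "e > 0" for e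
  proof -
    have "(\<lambda>m. (2 * \<delta> m) powr \<sigma> * A) \<longlonglongrightarrow> 0 * A"
    proof (intro tendsto_mult tendsto_const tendsto_zero_powrI [OF _ tendsto_const _ \<sigma>])
      show "(\<lambda>m. 2 * \<delta> m) \<longlonglongrightarrow> 0"
        using tendsto_mult_right_zero [OF LIMSEQ_Suc [OF lim_1_over_n], of 2] by (simp add: \<delta>_def)
    qed (simp add: \<delta>_def)
    then obtain m where m: "(2 * \<delta> m) powr \<sigma> * A < e / 2"
      using order_tendstoD(2) [of _ _ _ "e / 2"] e by (fastforce simp: eventually_sequentially)
    \<comment> \<open>The added 1 keeps \<open>k\<close> positive when the cover is empty or
      \<open>R' = 0\<close>.\<close>
    define k where "k = real (card (Z m)) * (R' ^ ?N / \<delta> m ^ ?N) + 1"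
    have k: "k > 0" using \<delta> [of m] by (auto simp: k_def R'_def intro!: add_nonneg_pos)
    define \<eta> where "\<eta> = e / (2 * k)"
    have \<eta>: "\<eta> > 0" using e k by (simp add: \<eta>_def)
    have "\<forall>z\<in>Z m. \<exists>N. \<forall>i\<ge>N. \<forall>j\<ge>N. \<bar>c (m, z) (r i) - c (m, z) (r j)\<bar> < \<eta>"
    proof
      fix z assume "z \<in> Z m"
      then have "(m, z) \<in> P" by (auto simp: P_def)
      from CauchyD [OF conv [OF this] \<eta>] show "\<exists>N. \<forall>i\<ge>N. \<forall>j\<ge>N. \<bar>c (m, z) (r i) - c (m, z) (r j)\<bar> < \<eta>" by auto
    qed
    then obtain N where N: "\<And>z i j. z \<in> Z m \<Longrightarrow> i \<ge> N z \<Longrightarrow> j \<ge> N z \<Longrightarrow> \<bar>c (m, z) (r i) - c (m, z) (r j)\<bar> < \<eta>"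
      by metis
    show ?thesis
    proof (intro exI allI impI)
      fix i j assume ij: "i \<ge> (\<Sum>z\<in>Z m. N z)" "j \<ge> (\<Sum>z\<in>Z m. N z)"
      have Nle: "N z \<le> (\<Sum>z\<in>Z m. N z)" if "z \<in> Z m" for z using that Z(1) by (intro member_le_sum) auto
      have "S m (r i) (r j) \<le> (\<Sum>z\<in>Z m. \<eta>)"
        unfolding S_def using N ij Nle by (intro sum_mono less_imp_le) (meson order_trans)
      then have "S m (r i) (r j) * (R' ^ ?N / \<delta> m ^ ?N) \<le> (real (card (Z m)) * \<eta>) * (R' ^ ?N / \<delta> m ^ ?N)"
        using \<delta> [of m] by (intro mult_right_mono) (auto simp: R'_def)
      also have "\<dots> = \<eta> * (k - 1)" by (simp add: k_def)
      also have "\<dots> \<le> \<eta> * k" using \<eta> by (intro mult_left_mono) auto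
      also have "\<dots> = e / 2" using k by (simp add: \<eta>_def)
      finally show "(\<integral>x. norm (w (r i) x - w (r j) x) \<partial>lborel) < e"
        using est [of "r i" "r j" m] m by linarith
    qed
  qed
  obtain r' u where "strict_mono r'" "u \<in> borel_measurable lborel" "AE x in lborel. (\<lambda>i. w (r (r' i)) x) \<longlonglongrightarrow> u x"
    "\<forall>x. u x = lim (\<lambda>i. w (r (r' i)) x)"
    using L1_cauchy_AE_limit [of lborel "\<lambda>n. w (r n)", OF w cauchy] by blast
  then show ?thesis
    using strict_mono_o [OF r(1)] by (intro exI [of _ "r \<circ> r'"] exI [of _ u]) auto
qed

section \<open>The energy as an $L^p$ norm\<close>

text \<open>A fixed direction along which scalar differences are embedded, so that they share a
  vector type with gradients.\<close>

definition unit_vec :: "'a::euclidean_space" where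
  "unit_vec = (SOME b. b \<in> Basis)"

lemma norm_unit_vec [simp]: "norm (unit_vec :: 'a::euclidean_space) = 1"
  unfolding unit_vec_def by (rule norm_Basis) (simp add: some_in_eq)

text \<open>The default 0 makes the choice Borel measurable for every \<open>u\<close>. It carries
  no information when there is no gradient; \<open>regular_for\<close> rules this out wherever the
  value counts.\<close>

definition grad_of :: "('a::euclidean_space \<Rightarrow> real) \<Rightarrow> 'a \<Rightarrow> 'a" where
  "grad_of u = (if \<exists>g. wgrad u g then SOME g. wgrad u g else (\<lambda>x. 0))"

lemma wgrad_grad_of: "wgrad u g \<Longrightarrow> wgrad u (grad_of u)"
  unfolding grad_of_def by (auto intro: someI_ex [of "wgrad u"])

lemma borel_measurable_grad_of [measurable]: "grad_of u \<in> borel_measurable borel"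
proof (cases "\<exists>g. wgrad u g")
  case True
  then show ?thesis using wgrad_grad_of wgradD(4) by blast
qed (simp add: grad_of_def)

text \<open>The total energy is realised as the \<open>p\<close>-th power of the norm of \<open>dmap u\<close> in one space \<open>L\<^sup>p\<close>.  A point
  \<open>(s, x, y)\<close> carries the difference \<open>u x - u y\<close> for \<open>0 < s < 1\<close>, and \<open>u x\<close> or the gradient at \<open>x\<close> for
  \<open>s = 0\<close> and \<open>s = 1\<close>, where \<open>y\<close> is a dummy variable in the unit cube.\<close>

definition dmap :: "('a::euclidean_space \<Rightarrow> real) \<Rightarrow> real \<times> 'a \<times> 'a \<Rightarrow> 'a" where
  "dmap u = (\<lambda>(s, x, y). if s = 0 then u x *\<^sub>R unit_vec else if s = 1 then grad_of u x else (u x - u y) *\<^sub>R unit_vec)"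

definition energy_weight :: "real \<Rightarrow> real \<times> 'a::euclidean_space \<times> 'a \<Rightarrow> real" where
  "energy_weight p = (\<lambda>(s, x, y). if s = 0 \<or> s = 1 then indicator (cbox 0 One) y
     else frac_const (real DIM('a)) s p * norm (x - y) powr - (real DIM('a) + s * p))"

definition energy_measure :: "real measure \<Rightarrow> real \<Rightarrow> (real \<times> 'a::euclidean_space \<times> 'a) measure" where
  "energy_measure \<mu> p = density (\<mu> \<Otimes>\<^sub>M lborel) (\<lambda>z. ennreal (energy_weight p z))"

text \<open>Without an atom at 1 the slice \<open>s = 1\<close> is a null set and the default value
  of \<open>grad_of\<close> does no harm.\<close>

definition regular_for :: "real measure \<Rightarrow> ('a::euclidean_space \<Rightarrow> real) \<Rightarrow> bool" where
  "regular_for \<mu> u \<longleftrightarrow> emeasure \<mu> {1} = 0 \<or> (\<exists>g. wgrad u g)"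

definition energy :: "real measure \<Rightarrow> real \<Rightarrow> ('a::euclidean_space \<Rightarrow> real) \<Rightarrow> real" where
  "energy \<mu> p u = (\<integral>z. norm (dmap u z) powr p \<partial>energy_measure \<mu> p)"

abbreviation "total_energy \<mu> p u \<equiv> \<integral>\<^sup>+s. seminorm_pow p s u \<partial>\<mu>"

text \<open>The Borel counterpart of \<open>Xp\<close>, with zero values at every point outside
  \<open>\<Omega>\<close>. By \<open>Xp_representative\<close> every member of \<open>Xp\<close>
  agrees almost everywhere with a member of it.\<close>

definition Xb :: "real measure \<Rightarrow> 'a::euclidean_space set \<Rightarrow> real \<Rightarrow> ('a \<Rightarrow> real) set" where
  "Xb \<mu> \<Omega> p = {u. u \<in> borel_measurable borel \<and> (\<forall>x. x \<notin> \<Omega> \<longrightarrow> u x = 0) \<and> total_energy \<mu> p u < \<infinity>}"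

lemma nn_integral_unit_cube:
  assumes [measurable]: "F \<in> borel_measurable borel"
  shows "(\<integral>\<^sup>+z. ennreal (indicator (cbox 0 One) (snd z)) * F (fst z) \<partial>(lborel :: ('a::euclidean_space \<times> 'a) measure))
    = (\<integral>\<^sup>+x. F x \<partial>lborel)"
proof -
  have cube: "emeasure lborel (cbox (0::'a) One) = 1" by (subst emeasure_lborel_cbox) (auto simp: inner_Basis)
  have [measurable]: "cbox (0::'a) One \<in> sets borel" by simp
  show ?thesis
    by (subst lborel_prod [symmetric], subst lborel.nn_integral_fst [symmetric])
      (auto simp: nn_integral_multc ennreal_indicator cube)
qed

section \<open>Measurability and slices of the energy measure\<close>

locale unit_measure =
  fixes \<mu> :: "real measure"
  assumes fb: "finite_borel_on_unit \<mu>"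
begin

lemma sets_mu: "sets \<mu> = sets (restrict_space borel {0..1})"
  using fb by (simp add: finite_borel_on_unit_def)

lemma space_mu: "space \<mu> = {0..1}"
  using sets_eq_imp_space_eq [OF sets_mu] by (simp add: space_restrict_space)

sublocale finite_measure \<mu>
  using fb by (simp add: finite_borel_on_unit_def)

sublocale pair_sigma_finite \<mu> "lborel :: ('a::euclidean_space \<times> 'a) measure" ..

lemma singleton_sets: "s \<in> {0..1} \<Longrightarrow> {s} \<in> sets \<mu>"
  unfolding sets_mu by (subst sets_restrict_space_iff) auto

lemma ident_measurable: "(\<lambda>s. s) \<in> borel_measurable \<mu>"
  by (subst measurable_cong_sets [OF sets_mu refl]) (rule measurable_restrict_space1, simp)

lemma frac_const_measurable:
  assumes "p > 1"
  shows "(\<lambda>s. frac_const (real DIM('a::euclidean_space)) s p) \<in> borel_measurable \<mu>"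
proof (subst measurable_cong_sets [OF sets_mu refl], rule borel_measurable_continuous_on_restrict)
  have "real DIM('a) \<ge> 1" by (simp add: Suc_leI)
  then show "continuous_on {0..1} (\<lambda>s. frac_const (real DIM('a)) s p)"
    unfolding frac_const_eq
    by (intro continuous_on_mult [OF _ continuous_on_frac_const_quotient [OF assms]]) (intro continuous_intros)
qed

lemma coordinates_measurable:
  "fst \<in> borel_measurable (\<mu> \<Otimes>\<^sub>M (lborel :: ('a::euclidean_space \<times> 'a) measure))" (is ?A)
  "(\<lambda>z. fst (snd z)) \<in> borel_measurable (\<mu> \<Otimes>\<^sub>M (lborel :: ('a \<times> 'a) measure))" (is ?B)
  "(\<lambda>z. snd (snd z)) \<in> borel_measurable (\<mu> \<Otimes>\<^sub>M (lborel :: ('a \<times> 'a) measure))" (is ?C)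
proof -
  show ?A
    using measurable_compose [OF measurable_fst [where ?M1.0 = \<mu>] ident_measurable] .
  have "fst \<in> borel_measurable (borel :: ('a \<times> 'a) measure)" "snd \<in> borel_measurable (borel :: ('a \<times> 'a) measure)"
    by (auto intro!: borel_measurable_continuous_onI continuous_intros)
  then have *: "fst \<in> borel_measurable (lborel :: ('a \<times> 'a) measure)" "snd \<in> borel_measurable (lborel :: ('a \<times> 'a) measure)"
    by simp_all
  show ?B ?C
    by (rule measurable_compose [OF measurable_snd *(1)], rule measurable_compose [OF measurable_snd *(2)])
qed

lemma exponent_sets: "{z \<in> space (\<mu> \<Otimes>\<^sub>M (lborel :: ('a::euclidean_space \<times> 'a) measure)). fst z = c} \<in> sets (\<mu> \<Otimes>\<^sub>M lborel)"
proof -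
  have "{z \<in> space (\<mu> \<Otimes>\<^sub>M (lborel :: ('a \<times> 'a) measure)). fst z = c} = fst -` {c} \<inter> space (\<mu> \<Otimes>\<^sub>M lborel)" by auto
  also have "\<dots> \<in> sets (\<mu> \<Otimes>\<^sub>M lborel)" by (rule measurable_sets [OF coordinates_measurable(1)]) simp
  finally show ?thesis .
qed

lemma dmap_measurable:
  assumes u: "u \<in> borel_measurable borel"
  shows "dmap u \<in> borel_measurable (\<mu> \<Otimes>\<^sub>M lborel)"
proof -
  have "dmap u = (\<lambda>z. if fst z = 0 then u (fst (snd z)) *\<^sub>R unit_vec else if fst z = 1 then grad_of u (fst (snd z))
      else (u (fst (snd z)) - u (snd (snd z))) *\<^sub>R unit_vec)"
    by (auto simp: dmap_def)
  also have "\<dots> \<in> borel_measurable (\<mu> \<Otimes>\<^sub>M lborel)"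
    by (intro measurable_If borel_measurable_scaleR borel_measurable_diff measurable_const exponent_sets
        measurable_compose [OF coordinates_measurable(2) u] measurable_compose [OF coordinates_measurable(3) u]
        measurable_compose [OF coordinates_measurable(2) borel_measurable_grad_of]) auto
  finally show ?thesis .
qed

lemma energy_weight_measurable:
  assumes p: "p > 1"
  shows "(energy_weight p :: real \<times> 'a::euclidean_space \<times> 'a \<Rightarrow> real) \<in> borel_measurable (\<mu> \<Otimes>\<^sub>M lborel)"
proof -
  have "(energy_weight p :: real \<times> 'a \<times> 'a \<Rightarrow> real) = (\<lambda>z. if fst z = 0 then indicator (cbox 0 One) (snd (snd z))
     else if fst z = 1 then indicator (cbox 0 One) (snd (snd z))
     else frac_const (real DIM('a)) (fst z) p * norm (fst (snd z) - snd (snd z)) powr - (real DIM('a) + fst z * p))"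
    by (auto simp: energy_weight_def)
  also have "\<dots> \<in> borel_measurable (\<mu> \<Otimes>\<^sub>M lborel)"
    by (intro measurable_If borel_measurable_times powr_real_measurable
        measurable_compose [OF borel_measurable_diff [OF coordinates_measurable(2,3)] borel_measurable_norm]
        borel_measurable_uminus borel_measurable_add measurable_const exponent_sets coordinates_measurable
        measurable_compose [OF measurable_fst frac_const_measurable [OF p]]
        measurable_compose [OF coordinates_measurable(3) borel_measurable_indicator]) auto
  finally show ?thesis .
qed

lemma sets_energy_measure [measurable_cong]: "sets (energy_measure \<mu> p) = sets (\<mu> \<Otimes>\<^sub>M lborel)"
  by (simp add: energy_measure_def)

lemma dmap_measurable':
  assumes "u \<in> borel_measurable borel"
  shows "dmap u \<in> borel_measurable (energy_measure \<mu> p)"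
  using dmap_measurable [OF assms] by (simp add: energy_measure_def)

lemma AE_energy_measureI:
  assumes p: "p > 1" and P: "AE z in \<mu> \<Otimes>\<^sub>M lborel. P z" shows "AE z in energy_measure \<mu> p. P z"
  unfolding energy_measure_def using P measurable_compose [OF energy_weight_measurable [OF p] measurable_ennreal]
  by (subst AE_density) (auto elim: eventually_mono)

lemma AE_energy_points:
  fixes Q :: "'a::euclidean_space \<Rightarrow> bool"
  assumes p: "p > 1" and Q: "AE x in lborel. Q x"
  shows "AE z in energy_measure \<mu> p. Q (fst (snd z)) \<and> Q (snd (snd z))"
proof (rule AE_energy_measureI [OF p])
  obtain N where N: "N \<in> null_sets lborel" "{x. \<not> Q x} \<subseteq> N"
    using Q by (auto simp: eventually_ae_filter)
  then have [measurable]: "N \<in> sets borel" by auto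
  have n: "AE x in lborel. x \<notin> N" using AE_not_in [OF N(1)] .
  have "AE z in \<mu> \<Otimes>\<^sub>M (lborel :: ('a \<times> 'a) measure). fst (snd z) \<notin> N \<and> snd (snd z) \<notin> N"
  proof (rule AE_pair_measure)
    show "{z \<in> space (\<mu> \<Otimes>\<^sub>M (lborel :: ('a \<times> 'a) measure)). fst (snd z) \<notin> N \<and> snd (snd z) \<notin> N} \<in> sets (\<mu> \<Otimes>\<^sub>M lborel)"
    proof -
      have "{z \<in> space (\<mu> \<Otimes>\<^sub>M (lborel :: ('a \<times> 'a) measure)). fst (snd z) \<notin> N \<and> snd (snd z) \<notin> N}
        = ((\<lambda>z. fst (snd z)) -` (- N) \<inter> space (\<mu> \<Otimes>\<^sub>M lborel)) \<inter> ((\<lambda>z. snd (snd z)) -` (- N) \<inter> space (\<mu> \<Otimes>\<^sub>M lborel))"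
        by auto
      also have "\<dots> \<in> sets (\<mu> \<Otimes>\<^sub>M lborel)"
        by (intro sets.Int measurable_sets [OF coordinates_measurable(2)] measurable_sets [OF coordinates_measurable(3)]) auto
      finally show ?thesis .
    qed
    have "AE z in (lborel :: ('a \<times> 'a) measure). fst z \<notin> N \<and> snd z \<notin> N"
      using AE_lborel_fst_snd [OF n] by eventually_elim simp
    then show "AE s in \<mu>. AE z in lborel. fst (snd (s, z)) \<notin> N \<and> snd (snd (s, z)) \<notin> N"
      by simp
  qed
  then show "AE z in \<mu> \<Otimes>\<^sub>M lborel. Q (fst (snd z)) \<and> Q (snd (snd z))"
    by eventually_elim (use N in auto)
qed

lemma AE_not_1: "emeasure \<mu> {1} = 0 \<Longrightarrow> AE s in \<mu>. s \<noteq> 1"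
  using AE_not_in [of "{1}" \<mu>] singleton_sets [of 1] by (auto simp: null_sets_def)

lemma AE_energy_not_1:
  assumes p: "p > 1" and z: "emeasure \<mu> {1} = 0"
  shows "AE z in (energy_measure \<mu> p :: (real \<times> 'a::euclidean_space \<times> 'a) measure). fst z \<noteq> 1"
proof (rule AE_energy_measureI [OF p], rule AE_pair_measure)
  have "{z \<in> space (\<mu> \<Otimes>\<^sub>M (lborel :: ('a \<times> 'a) measure)). fst z \<noteq> 1}
    = space (\<mu> \<Otimes>\<^sub>M lborel) - {z \<in> space (\<mu> \<Otimes>\<^sub>M (lborel :: ('a \<times> 'a) measure)). fst z = 1}" by auto
  then show "{z \<in> space (\<mu> \<Otimes>\<^sub>M (lborel :: ('a \<times> 'a) measure)). fst z \<noteq> 1} \<in> sets (\<mu> \<Otimes>\<^sub>M lborel)"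
    using exponent_sets [where c = 1 and 'a = 'a] by (simp only: sets.Diff sets.top)
qed (use AE_not_1 [OF z] in \<open>auto elim: eventually_mono\<close>)

lemma seminorm_1_finite:
  assumes "total_energy \<mu> p u < \<infinity>" "emeasure \<mu> {1} \<noteq> 0"
  shows "seminorm_pow p 1 u < \<infinity>"
proof (rule ccontr)
  assume "\<not> ?thesis"
  then have "seminorm_pow p 1 u = \<infinity>" by (simp add: less_top [symmetric])
  then have "(\<integral>\<^sup>+s. \<infinity> * indicator {1} s \<partial>\<mu>) \<le> total_energy \<mu> p u"
    by (intro nn_integral_mono) (auto simp: indicator_def)
  moreover have "(\<integral>\<^sup>+s. \<infinity> * indicator {1} s \<partial>\<mu>) = \<infinity> * emeasure \<mu> {1}"
    using singleton_sets [of 1] by (subst nn_integral_cmult_indicator) auto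
  ultimately show False using assms by (simp add: ennreal_top_mult)
qed

lemma regular_for_finite:
  assumes "u \<in> borel_measurable borel" "\<And>x. x \<notin> ball 0 R \<Longrightarrow> u x = 0" "total_energy \<mu> p u < \<infinity>"
  shows "regular_for \<mu> u"
  unfolding regular_for_def using seminorm_1_finite [OF assms(3)] seminorm_pow_1(2) [OF assms(1,2)] by blast

text \<open>Tonelli's theorem in \<open>s\<close>: the weight reproduces the kernel on each slice,
  and at the endpoints the unit cube integrates the dummy variable to 1. Regularity enters at
  \<open>s = 1\<close>, where the default gradient would give 0 in place of infinity.\<close>

lemma nn_integral_energy:
  fixes u :: "'a::euclidean_space \<Rightarrow> real"
  assumes u [measurable]: "u \<in> borel_measurable borel" and out: "\<And>x. x \<notin> ball 0 R \<Longrightarrow> u x = 0"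
    and p: "p > 1" and reg: "regular_for \<mu> u"
  shows "(\<integral>\<^sup>+z. ennreal (norm (dmap u z) powr p) \<partial>energy_measure \<mu> p) = total_energy \<mu> p u"
proof -
  note [measurable] = energy_weight_measurable [OF p, where 'a = 'a] dmap_measurable [OF u]
  have N1: "real DIM('a) \<ge> 1" by (simp add: Suc_leI)
  obtain c1 c2 where c: "c1 > 0" "\<And>s. 0 \<le> s \<Longrightarrow> s \<le> 1 \<Longrightarrow> c1 * (s * (1 - s)) \<le> frac_const (real DIM('a)) s p"
    using frac_const_bounds [OF p N1] by metis
  have "(\<integral>\<^sup>+z. ennreal (norm (dmap u z) powr p) \<partial>energy_measure \<mu> p)
    = (\<integral>\<^sup>+z. ennreal (energy_weight p z) * ennreal (norm (dmap u z) powr p) \<partial>(\<mu> \<Otimes>\<^sub>M lborel))"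
    unfolding energy_measure_def by (rule nn_integral_density) measurable
  also have "\<dots> = (\<integral>\<^sup>+s. (\<integral>\<^sup>+z. ennreal (energy_weight p (s, z)) * ennreal (norm (dmap u (s, z)) powr p) \<partial>lborel) \<partial>\<mu>)"
    by (rule lborel.nn_integral_fst [symmetric]) measurable
  also have "\<dots> = total_energy \<mu> p u"
  proof (rule nn_integral_cong_AE)
    have "AE s in \<mu>. s = 1 \<longrightarrow> (\<exists>g. wgrad u g)"
    proof (cases "emeasure \<mu> {1} = 0")
      case True
      show ?thesis using AE_not_1 [OF True] by eventually_elim simp
    next
      case False
      then show ?thesis using reg by (simp add: regular_for_def)
    qed
    moreover have "AE s in \<mu>. s \<in> {0..1}" using space_mu by (intro AE_I2) auto
    ultimately show "AE s in \<mu>. (\<integral>\<^sup>+z. ennreal (energy_weight p (s, z)) * ennreal (norm (dmap u (s, z)) powr p) \<partial>lborel) = seminorm_pow p s u"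
    proof eventually_elim
      case (elim s)
      consider "s = 0" | "s = 1" | "0 < s" "s < 1" using elim(2) by force
      then show ?case
      proof cases
        case 1
        have "(\<integral>\<^sup>+z. ennreal (energy_weight p (s, z)) * ennreal (norm (dmap u (s, z)) powr p) \<partial>lborel)
          = (\<integral>\<^sup>+z. ennreal (indicator (cbox 0 One) (snd z)) * ennreal (\<bar>u (fst z)\<bar> powr p) \<partial>(lborel :: ('a \<times> 'a) measure))"
          using 1 by (simp add: energy_weight_def dmap_def split_beta)
        also have "\<dots> = (\<integral>\<^sup>+x. ennreal (\<bar>u x\<bar> powr p) \<partial>lborel)" by (rule nn_integral_unit_cube) measurable
        finally show ?thesis using 1 by (simp add: seminorm_pow_0)
      next
        case 2
        then obtain g where "wgrad u g" using elim(1) by blast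
        then have w: "wgrad u (grad_of u)" by (rule wgrad_grad_of)
        have "(\<integral>\<^sup>+z. ennreal (energy_weight p (s, z)) * ennreal (norm (dmap u (s, z)) powr p) \<partial>lborel)
          = (\<integral>\<^sup>+z. ennreal (indicator (cbox 0 One) (snd z)) * ennreal (norm (grad_of u (fst z)) powr p) \<partial>(lborel :: ('a \<times> 'a) measure))"
          using 2 by (simp add: energy_weight_def dmap_def split_beta)
        also have "\<dots> = (\<integral>\<^sup>+x. ennreal (norm (grad_of u x) powr p) \<partial>lborel)" by (rule nn_integral_unit_cube) measurable
        finally show ?thesis using 2 seminorm_pow_1(1) [OF u out w] by simp
      next
        case 3
        let ?e = "real DIM('a) + s * p"
        have f0: "frac_const (real DIM('a)) s p \<ge> 0"
          using c(1) c(2) [of s] 3 by (smt (verit) mult_nonneg_nonneg)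
        have "(\<integral>\<^sup>+z. ennreal (energy_weight p (s, z)) * ennreal (norm (dmap u (s, z)) powr p) \<partial>lborel)
          = (\<integral>\<^sup>+z. ennreal (frac_const (real DIM('a)) s p) * ennreal (\<bar>u (fst z) - u (snd z)\<bar> powr p / norm (fst z - snd z) powr ?e) \<partial>lborel)"
        proof (rule nn_integral_cong)
          fix z :: "'a \<times> 'a"
          have "energy_weight p (s, z) = frac_const (real DIM('a)) s p * norm (fst z - snd z) powr - ?e"
            using 3 by (simp only: energy_weight_def split_beta fst_conv snd_conv) simp
          moreover have "norm (dmap u (s, z)) = \<bar>u (fst z) - u (snd z)\<bar>" using 3 by (simp add: dmap_def split_beta)
          moreover have "norm (fst z - snd z) powr - ?e * \<bar>u (fst z) - u (snd z)\<bar> powr p = \<bar>u (fst z) - u (snd z)\<bar> powr p / norm (fst z - snd z) powr ?e"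
            by (simp only: powr_minus divide_inverse mult.commute)
          ultimately show "ennreal (energy_weight p (s, z)) * ennreal (norm (dmap u (s, z)) powr p)
            = ennreal (frac_const (real DIM('a)) s p) * ennreal (\<bar>u (fst z) - u (snd z)\<bar> powr p / norm (fst z - snd z) powr ?e)"
            using f0 by (simp only: ennreal_mult [symmetric] mult.assoc) (simp add: ennreal_mult [symmetric] mult.assoc)
        qed
        also have "\<dots> = ennreal (frac_const (real DIM('a)) s p) * (\<integral>\<^sup>+z. ennreal (\<bar>u (fst z) - u (snd z)\<bar> powr p / norm (fst z - snd z) powr ?e) \<partial>lborel)"
          by (rule nn_integral_cmult) (subst lborel_prod [symmetric], measurable)
        finally show ?thesis using 3 by (simp add: seminorm_pow_def nn_integral_completion)
      qed
    qed
  qed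
  finally show ?thesis .
qed

lemma Lp_fun_dmap_iff:
  assumes u [measurable]: "u \<in> borel_measurable borel" and out: "\<And>x. x \<notin> ball 0 R \<Longrightarrow> u x = 0"
    and p: "p > 1" and reg: "regular_for \<mu> u"
  shows "Lp_fun (energy_measure \<mu> p) p (dmap u) \<longleftrightarrow> total_energy \<mu> p u < \<infinity>"
    and "energy \<mu> p u = enn2real (total_energy \<mu> p u)"
proof -
  have m: "dmap u \<in> borel_measurable (energy_measure \<mu> p)" by (rule dmap_measurable' [OF u])
  show "Lp_fun (energy_measure \<mu> p) p (dmap u) \<longleftrightarrow> total_energy \<mu> p u < \<infinity>"
    using m nn_integral_energy [OF assms] by (simp add: Lp_fun_def integrable_iff_bounded)
  show "energy \<mu> p u = enn2real (total_energy \<mu> p u)"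
    unfolding energy_def using nn_integral_energy [OF assms] m
    by (subst integral_eq_nn_integral) auto
qed

section \<open>Sums, multiples and truncations under \<open>dmap\<close>\<close>

lemma regular_for_add: "regular_for \<mu> u \<Longrightarrow> regular_for \<mu> v \<Longrightarrow> regular_for \<mu> (\<lambda>x. u x + v x)"
  unfolding regular_for_def using wgrad_add by blast

lemma regular_for_scale: "regular_for \<mu> u \<Longrightarrow> regular_for \<mu> (\<lambda>x. c * u x)"
  unfolding regular_for_def using wgrad_scale by blast

text \<open>Written as the instance \<open>k = 1\<close> of the truncations
  \<open>k * arctan (u / k)\<close>, so that their lemmas apply literally.\<close>

abbreviation "arctan_diff u v \<equiv> \<lambda>x. 1 * arctan ((u x - v x) / 1)"

lemma regular_for_arctan: "regular_for \<mu> u \<Longrightarrow> k > 0 \<Longrightarrow> regular_for \<mu> (\<lambda>x. k * arctan (u x / k))"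
  unfolding regular_for_def using wgrad_arctan by blast

text \<open>Identities for \<open>dmap\<close> can fail only through the choice of gradients on the
  slice \<open>s = 1\<close>, and this slice counts only when 1 is an atom.\<close>

lemma AE_dmapI:
  fixes Q :: "'a::euclidean_space \<Rightarrow> bool"
  assumes p: "p > 1" and Q: "emeasure \<mu> {1} \<noteq> 0 \<Longrightarrow> AE x in lborel. Q x"
    and P: "\<And>z. (fst z = 1 \<Longrightarrow> Q (fst (snd z))) \<Longrightarrow> P z"
  shows "AE z in energy_measure \<mu> p. P z"
proof (cases "emeasure \<mu> {1} = 0")
  case True
  show ?thesis using AE_energy_not_1 [OF p True] by eventually_elim (auto intro: P)
next
  case False
  show ?thesis using AE_energy_points [OF p Q [OF False]] by eventually_elim (auto intro: P)
qed

lemma AE_dmap_add: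
  fixes u v :: "'a::euclidean_space \<Rightarrow> real"
  assumes p: "p > 1" and reg: "regular_for \<mu> u" "regular_for \<mu> v"
  shows "AE z in energy_measure \<mu> p. dmap (\<lambda>x. u x + v x) z = dmap u z + dmap v z"
proof (rule AE_dmapI [OF p])
  assume "emeasure \<mu> {1} \<noteq> 0"
  then have w: "wgrad u (grad_of u)" "wgrad v (grad_of v)" using reg wgrad_grad_of unfolding regular_for_def by blast+
  show "AE x in lborel. grad_of (\<lambda>x. u x + v x) x = grad_of u x + grad_of v x"
    by (rule wgrad_unique [OF wgrad_grad_of [OF wgrad_add [OF w]] wgrad_add [OF w]]) simp
next
  fix z :: "real \<times> 'a \<times> 'a"
  assume "fst z = 1 \<Longrightarrow> grad_of (\<lambda>x. u x + v x) (fst (snd z)) = grad_of u (fst (snd z)) + grad_of v (fst (snd z))"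
  then show "dmap (\<lambda>x. u x + v x) z = dmap u z + dmap v z"
    by (cases z) (auto simp: dmap_def algebra_simps)
qed

lemma AE_dmap_scale:
  fixes u :: "'a::euclidean_space \<Rightarrow> real"
  assumes p: "p > 1" and reg: "regular_for \<mu> u"
  shows "AE z in energy_measure \<mu> p. dmap (\<lambda>x. c * u x) z = c *\<^sub>R dmap u z"
proof (rule AE_dmapI [OF p])
  assume "emeasure \<mu> {1} \<noteq> 0"
  then have w: "wgrad u (grad_of u)" using reg wgrad_grad_of unfolding regular_for_def by blast
  show "AE x in lborel. grad_of (\<lambda>x. c * u x) x = c *\<^sub>R grad_of u x"
    by (rule wgrad_unique [OF wgrad_grad_of [OF wgrad_scale [OF w]] wgrad_scale [OF w]]) simp
next
  fix z :: "real \<times> 'a \<times> 'a"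
  assume "fst z = 1 \<Longrightarrow> grad_of (\<lambda>x. c * u x) (fst (snd z)) = c *\<^sub>R grad_of u (fst (snd z))"
  then show "dmap (\<lambda>x. c * u x) z = c *\<^sub>R dmap u z"
    by (cases z) (auto simp: dmap_def algebra_simps)
qed

lemma AE_dmap_diff:
  assumes p: "p > 1" and reg: "regular_for \<mu> u" "regular_for \<mu> v"
  shows "AE z in energy_measure \<mu> p. dmap (\<lambda>x. u x - v x) z = dmap u z - dmap v z"
proof -
  have "AE z in energy_measure \<mu> p. dmap (\<lambda>x. u x + (- 1) * v x) z = dmap u z + dmap (\<lambda>x. (- 1) * v x) z"
    by (rule AE_dmap_add [OF p reg(1) regular_for_scale [OF reg(2)]])
  then show ?thesis using AE_dmap_scale [OF p reg(2), of "- 1"] by eventually_elim simp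
qed

lemma AE_dmap_arctan:
  fixes u :: "'a::euclidean_space \<Rightarrow> real"
  assumes p: "p > 1" and reg: "regular_for \<mu> u" and k: "k > 0"
  shows "AE z in energy_measure \<mu> p. dmap (\<lambda>x. k * arctan (u x / k)) z =
    (if fst z = 0 then (k * arctan (u (fst (snd z)) / k)) *\<^sub>R unit_vec
     else if fst z = 1 then (1 / (1 + (u (fst (snd z)) / k)\<^sup>2)) *\<^sub>R dmap u z
     else (k * arctan (u (fst (snd z)) / k) - k * arctan (u (snd (snd z)) / k)) *\<^sub>R unit_vec)" (is "AE z in _. ?P z")
proof (rule AE_dmapI [OF p])
  assume "emeasure \<mu> {1} \<noteq> 0"
  then have w: "wgrad u (grad_of u)" using reg wgrad_grad_of unfolding regular_for_def by blast
  show "AE x in lborel. grad_of (\<lambda>x. k * arctan (u x / k)) x = (1 / (1 + (u x / k)\<^sup>2)) *\<^sub>R grad_of u x"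
    by (rule wgrad_unique [OF wgrad_grad_of [OF wgrad_arctan [OF w k]] wgrad_arctan [OF w k]]) simp
next
  fix z :: "real \<times> 'a \<times> 'a"
  assume "fst z = 1 \<Longrightarrow> grad_of (\<lambda>x. k * arctan (u x / k)) (fst (snd z)) = (1 / (1 + (u (fst (snd z)) / k)\<^sup>2)) *\<^sub>R grad_of u (fst (snd z))"
  then show "?P z"
    by (cases z) (auto simp: dmap_def)
qed

lemma arctan_scaled_lipschitz:
  assumes k: "(k::real) > 0"
  shows "\<bar>k * arctan (a / k) - k * arctan (b / k)\<bar> \<le> \<bar>a - b\<bar>"
proof -
  have "\<bar>arctan x - arctan y\<bar> \<le> \<bar>x - y\<bar>" for x y :: real
  proof -
    have "norm (arctan x - arctan y) \<le> 1 * norm (x - y)"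
    proof (rule field_differentiable_bound [of UNIV arctan "\<lambda>x. inverse (1 + x\<^sup>2)"])
      show "(arctan has_field_derivative inverse (1 + z\<^sup>2)) (at z within UNIV)" for z :: real
        by (rule DERIV_arctan)
      show "norm (inverse (1 + z\<^sup>2)) \<le> 1" for z :: real
        by (simp add: inverse_le_1_iff)
    qed auto
    then show ?thesis by simp
  qed
  then have "k * \<bar>arctan (a / k) - arctan (b / k)\<bar> \<le> k * \<bar>a / k - b / k\<bar>" using k by (intro mult_left_mono) auto
  also have "\<dots> = \<bar>a - b\<bar>" using k by (simp add: diff_divide_distrib [symmetric])
  finally show ?thesis using k by (simp add: right_diff_distrib [symmetric] abs_mult)
qed

lemma AE_dmap_arctan_le:
  assumes p: "p > 1" and reg: "regular_for \<mu> u" and k: "k > 0"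
  shows "AE z in energy_measure \<mu> p. norm (dmap (\<lambda>x. k * arctan (u x / k)) z) \<le> norm (dmap u z)"
  using AE_dmap_arctan [OF assms]
proof eventually_elim
  case (elim z)
  obtain s x y where z: "z = (s, x, y)" by (cases z)
  consider "s = 0" | "s = 1" | "s \<noteq> 0" "s \<noteq> 1" by blast
  then show ?case
  proof cases
    case 1
    then show ?thesis using elim z arctan_scaled_lipschitz [OF k, of "u x" 0] by (simp add: dmap_def)
  next
    case 2
    have le1: "1 / (1 + (u x / k)\<^sup>2) \<le> 1" by (simp add: divide_le_eq_1 add_pos_nonneg)
    have ge0: "0 \<le> 1 / (1 + (u x / k)\<^sup>2)" by simp
    have "norm (dmap (\<lambda>x. k * arctan (u x / k)) z) = \<bar>1 / (1 + (u x / k)\<^sup>2)\<bar> * norm (dmap u z)"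
      using elim 2 z by simp
    also have "\<bar>1 / (1 + (u x / k)\<^sup>2)\<bar> = 1 / (1 + (u x / k)\<^sup>2)" using ge0 by (rule abs_of_nonneg)
    also have "1 / (1 + (u x / k)\<^sup>2) * norm (dmap u z) \<le> 1 * norm (dmap u z)"
      by (rule mult_right_mono [OF le1]) simp
    finally show ?thesis by simp
  next
    case 3
    then show ?thesis using elim z arctan_scaled_lipschitz [OF k, of "u x" "u y"] by (simp add: dmap_def)
  qed
qed

text \<open>Testing the difference of two fluxes with \<open>arctan (u - v)\<close> is nonnegative, and on the gradient part it
  controls the monotonicity gap up to the derivative of \<open>arctan\<close>.\<close>

lemma AE_flux_arctan:
  fixes u v :: "'a::euclidean_space \<Rightarrow> real"
  assumes p: "p > 1" and reg: "regular_for \<mu> u" "regular_for \<mu> v"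
  shows "AE z in energy_measure \<mu> p.
    0 \<le> (pflux p (dmap u z) - pflux p (dmap v z)) \<bullet> dmap (arctan_diff u v) z
    \<and> (fst z = 1 \<longrightarrow> (pflux p (dmap u z) - pflux p (dmap v z)) \<bullet> dmap (arctan_diff u v) z
       = (1 / (1 + (u (fst (snd z)) - v (fst (snd z)))\<^sup>2)) * ((pflux p (dmap u z) - pflux p (dmap v z)) \<bullet> (dmap u z - dmap v z)))"
proof -
  have "regular_for \<mu> (\<lambda>x. u x - v x)"
    using regular_for_add [OF reg(1) regular_for_scale [OF reg(2), of "- 1"]] by simp
  from AE_dmap_arctan [OF p this zero_less_one] AE_dmap_diff [OF p reg]
  show ?thesis
  proof eventually_elim
    case (elim z)
    obtain s x y where z: "z = (s, x, y)" by (cases z)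
    \<comment> \<open>Both the flux and \<open>arctan\<close> are monotone, so the two factors share
      the sign of \<open>c - d\<close>.\<close>
    have scalar: "0 \<le> (pflux p (a *\<^sub>R (unit_vec :: 'a)) - pflux p (b *\<^sub>R unit_vec)) \<bullet> ((arctan c - arctan d) *\<^sub>R unit_vec)"
      if "a - b = c - d" for a b c d :: real
    proof -
      have gap: "0 \<le> (pflux p (a *\<^sub>R (unit_vec :: 'a)) - pflux p (b *\<^sub>R unit_vec)) \<bullet> ((a - b) *\<^sub>R unit_vec)"
        using pflux_mono [OF p, of "a *\<^sub>R unit_vec" "b *\<^sub>R (unit_vec :: 'a)"] by (simp only: scaleR_left_diff_distrib)
      let ?F = "(pflux p (a *\<^sub>R (unit_vec :: 'a)) - pflux p (b *\<^sub>R unit_vec)) \<bullet> unit_vec"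
      have F: "0 \<le> (c - d) * ?F" using gap that by simp
      have "0 \<le> (arctan c - arctan d) * ?F"
      proof (cases c d rule: linorder_cases)
        case less
        then have "?F \<le> 0" "arctan c - arctan d \<le> 0" using F by (auto simp: zero_le_mult_iff arctan_le_iff)
        then show ?thesis by (rule mult_nonpos_nonpos [rotated])
      next
        case greater
        then have "0 \<le> ?F" "0 \<le> arctan c - arctan d" using F by (auto simp: zero_le_mult_iff arctan_le_iff)
        then show ?thesis by simp
      qed simp
      then show ?thesis by simp
    qed
    consider "s = 0" | "s = 1" | "s \<noteq> 0" "s \<noteq> 1" by blast
    then show ?case
    proof cases
      case 1
      then show ?thesis using elim(1) z scalar [of "u x" "v x" "u x - v x" 0] by (simp add: dmap_def)
    next
      case 2
      have eq: "dmap (arctan_diff u v) z = (1 / (1 + (u x - v x)\<^sup>2)) *\<^sub>R (dmap u z - dmap v z)"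
        using elim 2 z by simp
      have "0 \<le> (1 / (1 + (u x - v x)\<^sup>2)) * ((pflux p (dmap u z) - pflux p (dmap v z)) \<bullet> (dmap u z - dmap v z))"
        by (intro mult_nonneg_nonneg pflux_mono [OF p]) auto
      then show ?thesis unfolding eq using z by simp
    next
      case 3
      then show ?thesis using elim(1) z scalar [of "u x - u y" "v x - v y" "u x - v x" "u y - v y"] by (simp add: dmap_def)
    qed
  qed
qed

end

text \<open>Young's inequality with the small weight on the bounded factor \<open>f\<close> and the
  large one on \<open>h\<close>. One \<open>\<delta>\<close> serves all pairs, a uniformity on which
  \<open>flux_gap_small\<close> relies.\<close>

lemma mixed_integral_small:
  fixes s :: real
  assumes s: "s > 1" and K: "K \<ge> 0" and \<eta>: "\<eta> > 0"
  shows "\<exists>\<delta>>0. \<forall>(f :: 'm \<Rightarrow> 'e::euclidean_space) h. Lp_fun M s f \<longrightarrow> Lp_fun M s h \<longrightarrow> (\<integral>x. norm (f x) powr s \<partial>M) \<le> K \<longrightarrow>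
    (\<integral>x. norm (h x) powr s \<partial>M) \<le> \<delta> \<longrightarrow> \<bar>\<integral>x. pflux s (f x) \<bullet> h x \<partial>M\<bar> \<le> \<eta>"
proof -
  define \<epsilon> where "\<epsilon> = \<eta> / (2 * (K + 1))"
  have \<epsilon>: "\<epsilon> > 0" using K \<eta> by (simp add: \<epsilon>_def)
  have eK: "\<epsilon> * K \<le> \<eta> / 2" using K \<eta> by (simp add: \<epsilon>_def field_simps)
  obtain C where C: "C \<ge> 0" "\<And>x y. x \<ge> 0 \<Longrightarrow> y \<ge> 0 \<Longrightarrow> x powr (s - 1) * y \<le> \<epsilon> * x powr s + C * y powr s"
    using young_eps [OF s \<epsilon>] by auto
  show ?thesis
  proof (intro exI [of _ "\<eta> / (2 * (C + 1))"] conjI allI impI)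
    show "\<eta> / (2 * (C + 1)) > 0" using \<eta> C by simp
    fix f h :: "'m \<Rightarrow> 'e"
    assume f: "Lp_fun M s f" and h: "Lp_fun M s h" and fK: "(\<integral>x. norm (f x) powr s \<partial>M) \<le> K"
      and hd: "(\<integral>x. norm (h x) powr s \<partial>M) \<le> \<eta> / (2 * (C + 1))"
    note i = Lp_fun_pairing [OF s f h]
    have "\<bar>\<integral>x. pflux s (f x) \<bullet> h x \<partial>M\<bar> \<le> (\<integral>x. \<bar>pflux s (f x) \<bullet> h x\<bar> \<partial>M)" by (rule integral_abs_bound)
    also have "\<dots> \<le> (\<integral>x. \<epsilon> * norm (f x) powr s + C * norm (h x) powr s \<partial>M)"
    proof (rule integral_mono)
      show "integrable M (\<lambda>x. \<epsilon> * norm (f x) powr s + C * norm (h x) powr s)"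
        using Lp_funD(2) [OF f] Lp_funD(2) [OF h] by auto
      show "\<bar>pflux s (f x) \<bullet> h x\<bar> \<le> \<epsilon> * norm (f x) powr s + C * norm (h x) powr s" for x
        using abs_pflux_inner_le [of s "f x" "h x"] C(2) [of "norm (f x)" "norm (h x)"] by simp
    qed (use i in auto)
    also have "\<dots> = \<epsilon> * (\<integral>x. norm (f x) powr s \<partial>M) + C * (\<integral>x. norm (h x) powr s \<partial>M)"
      using Lp_funD(2) [OF f] Lp_funD(2) [OF h] by simp
    also have "\<dots> \<le> \<epsilon> * K + C * (\<eta> / (2 * (C + 1)))"
      using \<epsilon> C fK hd by (intro add_mono mult_left_mono) auto
    also have "C * (\<eta> / (2 * (C + 1))) \<le> \<eta> / 2" using C \<eta> by (simp add: field_simps)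
    finally show "\<bar>\<integral>x. pflux s (f x) \<bullet> h x \<partial>M\<bar> \<le> \<eta>" using eK by linarith
  qed
qed

section \<open>The slice of order 1 and almost everywhere limits\<close>

context unit_measure
begin

text \<open>The slice \<open>s = 1\<close> has weight \<open>emeasure \<mu> {1}\<close>, so with an
  atom there an integral over the energy measure controls an integral over \<open>x\<close>
  alone.\<close>

lemma nn_integral_slice_1:
  fixes f :: "'a::euclidean_space \<Rightarrow> ennreal"
  assumes p: "p > 1" and [measurable]: "f \<in> borel_measurable borel" "F \<in> borel_measurable (energy_measure \<mu> p)"
    and le: "AE z in energy_measure \<mu> p. fst z = 1 \<longrightarrow> f (fst (snd z)) \<le> F z"
  shows "emeasure \<mu> {1} * (\<integral>\<^sup>+x. f x \<partial>lborel) \<le> (\<integral>\<^sup>+z. F z \<partial>energy_measure \<mu> p)"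
proof -
  define H where "H z = indicator {1} (fst z) * f (fst (snd z))" for z :: "real \<times> 'a \<times> 'a"
  have Hm: "H \<in> borel_measurable (\<mu> \<Otimes>\<^sub>M lborel)"
    unfolding H_def
    by (intro borel_measurable_times_ennreal measurable_compose [OF coordinates_measurable(1) borel_measurable_indicator]
        measurable_compose [OF coordinates_measurable(2) assms(2)]) simp
  note [measurable] = Hm energy_weight_measurable [OF p, where 'a = 'a]
  have "(\<integral>\<^sup>+z. H z \<partial>energy_measure \<mu> p) = (\<integral>\<^sup>+z. ennreal (energy_weight p z) * H z \<partial>(\<mu> \<Otimes>\<^sub>M lborel))"
    unfolding energy_measure_def by (rule nn_integral_density) measurable
  also have "\<dots> = (\<integral>\<^sup>+s. (\<integral>\<^sup>+z. ennreal (energy_weight p (s, z)) * H (s, z) \<partial>lborel) \<partial>\<mu>)"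
    by (rule lborel.nn_integral_fst [symmetric]) measurable
  also have "\<dots> = (\<integral>\<^sup>+s. (\<integral>\<^sup>+x. f x \<partial>lborel) * indicator {1} s \<partial>\<mu>)"
  proof (rule nn_integral_cong)
    fix s
    show "(\<integral>\<^sup>+z. ennreal (energy_weight p (s, z)) * H (s, z) \<partial>lborel) = (\<integral>\<^sup>+x. f x \<partial>lborel) * indicator {1} s"
      using nn_integral_unit_cube [OF assms(2)] by (cases "s = 1") (auto simp: energy_weight_def H_def split_beta)
  qed
  also have "\<dots> = (\<integral>\<^sup>+x. f x \<partial>lborel) * emeasure \<mu> {1}"
    using singleton_sets [of 1] by (subst nn_integral_cmult_indicator) auto
  finally have "emeasure \<mu> {1} * (\<integral>\<^sup>+x. f x \<partial>lborel) = (\<integral>\<^sup>+z. H z \<partial>energy_measure \<mu> p)" by (simp add: mult.commute)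
  also have "\<dots> \<le> (\<integral>\<^sup>+z. F z \<partial>energy_measure \<mu> p)"
    using le by (intro nn_integral_mono_AE) (auto simp: H_def indicator_def elim!: eventually_mono)
  finally show ?thesis .
qed

lemma AE_dmap_tendsto:
  fixes u :: "nat \<Rightarrow> 'a::euclidean_space \<Rightarrow> real"
  assumes p: "p > 1" and u: "AE x in lborel. (\<lambda>n. u n x) \<longlonglongrightarrow> v x"
    and g: "emeasure \<mu> {1} \<noteq> 0 \<Longrightarrow> AE x in lborel. (\<lambda>n. grad_of (u n) x) \<longlonglongrightarrow> grad_of v x"
  shows "AE z in energy_measure \<mu> p. (\<lambda>n. dmap (u n) z) \<longlonglongrightarrow> dmap v z"
proof -
  have lim: "(\<lambda>n. dmap (u n) z) \<longlonglongrightarrow> dmap v z"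
    if "(\<lambda>n. u n (fst (snd z))) \<longlonglongrightarrow> v (fst (snd z))" "(\<lambda>n. u n (snd (snd z))) \<longlonglongrightarrow> v (snd (snd z))"
      "fst z = 1 \<Longrightarrow> (\<lambda>n. grad_of (u n) (fst (snd z))) \<longlonglongrightarrow> grad_of v (fst (snd z))" for z
    using that by (cases z) (auto simp: dmap_def intro!: tendsto_intros)
  show ?thesis
  proof (cases "emeasure \<mu> {1} = 0")
    case True
    show ?thesis
      using AE_energy_points [OF p u] AE_energy_not_1 [OF p True] by eventually_elim (auto intro: lim)
  next
    case False
    show ?thesis
      using AE_energy_points [OF p u] AE_energy_points [OF p g [OF False]] by eventually_elim (auto intro: lim)
  qed
qed

end

section \<open>The function space with Borel representatives\<close>

locale energy_space = unit_measure +
  fixes \<Omega> :: "'a::euclidean_space set" and p R :: real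
  assumes open_\<Omega>: "open \<Omega>" and sub_ball: "\<Omega> \<subseteq> ball 0 R" and p1: "p > 1"
begin

abbreviation "X \<equiv> Xb \<mu> \<Omega> p"
abbreviation "EM \<equiv> energy_measure \<mu> p :: (real \<times> 'a \<times> 'a) measure"
abbreviation "E \<equiv> energy \<mu> p :: ('a \<Rightarrow> real) \<Rightarrow> real"

lemma XbD:
  assumes "u \<in> X"
  shows "u \<in> borel_measurable borel" "\<And>x. x \<notin> \<Omega> \<Longrightarrow> u x = 0" "\<And>x. x \<notin> ball 0 R \<Longrightarrow> u x = 0"
    "regular_for \<mu> u" "Lp_fun EM p (dmap u)" "E u = enn2real (total_energy \<mu> p u)"
proof -
  show b: "u \<in> borel_measurable borel" and "\<And>x. x \<notin> \<Omega> \<Longrightarrow> u x = 0" and o: "\<And>x. x \<notin> ball 0 R \<Longrightarrow> u x = 0"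
    using assms sub_ball by (auto simp: Xb_def)
  have fin: "total_energy \<mu> p u < \<infinity>" using assms by (simp add: Xb_def)
  show r: "regular_for \<mu> u" by (rule regular_for_finite [OF b o fin])
  show "Lp_fun EM p (dmap u)" "E u = enn2real (total_energy \<mu> p u)"
    using Lp_fun_dmap_iff [OF b o p1 r] fin by auto
qed

lemma XbI:
  assumes "u \<in> borel_measurable borel" "\<And>x. x \<notin> \<Omega> \<Longrightarrow> u x = 0" "regular_for \<mu> u" "Lp_fun EM p (dmap u)"
  shows "u \<in> X"
proof -
  have o: "u x = 0" if "x \<notin> ball 0 R" for x using assms(2) that sub_ball by blast
  show ?thesis using assms Lp_fun_dmap_iff(1) [OF assms(1) o p1 assms(3)] by (simp add: Xb_def)
qed

lemma Lp_fun_cong_AE: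
  assumes "Lp_fun M s f" "g \<in> borel_measurable M" "AE z in M. g z = f z"
  shows "Lp_fun M s g"
  using assms unfolding Lp_fun_def
  by (auto intro!: integrable_cong_AE_imp [where g = "\<lambda>x. norm (f x) powr s"] elim!: eventually_mono)

lemma Xb_add: assumes "u \<in> X" "v \<in> X" shows "(\<lambda>x. u x + v x) \<in> X"
proof (rule XbI)
  note [measurable] = XbD(1) [OF assms(1)] XbD(1) [OF assms(2)]
  show b: "(\<lambda>x. u x + v x) \<in> borel_measurable borel" by measurable
  show "regular_for \<mu> (\<lambda>x. u x + v x)" by (rule regular_for_add [OF XbD(4) XbD(4)]) (use assms in auto)
  have "Lp_fun EM p (\<lambda>z. dmap u z + dmap v z)" using p1 XbD(5) assms by (intro Lp_fun_add) auto
  then show "Lp_fun EM p (dmap (\<lambda>x. u x + v x))"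
    by (rule Lp_fun_cong_AE [OF _ dmap_measurable' [OF b] AE_dmap_add [OF p1 XbD(4) XbD(4)]]) (use assms in auto)
qed (simp add: XbD(2) [OF assms(1)] XbD(2) [OF assms(2)])

lemma Xb_scale: assumes "u \<in> X" shows "(\<lambda>x. c * u x) \<in> X"
proof (rule XbI)
  note [measurable] = XbD(1) [OF assms(1)]
  show b: "(\<lambda>x. c * u x) \<in> borel_measurable borel" by measurable
  show "regular_for \<mu> (\<lambda>x. c * u x)" by (rule regular_for_scale [OF XbD(4) [OF assms]])
  show "Lp_fun EM p (dmap (\<lambda>x. c * u x))"
    by (rule Lp_fun_cong_AE [OF Lp_fun_scaleR [OF XbD(5) [OF assms]] dmap_measurable' [OF b] AE_dmap_scale [OF p1 XbD(4) [OF assms]]])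
qed (simp add: XbD(2) [OF assms(1)])

lemma Xb_diff: assumes "u \<in> X" "v \<in> X" shows "(\<lambda>x. u x - v x) \<in> X"
  using Xb_add [OF assms(1) Xb_scale [OF assms(2), of "- 1"]] by simp

text \<open>The scaled \<open>arctan\<close> is a contraction with derivative at most 1, so no
  component of \<open>dmap\<close> grows. It provides both the bounded test functions and the
  bounded truncations.\<close>

lemma Xb_arctan: assumes "u \<in> X" "k > 0" shows "(\<lambda>x. k * arctan (u x / k)) \<in> X"
  and "E (\<lambda>x. k * arctan (u x / k)) \<le> E u"
proof -
  note [measurable] = XbD(1) [OF assms(1)]
  have b: "(\<lambda>x. k * arctan (u x / k)) \<in> borel_measurable borel" by measurable
  have le: "AE z in EM. norm (dmap (\<lambda>x. k * arctan (u x / k)) z) powr p \<le> norm (dmap u z) powr p"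
    using AE_dmap_arctan_le [OF p1 XbD(4) [OF assms(1)] assms(2)] p1
    by (auto elim!: eventually_mono intro!: powr_mono2)
  have L: "Lp_fun EM p (dmap (\<lambda>x. k * arctan (u x / k)))"
    by (rule Lp_fun_bound [OF dmap_measurable' [OF b] Lp_funD(2) [OF XbD(5) [OF assms(1)]] le])
  show "(\<lambda>x. k * arctan (u x / k)) \<in> X"
    by (rule XbI [OF b _ regular_for_arctan [OF XbD(4) [OF assms(1)] assms(2)] L]) (use XbD(2) [OF assms(1)] in auto)
  show "E (\<lambda>x. k * arctan (u x / k)) \<le> E u"
    unfolding energy_def by (rule integral_mono_AE [OF Lp_funD(2) [OF L] Lp_funD(2) [OF XbD(5) [OF assms(1)]] le])
qed

lemma energy_nonneg [simp]: "0 \<le> E u"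
  unfolding energy_def by (intro integral_nonneg_AE) auto

lemma energy_diff_le:
  assumes "u \<in> X" "v \<in> X" shows "E (\<lambda>x. u x - v x) \<le> 2 powr p * (E u + E v)"
proof -
  have "E (\<lambda>x. u x - v x) \<le> (\<integral>z. 2 powr p * (norm (dmap u z) powr p + norm (dmap v z) powr p) \<partial>EM)"
    unfolding energy_def
  proof (rule integral_mono_AE)
    show "AE z in EM. norm (dmap (\<lambda>x. u x - v x) z) powr p \<le> 2 powr p * (norm (dmap u z) powr p + norm (dmap v z) powr p)"
      using AE_dmap_diff [OF p1 XbD(4) XbD(4), OF assms]
      by eventually_elim (use p1 in \<open>auto intro: norm_powr_diff_le\<close>)
  qed (use Lp_funD(2) [OF XbD(5)] Xb_diff assms in auto)
  also have "\<dots> = 2 powr p * (E u + E v)"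
    unfolding energy_def using Lp_funD(2) [OF XbD(5)] assms by simp
  finally show ?thesis .
qed

lemma energy_scale: assumes "u \<in> X" shows "E (\<lambda>x. c * u x) = \<bar>c\<bar> powr p * E u"
proof -
  have b: "(\<lambda>x. c * u x) \<in> borel_measurable borel" using XbD(1) [OF assms] by measurable
  have m: "dmap (\<lambda>x. c * u x) \<in> borel_measurable EM" "dmap u \<in> borel_measurable EM"
    using dmap_measurable' [OF b] dmap_measurable' [OF XbD(1) [OF assms]] by auto
  have "E (\<lambda>x. c * u x) = (\<integral>z. \<bar>c\<bar> powr p * norm (dmap u z) powr p \<partial>EM)"
    unfolding energy_def
  proof (rule integral_cong_AE)
    show "AE z in EM. norm (dmap (\<lambda>x. c * u x) z) powr p = \<bar>c\<bar> powr p * norm (dmap u z) powr p"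
      using AE_dmap_scale [OF p1 XbD(4) [OF assms], of c] by eventually_elim (simp add: powr_mult)
  qed (use m in measurable)
  then show ?thesis by (simp add: energy_def)
qed

end

section \<open>The compactness argument\<close>

text \<open>In the application \<open>junk\<close> is the term subtracted in the critical level, and \<open>0\<close> for \<open>q \<ge> p\<close>: it
  bounds the lower order part of the functional at a critical point from below.\<close>

locale ps_functional = energy_space \<mu> \<Omega> p R + minus: unit_measure \<mu>m
  for \<mu> \<mu>m :: "real measure" and \<Omega> :: "'a::euclidean_space set" and p R :: real +
  fixes r q lam S c junk \<sigma> C\<sigma> :: real
  assumes minus_1: "emeasure \<mu>m {1} = 0"
    and pr: "p < r" and q1: "1 < q" and qr: "q < r" and lam: "lam > 0" and S: "S > 0"
    and sob_Lr: "\<And>u. u \<in> X \<Longrightarrow> Lp_fun lborel r u"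
    and sob: "\<And>u. u \<in> X \<Longrightarrow> S * power_integral r u powr (p / r) \<le> E u"
    and minus_Lp: "\<And>u. u \<in> X \<Longrightarrow> Lp_fun (energy_measure \<mu>m p) p (dmap u)"
    and minus_half: "\<And>u. u \<in> X \<Longrightarrow> energy \<mu>m p u \<le> E u / 2"
    and \<sigma>: "\<sigma> > 0" and C\<sigma>: "C\<sigma> \<ge> 0"
    and gag: "\<And>u. u \<in> X \<Longrightarrow> gagliardo p \<sigma> u \<le> ennreal (C\<sigma> * E u)"
    and minus_compact: "\<And>B \<eta>. B \<ge> 0 \<Longrightarrow> \<eta> > 0 \<Longrightarrow>
      \<exists>\<delta>>0. \<forall>v\<in>X. E v \<le> B \<longrightarrow> power_integral p v \<le> \<delta> \<longrightarrow> energy \<mu>m p v \<le> \<eta>"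
    and junk: "\<And>u. u \<in> X \<Longrightarrow> - junk \<le> lam * (1 / p - 1 / q) * power_integral q u + (1 / p - 1 / r) * power_integral r u"
    and level: "c < (1 / p - 1 / r) * S powr (r / (r - p)) - junk"
begin

abbreviation "EMm \<equiv> energy_measure \<mu>m p :: (real \<times> 'a \<times> 'a) measure"
abbreviation "m \<equiv> energy \<mu>m p :: ('a \<Rightarrow> real) \<Rightarrow> real"

section \<open>The functional, its derivative, and bounds along Palais-Smale sequences\<close>

definition "T u = (\<integral>x. \<bar>u x\<bar> powr r \<partial>(lborel :: 'a measure))"
definition "Q u = (\<integral>x. \<bar>u x\<bar> powr q \<partial>(lborel :: 'a measure))"
definition "J u = E u / p - m u / p - lam / q * Q u - T u / r"
definition "A u v = (\<integral>z. pflux p (dmap u z) \<bullet> dmap v z \<partial>EM)"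
definition "Am u v = (\<integral>z. pflux p (dmap u z) \<bullet> dmap v z \<partial>EMm)"
definition "Bf s u v = (\<integral>x. pflux s (u x) \<bullet> v x \<partial>(lborel :: 'a measure))" for u v :: "'a \<Rightarrow> real"
text \<open>The directional derivative of \<open>J\<close>, as \<open>J_gateaux\<close> proves; the
  compactness argument uses it purely as a formula.\<close>

definition "DJ u v = A u v - Am u v - lam * Bf q u v - Bf r u v"
definition "d = 1 / p - 1 / r"

lemma r1: "r > 1" using p1 pr by simp

lemma d_pos: "d > 0"
  unfolding d_def using p1 pr by (simp add: frac_less2)

lemma \<Omega>_sets: "\<Omega> \<in> sets lborel" "emeasure lborel \<Omega> < \<infinity>"
proof -
  show s: "\<Omega> \<in> sets lborel" using open_\<Omega> by simp
  have "emeasure lborel \<Omega> \<le> emeasure lborel (ball (0::'a) R)" by (intro emeasure_mono sub_ball) auto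
  then show "emeasure lborel \<Omega> < \<infinity>" using emeasure_lborel_ball_finite [of "0::'a" R] by (rule le_less_trans)
qed

lemma Xb_Lp: assumes "u \<in> X" "0 < s" "s \<le> r" shows "Lp_fun lborel s u"
proof (cases "s = r")
  case True then show ?thesis using sob_Lr assms by simp
next
  case False
  then show ?thesis
    using assms XbD(2) [OF assms(1)] by (intro Lp_fun_lower [OF _ _ \<Omega>_sets sob_Lr [OF assms(1)]]) auto
qed

lemma Xb_integrable: assumes "u \<in> X" shows "integrable lborel u"
  using Xb_Lp [OF assms, of 1] r1 by (auto simp: Lp_fun_def intro: integrable_abs_cancel)

lemma DJ_self: "DJ u u = E u - m u - lam * Q u - T u"
proof -
  have "pflux s x * x = \<bar>x\<bar> powr s" for s x :: real using pflux_inner_self [of s x] by simp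
  then show ?thesis by (simp add: DJ_def A_def Am_def Bf_def pflux_inner_self energy_def T_def Q_def)
qed

lemma T_nonneg [simp]: "T u \<ge> 0" and Q_nonneg [simp]: "Q u \<ge> 0" and m_nonneg [simp]: "m u \<ge> 0"
  unfolding T_def Q_def energy_def by (auto intro!: integral_nonneg_AE)

lemma iO: "integrable lborel (indicator \<Omega> :: 'a \<Rightarrow> real)"
  using \<Omega>_sets by (intro integrable_real_indicator) auto

lemma Q_le_T:
  assumes "\<epsilon> > 0"
  shows "\<exists>C\<ge>0. \<forall>u\<in>X. Q u \<le> \<epsilon> * T u + C"
proof -
  obtain C where C: "C \<ge> 0" "\<And>x. x \<ge> 0 \<Longrightarrow> x powr q \<le> \<epsilon> * x powr r + C"
    using powr_le_eps [OF _ qr assms] q1 by auto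
  show ?thesis
  proof (intro exI [of _ "C * measure lborel \<Omega>"] conjI ballI)
    fix u assume u: "u \<in> X"
    have "Q u \<le> (\<integral>x. \<epsilon> * \<bar>u x\<bar> powr r + C * indicator \<Omega> x \<partial>lborel)"
      unfolding Q_def
    proof (rule integral_mono)
      show "\<bar>u x\<bar> powr q \<le> \<epsilon> * \<bar>u x\<bar> powr r + C * indicator \<Omega> x" for x
        using C(2) [of "\<bar>u x\<bar>"] XbD(2) [OF u, of x] q1 by (cases "x \<in> \<Omega>") auto
    qed (use Lp_funD(2) [OF Xb_Lp [OF u]] q1 qr r1 iO in auto)
    also have "\<dots> = \<epsilon> * T u + C * measure lborel \<Omega>"
      unfolding T_def using Lp_funD(2) [OF sob_Lr [OF u]] iO by simp
    finally show "Q u \<le> \<epsilon> * T u + C * measure lborel \<Omega>" .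
  qed (use C in auto)
qed

text \<open>Energy and negative part are both homogeneous of degree \<open>p\<close> and cancel,
  which leaves only terms of order zero.\<close>

lemma J_DJ: "J u - DJ u u / p = lam * (1 / p - 1 / q) * Q u + d * T u"
  using p1 r1 q1 by (simp add: J_def DJ_self d_def field_simps)

text \<open>With \<open>\<rho> = E u powr (1 / p)\<close>, the combination in \<open>J_DJ\<close>
  bounds \<open>T u\<close> by a linear function of \<open>\<rho>\<close>, since \<open>Q\<close> is
  of lower order. The value of \<open>J\<close> then bounds \<open>E u\<close> linearly in
  \<open>\<rho>\<close>, where \<open>minus_half\<close> leaves at least half of the energy, and
  \<open>p > 1\<close> absorbs \<open>\<rho>\<close>.\<close>

lemma bounded_of_PS:
  assumes "M \<ge> 0"
  shows "\<exists>K\<ge>0. \<forall>u\<in>X. J u \<le> M \<longrightarrow> \<bar>DJ u u\<bar> \<le> M * (E u) powr (1 / p) \<longrightarrow> E u \<le> K"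
proof -
  define a where "a = lam * \<bar>1 / p - 1 / q\<bar>"
  have a0: "a \<ge> 0" using lam by (simp add: a_def)
  obtain C where C: "C \<ge> 0" "\<And>u. u \<in> X \<Longrightarrow> Q u \<le> (d / (2 * (a + 1))) * T u + C"
    using Q_le_T [of "d / (2 * (a + 1))"] d_pos a0 by auto
  obtain C1 where C1: "C1 \<ge> 0" "\<And>u. u \<in> X \<Longrightarrow> Q u \<le> 1 * T u + C1"
    using Q_le_T [of 1] by auto
  define b1 where "b1 = 2 / d * (M + a * C)"
  define b2 where "b2 = 2 / d * (M / p)"
  define g where "g = lam / q + 1 / r"
  have g0: "g \<ge> 0" using lam q1 r1 by (simp add: g_def)
  define a' where "a' = 2 * p * (M + lam / q * C1 + g * b1)"
  define b' where "b' = 2 * p * (g * b2)"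
  have b'0: "b' \<ge> 0" using p1 g0 d_pos assms by (simp add: b'_def b2_def)
  have a'0: "a' \<ge> 0" using p1 g0 d_pos assms a0 C C1 lam q1 by (simp add: a'_def b1_def)
  obtain C2 where C2: "C2 \<ge> 0" "\<And>x. x \<ge> 0 \<Longrightarrow> x powr 1 \<le> (1 / (2 * (b' + 1))) * x powr p + C2"
    using powr_le_eps [of 1 p "1 / (2 * (b' + 1))"] p1 b'0 by auto
  show ?thesis
  proof (intro exI [of _ "2 * (a' + b' * C2)"] conjI ballI impI)
    show "0 \<le> 2 * (a' + b' * C2)" using a'0 b'0 C2 by simp
    fix u assume u: "u \<in> X" and JM: "J u \<le> M" and D: "\<bar>DJ u u\<bar> \<le> M * (E u) powr (1 / p)"
    define \<rho> where "\<rho> = (E u) powr (1 / p)"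
    have \<rho>0: "\<rho> \<ge> 0" by (simp add: \<rho>_def)
    have "d * T u = J u - DJ u u / p - lam * (1 / p - 1 / q) * Q u" using J_DJ [of u] by linarith
    also have "\<dots> \<le> M + M * \<rho> / p + a * Q u"
    proof -
      have 1: "- (DJ u u / p) \<le> M * \<rho> / p" using D p1 by (simp add: \<rho>_def field_simps)
      have "- (lam * (1 / p - 1 / q)) \<le> a"
        using lam abs_ge_minus_self [of "lam * (1 / p - 1 / q)"] by (simp add: a_def abs_mult)
      then have "- (lam * (1 / p - 1 / q)) * Q u \<le> a * Q u" by (rule mult_right_mono) simp
      then have 2: "- (lam * (1 / p - 1 / q) * Q u) \<le> a * Q u" by simp
      show ?thesis using JM 1 2 by linarith
    qed
    also have "a * Q u \<le> a * ((d / (2 * (a + 1))) * T u + C)" using C(2) [OF u] a0 by (rule mult_left_mono)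
    also have "a * ((d / (2 * (a + 1))) * T u + C) \<le> d / 2 * T u + a * C"
    proof -
      have "a * (d / (2 * (a + 1))) \<le> d / 2" using a0 d_pos by (simp add: field_simps)
      then have "a * (d / (2 * (a + 1))) * T u \<le> d / 2 * T u" by (rule mult_right_mono) simp
      then show ?thesis by (simp add: distrib_left mult.assoc)
    qed
    finally have "d * T u \<le> M + M * \<rho> / p + (d / 2 * T u + a * C)" by simp
    moreover have "d * T u = d / 2 * T u + d / 2 * T u" by simp
    ultimately have "d / 2 * T u \<le> M + M * \<rho> / p + a * C" by linarith
    then have "2 / d * (d / 2 * T u) \<le> 2 / d * (M + M * \<rho> / p + a * C)" using d_pos by (intro mult_left_mono) auto
    moreover have "2 / d * (d / 2 * T u) = T u" using d_pos by simp
    moreover have "2 / d * (M + M * \<rho> / p + a * C) = b1 + b2 * \<rho>"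
      by (simp add: b1_def b2_def algebra_simps add_divide_distrib)
    ultimately have T: "T u \<le> b1 + b2 * \<rho>" by (simp only:)
    have "E u / (2 * p) \<le> E u / p - m u / p" using minus_half [OF u] p1 by (simp add: field_simps)
    also have "\<dots> = J u + lam / q * Q u + T u / r" by (simp add: J_def)
    also have "\<dots> \<le> M + lam / q * (1 * T u + C1) + T u / r"
      using JM C1(2) [OF u] lam q1 by (intro add_mono mult_left_mono) auto
    also have "\<dots> = M + lam / q * C1 + g * T u" by (simp add: g_def algebra_simps)
    also have "\<dots> \<le> M + lam / q * C1 + g * (b1 + b2 * \<rho>)" using T g0 by (intro add_left_mono mult_left_mono)
    finally have "2 * p * (E u / (2 * p)) \<le> 2 * p * (M + lam / q * C1 + g * (b1 + b2 * \<rho>))"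
      using p1 by (intro mult_left_mono) auto
    then have 1: "E u \<le> a' + b' * \<rho>" using p1 by (simp add: a'_def b'_def algebra_simps)
    have "\<rho> powr p = E u" using p1 by (simp add: \<rho>_def powr_powr)
    then have "\<rho> \<le> (1 / (2 * (b' + 1))) * E u + C2" using C2(2) [OF \<rho>0] \<rho>0 by simp
    then have "b' * \<rho> \<le> b' * ((1 / (2 * (b' + 1))) * E u + C2)" using b'0 by (rule mult_left_mono)
    also have "\<dots> \<le> E u / 2 + b' * C2"
    proof -
      have "b' * (1 / (2 * (b' + 1))) \<le> 1 / 2" using b'0 by (simp add: field_simps)
      then have "b' * (1 / (2 * (b' + 1))) * E u \<le> 1 / 2 * E u" by (rule mult_right_mono) simp
      then show ?thesis by (simp add: distrib_left mult.assoc)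
    qed
    finally show "E u \<le> 2 * (a' + b' * C2)" using 1 by simp
  qed
qed

lemma T_le:
  assumes "u \<in> X" shows "T u \<le> (E u / S) powr (r / p)"
proof -
  have "T u powr (p / r) \<le> E u / S" using sob [OF assms] S by (simp add: T_def field_simps)
  then have "(T u powr (p / r)) powr (r / p) \<le> (E u / S) powr (r / p)"
    using p1 r1 by (intro powr_mono2) auto
  then show ?thesis using p1 r1 by (simp add: powr_powr)
qed

lemma T_le_bound: "u \<in> X \<Longrightarrow> E u \<le> K \<Longrightarrow> T u \<le> (K / S) powr (r / p)"
  using T_le [of u] S p1 r1 by (rule_tac order_trans [OF _ powr_mono2]) (auto intro!: divide_right_mono)

lemma minus_cong_diff: "u \<in> X \<Longrightarrow> v \<in> X \<Longrightarrow> AE z in EMm. dmap (\<lambda>x. u x - v x) z = dmap u z - dmap v z"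
  by (rule minus.AE_dmap_diff [OF p1]) (use minus_1 in \<open>auto simp: regular_for_def\<close>)

lemma minus_arctan_le: "u \<in> X \<Longrightarrow> m (\<lambda>x. 1 * arctan (u x / 1)) \<le> m u"
proof -
  assume u: "u \<in> X"
  have le: "AE z in EMm. norm (dmap (\<lambda>x. 1 * arctan (u x / 1)) z) powr p \<le> norm (dmap u z) powr p"
    using minus.AE_dmap_arctan_le [OF p1, of u 1] minus_1
    by (auto simp: regular_for_def elim!: eventually_mono intro!: powr_mono2 less_imp_le [OF less_trans [OF zero_less_one p1]])
  show ?thesis unfolding energy_def
    by (rule integral_mono_AE [OF Lp_funD(2) [OF minus_Lp [OF Xb_arctan(1) [OF u zero_less_one]]] Lp_funD(2) [OF minus_Lp [OF u]] le])
qed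

lemma mixed_integral_small_EM:
  fixes M :: "'m measure"
  assumes "s > 1" "K \<ge> 0" "\<eta> > 0"
  obtains \<delta> where "\<delta> > 0" "\<And>(f :: 'm \<Rightarrow> 'e::euclidean_space) h. Lp_fun M s f \<Longrightarrow> Lp_fun M s h \<Longrightarrow> (\<integral>x. norm (f x) powr s \<partial>M) \<le> K \<Longrightarrow>
    (\<integral>x. norm (h x) powr s \<partial>M) \<le> \<delta> \<Longrightarrow> \<bar>\<integral>x. pflux s (f x) \<bullet> h x \<partial>M\<bar> \<le> \<eta>"
  using mixed_integral_small [OF assms, of M, where 'e = 'e] by blast

text \<open>Boundedness trades every power above 1 for the first power: even the critical integral
  of \<open>arctan (u - v)\<close> is controlled by the distance in mean.\<close>

lemma arctan_powr_le:
  assumes "s > 1" shows "\<bar>arctan t\<bar> powr s \<le> 2 powr (s - 1) * \<bar>t\<bar>"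
proof -
  have "\<bar>arctan t\<bar> \<le> 2" using arctan_bounded [of t] pi_less_4 by (auto simp: abs_le_iff)
  then have "\<bar>arctan t\<bar> powr (s - 1) * \<bar>arctan t\<bar> \<le> 2 powr (s - 1) * \<bar>t\<bar>"
    using assms by (intro mult_mono powr_mono2 abs_arctan_le) auto
  then show ?thesis using powr_p_mult [of "\<bar>arctan t\<bar>" s] by simp
qed

text \<open>Flux differences tested with \<open>arctan (u - v)\<close>: apart from the derivative of the functional all terms are
  of lower order, including the critical one, because \<open>arctan\<close> is bounded.\<close>

lemma flux_gap_small:
  assumes K: "K \<ge> 0" and \<eta>: "\<eta> > 0"
  shows "\<exists>\<delta>>0. \<forall>u\<in>X. \<forall>v\<in>X. E u \<le> K \<longrightarrow> E v \<le> K \<longrightarrow> (\<integral>x. \<bar>u x - v x\<bar> \<partial>lborel) \<le> \<delta> \<longrightarrow> (\<integral>x. \<bar>u x - v x\<bar> powr p \<partial>lborel) \<le> \<delta> \<longrightarrow>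
    (\<forall>e. (\<forall>h\<in>X. \<bar>DJ u h\<bar> \<le> e * E h powr (1 / p)) \<longrightarrow> (\<forall>h\<in>X. \<bar>DJ v h\<bar> \<le> e * E h powr (1 / p)) \<longrightarrow> 0 \<le> e \<longrightarrow> e \<le> \<delta> \<longrightarrow>
    A u (arctan_diff u v) - A v (arctan_diff u v) \<le> \<eta>)"
proof -
  define B where "B = 2 powr p * (K + K)"
  have B0: "B \<ge> 0" using K by (simp add: B_def)
  \<comment> \<open>The budget for each of \<open>u\<close> and \<open>v\<close>: one
    \<open>\<theta>\<close> for the negative part, one for the critical term,
    \<open>lam * \<theta>\<close> for the lower order term, and
    \<open>\<theta> * (B powr (1 / p) + 1)\<close> for the derivative.\<close>
  define \<theta> where "\<theta> = \<eta> / (4 + 2 * lam + 2 * (B powr (1 / p) + 1))"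
  have den: "4 + 2 * lam + 2 * (B powr (1 / p) + 1) > 0" using lam by (auto intro!: add_pos_nonneg)
  have \<theta>: "\<theta> > 0" using \<eta> den by (simp add: \<theta>_def)
  have \<theta>eq: "(4 + 2 * lam + 2 * (B powr (1 / p) + 1)) * \<theta> = \<eta>" using den by (simp add: \<theta>_def)
  obtain \<delta>1 where \<delta>1: "\<delta>1 > 0" "\<And>(f :: real \<times> 'a \<times> 'a \<Rightarrow> 'a) h. Lp_fun EMm p f \<Longrightarrow> Lp_fun EMm p h \<Longrightarrow> (\<integral>x. norm (f x) powr p \<partial>EMm) \<le> K \<Longrightarrow>
    (\<integral>x. norm (h x) powr p \<partial>EMm) \<le> \<delta>1 \<Longrightarrow> \<bar>\<integral>x. pflux p (f x) \<bullet> h x \<partial>EMm\<bar> \<le> \<theta>"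
    by (rule mixed_integral_small_EM [OF p1 K \<theta>]) (rule that)
  obtain Cq where Cq: "Cq \<ge> 0" "\<And>u. u \<in> X \<Longrightarrow> Q u \<le> 1 * T u + Cq" using Q_le_T [of 1] by auto
  define TK where "TK = (K / S) powr (r / p)"
  have TK: "T u \<le> TK" if "u \<in> X" "E u \<le> K" for u
    using T_le_bound [OF that] by (simp add: TK_def)
  have TK0: "TK \<ge> 0" "TK + Cq \<ge> 0" using Cq(1) by (auto simp: TK_def)
  obtain \<delta>2 where \<delta>2: "\<delta>2 > 0" "\<And>(f :: 'a \<Rightarrow> real) h. Lp_fun lborel q f \<Longrightarrow> Lp_fun lborel q h \<Longrightarrow> (\<integral>x. norm (f x) powr q \<partial>lborel) \<le> TK + Cq \<Longrightarrow>
    (\<integral>x. norm (h x) powr q \<partial>lborel) \<le> \<delta>2 \<Longrightarrow> \<bar>\<integral>x. pflux q (f x) \<bullet> h x \<partial>lborel\<bar> \<le> \<theta>"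
    by (rule mixed_integral_small_EM [OF q1 TK0(2) \<theta>]) (rule that)
  obtain \<delta>3 where \<delta>3: "\<delta>3 > 0" "\<And>(f :: 'a \<Rightarrow> real) h. Lp_fun lborel r f \<Longrightarrow> Lp_fun lborel r h \<Longrightarrow> (\<integral>x. norm (f x) powr r \<partial>lborel) \<le> TK \<Longrightarrow>
    (\<integral>x. norm (h x) powr r \<partial>lborel) \<le> \<delta>3 \<Longrightarrow> \<bar>\<integral>x. pflux r (f x) \<bullet> h x \<partial>lborel\<bar> \<le> \<theta>"
    by (rule mixed_integral_small_EM [OF r1 TK0(1) \<theta>]) (rule that)
  obtain \<delta>4 where \<delta>4: "\<delta>4 > 0" "\<And>v. v \<in> X \<Longrightarrow> E v \<le> B \<Longrightarrow> power_integral p v \<le> \<delta>4 \<Longrightarrow> m v \<le> \<delta>1"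
    using minus_compact [OF B0 \<delta>1(1)] by blast
  \<comment> \<open>The divisors undo the factor \<open>2 powr (s - 1)\<close> of
    \<open>arctan_powr_le\<close> for \<open>s = q\<close> and \<open>s = r\<close>; the entry
    \<open>\<theta>\<close> bounds the error \<open>e\<close> of the derivative.\<close>
  define \<delta> where "\<delta> = min \<theta> (min \<delta>4 (min (\<delta>2 / 2 powr (q - 1)) (\<delta>3 / 2 powr (r - 1))))"
  show ?thesis
  proof (intro exI [of _ \<delta>] conjI ballI allI impI)
    show "\<delta> > 0" using \<theta> \<delta>4 \<delta>2 \<delta>3 by (simp add: \<delta>_def)
    fix u v e
    assume u: "u \<in> X" and v: "v \<in> X" and uK: "E u \<le> K" and vK: "E v \<le> K"
      and L1: "(\<integral>x. \<bar>u x - v x\<bar> \<partial>lborel) \<le> \<delta>" and Lp: "(\<integral>x. \<bar>u x - v x\<bar> powr p \<partial>lborel) \<le> \<delta>"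
      and Du: "\<forall>h\<in>X. \<bar>DJ u h\<bar> \<le> e * E h powr (1 / p)" and Dv: "\<forall>h\<in>X. \<bar>DJ v h\<bar> \<le> e * E h powr (1 / p)"
      and e: "0 \<le> e" "e \<le> \<delta>"
    define w where "w x = u x - v x" for x
    define h where "h x = 1 * arctan (w x / 1)" for x
    have w: "w \<in> X" unfolding w_def [abs_def] by (rule Xb_diff [OF u v])
    have h: "h \<in> X" unfolding h_def [abs_def] by (rule Xb_arctan(1) [OF w]) simp
    have Ew: "E w \<le> B"
    proof -
      have "E w \<le> 2 powr p * (E u + E v)" unfolding w_def [abs_def] by (rule energy_diff_le [OF u v])
      also have "\<dots> \<le> B" unfolding B_def using uK vK by (intro mult_left_mono) auto
      finally show ?thesis .
    qed
    have Eh: "E h \<le> B"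
      using Xb_arctan(2) [OF w zero_less_one] Ew unfolding h_def [abs_def] by linarith
    have mh: "m h \<le> \<delta>1"
      using minus_arctan_le [OF w] \<delta>4(2) [OF w Ew] Lp unfolding h_def [abs_def] w_def \<delta>_def by linarith
    have hs: "(\<integral>x. norm (h x) powr s \<partial>lborel) \<le> \<delta>s" if s: "1 < s" "s \<le> r" and ds: "\<delta> \<le> \<delta>s / 2 powr (s - 1)" for s \<delta>s
    proof -
      have "(\<integral>x. norm (h x) powr s \<partial>lborel) \<le> (\<integral>x. 2 powr (s - 1) * \<bar>w x\<bar> \<partial>lborel)"
        using Lp_funD(2) [OF Xb_Lp [OF h, of s]] Xb_integrable [OF w] s arctan_powr_le [OF s(1)]
        by (intro integral_mono) (auto simp: h_def)
      also have "\<dots> \<le> 2 powr (s - 1) * \<delta>" using L1 by (simp add: w_def)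
      also have "\<dots> \<le> 2 powr (s - 1) * (\<delta>s / 2 powr (s - 1))" using ds by (intro mult_left_mono) auto
      finally show ?thesis by simp
    qed
    have t: "\<bar>Am f h\<bar> \<le> \<theta>" "\<bar>Bf q f h\<bar> \<le> \<theta>" "\<bar>Bf r f h\<bar> \<le> \<theta>" if f: "f \<in> X" "E f \<le> K" for f
    proof -
      have "m f \<le> K" using minus_half [OF f(1)] f(2) energy_nonneg [of f] by linarith
      then show "\<bar>Am f h\<bar> \<le> \<theta>" unfolding Am_def using mh
        by (intro \<delta>1(2) minus_Lp f(1) h) (auto simp: energy_def)
      have "Q f \<le> TK + Cq" using Cq(2) [OF f(1)] TK [OF f] by linarith
      then show "\<bar>Bf q f h\<bar> \<le> \<theta>" unfolding Bf_def using q1 qr hs [of q \<delta>2]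
        by (intro \<delta>2(2) Xb_Lp f(1) h) (auto simp: Q_def \<delta>_def)
      show "\<bar>Bf r f h\<bar> \<le> \<theta>" unfolding Bf_def using r1 TK [OF f] hs [of r \<delta>3]
        by (intro \<delta>3(2) Xb_Lp f(1) h) (auto simp: T_def \<delta>_def)
    qed
    have De: "e * E h powr (1 / p) \<le> \<theta> * (B powr (1 / p) + 1)"
    proof -
      have "E h powr (1 / p) \<le> B powr (1 / p)" using Eh p1 by (intro powr_mono2) auto
      moreover have "e \<le> \<theta>" using e(2) by (simp add: \<delta>_def)
      ultimately show ?thesis using e \<theta> by (intro mult_mono) auto
    qed
    have expand: "A f h = DJ f h + Am f h + lam * Bf q f h + Bf r f h" for f by (simp add: DJ_def)
    have lamB: "\<bar>lam * Bf q f h\<bar> \<le> lam * \<theta>" if "f \<in> X" "E f \<le> K" for f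
      using t(2) [OF that] lam by (simp add: abs_mult mult_left_mono)
    have one: "\<bar>A f h\<bar> \<le> (2 + lam + (B powr (1 / p) + 1)) * \<theta>" if f: "f \<in> X" "E f \<le> K" "\<bar>DJ f h\<bar> \<le> e * E h powr (1 / p)" for f
    proof -
      have "\<bar>A f h\<bar> \<le> \<bar>DJ f h\<bar> + \<bar>Am f h\<bar> + \<bar>lam * Bf q f h\<bar> + \<bar>Bf r f h\<bar>" unfolding expand by linarith
      also have "\<dots> \<le> \<theta> * (B powr (1 / p) + 1) + \<theta> + lam * \<theta> + \<theta>"
        using f(3) De t(1,3) [OF f(1,2)] lamB [OF f(1,2)] by linarith
      finally show ?thesis by (simp add: algebra_simps)
    qed
    have "\<bar>A u h\<bar> \<le> (2 + lam + (B powr (1 / p) + 1)) * \<theta>" "\<bar>A v h\<bar> \<le> (2 + lam + (B powr (1 / p) + 1)) * \<theta>"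
      using one [OF u uK] one [OF v vK] Du Dv h by auto
    then have "A u h - A v h \<le> 2 * ((2 + lam + (B powr (1 / p) + 1)) * \<theta>)" by linarith
    also have "\<dots> = \<eta>" unfolding \<theta>eq [symmetric] by (simp add: algebra_simps)
    finally show "A u (arctan_diff u v) - A v (arctan_diff u v) \<le> \<eta>"
      unfolding h_def [abs_def] w_def .
  qed
qed

end

section \<open>Convergence of gradients when 1 is an atom\<close>

context unit_measure
begin

lemma integral_slice_1:
  fixes f :: "'a::euclidean_space \<Rightarrow> real"
  assumes p: "p > 1" and f: "f \<in> borel_measurable borel" "\<And>x. 0 \<le> f x" and F: "integrable (energy_measure \<mu> p) F"
    and F0: "AE z in energy_measure \<mu> p. 0 \<le> F z"
    and le: "AE z in energy_measure \<mu> p. fst z = 1 \<longrightarrow> f (fst (snd z)) \<le> F z" and a: "emeasure \<mu> {1} \<noteq> 0"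
  shows "integrable lborel f" "(\<integral>x. f x \<partial>lborel) \<le> (\<integral>z. F z \<partial>energy_measure \<mu> p) / measure \<mu> {1}"
proof -
  define a1 where "a1 = measure \<mu> {1}"
  have a1: "emeasure \<mu> {1} = ennreal a1" "a1 > 0"
    using a by (auto simp: a1_def emeasure_eq_measure less_le)
  have "ennreal a1 * (\<integral>\<^sup>+x. ennreal (f x) \<partial>lborel) \<le> (\<integral>\<^sup>+z. ennreal (F z) \<partial>energy_measure \<mu> p)"
    unfolding a1(1) [symmetric]
    by (rule nn_integral_slice_1 [OF p]) (use f F le in \<open>auto intro: ennreal_leI elim!: eventually_mono\<close>)
  also have "\<dots> = ennreal (\<integral>z. F z \<partial>energy_measure \<mu> p)" using F F0 by (simp add: nn_integral_eq_integral)
  finally have le: "ennreal a1 * (\<integral>\<^sup>+x. ennreal (f x) \<partial>lborel) \<le> ennreal (\<integral>z. F z \<partial>energy_measure \<mu> p)" .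
  have "(\<integral>\<^sup>+x. ennreal (f x) \<partial>lborel) < \<infinity>"
  proof (rule ccontr)
    assume "\<not> ?thesis"
    then have "(\<integral>\<^sup>+x. ennreal (f x) \<partial>lborel) = \<infinity>" by (simp add: less_top [symmetric])
    then show False using le a1(2) by (simp add: ennreal_mult_top top_unique)
  qed
  then show i: "integrable lborel f" using f by (intro integrableI_bounded) auto
  have "ennreal (a1 * (\<integral>x. f x \<partial>lborel)) \<le> ennreal (\<integral>z. F z \<partial>energy_measure \<mu> p)"
    using le i f a1 by (simp add: nn_integral_eq_integral ennreal_mult)
  then have "a1 * (\<integral>x. f x \<partial>lborel) \<le> (\<integral>z. F z \<partial>energy_measure \<mu> p)"
    using integral_nonneg_AE [OF F0] by (simp add: ennreal_le_iff)
  then show "(\<integral>x. f x \<partial>lborel) \<le> (\<integral>z. F z \<partial>energy_measure \<mu> p) / measure \<mu> {1}"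
    using a1(2) by (simp add: a1_def field_simps)
qed

end

context energy_space
begin

lemma Xb_wgrad: "u \<in> X \<Longrightarrow> emeasure \<mu> {1} \<noteq> 0 \<Longrightarrow> wgrad u (grad_of u)"
  using XbD(4) wgrad_grad_of unfolding regular_for_def by blast

lemma grad_Lp:
  assumes u: "u \<in> X" and a: "emeasure \<mu> {1} \<noteq> 0"
  shows "Lp_fun lborel p (grad_of u)" "(\<integral>x. norm (grad_of u x) powr p \<partial>lborel) \<le> E u / measure \<mu> {1}"
proof -
  have le: "AE z in EM. fst z = 1 \<longrightarrow> norm (grad_of u (fst (snd z))) powr p \<le> norm (dmap u z) powr p"
    by (intro AE_I2) (auto simp: dmap_def)
  note sl = integral_slice_1 [OF p1 _ _ Lp_funD(2) [OF XbD(5) [OF u]] _ le a]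
  show "Lp_fun lborel p (grad_of u)" unfolding Lp_fun_def using sl(1) by auto
  show "(\<integral>x. norm (grad_of u x) powr p \<partial>lborel) \<le> E u / measure \<mu> {1}"
    unfolding energy_def by (rule sl(2)) auto
qed

end

context ps_functional
begin

lemma L1_le: assumes "u \<in> X" shows "(\<integral>x. \<bar>u x\<bar> \<partial>lborel) \<le> T u + measure lborel \<Omega>"
proof -
  have "(\<integral>x. \<bar>u x\<bar> \<partial>lborel) \<le> (\<integral>x. \<bar>u x\<bar> powr r + indicator \<Omega> x \<partial>lborel)"
  proof (rule integral_mono)
    fix x
    have "\<bar>t\<bar> \<le> \<bar>t\<bar> powr r + 1" for t :: real
    proof (cases "\<bar>t\<bar> \<le> 1")
      case False
      then have "\<bar>t\<bar> powr 1 \<le> \<bar>t\<bar> powr r" using r1 by (intro powr_mono) auto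
      then show ?thesis using False by simp
    qed (simp add: add_increasing)
    then show "\<bar>u x\<bar> \<le> \<bar>u x\<bar> powr r + indicator \<Omega> x"
      using XbD(2) [OF assms, of x] by (cases "x \<in> \<Omega>") auto
  qed (use Xb_integrable [OF assms] Lp_funD(2) [OF sob_Lr [OF assms]] iO in auto)
  also have "\<dots> = T u + measure lborel \<Omega>"
    unfolding T_def using Lp_funD(2) [OF sob_Lr [OF assms]] iO by simp
  finally show ?thesis .
qed

lemma cancel_eighth: "2 * k * (e / (8 * k)) = e / 4" if "k > 0" for k e :: real
  using that by simp

text \<open>Where \<open>\<bar>u x - v x\<bar> \<le> 1\<close> the derivative of
  \<open>arctan\<close> is at least \<open>1 / 2\<close>, so the tested gap controls the
  monotonicity gap and \<open>norm_diff_le_pflux_gap\<close> applies. Elsewhere superlinear growth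
  bounds both gradients up to the constant \<open>C'\<close>, and
  \<open>C' \<le> C' * \<bar>u x - v x\<bar>\<close> there.\<close>

lemma gradient_gap:
  assumes K: "K \<ge> 0" and e: "e > 0" and a: "emeasure \<mu> {1} \<noteq> 0"
  shows "\<exists>\<eta>>0. \<forall>u\<in>X. \<forall>v\<in>X. E u \<le> K \<longrightarrow> E v \<le> K \<longrightarrow> (\<integral>x. \<bar>u x - v x\<bar> \<partial>lborel) \<le> \<eta> \<longrightarrow>
    A u (arctan_diff u v) - A v (arctan_diff u v) \<le> \<eta> \<longrightarrow>
    (\<integral>x. norm (grad_of u x - grad_of v x) \<partial>lborel) < e"
proof -
  define a1 where "a1 = measure \<mu> {1}"
  have a1: "a1 > 0" using a by (simp add: a1_def emeasure_eq_measure less_le)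
  define V where "V = measure lborel (cball (0::'a) R)"
  have V0: "V \<ge> 0" by (simp add: V_def)
  \<comment> \<open>The coefficient of \<open>\<epsilon>\<close> in the integral of \<open>W\<close>
    below, plus 1 for positivity: the volume of the ball, and twice the bound \<open>K / a1\<close>
    for each of the two gradients.\<close>
  define k where "k = V + 4 * (K / a1) + 1"
  have den: "k > 0" unfolding k_def using V0 K a1 by (auto intro!: add_nonneg_pos add_nonneg_nonneg)
  define \<epsilon> where "\<epsilon> = e / (4 * k)"
  have \<epsilon>: "\<epsilon> > 0" using e den by (simp add: \<epsilon>_def)
  have \<epsilon>le: "\<epsilon> * (V + 4 * (K / a1)) \<le> e / 4"
  proof -
    have "\<epsilon> * (V + 4 * (K / a1)) \<le> \<epsilon> * k" using \<epsilon> by (intro mult_left_mono) (auto simp: k_def)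
    also have "\<dots> = e / 4" using den by (simp add: \<epsilon>_def)
    finally show ?thesis .
  qed
  obtain C where C: "C \<ge> 0" "\<And>x y :: 'a. norm (x - y) \<le> \<epsilon> * (1 + norm x powr p + norm y powr p) + C * ((pflux p x - pflux p y) \<bullet> (x - y))"
    using norm_diff_le_pflux_gap [OF p1 \<epsilon>] by blast
  obtain C' where C': "C' \<ge> 0" "\<And>x. x \<ge> 0 \<Longrightarrow> x powr 1 \<le> \<epsilon> * x powr p + C'"
    using powr_le_eps [of 1 p \<epsilon>] p1 \<epsilon> by auto
  define \<eta> where "\<eta> = min (a1 * e / (8 * (C + 1))) (e / (8 * (C' + 1)))"
  have \<eta>: "\<eta> > 0" using a1 e C C' by (simp add: \<eta>_def)
  have \<eta>1: "2 * C * (\<eta> / a1) \<le> e / 4"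
  proof -
    have "\<eta> / a1 \<le> (a1 * e / (8 * (C + 1))) / a1" using a1 by (intro divide_right_mono) (auto simp: \<eta>_def)
    then have "2 * C * (\<eta> / a1) \<le> 2 * (C + 1) * (e / (8 * (C + 1)))"
      using a1 C e \<eta> by (intro mult_mono) auto
    also have "\<dots> = e / 4" using C by (intro cancel_eighth) simp
    finally show ?thesis .
  qed
  have \<eta>2: "2 * C' * \<eta> \<le> e / 4"
  proof -
    have "2 * C' * \<eta> \<le> 2 * (C' + 1) * (e / (8 * (C' + 1)))"
      using C' \<eta> by (intro mult_mono) (auto simp: \<eta>_def)
    also have "\<dots> = e / 4" using C' by (intro cancel_eighth) simp
    finally show ?thesis .
  qed
  show ?thesis
  proof (intro exI [of _ \<eta>] conjI ballI impI \<eta>)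
    fix u v assume u: "u \<in> X" and v: "v \<in> X" and uK: "E u \<le> K" and vK: "E v \<le> K"
      and L1: "(\<integral>x. \<bar>u x - v x\<bar> \<partial>lborel) \<le> \<eta>"
      and G: "A u (arctan_diff u v) - A v (arctan_diff u v) \<le> \<eta>"
    define h where "h x = 1 * arctan ((u x - v x) / 1)" for x
    have h: "h \<in> X" unfolding h_def [abs_def] by (rule Xb_arctan(1) [OF Xb_diff [OF u v]]) simp
    let ?g = "grad_of u" and ?k = "grad_of v"
    have wu: "wgrad u ?g" and wv: "wgrad v ?k" using Xb_wgrad [OF _ a] u v by auto
    note [measurable] = XbD(1) [OF u] XbD(1) [OF v] borel_measurable_pflux [OF p1]
    define \<psi> where "\<psi> x = 1 / (1 + (u x - v x)\<^sup>2)" for x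
    define gap where "gap x = (pflux p (?g x) - pflux p (?k x)) \<bullet> (?g x - ?k x)" for x
    have gap0: "gap x \<ge> 0" for x unfolding gap_def by (rule pflux_mono [OF p1])
    have \<psi>0: "\<psi> x \<ge> 0" for x by (simp add: \<psi>_def)
    define F where "F z = (pflux p (dmap u z) - pflux p (dmap v z)) \<bullet> dmap h z" for z
    have iF: "integrable EM F"
      unfolding F_def inner_diff_left
      using Lp_fun_pairing(1) [OF p1 XbD(5) XbD(5)] u v h by auto
    have AEF: "AE z in EM. 0 \<le> F z \<and> (fst z = 1 \<longrightarrow> F z = \<psi> (fst (snd z)) * gap (fst (snd z)))"
      using AE_flux_arctan [OF p1 XbD(4) [OF u] XbD(4) [OF v]]
    proof eventually_elim
      case (elim z)
      have "dmap f z = grad_of f (fst (snd z))" if "fst z = 1" for f using that by (cases z) (simp add: dmap_def)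
      then show ?case using elim unfolding F_def h_def [abs_def] \<psi>_def gap_def by auto
    qed
    have gapm: "(\<lambda>x. \<psi> x * gap x) \<in> borel_measurable borel" unfolding \<psi>_def gap_def by measurable
    have sl1: "AE z in EM. 0 \<le> F z" using AEF by eventually_elim simp
    have sl2: "AE z in EM. fst z = 1 \<longrightarrow> \<psi> (fst (snd z)) * gap (fst (snd z)) \<le> F z" using AEF by eventually_elim simp
    note sl = integral_slice_1 [OF p1 gapm _ iF sl1 sl2 a]
    have "(\<integral>z. F z \<partial>EM) = A u h - A v h"
      unfolding F_def A_def inner_diff_left using Lp_fun_pairing(1) [OF p1 XbD(5) XbD(5)] u v h by auto
    then have gapI: "integrable lborel (\<lambda>x. \<psi> x * gap x)" "(\<integral>x. \<psi> x * gap x \<partial>lborel) \<le> \<eta> / a1"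
      using sl gap0 \<psi>0 G a1 unfolding a1_def [symmetric] h_def [abs_def]
      by (auto intro: order_trans [OF _ divide_right_mono])
    note gu = grad_Lp [OF u a] and gv = grad_Lp [OF v a]
    have gK: "(\<integral>x. norm (?g x) powr p \<partial>lborel) \<le> K / a1" "(\<integral>x. norm (?k x) powr p \<partial>lborel) \<le> K / a1"
      using gu(2) gv(2) uK vK a1 unfolding a1_def [symmetric] by (auto intro: order_trans [OF _ divide_right_mono])
    define W where "W x = indicator (cball 0 R) x * \<epsilon> + 2 * \<epsilon> * norm (?g x) powr p + 2 * \<epsilon> * norm (?k x) powr p + 2 * C * (\<psi> x * gap x) + 2 * C' * \<bar>u x - v x\<bar>" for x
    have iC: "integrable lborel (indicator (cball (0::'a) R) :: 'a \<Rightarrow> real)"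
      using emeasure_lborel_cball_finite [of "0::'a" R] by (intro integrable_real_indicator) auto
    have iuv: "integrable lborel (\<lambda>x. \<bar>u x - v x\<bar>)" using Xb_integrable u v by auto
    have "(\<integral>x. norm (?g x - ?k x) \<partial>lborel) \<le> (\<integral>x. W x \<partial>lborel)"
    proof (rule integral_mono_AE)
      show "integrable lborel (\<lambda>x. norm (?g x - ?k x))" using wgradD(2) [OF wu] wgradD(2) [OF wv] by auto
      show "integrable lborel W"
        unfolding W_def using iC iuv gapI(1) Lp_funD(2) [OF gu(1)] Lp_funD(2) [OF gv(1)] by auto
      have sg: "AE x in lborel. x \<in> - cball 0 R \<longrightarrow> ?g x = 0" by (rule wgrad_support [OF wu XbD(3) [OF u]])
      have sk: "AE x in lborel. x \<in> - cball 0 R \<longrightarrow> ?k x = 0" by (rule wgrad_support [OF wv XbD(3) [OF v]])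
      from sg sk show "AE x in lborel. norm (?g x - ?k x) \<le> W x"
      proof eventually_elim
        case (elim x)
        have pos: "0 \<le> 2 * C * (\<psi> x * gap x)" "0 \<le> 2 * C' * \<bar>u x - v x\<bar>" "0 \<le> \<epsilon> * norm (?g x) powr p" "0 \<le> \<epsilon> * norm (?k x) powr p"
          using C C' gap0 \<psi>0 \<epsilon> by auto
        show ?case
        proof (cases "x \<in> cball 0 R")
          case False
          then have "norm (?g x - ?k x) = 0" using elim by simp
          also have "0 \<le> W x" unfolding W_def using False pos by simp
          finally show ?thesis .
        next
          case inC: True
          show ?thesis
          proof (cases "\<bar>u x - v x\<bar> \<le> 1")
            case True
            then have "(u x - v x)\<^sup>2 \<le> 1" by (simp add: abs_square_le_1)
            then have "1 \<le> 2 * \<psi> x" unfolding \<psi>_def by (simp add: field_simps add_pos_nonneg)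
            then have "C * (1 * gap x) \<le> C * ((2 * \<psi> x) * gap x)"
              using C gap0 by (intro mult_left_mono mult_right_mono) auto
            then have cg: "C * gap x \<le> 2 * C * (\<psi> x * gap x)" by (simp add: mult_ac)
            have "norm (?g x - ?k x) \<le> \<epsilon> * (1 + norm (?g x) powr p + norm (?k x) powr p) + C * gap x"
              unfolding gap_def by (rule C(2))
            also have "\<dots> = \<epsilon> + \<epsilon> * norm (?g x) powr p + \<epsilon> * norm (?k x) powr p + C * gap x"
              by (simp add: distrib_left)
            finally show ?thesis using cg pos inC unfolding W_def by simp
          next
            case False
            have "C' * 1 \<le> C' * \<bar>u x - v x\<bar>" using False C' by (intro mult_left_mono) auto
            moreover have "norm (?g x) \<le> \<epsilon> * norm (?g x) powr p + C'" "norm (?k x) \<le> \<epsilon> * norm (?k x) powr p + C'"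
              using C'(2) [of "norm (?g x)"] C'(2) [of "norm (?k x)"] by auto
            moreover have "norm (?g x - ?k x) \<le> norm (?g x) + norm (?k x)" by (rule norm_triangle_ineq4)
            moreover have "2 * \<epsilon> * t = \<epsilon> * t + \<epsilon> * t" "2 * C' * t = C' * t + C' * t" for t by simp_all
            moreover have "indicator (cball 0 R) x * \<epsilon> = \<epsilon>" using inC by simp
            ultimately show ?thesis using pos \<epsilon> unfolding W_def by linarith
          qed
        qed
      qed
    qed
    also have "(\<integral>x. W x \<partial>lborel) = V * \<epsilon> + 2 * \<epsilon> * (\<integral>x. norm (?g x) powr p \<partial>lborel) + 2 * \<epsilon> * (\<integral>x. norm (?k x) powr p \<partial>lborel)
      + 2 * C * (\<integral>x. \<psi> x * gap x \<partial>lborel) + 2 * C' * (\<integral>x. \<bar>u x - v x\<bar> \<partial>lborel)"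
      unfolding W_def V_def using iC iuv gapI(1) Lp_funD(2) [OF gu(1)] Lp_funD(2) [OF gv(1)] by simp
    also have "\<dots> \<le> V * \<epsilon> + 2 * \<epsilon> * (K / a1) + 2 * \<epsilon> * (K / a1) + 2 * C * (\<eta> / a1) + 2 * C' * \<eta>"
      using gK gapI(2) L1 V0 C C' \<epsilon> by (intro add_mono mult_left_mono) auto
    also have "V * \<epsilon> + 2 * \<epsilon> * (K / a1) + 2 * \<epsilon> * (K / a1) = \<epsilon> * (V + 4 * (K / a1))" by (simp add: algebra_simps)
    finally show "(\<integral>x. norm (?g x - ?k x) \<partial>lborel) < e" using \<epsilon>le \<eta>1 \<eta>2 e by linarith
  qed
qed

text \<open>No weak compactness is needed: the gradients form a Cauchy sequence in \<open>L\<^sup>1\<close>, so a subsequence of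
  \<open>dmap (u n)\<close> converges almost everywhere.\<close>

lemma PS_AE_limit:
  assumes u: "\<And>n. u n \<in> X" and K: "K \<ge> 0" "\<And>n. E (u n) \<le> K"
    and \<epsilon>: "\<And>n. 0 \<le> \<epsilon> n" "\<epsilon> \<longlonglongrightarrow> 0" and D: "\<And>n h. h \<in> X \<Longrightarrow> \<bar>DJ (u n) h\<bar> \<le> \<epsilon> n * E h powr (1 / p)"
  shows "\<exists>k w. strict_mono k \<and> w \<in> X \<and> (AE x in lborel. (\<lambda>n. u (k n) x) \<longlonglongrightarrow> w x)
    \<and> (AE z in EM. (\<lambda>n. dmap (u (k n)) z) \<longlonglongrightarrow> dmap w z)
    \<and> (AE z in EMm. (\<lambda>n. dmap (u (k n)) z) \<longlonglongrightarrow> dmap w z)"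
proof -
  define TK where "TK = (K / S) powr (r / p)"
  have TK: "T (u n) \<le> TK" for n
    using T_le_bound [OF u K(2)] by (simp add: TK_def)
  define B where "B = C\<sigma> * K + TK + measure lborel \<Omega>"
  have B: "B \<ge> 0" "C\<sigma> * K \<le> B" "TK + measure lborel \<Omega> \<le> B"
    using C\<sigma> K by (auto simp: B_def TK_def)
  have "\<exists>r u'. strict_mono r \<and> u' \<in> borel_measurable borel \<and> (AE x in lborel. (\<lambda>i. u (r i) x) \<longlonglongrightarrow> u' x)
    \<and> (\<forall>x. u' x = lim (\<lambda>i. u (r i) x))"
  proof (rule L1_compactness [OF Xb_integrable [OF u] _ p1 \<sigma> _ _ B(1)])
    show "u n x = 0" if "x \<notin> ball 0 R" for n x by (rule XbD(3) [OF u that])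
    show "gagliardo p \<sigma> (u n) \<le> ennreal B" for n
      using gag [OF u, of n] mult_left_mono [OF K(2) [of n] C\<sigma>] B(2) by (meson ennreal_leI order_trans)
    show "(\<integral>x. \<bar>u n x\<bar> \<partial>lborel) \<le> B" for n using L1_le [OF u, of n] TK [of n] B(3) by linarith
  qed
  then obtain k1 w where k1: "strict_mono k1" and wm [measurable]: "w \<in> borel_measurable borel"
    and wl: "AE x in lborel. (\<lambda>i. u (k1 i) x) \<longlonglongrightarrow> w x" and wlim: "\<And>x. w x = lim (\<lambda>i. u (k1 i) x)" by blast
  have w0: "w x = 0" if "x \<notin> \<Omega>" for x using XbD(2) [OF u that] by (simp add: wlim)
  have Lw: "Lp_fun lborel r w"
    by (rule Lp_fun_limit(1) [OF sob_Lr [OF u] _ _ wl, where B = TK]) (use TK r1 in \<open>auto simp: T_def\<close>)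
  have Td: "(\<integral>x. \<bar>u (k1 n) x - w x\<bar> powr r \<partial>lborel) \<le> 2 powr r * (TK + T w)" for n
  proof -
    have "(\<integral>x. \<bar>u (k1 n) x - w x\<bar> powr r \<partial>lborel) \<le> (\<integral>x. 2 powr r * (\<bar>u (k1 n) x\<bar> powr r + \<bar>w x\<bar> powr r) \<partial>lborel)"
    proof (rule integral_mono)
      show "\<bar>u (k1 n) x - w x\<bar> powr r \<le> 2 powr r * (\<bar>u (k1 n) x\<bar> powr r + \<bar>w x\<bar> powr r)" for x
        using norm_powr_diff_le [of r "u (k1 n) x" "w x"] r1 by simp
    qed (use Lp_funD(2) [OF sob_Lr [OF u]] Lp_funD(2) [OF Lw] Lp_funD(2) [OF Lp_fun_diff [OF _ sob_Lr [OF u] Lw]] r1 in auto)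
    also have "\<dots> = 2 powr r * (T (u (k1 n)) + T w)"
      unfolding T_def using Lp_funD(2) [OF sob_Lr [OF u]] Lp_funD(2) [OF Lw] by simp
    also have "\<dots> \<le> 2 powr r * (TK + T w)" using TK by (intro mult_left_mono) auto
    finally show ?thesis .
  qed
  have low: "(\<lambda>n. \<integral>x. \<bar>u (k1 n) x - w x\<bar> powr s \<partial>lborel) \<longlonglongrightarrow> 0" if s: "0 < s" "s < r" for s
  proof (rule integral_powr_lower_tendsto_0(2) [OF s \<Omega>_sets _ Td])
    show "Lp_fun lborel r (\<lambda>x. u (k1 n) x - w x)" for n using r1 by (intro Lp_fun_diff sob_Lr u Lw) auto
    show "u (k1 n) x - w x = 0" if "x \<notin> \<Omega>" for n x using XbD(2) [OF u that] w0 [OF that] by simp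
    show "AE x in lborel. (\<lambda>n. u (k1 n) x - w x) \<longlonglongrightarrow> 0" using wl by eventually_elim (rule LIM_zero)
  qed
  have iw: "integrable lborel w"
    using Lp_fun_lower [OF _ r1 \<Omega>_sets Lw w0] by (auto simp: Lp_fun_def intro: integrable_abs_cancel)
  have low1: "(\<lambda>n. \<integral>x. \<bar>u (k1 n) x - w x\<bar> \<partial>lborel) \<longlonglongrightarrow> 0" using low [of 1] r1 by simp
  \<comment> \<open>Reduces the claim to a further subsequence along which the gradients converge to
    a gradient of \<open>w\<close>; without an atom at 1 any subsequence will do.\<close>
  have finish: ?thesis
    if k2: "strict_mono k2" and reg: "regular_for \<mu> w"
      and g: "emeasure \<mu> {1} \<noteq> 0 \<Longrightarrow> AE x in lborel. (\<lambda>n. grad_of (u (k1 (k2 n))) x) \<longlonglongrightarrow> grad_of w x" for k2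
  proof -
    have l: "AE x in lborel. (\<lambda>n. u (k1 (k2 n)) x) \<longlonglongrightarrow> w x"
      using wl by eventually_elim (use LIMSEQ_subseq_LIMSEQ [OF _ k2] in \<open>force simp: o_def\<close>)
    have d: "AE z in EM. (\<lambda>n. dmap (u (k1 (k2 n))) z) \<longlonglongrightarrow> dmap w z"
      by (rule AE_dmap_tendsto [OF p1 l g])
    have dm: "AE z in EMm. (\<lambda>n. dmap (u (k1 (k2 n))) z) \<longlonglongrightarrow> dmap w z"
      by (rule minus.AE_dmap_tendsto [OF p1 l]) (use minus_1 in simp)
    have Lwd: "Lp_fun EM p (dmap w)"
      by (rule Lp_fun_limit(1) [OF XbD(5) [OF u] _ dmap_measurable' [OF wm] d, where B = K])
        (use K p1 in \<open>auto simp: energy_def\<close>)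
    have "w \<in> X" by (rule XbI [OF wm w0 reg Lwd])
    then show ?thesis using strict_mono_o [OF k1 k2] l d dm by (intro exI [of _ "k1 \<circ> k2"] exI [of _ w]) auto
  qed
  show ?thesis
  proof (cases "emeasure \<mu> {1} = 0")
    case True
    then show ?thesis by (intro finish [of id]) (auto simp: regular_for_def strict_mono_id)
  next
    case a: False
    define a1 where "a1 = measure \<mu> {1}"
    have a1: "a1 > 0" using a by (simp add: a1_def emeasure_eq_measure less_le)
    have wg: "wgrad (u n) (grad_of (u n))" for n by (rule Xb_wgrad [OF u a])
    have cauchy: "\<exists>N. \<forall>i\<ge>N. \<forall>j\<ge>N. (\<integral>x. norm (grad_of (u (k1 i)) x - grad_of (u (k1 j)) x) \<partial>lborel) < e" if e: "e > 0" for e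
    proof -
      obtain \<eta> where \<eta>: "\<eta> > 0" "\<And>u v. u \<in> X \<Longrightarrow> v \<in> X \<Longrightarrow> E u \<le> K \<Longrightarrow> E v \<le> K \<Longrightarrow> (\<integral>x. \<bar>u x - v x\<bar> \<partial>lborel) \<le> \<eta> \<Longrightarrow>
          A u (arctan_diff u v) - A v (arctan_diff u v) \<le> \<eta> \<Longrightarrow>
          (\<integral>x. norm (grad_of u x - grad_of v x) \<partial>lborel) < e"
        using gradient_gap [OF K(1) e a] by blast
      obtain \<delta> where \<delta>: "\<delta> > 0" "\<And>u v e. u \<in> X \<Longrightarrow> v \<in> X \<Longrightarrow> E u \<le> K \<Longrightarrow> E v \<le> K \<Longrightarrow> (\<integral>x. \<bar>u x - v x\<bar> \<partial>lborel) \<le> \<delta> \<Longrightarrow>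
          (\<integral>x. \<bar>u x - v x\<bar> powr p \<partial>lborel) \<le> \<delta> \<Longrightarrow> (\<forall>h\<in>X. \<bar>DJ u h\<bar> \<le> e * E h powr (1 / p)) \<Longrightarrow> (\<forall>h\<in>X. \<bar>DJ v h\<bar> \<le> e * E h powr (1 / p)) \<Longrightarrow> 0 \<le> e \<Longrightarrow> e \<le> \<delta> \<Longrightarrow>
          A u (arctan_diff u v) - A v (arctan_diff u v) \<le> \<eta>"
        using flux_gap_small [OF K(1) \<eta>(1)] by blast
      have pdiff: "(\<integral>x. \<bar>u (k1 i) x - u (k1 j) x\<bar> powr s \<partial>lborel) \<le> 2 powr s * ((\<integral>x. \<bar>u (k1 i) x - w x\<bar> powr s \<partial>lborel) + (\<integral>x. \<bar>u (k1 j) x - w x\<bar> powr s \<partial>lborel))"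
        if s: "0 < s" "s < r" for i j s
      proof -
        have Lps: "Lp_fun lborel s (\<lambda>x. u (k1 i) x - w x)" for i
          by (rule Lp_fun_diff [OF less_imp_le [OF s(1)] Xb_Lp [OF u s(1) less_imp_le [OF s(2)]] Lp_fun_lower [OF s \<Omega>_sets Lw w0]])
        have "(\<integral>x. \<bar>u (k1 i) x - u (k1 j) x\<bar> powr s \<partial>lborel) \<le> (\<integral>x. 2 powr s * (\<bar>u (k1 i) x - w x\<bar> powr s + \<bar>u (k1 j) x - w x\<bar> powr s) \<partial>lborel)"
        proof (rule integral_mono)
          show "\<bar>u (k1 i) x - u (k1 j) x\<bar> powr s \<le> 2 powr s * (\<bar>u (k1 i) x - w x\<bar> powr s + \<bar>u (k1 j) x - w x\<bar> powr s)" for x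
            using norm_powr_diff_le [of s "u (k1 i) x - w x" "u (k1 j) x - w x"] s by simp
          have "Lp_fun lborel s (\<lambda>x. u (k1 i) x - u (k1 j) x)" using s by (intro Lp_fun_diff Xb_Lp u) auto
          then show "integrable lborel (\<lambda>x. \<bar>u (k1 i) x - u (k1 j) x\<bar> powr s)" by (auto simp: Lp_fun_def)
        qed (use Lp_funD(2) [OF Lps] in auto)
        also have "\<dots> = 2 powr s * ((\<integral>x. \<bar>u (k1 i) x - w x\<bar> powr s \<partial>lborel) + (\<integral>x. \<bar>u (k1 j) x - w x\<bar> powr s \<partial>lborel))"
          using Lp_funD(2) [OF Lps] by simp
        finally show ?thesis .
      qed
      define \<zeta> where "\<zeta> = min \<eta> \<delta>"
      have \<zeta>: "\<zeta> > 0" using \<eta> \<delta> by (simp add: \<zeta>_def)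
      have small: "\<exists>N. \<forall>i\<ge>N. \<forall>j\<ge>N. (\<integral>x. \<bar>u (k1 i) x - u (k1 j) x\<bar> powr s \<partial>lborel) \<le> \<zeta>" if s: "0 < s" "s < r" for s
      proof -
        define t where "t = \<zeta> / (2 powr s * 2)"
        have t: "t > 0" using \<zeta> by (simp add: t_def)
        from LIMSEQ_D [OF low [OF s] this]
        obtain N where N: "\<And>i. i \<ge> N \<Longrightarrow> (\<integral>x. \<bar>u (k1 i) x - w x\<bar> powr s \<partial>lborel) < t" by auto
        show ?thesis
        proof (intro exI allI impI)
          fix i j assume "i \<ge> N" "j \<ge> N"
          then have "2 powr s * ((\<integral>x. \<bar>u (k1 i) x - w x\<bar> powr s \<partial>lborel) + (\<integral>x. \<bar>u (k1 j) x - w x\<bar> powr s \<partial>lborel)) \<le> 2 powr s * (t + t)"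
            using N [of i] N [of j] by (intro mult_left_mono add_mono) auto
          also have "\<dots> = \<zeta>" by (simp add: t_def)
          finally show "(\<integral>x. \<bar>u (k1 i) x - u (k1 j) x\<bar> powr s \<partial>lborel) \<le> \<zeta>"
            using pdiff [OF s, of i j] by linarith
        qed
      qed
      obtain N1 where N1: "\<And>i j. i \<ge> N1 \<Longrightarrow> j \<ge> N1 \<Longrightarrow> (\<integral>x. \<bar>u (k1 i) x - u (k1 j) x\<bar> powr 1 \<partial>lborel) \<le> \<zeta>"
        using small [of 1] r1 by auto
      obtain N2 where N2: "\<And>i j. i \<ge> N2 \<Longrightarrow> j \<ge> N2 \<Longrightarrow> (\<integral>x. \<bar>u (k1 i) x - u (k1 j) x\<bar> powr p \<partial>lborel) \<le> \<zeta>"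
        using small [of p] p1 pr by auto
      obtain N3 where N3: "\<And>n. n \<ge> N3 \<Longrightarrow> \<epsilon> n < \<delta>"
        using LIMSEQ_D [OF \<epsilon>(2) \<delta>(1)] by (auto simp: abs_less_iff)
      show ?thesis
      proof (intro exI allI impI)
        fix i j assume ij: "i \<ge> max N1 (max N2 N3)" "j \<ge> max N1 (max N2 N3)"
        have L1: "(\<integral>x. \<bar>u (k1 i) x - u (k1 j) x\<bar> \<partial>lborel) \<le> \<zeta>" using N1 [of i j] ij by simp
        have Lp: "(\<integral>x. \<bar>u (k1 i) x - u (k1 j) x\<bar> powr p \<partial>lborel) \<le> \<zeta>" using N2 [of i j] ij by simp
        have ge: "k1 n \<ge> N3" if "n \<ge> max N1 (max N2 N3)" for n
          using seq_suble [OF k1, of n] that by simp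
        define e' where "e' = max (\<epsilon> (k1 i)) (\<epsilon> (k1 j))"
        have e': "0 \<le> e'" "e' \<le> \<delta>" using \<epsilon>(1) [of "k1 i"] N3 [OF ge [OF ij(1)]] N3 [OF ge [OF ij(2)]] by (auto simp: e'_def)
        have De: "\<forall>h\<in>X. \<bar>DJ (u (k1 i)) h\<bar> \<le> e' * E h powr (1 / p)" "\<forall>h\<in>X. \<bar>DJ (u (k1 j)) h\<bar> \<le> e' * E h powr (1 / p)"
          by (intro ballI order_trans [OF D mult_right_mono], auto simp: e'_def)+
        have "A (u (k1 i)) (\<lambda>x. 1 * arctan ((u (k1 i) x - u (k1 j) x) / 1)) - A (u (k1 j)) (\<lambda>x. 1 * arctan ((u (k1 i) x - u (k1 j) x) / 1)) \<le> \<eta>"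
          by (rule \<delta>(2) [OF u u K(2) K(2) _ _ De e']) (use L1 Lp in \<open>auto simp: \<zeta>_def\<close>)
        then show "(\<integral>x. norm (grad_of (u (k1 i)) x - grad_of (u (k1 j)) x) \<partial>lborel) < e"
          by (intro \<eta>(2) u K(2)) (use L1 in \<open>auto simp: \<zeta>_def\<close>)
      qed
    qed
    have ig: "integrable lborel (grad_of (u n))" for n by (rule wgradD(2) [OF wg])
    obtain k2 g where k2: "strict_mono k2" and gm: "g \<in> borel_measurable lborel"
      and gl: "AE x in lborel. (\<lambda>i. grad_of (u (k1 (k2 i))) x) \<longlonglongrightarrow> g x"
      using L1_cauchy_AE_limit [of lborel "\<lambda>n. grad_of (u (k1 n))", OF ig cauchy] by blast
    let ?C = "cball (0::'a) R"
    \<comment> \<open>All gradients vanish outside the ball, so the cut-off leaves the limit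
      unchanged almost everywhere; on a set of finite measure the power \<open>p\<close> then gives
      integrability.\<close>
    define h where "h x = indicator ?C x *\<^sub>R g x" for x
    have Cs: "?C \<in> sets lborel" "emeasure lborel ?C < \<infinity>" using emeasure_lborel_cball_finite [of "0::'a" R] by auto
    have hm: "h \<in> borel_measurable lborel"
      unfolding h_def using gm by (intro borel_measurable_scaleR borel_measurable_indicator) auto
    have hl: "AE x in lborel. (\<lambda>i. grad_of (u (k1 (k2 i))) x) \<longlonglongrightarrow> h x"
    proof -
      have "AE x in lborel. \<forall>i. x \<in> - ?C \<longrightarrow> grad_of (u (k1 (k2 i))) x = 0"
        unfolding AE_all_countable using wgrad_support [OF wg XbD(3) [OF u]] by blast
      then show ?thesis using gl
      proof eventually_elim
        case (elim x)
        show ?case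
        proof (cases "x \<in> ?C")
          case True then show ?thesis using elim(2) by (simp add: h_def)
        next
          case False then show ?thesis using elim(1) by (simp add: h_def)
        qed
      qed
    qed
    have gb: "(\<integral>x. norm (grad_of (u n) x) powr p \<partial>lborel) \<le> K / a1" for n
      using grad_Lp(2) [OF u a, of n] divide_right_mono [OF K(2) [of n], of a1] a1 unfolding a1_def [symmetric] by linarith
    have Lh: "Lp_fun lborel p h"
      by (rule Lp_fun_limit(1) [OF grad_Lp(1) [OF u a] gb hm hl]) (use p1 in simp)
    have ih: "integrable lborel h"
    proof -
      have Ln: "Lp_fun lborel p (\<lambda>x. norm (h x))" using Lh by (auto simp: Lp_fun_def)
      have "Lp_fun lborel 1 (\<lambda>x. norm (h x))"
        by (rule Lp_fun_lower [OF _ p1 Cs Ln]) (auto simp: h_def)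
      then show ?thesis using hm by (auto simp: Lp_fun_def intro: integrable_norm_cancel)
    qed
    \<comment> \<open>The bound on the power \<open>p\<close> upgrades almost everywhere convergence
      of the gradients to convergence in mean, the form in which \<open>wgrad_closed\<close> takes
      it.\<close>
    define f where "f n x = indicator ?C x * norm (grad_of (u (k1 (k2 n))) x - h x)" for n x
    have f1: "Lp_fun lborel p (f n)" "(\<integral>x. \<bar>f n x\<bar> powr p \<partial>lborel) \<le> 2 powr p * (K / a1 + (\<integral>x. norm (h x) powr p \<partial>lborel))" for n
    proof -
      have [measurable]: "h \<in> borel_measurable borel" using hm by simp
      have Cm [measurable]: "?C \<in> sets borel" by simp
      have fm: "f n \<in> borel_measurable lborel" unfolding f_def
        by (intro borel_measurable_times borel_measurable_indicator) auto
      have i: "integrable lborel (\<lambda>x. 2 powr p * (norm (grad_of (u (k1 (k2 n))) x) powr p + norm (h x) powr p))"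
        using Lp_funD(2) [OF grad_Lp(1) [OF u a]] Lp_funD(2) [OF Lh] by auto
      have le: "norm (f n x) powr p \<le> 2 powr p * (norm (grad_of (u (k1 (k2 n))) x) powr p + norm (h x) powr p)" for x
        using norm_powr_diff_le [of p "grad_of (u (k1 (k2 n))) x" "h x"] p1 by (cases "x \<in> ?C") (auto simp: f_def)
      show L: "Lp_fun lborel p (f n)" by (rule Lp_fun_bound [OF fm i]) (use le in auto)
      have "(\<integral>x. \<bar>f n x\<bar> powr p \<partial>lborel) \<le> (\<integral>x. 2 powr p * (norm (grad_of (u (k1 (k2 n))) x) powr p + norm (h x) powr p) \<partial>lborel)"
        using Lp_funD(2) [OF L] i le by (intro integral_mono) auto
      also have "\<dots> = 2 powr p * ((\<integral>x. norm (grad_of (u (k1 (k2 n))) x) powr p \<partial>lborel) + (\<integral>x. norm (h x) powr p \<partial>lborel))"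
        using Lp_funD(2) [OF grad_Lp(1) [OF u a]] Lp_funD(2) [OF Lh] by simp
      also have "\<dots> \<le> 2 powr p * (K / a1 + (\<integral>x. norm (h x) powr p \<partial>lborel))"
        using gb by (intro mult_left_mono add_right_mono) auto
      finally show "(\<integral>x. \<bar>f n x\<bar> powr p \<partial>lborel) \<le> 2 powr p * (K / a1 + (\<integral>x. norm (h x) powr p \<partial>lborel))" .
    qed
    have flim: "AE x in lborel. (\<lambda>n. f n x) \<longlonglongrightarrow> 0"
      using hl
    proof eventually_elim
      case (elim x)
      have "(\<lambda>n. norm (grad_of (u (k1 (k2 n))) x - h x)) \<longlonglongrightarrow> 0"
        using tendsto_norm_zero [OF LIM_zero [OF elim]] .
      from tendsto_mult_right_zero [OF this, of "indicator ?C x"] show ?case by (simp add: f_def)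
    qed
    have "(\<lambda>n. \<integral>x. \<bar>f n x\<bar> powr 1 \<partial>lborel) \<longlonglongrightarrow> 0"
      by (rule integral_powr_lower_tendsto_0(2) [OF _ p1 Cs f1 _ flim]) (auto simp: f_def)
    moreover have "(\<integral>x. \<bar>f n x\<bar> powr 1 \<partial>lborel) = (\<integral>x. norm (grad_of (u (k1 (k2 n))) x - h x) \<partial>lborel)" for n
    proof (rule integral_cong_AE)
      have "AE x in lborel. x \<in> - cball 0 R \<longrightarrow> grad_of (u (k1 (k2 n))) x = 0"
        by (rule wgrad_support [OF wg XbD(3) [OF u]])
      then show "AE x in lborel. \<bar>f n x\<bar> powr 1 = norm (grad_of (u (k1 (k2 n))) x - h x)"
        by eventually_elim (auto simp: f_def h_def indicator_def)
    qed (use Lp_funD(1) [OF f1(1)] hm in \<open>auto intro!: borel_measurable_norm\<close>)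
    ultimately have gL1: "(\<lambda>n. \<integral>x. norm (grad_of (u (k1 (k2 n))) x - h x) \<partial>lborel) \<longlonglongrightarrow> 0" by simp
    have uL1: "(\<lambda>n. \<integral>x. \<bar>u (k1 (k2 n)) x - w x\<bar> \<partial>lborel) \<longlonglongrightarrow> 0"
      using LIMSEQ_subseq_LIMSEQ [OF low1 k2] by (simp add: o_def)
    have wh: "wgrad w h" by (rule wgrad_closed [OF wg iw ih uL1 gL1])
    then have "AE x in lborel. grad_of w x = h x" by (intro wgrad_unique [OF wgrad_grad_of wh]) auto
    then have "AE x in lborel. (\<lambda>n. grad_of (u (k1 (k2 n))) x) \<longlonglongrightarrow> grad_of w x"
      using hl by eventually_elim simp
    then show ?thesis by (intro finish [OF k2]) (use wh in \<open>auto simp: regular_for_def\<close>)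
  qed
qed

end

section \<open>Splitting off the limit, and the dichotomy for the remainder\<close>

context ps_functional
begin

text \<open>All four integrals split. For \<open>Q\<close> the remainder vanishes because
  \<open>q < r\<close> on a set of finite measure, for \<open>m\<close> by
  \<open>minus_compact\<close>, since the remainder tends to 0 in the power \<open>p\<close>; only
  \<open>E\<close> and \<open>T\<close> keep a remainder.\<close>

lemma brezis_lieb_energies:
  assumes y: "\<And>n. y n \<in> X" and w: "w \<in> X" and K: "\<And>n. E (y n) \<le> K"
    and l: "AE x in lborel. (\<lambda>n. y n x) \<longlonglongrightarrow> w x"
    and dl: "AE z in EM. (\<lambda>n. dmap (y n) z) \<longlonglongrightarrow> dmap w z"
    and dml: "AE z in EMm. (\<lambda>n. dmap (y n) z) \<longlonglongrightarrow> dmap w z"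
  shows "(\<lambda>n. E (y n) - E (\<lambda>x. y n x - w x)) \<longlonglongrightarrow> E w"
    and "(\<lambda>n. T (y n) - T (\<lambda>x. y n x - w x)) \<longlonglongrightarrow> T w"
    and "(\<lambda>n. Q (y n)) \<longlonglongrightarrow> Q w" and "(\<lambda>n. m (y n)) \<longlonglongrightarrow> m w"
    and "(\<lambda>n. DJ (y n) w) \<longlonglongrightarrow> DJ w w"
proof -
  have v: "(\<lambda>x. y n x - w x) \<in> X" for n by (rule Xb_diff [OF y w])
  define TK where "TK = (K / S) powr (r / p)"
  have TK: "T (y n) \<le> TK" for n
    using T_le_bound [OF y K] by (simp add: TK_def)
  have Em: "E (\<lambda>x. y n x - w x) = (\<integral>z. norm (dmap (y n) z - dmap w z) powr p \<partial>EM)" for n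
    unfolding energy_def
    by (rule integral_cong_AE) (use AE_dmap_diff [OF p1 XbD(4) XbD(4), OF y w, of n] Lp_funD(1) [OF XbD(5) [OF y, of n]]
        Lp_funD(1) [OF XbD(5) [OF w]] Lp_funD(1) [OF XbD(5) [OF v, of n]] in \<open>auto elim!: eventually_mono\<close>)
  have mm: "m (\<lambda>x. y n x - w x) = (\<integral>z. norm (dmap (y n) z - dmap w z) powr p \<partial>EMm)" for n
    unfolding energy_def
    by (rule integral_cong_AE) (use minus_cong_diff [OF y w, of n] Lp_funD(1) [OF minus_Lp [OF y, of n]]
        Lp_funD(1) [OF minus_Lp [OF w]] Lp_funD(1) [OF minus_Lp [OF v, of n]] in \<open>auto elim!: eventually_mono\<close>)
  have EK: "(\<integral>z. norm (dmap (y n) z) powr p \<partial>EM) \<le> K" for n using K [of n] by (simp add: energy_def)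
  have mK: "(\<integral>z. norm (dmap (y n) z) powr p \<partial>EMm) \<le> K / 2" for n
    using K [of n] minus_half [OF y, of n] by (simp add: energy_def)
  have TK': "(\<integral>x. norm (y n x) powr r \<partial>lborel) \<le> TK" for n using TK [of n] by (simp add: T_def)
  obtain C where C: "\<And>u. u \<in> X \<Longrightarrow> Q u \<le> 1 * T u + C" using Q_le_T [of 1] by auto
  have QK: "(\<integral>x. norm (y n x) powr q \<partial>lborel) \<le> TK + C" for n
    using C [OF y, of n] TK [of n] by (simp add: Q_def)
  have Lq: "Lp_fun lborel q u" if "u \<in> X" for u using Xb_Lp [OF that, of q] q1 qr by simp
  show "(\<lambda>n. E (y n) - E (\<lambda>x. y n x - w x)) \<longlonglongrightarrow> E w"
    using brezis_lieb [OF p1 XbD(5) [OF y] EK XbD(5) [OF w] dl] by (simp add: Em) (simp add: energy_def)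
  show "(\<lambda>n. T (y n) - T (\<lambda>x. y n x - w x)) \<longlonglongrightarrow> T w"
    using brezis_lieb [OF r1 sob_Lr [OF y] TK' sob_Lr [OF w] l] by (simp add: T_def)
  have v0: "AE x in lborel. (\<lambda>n. y n x - w x) \<longlonglongrightarrow> 0" using l by eventually_elim (rule LIM_zero)
  have vs: "x \<notin> \<Omega> \<Longrightarrow> y n x - w x = 0" for n x using XbD(2) [OF y] XbD(2) [OF w] by simp
  have vK: "E (\<lambda>x. y n x - w x) \<le> 2 powr p * (K + E w)" for n
    using energy_diff_le [OF y w, of n] K [of n]
    by (rule_tac order_trans [OF _ mult_left_mono [of "E (y n) + E w"]]) auto
  have vT: "(\<integral>x. \<bar>y n x - w x\<bar> powr r \<partial>lborel) \<le> (2 powr p * (K + E w) / S) powr (r / p)" for n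
    using T_le_bound [OF v vK] by (simp add: T_def)
  have low: "(\<lambda>n. \<integral>x. \<bar>y n x - w x\<bar> powr s \<partial>lborel) \<longlonglongrightarrow> 0" if "0 < s" "s < r" for s
    by (rule integral_powr_lower_tendsto_0(2) [OF that \<Omega>_sets sob_Lr [OF v] vT vs v0])
  have "(\<lambda>n. (Q (y n) - Q (\<lambda>x. y n x - w x)) + Q (\<lambda>x. y n x - w x)) \<longlonglongrightarrow> Q w + 0"
    using brezis_lieb [OF q1 Lq [OF y] QK Lq [OF w] l] low [of q] q1 qr by (intro tendsto_add) (auto simp: Q_def)
  then show "(\<lambda>n. Q (y n)) \<longlonglongrightarrow> Q w" by simp
  have B0: "0 \<le> 2 powr p * (K + E w)" using vK [of 0] energy_nonneg order_trans by blast
  have m0: "(\<lambda>n. m (\<lambda>x. y n x - w x)) \<longlonglongrightarrow> 0"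
  proof (rule LIMSEQ_I)
    fix e :: real assume e: "e > 0"
    obtain \<delta> where \<delta>: "\<delta> > 0" "\<And>v. v \<in> X \<Longrightarrow> E v \<le> 2 powr p * (K + E w) \<Longrightarrow> power_integral p v \<le> \<delta> \<Longrightarrow> m v \<le> e / 2"
      using minus_compact [OF B0, of "e / 2"] e by auto
    obtain N where N: "\<And>n. n \<ge> N \<Longrightarrow> norm ((\<integral>x. \<bar>y n x - w x\<bar> powr p \<partial>lborel) - 0) < \<delta>"
      using LIMSEQ_D [OF low [of p] \<delta>(1)] p1 pr by auto
    show "\<exists>N. \<forall>n\<ge>N. norm (m (\<lambda>x. y n x - w x) - 0) < e"
    proof (intro exI allI impI)
      fix n assume n: "n \<ge> N"
      have "m (\<lambda>x. y n x - w x) \<le> e / 2" by (rule \<delta>(2) [OF v vK]) (use N [OF n] in \<open>simp add: abs_less_iff\<close>)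
      then show "norm (m (\<lambda>x. y n x - w x) - 0) < e" using e by simp
    qed
  qed
  have "(\<lambda>n. (m (y n) - m (\<lambda>x. y n x - w x)) + m (\<lambda>x. y n x - w x)) \<longlonglongrightarrow> m w + 0"
    using brezis_lieb [OF p1 minus_Lp [OF y] mK minus_Lp [OF w] dml]
    by (intro tendsto_add m0) (simp add: mm, simp add: energy_def)
  then show "(\<lambda>n. m (y n)) \<longlonglongrightarrow> m w" by simp
  have "(\<lambda>n. A (y n) w) \<longlonglongrightarrow> A w w"
    unfolding A_def by (rule pflux_pairing_tendsto [OF p1 XbD(5) [OF y] EK XbD(5) [OF w] dl XbD(5) [OF w]])
  moreover have "(\<lambda>n. Am (y n) w) \<longlonglongrightarrow> Am w w"
    unfolding Am_def by (rule pflux_pairing_tendsto [OF p1 minus_Lp [OF y] mK minus_Lp [OF w] dml minus_Lp [OF w]])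
  moreover have "(\<lambda>n. Bf q (y n) w) \<longlonglongrightarrow> Bf q w w"
    unfolding Bf_def by (rule pflux_pairing_tendsto [OF q1 Lq [OF y] QK Lq [OF w] l Lq [OF w]])
  moreover have "(\<lambda>n. Bf r (y n) w) \<longlonglongrightarrow> Bf r w w"
    unfolding Bf_def by (rule pflux_pairing_tendsto [OF r1 sob_Lr [OF y] TK' sob_Lr [OF w] l sob_Lr [OF w]])
  ultimately show "(\<lambda>n. DJ (y n) w) \<longlonglongrightarrow> DJ w w"
    unfolding DJ_def by (intro tendsto_intros)
qed

lemma palais_smale:
  assumes u: "\<And>n. u n \<in> X" and Jc: "(\<lambda>n. J (u n)) \<longlonglongrightarrow> c"
    and \<epsilon>: "\<And>n. 0 \<le> \<epsilon> n" "\<epsilon> \<longlonglongrightarrow> 0" and D: "\<And>n h. h \<in> X \<Longrightarrow> \<bar>DJ (u n) h\<bar> \<le> \<epsilon> n * E h powr (1 / p)"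
  shows "\<exists>k w. strict_mono k \<and> w \<in> X \<and> (\<lambda>n. E (\<lambda>x. u (k n) x - w x)) \<longlonglongrightarrow> 0"
proof -
  obtain M1 where M1: "\<And>n. norm (J (u n)) \<le> M1" using Jc convergent_imp_Bseq [of "\<lambda>n. J (u n)"] by (auto simp: convergent_def Bseq_def)
  obtain M2 where M2: "\<And>n. norm (\<epsilon> n) \<le> M2" using \<epsilon>(2) convergent_imp_Bseq [of \<epsilon>] by (auto simp: convergent_def Bseq_def)
  define M where "M = max 0 (max M1 M2)"
  obtain K where K: "K \<ge> 0" "\<And>u. u \<in> X \<Longrightarrow> J u \<le> M \<Longrightarrow> \<bar>DJ u u\<bar> \<le> M * (E u) powr (1 / p) \<Longrightarrow> E u \<le> K"
    using bounded_of_PS [of M] by (auto simp: M_def)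
  have uK: "E (u n) \<le> K" for n
  proof (rule K(2) [OF u])
    show "J (u n) \<le> M" using M1 [of n] by (simp add: M_def)
    have "\<epsilon> n * E (u n) powr (1 / p) \<le> M * E (u n) powr (1 / p)"
      using M2 [of n] by (intro mult_right_mono) (auto simp: M_def)
    then show "\<bar>DJ (u n) (u n)\<bar> \<le> M * E (u n) powr (1 / p)" using D [OF u, of n n] by simp
  qed
  obtain k w where k: "strict_mono k" and w: "w \<in> X" and lims: "AE x in lborel. (\<lambda>n. u (k n) x) \<longlonglongrightarrow> w x"
      "AE z in EM. (\<lambda>n. dmap (u (k n)) z) \<longlonglongrightarrow> dmap w z" "AE z in EMm. (\<lambda>n. dmap (u (k n)) z) \<longlonglongrightarrow> dmap w z"
    using PS_AE_limit [OF u K(1) uK \<epsilon> D] by blast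
  define y where "y n = u (k n)" for n
  define a where "a n = E (\<lambda>x. y n x - w x)" for n
  define b where "b n = T (\<lambda>x. y n x - w x)" for n
  have yX: "y n \<in> X" and yK: "E (y n) \<le> K" for n by (auto simp: y_def u uK)
  note bl = brezis_lieb_energies [of y, OF yX w yK lims [folded y_def], folded a_def b_def]
  have \<epsilon>k: "(\<lambda>n. \<epsilon> (k n)) \<longlonglongrightarrow> 0" using LIMSEQ_subseq_LIMSEQ [OF \<epsilon>(2) k] by (simp add: o_def)
  have D0: "(\<lambda>n. DJ (y n) (h n)) \<longlonglongrightarrow> 0" if h: "\<And>n. h n \<in> X" "\<And>n. E (h n) \<le> K'" for h K'
  proof (rule Lim_null_comparison)
    show "\<forall>\<^sub>F n in sequentially. norm (DJ (y n) (h n)) \<le> \<epsilon> (k n) * K' powr (1 / p)"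
    proof (rule always_eventually, rule allI)
      fix n
      have "\<bar>DJ (y n) (h n)\<bar> \<le> \<epsilon> (k n) * E (h n) powr (1 / p)" unfolding y_def by (rule D [OF h(1)])
      also have "\<dots> \<le> \<epsilon> (k n) * K' powr (1 / p)"
        using \<epsilon>(1) h(2) p1 by (intro mult_left_mono powr_mono2) auto
      finally show "norm (DJ (y n) (h n)) \<le> \<epsilon> (k n) * K' powr (1 / p)" by simp
    qed
    show "(\<lambda>n. \<epsilon> (k n) * K' powr (1 / p)) \<longlonglongrightarrow> 0" by (rule tendsto_mult_left_zero [OF \<epsilon>k])
  qed
  have Dw: "E w - m w - lam * Q w - T w = 0"
    using LIMSEQ_unique [OF bl(5) D0 [OF w order_refl]] by (simp add: DJ_self)
  have Dy: "(\<lambda>n. E (y n) - m (y n) - lam * Q (y n) - T (y n)) \<longlonglongrightarrow> 0"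
    using D0 [of y, OF yX yK] by (simp add: DJ_self)
  have Jy: "(\<lambda>n. E (y n) / p - m (y n) / p - lam / q * Q (y n) - T (y n) / r) \<longlonglongrightarrow> c"
    using LIMSEQ_subseq_LIMSEQ [OF Jc k] by (simp add: o_def y_def J_def)
  \<comment> \<open>Every summand has a known limit, and algebraically the sum is
    \<open>a n - b n\<close>. The equation \<open>DJ w w = 0\<close> makes the limit 0.\<close>
  have "(\<lambda>n. (E (y n) - m (y n) - lam * Q (y n) - T (y n)) + m (y n) + lam * Q (y n) - (E (y n) - a n) + (T (y n) - b n))
    \<longlonglongrightarrow> 0 + m w + lam * Q w - E w + T w"
    by (intro tendsto_intros Dy bl)
  moreover have "0 + m w + lam * Q w - E w + T w = 0" using Dw by simp
  moreover have "(E (y n) - m (y n) - lam * Q (y n) - T (y n)) + m (y n) + lam * Q (y n) - (E (y n) - a n) + (T (y n) - b n) = a n - b n" for n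
    by simp
  ultimately have ab: "(\<lambda>n. a n - b n) \<longlonglongrightarrow> 0" by simp
  \<comment> \<open>The same device for the functional. Replacing \<open>b n\<close> by
    \<open>a n\<close> merges the weights \<open>1 / p\<close> and \<open>1 / r\<close> into
    \<open>d\<close>.\<close>
  have "(\<lambda>n. (E (y n) / p - m (y n) / p - lam / q * Q (y n) - T (y n) / r) + m (y n) / p + lam / q * Q (y n)
      - (E (y n) - a n) / p + (T (y n) - b n) / r - (a n - b n) / r)
    \<longlonglongrightarrow> c + m w / p + lam / q * Q w - E w / p + T w / r - 0 / r"
    using p1 r1 by (intro tendsto_intros Jy bl ab) auto
  moreover have "(E (y n) / p - m (y n) / p - lam / q * Q (y n) - T (y n) / r) + m (y n) / p + lam / q * Q (y n)
      - (E (y n) - a n) / p + (T (y n) - b n) / r - (a n - b n) / r = d * a n" for n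
    by (simp add: d_def diff_divide_distrib algebra_simps)
  moreover have "c + m w / p + lam / q * Q w - E w / p + T w / r - 0 / r = c - J w" by (simp add: J_def)
  ultimately have "(\<lambda>n. d * a n) \<longlonglongrightarrow> c - J w" by (simp only:)
  then have "(\<lambda>n. (d * a n) / d) \<longlonglongrightarrow> (c - J w) / d" using d_pos by (intro tendsto_divide tendsto_const) auto
  moreover define \<l> where "\<l> = (c - J w) / d"
  ultimately have al: "a \<longlonglongrightarrow> \<l>" using d_pos by simp
  have bl': "b \<longlonglongrightarrow> \<l>" using tendsto_diff [OF al ab] by simp
  have l0: "\<l> \<ge> 0" by (rule LIMSEQ_le_const [OF al]) (auto simp: a_def)
  have "(\<lambda>n. S * b n powr (p / r)) \<longlonglongrightarrow> S * \<l> powr (p / r)"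
    using p1 r1 by (intro tendsto_intros tendsto_powr2 bl') (auto simp: b_def)
  then have Sl: "S * \<l> powr (p / r) \<le> \<l>"
    by (rule LIMSEQ_le [OF _ al]) (use sob [OF Xb_diff [OF yX w]] in \<open>auto simp: a_def b_def T_def\<close>)
  have "\<l> = 0"
  proof (rule ccontr)
    assume "\<l> \<noteq> 0"
    then have lp: "\<l> > 0" using l0 by simp
    have "S * \<l> powr (p / r) \<le> \<l> powr ((r - p) / r) * \<l> powr (p / r)"
      using Sl lp r1 by (simp add: powr_add [symmetric] diff_divide_distrib)
    then have "S \<le> \<l> powr ((r - p) / r)" using lp by simp
    then have "S powr (r / (r - p)) \<le> (\<l> powr ((r - p) / r)) powr (r / (r - p))"
      using S pr r1 by (intro powr_mono2) auto
    also have "\<dots> = \<l>" using lp pr r1 by (simp add: powr_powr)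
    finally have "d * S powr (r / (r - p)) \<le> d * \<l>" using d_pos by (intro mult_left_mono) auto
    also have "d * \<l> = c - J w" using d_pos by (simp add: \<l>_def)
    finally have 1: "d * S powr (r / (r - p)) \<le> c - J w" .
    \<comment> \<open>Since \<open>DJ w w = 0\<close>, the value \<open>J w\<close> consists of
      terms of order zero, and \<open>junk\<close> bounds these from below.\<close>
    have "J w = lam * (1 / p - 1 / q) * Q w + d * T w"
      using J_DJ [of w] Dw by (simp add: DJ_self)
    then have "- junk \<le> J w" using junk [OF w] by (simp add: Q_def T_def d_def)
    then show False using level 1 unfolding d_def [symmetric] by linarith
  qed
  then have "(\<lambda>n. E (\<lambda>x. u (k n) x - w x)) \<longlonglongrightarrow> 0" using al by (simp add: a_def [abs_def] y_def)
  then show ?thesis using k w by blast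
qed

end

section \<open>The hypotheses of the compactness argument\<close>

text \<open>The hypotheses on the two measures with \<open>\<kappa>\<close> replaced by
  \<open>1 / (2 * C)\<close>, where \<open>C\<close> is the constant of the seminorm
  comparison.\<close>

locale lower_perturbation = energy_space \<mu> \<Omega> p R + minus: unit_measure \<mu>m
  for \<mu> \<mu>m :: "real measure" and \<Omega> :: "'a::euclidean_space set" and p R :: real +
  fixes sbar C :: real
  assumes sbar: "0 < sbar" "sbar \<le> 1" and plus_high: "measure \<mu> {sbar..1} > 0"
    and minus_high: "\<And>A. A \<in> sets \<mu>m \<Longrightarrow> A \<subseteq> {sbar..1} \<Longrightarrow> measure \<mu>m A = 0"
    and minus_low: "measure \<mu>m {0..sbar} \<le> 1 / (2 * C) * measure \<mu> {sbar..1}"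
    and C: "C \<ge> 1"
    and comparison: "\<And>(u :: 'a \<Rightarrow> real) s s'. u \<in> borel_measurable borel \<Longrightarrow> (\<And>x. x \<notin> ball 0 R \<Longrightarrow> u x = 0) \<Longrightarrow>
      0 \<le> s \<Longrightarrow> s \<le> s' \<Longrightarrow> s' \<le> 1 \<Longrightarrow> seminorm_pow p s u \<le> ennreal C * seminorm_pow p s' u"
begin

definition "a = measure \<mu> {sbar..1}"

lemma a: "a > 0" using plus_high by (simp add: a_def)

lemma nn_energy: "u \<in> X \<Longrightarrow> total_energy \<mu> p u = ennreal (E u)"
  using XbD(6) [of u] by (simp add: Xb_def)

text \<open>Integrate the comparison with order \<open>s'\<close> over all \<open>s'\<close> in
  \<open>{sbar..1}\<close>: a seminorm of low order is at most \<open>C\<close> times the average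
  over the high orders.\<close>

lemma seminorm_low:
  assumes u: "u \<in> X" and s: "0 \<le> s" "s \<le> sbar"
  shows "seminorm_pow p s u \<le> ennreal (C * E u / a)"
proof -
  let ?I = "{sbar..1}"
  have I: "?I \<in> sets \<mu>" unfolding sets_mu using sbar by (subst sets_restrict_space_iff) auto
  have C0: "ennreal C \<noteq> 0" "ennreal C \<noteq> top" using C by auto
  have "(seminorm_pow p s u / ennreal C) * ennreal a = (\<integral>\<^sup>+s'. (seminorm_pow p s u / ennreal C) * indicator ?I s' \<partial>\<mu>)"
    using I by (subst nn_integral_cmult_indicator) (auto simp: a_def emeasure_eq_measure)
  also have "\<dots> \<le> (\<integral>\<^sup>+s'. seminorm_pow p s' u \<partial>\<mu>)"
  proof (rule nn_integral_mono)
    fix s'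
    have "seminorm_pow p s u / ennreal C \<le> seminorm_pow p s' u" if "s' \<in> ?I"
    proof -
      have "seminorm_pow p s u \<le> ennreal C * seminorm_pow p s' u"
        using comparison [OF XbD(1,3) [OF u]] s that by simp
      then have "seminorm_pow p s u / ennreal C \<le> ennreal C * seminorm_pow p s' u / ennreal C"
        by (rule divide_right_mono_ennreal)
      also have "\<dots> = seminorm_pow p s' u" using C0
        by (simp add: mult.commute [of "ennreal C"] ennreal_mult_divide_eq)
      finally show ?thesis .
    qed
    then show "(seminorm_pow p s u / ennreal C) * indicator ?I s' \<le> seminorm_pow p s' u"
      by (auto simp: indicator_def)
  qed
  finally have *: "(seminorm_pow p s u / ennreal C) * ennreal a \<le> ennreal (E u)" using nn_energy [OF u] by simp
  have "seminorm_pow p s u = (seminorm_pow p s u / ennreal C) * ennreal a * ennreal (C / a)"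
  proof -
    have "ennreal a * ennreal (C / a) = ennreal C" using a C by (simp add: ennreal_mult [symmetric])
    moreover have "seminorm_pow p s u / ennreal C * ennreal C = seminorm_pow p s u"
      unfolding ennreal_divide_times using C0 by (simp add: ennreal_divide_self)
    ultimately show ?thesis by (simp add: mult.assoc)
  qed
  also have "\<dots> \<le> ennreal (E u) * ennreal (C / a)" using * by (rule mult_right_mono) simp
  also have "\<dots> = ennreal (C * E u / a)" using a C by (simp add: ennreal_mult [symmetric] mult.commute)
  finally show ?thesis .
qed

lemma AE_minus_low: "AE s in \<mu>m. 0 \<le> s \<and> s < sbar"
proof -
  have I: "{sbar..1} \<in> sets \<mu>m" unfolding minus.sets_mu using sbar by (subst sets_restrict_space_iff) auto
  have "emeasure \<mu>m {sbar..1} = 0" using minus_high [OF I order_refl] by (simp add: minus.emeasure_eq_measure)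
  then have "AE s in \<mu>m. s \<notin> {sbar..1}" using I by (intro AE_not_in) (simp add: null_sets_def)
  then show ?thesis using AE_space by eventually_elim (auto simp: minus.space_mu)
qed

lemma minus_1: "emeasure \<mu>m {1} = 0"
  using minus_high [of "{1}"] minus.singleton_sets [of 1] sbar by (simp add: minus.emeasure_eq_measure)

lemma minus_interval: "{0..sbar} \<in> sets \<mu>m"
  unfolding minus.sets_mu using sbar by (subst sets_restrict_space_iff) auto

lemma nn_minus_restrict: "(\<integral>\<^sup>+s\<in>{0..sbar}. seminorm_pow p s u \<partial>\<mu>m) = (\<integral>\<^sup>+s. seminorm_pow p s u \<partial>\<mu>m)"
  by (rule nn_integral_cong_AE) (use AE_minus_low in \<open>eventually_elim, auto\<close>)

text \<open>The mass \<open>a\<close> cancels, and \<open>C\<close> cancels against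
  \<open>1 / (2 * C)\<close>, so the factor \<open>1 / 2\<close> is the same for all
  measures.\<close>

lemma nn_minus_le:
  assumes u: "u \<in> X" shows "(\<integral>\<^sup>+s. seminorm_pow p s u \<partial>\<mu>m) \<le> ennreal (E u / 2)"
proof -
  have "(\<integral>\<^sup>+s. seminorm_pow p s u \<partial>\<mu>m) \<le> (\<integral>\<^sup>+s. ennreal (C * E u / a) * indicator {0..sbar} s \<partial>\<mu>m)"
    using AE_minus_low by (intro nn_integral_mono_AE, eventually_elim) (use seminorm_low [OF u] in auto)
  also have "\<dots> = ennreal (C * E u / a * measure \<mu>m {0..sbar})"
    using minus_interval a C by (subst nn_integral_cmult_indicator) (auto simp: minus.emeasure_eq_measure ennreal_mult [symmetric])
  also have "\<dots> \<le> ennreal (E u / 2)"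
  proof (rule ennreal_leI)
    have "C * E u / a * measure \<mu>m {0..sbar} \<le> C * E u / a * (1 / (2 * C) * a)"
      using minus_low a C by (intro mult_left_mono) (auto simp: a_def)
    then show "C * E u / a * measure \<mu>m {0..sbar} \<le> E u / 2" using a C by simp
  qed
  finally show ?thesis .
qed

lemma minus_energy:
  assumes u: "u \<in> X"
  shows "Lp_fun (energy_measure \<mu>m p) p (dmap u)" "ennreal (energy \<mu>m p u) = (\<integral>\<^sup>+s. seminorm_pow p s u \<partial>\<mu>m)"
    and "energy \<mu>m p u \<le> E u / 2"
proof -
  have reg: "regular_for \<mu>m u" using minus_1 by (simp add: regular_for_def)
  have fin: "(\<integral>\<^sup>+s. seminorm_pow p s u \<partial>\<mu>m) < \<infinity>" using nn_minus_le [OF u] by (rule le_less_trans) simp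
  note i = minus.Lp_fun_dmap_iff [OF XbD(1,3) [OF u] p1 reg]
  show "Lp_fun (energy_measure \<mu>m p) p (dmap u)" using i(1) fin by simp
  show e: "ennreal (energy \<mu>m p u) = (\<integral>\<^sup>+s. seminorm_pow p s u \<partial>\<mu>m)" using i(2) fin by simp
  have "ennreal (energy \<mu>m p u) \<le> ennreal (E u / 2)" using nn_minus_le [OF u] unfolding e .
  then show "energy \<mu>m p u \<le> E u / 2" by (subst (asm) ennreal_le_iff) auto
qed

text \<open>The order \<open>sbar / 2\<close> lies strictly between 0 and 1 even for
  \<open>sbar = 1\<close>; there \<open>frac_const\<close> is positive and can be divided out. This
  feeds \<open>L1_compactness\<close>.\<close>

lemma gagliardo_le:
  "\<exists>C\<sigma>\<ge>0. \<forall>u\<in>X. gagliardo p (sbar / 2) u \<le> ennreal (C\<sigma> * E u)"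
proof -
  define \<sigma> where "\<sigma> = sbar / 2"
  have \<sigma>: "0 < \<sigma>" "\<sigma> < 1" "\<sigma> \<le> sbar" using sbar by (auto simp: \<sigma>_def)
  have N1: "real DIM('a) \<ge> 1" by (simp add: Suc_leI)
  define f where "f = frac_const (real DIM('a)) \<sigma> p"
  obtain c1 c2 where "c1 > 0" "\<And>s. 0 \<le> s \<Longrightarrow> s \<le> 1 \<Longrightarrow> c1 * (s * (1 - s)) \<le> frac_const (real DIM('a)) s p"
    using frac_const_bounds [OF p1 N1] by metis
  then have "c1 * (\<sigma> * (1 - \<sigma>)) \<le> f" "0 < c1 * (\<sigma> * (1 - \<sigma>))" using \<sigma> by (auto simp: f_def)
  then have f: "f > 0" by linarith
  show ?thesis
  proof (intro exI [of _ "C / a / f"] conjI ballI)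
    show "0 \<le> C / a / f" using C a f by simp
    fix u assume u: "u \<in> X"
    have cancel: "gagliardo p \<sigma> u * ennreal f / ennreal f = gagliardo p \<sigma> u"
      by (rule ennreal_mult_divide_eq) (use f in auto)
    have "ennreal f * gagliardo p \<sigma> u \<le> ennreal (C * E u / a)"
      using seminorm_low [OF u, of \<sigma>] \<sigma> seminorm_pow_gagliardo [OF XbD(1) [OF u], of \<sigma> p] by (simp add: f_def)
    then have "gagliardo p \<sigma> u * ennreal f / ennreal f \<le> ennreal (C * E u / a) / ennreal f"
      by (intro divide_right_mono_ennreal) (simp add: mult.commute)
    then show "gagliardo p (sbar / 2) u \<le> ennreal (C / a / f * E u)"
      unfolding cancel using f a C by (simp add: divide_ennreal \<sigma>_def mult_ac)
  qed
qed

text \<open>As \<open>\<mu>m\<close> has no mass on \<open>{sbar..1}\<close>, it has little mass on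
  orders close to \<open>sbar\<close>, where the seminorms are merely bounded. Orders below
  \<open>\<sigma>\<close> compare with \<open>\<sigma>\<close>, and interpolation between
  \<open>Lpow\<close> and an order \<open>\<sigma>'\<close> in between makes the seminorm of order
  \<open>\<sigma>\<close> small.\<close>

lemma minus_compact:
  assumes B: "B \<ge> 0" and \<eta>: "\<eta> > 0"
  shows "\<exists>\<delta>>0. \<forall>v\<in>X. E v \<le> B \<longrightarrow> power_integral p v \<le> \<delta> \<longrightarrow> energy \<mu>m p v \<le> \<eta>"
proof -
  define b where "b = C * B / a"
  have b: "b \<ge> 0" using B a C by (simp add: b_def)
  define M where "M = measure \<mu>m {0..1}"
  have M: "M \<ge> 0" by (simp add: M_def)
  \<comment> \<open>The offset 2 keeps the left end at least \<open>sbar / 2\<close>, so that the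
    order \<open>\<sigma>\<close> picked below is positive.\<close>
  define I where "I n = {sbar - sbar / real (n + 2)..<sbar}" for n
  have "I n \<subseteq> {0..1}" for n
  proof
    fix s assume s: "s \<in> I n"
    have "0 \<le> sbar - sbar / real (n + 2)" using sbar by (simp add: field_simps)
    then show "s \<in> {0..1}" using s sbar unfolding I_def by simp
  qed
  then have I: "I n \<in> sets \<mu>m" for n
    unfolding minus.sets_mu by (subst sets_restrict_space_iff) (auto simp: I_def)
  have dec: "decseq I"
    unfolding I_def decseq_def using sbar by (auto simp: field_simps intro!: frac_le)
  have "(\<Inter>n. I n) = {}"
  proof safe
    fix s assume s: "s \<in> (\<Inter>n. I n)"
    have "(\<lambda>n. sbar - sbar / real (n + 2)) \<longlonglongrightarrow> sbar - 0"
      by (intro tendsto_intros LIMSEQ_ignore_initial_segment lim_const_over_n)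
    then have "sbar - 0 \<le> s" by (rule LIMSEQ_le_const2) (use s in \<open>auto simp: I_def\<close>)
    then show "s \<in> {}" using s by (auto simp: I_def)
  qed
  then have "(\<lambda>n. measure \<mu>m (I n)) \<longlonglongrightarrow> 0"
    using minus.finite_Lim_measure_decseq [OF _ dec] I by auto
  then obtain n where n: "measure \<mu>m (I n) < \<eta> / (2 * (b + 1))"
    using LIMSEQ_D [of _ 0 "\<eta> / (2 * (b + 1))"] \<eta> b by fastforce
  define \<sigma> where "\<sigma> = sbar - sbar / real (n + 2)"
  have \<sigma>: "0 < \<sigma>" "\<sigma> < sbar" using sbar by (auto simp: \<sigma>_def field_simps add_pos_nonneg)
  define \<sigma>' where "\<sigma>' = (\<sigma> + sbar) / 2"
  have \<sigma>': "\<sigma> < \<sigma>'" "\<sigma>' < sbar" using \<sigma> by (auto simp: \<sigma>'_def)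
  define \<epsilon> where "\<epsilon> = \<eta> / (4 * (C * (M + 1)))"
  have \<epsilon>: "\<epsilon> > 0" using \<eta> C M by (simp add: \<epsilon>_def)
  obtain C' where C': "C' \<ge> 0" "\<And>u :: 'a \<Rightarrow> real. u \<in> borel_measurable borel \<Longrightarrow> seminorm_pow p \<sigma>' u \<le> ennreal b \<Longrightarrow>
      seminorm_pow p \<sigma> u \<le> ennreal \<epsilon> + ennreal C' * Lpow p u"
    using seminorm_interpolation [OF p1 \<sigma>(1) \<sigma>'(1) _ b \<epsilon>, where 'a = 'a] \<sigma>' sbar by auto
  define \<delta> where "\<delta> = \<epsilon> / (C' + 1)"
  have \<delta>: "\<delta> > 0" "C' * \<delta> \<le> \<epsilon>" using \<epsilon> C' by (auto simp: \<delta>_def field_simps)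
  show ?thesis
  proof (intro exI [of _ \<delta>] conjI ballI impI \<delta>(1))
    fix v assume v: "v \<in> X" and vB: "E v \<le> B" and v\<delta>: "(power_integral p v) \<le> \<delta>"
    have low: "seminorm_pow p s v \<le> ennreal b" if "0 \<le> s" "s \<le> sbar" for s
    proof (rule order_trans [OF seminorm_low [OF v that] ennreal_leI])
      show "C * E v / a \<le> b" unfolding b_def using vB a C by (intro divide_right_mono mult_left_mono) auto
    qed
    have "Lpow p v < \<infinity>" using le_less_trans [OF low [of 0] ennreal_less_top] sbar by (simp add: seminorm_pow_0 Lpow_def)
    then have "integrable lborel (\<lambda>x. \<bar>v x\<bar> powr p)"
      using XbD(1) [OF v] by (intro integrableI_nonneg) (auto simp: Lpow_def)
    then have "Lpow p v = ennreal (power_integral p v)" unfolding Lpow_def by (intro nn_integral_eq_integral) auto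
    then have "ennreal C' * Lpow p v \<le> ennreal (C' * \<delta>)"
      using C' v\<delta> by (auto simp: ennreal_mult [symmetric] intro!: ennreal_leI mult_left_mono)
    also have "\<dots> \<le> ennreal \<epsilon>" using \<delta> by (intro ennreal_leI)
    finally have "seminorm_pow p \<sigma> v \<le> ennreal \<epsilon> + ennreal \<epsilon>"
      using C'(2) [OF XbD(1) [OF v] low] \<sigma> \<sigma>' by (meson add_left_mono less_imp_le less_trans order_trans)
    then have s2: "seminorm_pow p \<sigma> v \<le> ennreal (2 * \<epsilon>)" using \<epsilon> by (simp add: ennreal_plus [symmetric] del: ennreal_plus)
    have cs: "seminorm_pow p s v \<le> ennreal (C * (2 * \<epsilon>)) * indicator {0..1} s + ennreal b * indicator (I n) s"
      if "0 \<le> s" "s < sbar" for s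
    proof (cases "s < \<sigma>")
      case True
      have "seminorm_pow p s v \<le> ennreal C * seminorm_pow p \<sigma> v"
        using True that \<sigma> sbar by (intro comparison XbD(1,3) [OF v]) auto
      also have "\<dots> \<le> ennreal C * ennreal (2 * \<epsilon>)" using s2 by (rule mult_left_mono) simp
      also have "\<dots> = ennreal (C * (2 * \<epsilon>))" using C \<epsilon> by (simp add: ennreal_mult)
      finally show ?thesis using True that sbar \<sigma> by (simp add: add_increasing2)
    next
      case False
      then have "s \<in> I n" using that by (simp add: I_def \<sigma>_def)
      then show ?thesis using low [of s] that by (simp add: add_increasing)
    qed
    have m01: "{0..1} \<in> sets \<mu>m" using sets.top [of \<mu>m] by (simp add: minus.space_mu)
    have "(\<integral>\<^sup>+s. seminorm_pow p s v \<partial>\<mu>m) \<le> (\<integral>\<^sup>+s. ennreal (C * (2 * \<epsilon>)) * indicator {0..1} s + ennreal b * indicator (I n) s \<partial>\<mu>m)"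
      using AE_minus_low by (intro nn_integral_mono_AE, eventually_elim) (use cs in auto)
    also have "\<dots> = ennreal (C * (2 * \<epsilon>)) * emeasure \<mu>m {0..1} + ennreal b * emeasure \<mu>m (I n)"
      using I m01 by (subst nn_integral_add) (auto simp: nn_integral_cmult_indicator)
    also have "\<dots> = ennreal (C * (2 * \<epsilon>) * M + b * measure \<mu>m (I n))"
      using C \<epsilon> b M by (simp add: minus.emeasure_eq_measure M_def ennreal_mult)
    finally have "ennreal (energy \<mu>m p v) \<le> ennreal (C * (2 * \<epsilon>) * M + b * measure \<mu>m (I n))"
      using minus_energy(2) [OF v] by simp
    then have "energy \<mu>m p v \<le> C * (2 * \<epsilon>) * M + b * measure \<mu>m (I n)"
      using C \<epsilon> b M by (subst (asm) ennreal_le_iff) auto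
    also have "\<dots> \<le> \<eta> / 2 + \<eta> / 2"
    proof (rule add_mono)
      have "C * (2 * \<epsilon>) * M \<le> 2 * \<epsilon> * (C * (M + 1))" using C \<epsilon> by (simp add: algebra_simps)
      also have "\<dots> = \<eta> / 2"
      proof -
        have "k > 0 \<Longrightarrow> 2 * (\<eta> / (4 * k)) * k = \<eta> / 2" for k :: real by simp
        then show ?thesis unfolding \<epsilon>_def using C M by simp
      qed
      finally show "C * (2 * \<epsilon>) * M \<le> \<eta> / 2" .
      have "b * measure \<mu>m (I n) \<le> (b + 1) * (\<eta> / (2 * (b + 1)))" using n b by (intro mult_mono) auto
      also have "\<dots> = \<eta> / 2"
      proof -
        have "k > 0 \<Longrightarrow> k * (\<eta> / (2 * k)) = \<eta> / 2" for k :: real by simp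
        then show ?thesis by this (use b in simp)
      qed
      finally show "b * measure \<mu>m (I n) \<le> \<eta> / 2" .
    qed
    finally show "energy \<mu>m p v \<le> \<eta>" by simp
  qed
qed

end

text \<open>The derivative of \<open>arctan\<close> at 0 is 1; so the truncations
  \<open>k * arctan (u / k)\<close> are bounded functions that approximate \<open>u\<close>.\<close>

lemma tendsto_scaled_arctan: "(\<lambda>n. real (Suc n) * arctan (t / real (Suc n))) \<longlonglongrightarrow> t"
proof (cases "t = 0")
  case False
  have "((\<lambda>h. arctan h / h) \<longlongrightarrow> 1) (at 0)"
    using DERIV_arctan [of 0] by (simp add: has_field_derivative_iff)
  moreover have "filterlim (\<lambda>n. t / real (Suc n)) (at 0) sequentially"
    using False LIMSEQ_Suc [OF lim_const_over_n [of t]] by (auto simp: filterlim_at)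
  ultimately have "(\<lambda>n. arctan (t / real (Suc n)) / (t / real (Suc n))) \<longlonglongrightarrow> 1"
    by (rule filterlim_compose)
  from tendsto_mult_left [OF this, of t] False show ?thesis by (simp add: mult.commute)
qed simp

section \<open>Borel representatives and the best Sobolev constant\<close>

context energy_space
begin

lemma X_subset_Xp: "u \<in> X \<Longrightarrow> u \<in> Xp \<mu> \<Omega> p"
  by (auto simp: Xp_def Xb_def borel_imp_lebesgue_measurable)

lemma Xp_representative:
  assumes u: "u \<in> Xp \<mu> \<Omega> p"
  shows "\<exists>v\<in>X. AE x in lebesgue. u x = v x"
proof -
  have um: "u \<in> borel_measurable lebesgue" and u0: "AE x in lebesgue. x \<notin> \<Omega> \<longrightarrow> u x = 0"
    and fin: "total_energy \<mu> p u < \<infinity>" using u by (auto simp: Xp_def)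
  obtain g where g [measurable]: "g \<in> borel_measurable borel" and ug: "AE x in lborel. u x = g x"
    using lebesgue_ex_borel [OF um] by blast
  define v where "v x = indicator \<Omega> x * g x" for x
  have vm: "v \<in> borel_measurable borel"
    unfolding v_def using open_\<Omega> by (intro borel_measurable_times borel_measurable_indicator g) auto
  have "AE x in lebesgue. u x = g x" using ug by (rule AE_completion)
  then have ae: "AE x in lebesgue. u x = v x"
    using u0 by eventually_elim (auto simp: v_def indicator_def)
  have "seminorm_pow p s u = seminorm_pow p s v" for s
    by (rule seminorm_pow_cong [OF ae um borel_imp_lebesgue_measurable [OF vm]])
  then have "v \<in> X" using vm fin by (auto simp: Xb_def v_def)
  then show ?thesis using ae by blast
qed

lemma rho_eq:
  assumes um: "u \<in> borel_measurable lebesgue" and v: "v \<in> X" and ae: "AE x in lebesgue. u x = v x"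
  shows "rho \<mu> p u = E v powr (1 / p)"
proof -
  have "seminorm_pow p s u = seminorm_pow p s v" for s
    by (rule seminorm_pow_cong [OF ae um borel_imp_lebesgue_measurable [OF XbD(1) [OF v]]])
  then show ?thesis using XbD(6) [OF v] by (simp add: rho_def)
qed

lemma set_integral_powr_eq:
  assumes um: "u \<in> borel_measurable lebesgue" and v: "v \<in> X" and ae: "AE x in lebesgue. u x = v x" and s: "s > 0"
  shows "(LINT x:\<Omega>|lebesgue. \<bar>u x\<bar> powr s) = power_integral s v"
proof -
  have \<Omega>m: "\<Omega> \<in> sets lebesgue" using open_\<Omega> by (simp add: borel_open)
  have "(LINT x:\<Omega>|lebesgue. \<bar>u x\<bar> powr s) = (\<integral>x. \<bar>v x\<bar> powr s \<partial>lebesgue)"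
    unfolding set_lebesgue_integral_def
  proof (rule integral_cong_AE)
    show "(\<lambda>x. indicator \<Omega> x *\<^sub>R \<bar>u x\<bar> powr s) \<in> borel_measurable lebesgue"
      using um \<Omega>m by (intro borel_measurable_scaleR borel_measurable_indicator) auto
    show "(\<lambda>x. \<bar>v x\<bar> powr s) \<in> borel_measurable lebesgue"
      using borel_imp_lebesgue_measurable [OF XbD(1) [OF v]] by simp
    show "AE x in lebesgue. indicator \<Omega> x *\<^sub>R \<bar>u x\<bar> powr s = \<bar>v x\<bar> powr s"
      using ae by eventually_elim (use XbD(2) [OF v] s in \<open>auto simp: indicator_def\<close>)
  qed
  also have "\<dots> = power_integral s v"
    using XbD(1) [OF v] by (intro integral_completion) auto
  finally show ?thesis .
qed

lemma Lp_fun_arctan: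
  assumes u: "u \<in> X" and k: "k > 0" and r: "r > 0"
  shows "Lp_fun lborel r (\<lambda>x. k * arctan (u x / k))"
proof (rule Lp_fun_bound)
  note [measurable] = XbD(1) [OF u]
  show "(\<lambda>x. k * arctan (u x / k)) \<in> borel_measurable lborel" by measurable
  show "integrable lborel (\<lambda>x. (k * 2) powr r * indicator (ball (0::'a) R) x :: real)"
    using emeasure_lborel_ball_finite [of "0::'a" R] by (intro integrable_mult_right integrable_real_indicator) auto
  show "AE x in lborel. norm (k * arctan (u x / k)) powr r \<le> (k * 2) powr r * indicator (ball 0 R) x"
  proof (rule AE_I2)
    fix x
    have "\<bar>arctan (u x / k)\<bar> \<le> 2" using arctan_bounded [of "u x / k"] pi_less_4 by (auto simp: abs_le_iff)
    then have "norm (k * arctan (u x / k)) powr r \<le> (k * 2) powr r"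
      using k r by (intro powr_mono2) (auto simp: abs_mult)
    then show "norm (k * arctan (u x / k)) powr r \<le> (k * 2) powr r * indicator (ball 0 R) x"
      using XbD(3) [OF u, of x] r by (cases "x \<in> ball 0 R") auto
  qed
qed

context
  fixes t r :: real
  assumes r: "r = crit_exp (real DIM('a)) t p" "r > 0"
begin

lemma sobolev_normalized:
  assumes u: "u \<in> X" and pos: "(power_integral r u) > 0"
  defines "k \<equiv> power_integral r u powr (- (1 / r))"
  shows "E (\<lambda>x. k * u x) \<in> {enn2real (total_energy \<mu> p u) | u.
    u \<in> Xp \<mu> \<Omega> p \<and> (LINT x:\<Omega>|lebesgue. \<bar>u x\<bar> powr r) powr (1 / r) = 1}"
proof -
  have v: "(\<lambda>x. k * u x) \<in> X" by (rule Xb_scale [OF u])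
  have "(LINT x:\<Omega>|lebesgue. \<bar>k * u x\<bar> powr r) = (\<integral>x. \<bar>k * u x\<bar> powr r \<partial>lborel)"
    by (rule set_integral_powr_eq [OF borel_imp_lebesgue_measurable [OF XbD(1) [OF v]] v _ r(2)]) simp
  also have "\<dots> = k powr r * power_integral r u"
    by (simp add: abs_mult powr_mult k_def)
  also have "k powr r = power_integral r u powr (- 1)" using r(2) by (simp add: k_def powr_powr)
  also have "\<dots> * power_integral r u = 1" using pos by (simp add: powr_minus)
  finally show ?thesis using XbD(6) [OF v] X_subset_Xp [OF v] by auto
qed

text \<open>The infimum may be over the empty set. Then the bounded function
  \<open>arctan u\<close>, whose critical integral is certainly finite, cannot be normalised; its
  integral is 0, and \<open>u\<close> vanishes almost everywhere.\<close>

lemma best_sobolev_nonneg_or_trivial: "0 \<le> best_sobolev \<mu> \<Omega> p t \<or> (\<forall>u\<in>X. E u = 0)"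
proof (cases "{enn2real (total_energy \<mu> p u) | u.
    u \<in> Xp \<mu> \<Omega> p \<and> (LINT x:\<Omega>|lebesgue. \<bar>u x\<bar> powr r) powr (1 / r) = 1} = {}")
  case True
  have "E u = 0" if u: "u \<in> X" for u
  proof -
    let ?v = "\<lambda>x. 1 * arctan (u x / 1)"
    have v: "?v \<in> X" by (rule Xb_arctan(1) [OF u]) simp
    have L: "Lp_fun lborel r ?v" by (rule Lp_fun_arctan [OF u _ r(2)]) simp
    have "\<not> (\<integral>x. \<bar>?v x\<bar> powr r \<partial>lborel) > 0" using sobolev_normalized [OF v] True by blast
    moreover have "(\<integral>x. \<bar>?v x\<bar> powr r \<partial>lborel) \<ge> 0" by (intro integral_nonneg_AE) auto
    ultimately have "(\<integral>x. \<bar>?v x\<bar> powr r \<partial>lborel) = 0" by linarith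
    then have "AE x in lborel. \<bar>?v x\<bar> powr r = 0"
      using Lp_funD(2) [OF L] by (subst (asm) integral_nonneg_eq_0_iff_AE) auto
    then have "AE x in lborel. u x = 0 * u x" by eventually_elim simp
    then have ae: "AE x in lebesgue. u x = 0 * u x" by (rule AE_completion)
    have um: "u \<in> borel_measurable lebesgue" by (rule borel_imp_lebesgue_measurable [OF XbD(1) [OF u]])
    have "E u powr (1 / p) = E (\<lambda>x. 0 * u x) powr (1 / p)"
      using rho_eq [OF um u] rho_eq [OF um Xb_scale [OF u] ae] by simp
    also have "E (\<lambda>x. 0 * u x) = 0" by (subst energy_scale [OF u]) simp
    finally show ?thesis by simp
  qed
  then show ?thesis by blast
next
  case False
  then show ?thesis unfolding best_sobolev_def Let_def r(1) [symmetric]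
    by (intro disjI1 cInf_greatest) auto
qed

text \<open>Normalise \<open>u\<close>. If the critical power is not integrable, its integral has
  the default value 0 and the left side vanishes.\<close>

lemma best_sobolev_bound:
  assumes u: "u \<in> X"
  shows "best_sobolev \<mu> \<Omega> p t * power_integral r u powr (p / r) \<le> E u"
proof (cases "power_integral r u = 0")
  case False
  let ?T = "\<integral>x. \<bar>u x\<bar> powr r \<partial>lborel"
  have T: "?T > 0" using False integral_nonneg_AE [of "\<lambda>x. \<bar>u x\<bar> powr r" lborel] by (auto simp: less_le)
  have "best_sobolev \<mu> \<Omega> p t \<le> E (\<lambda>x. ?T powr (- (1 / r)) * u x)"
    unfolding best_sobolev_def Let_def r(1) [symmetric]
    by (rule cInf_lower [OF sobolev_normalized [OF u T]]) (auto intro!: bdd_belowI [of _ 0])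
  also have "\<dots> = ?T powr (- (p / r)) * E u" by (subst energy_scale [OF u]) (simp add: powr_powr)
  also have "\<dots> = E u / ?T powr (p / r)" by (simp add: powr_minus divide_inverse)
  finally show ?thesis using T by (simp add: pos_le_divide_eq)
qed simp

text \<open>Because of that default, \<open>best_sobolev_bound\<close> says nothing about
  integrability of \<open>u\<close> itself. It bounds the truncations uniformly, and Fatou's lemma
  passes to \<open>u\<close>.\<close>

lemma best_sobolev_embedding:
  assumes u: "u \<in> X" and S: "best_sobolev \<mu> \<Omega> p t > 0"
  shows "Lp_fun lborel r u"
proof -
  define v where "v n x = real (Suc n) * arctan (u x / real (Suc n))" for n x
  have vX: "v n \<in> X" and vE: "E (v n) \<le> E u" for n
    unfolding v_def [abs_def] by (rule Xb_arctan [OF u]; simp)+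
  have L: "Lp_fun lborel r (v n)" for n unfolding v_def [abs_def] by (rule Lp_fun_arctan [OF u _ r(2)]) simp
  have B: "(\<integral>x. norm (v n x) powr r \<partial>lborel) \<le> (E u / best_sobolev \<mu> \<Omega> p t) powr (r / p)" for n
  proof -
    let ?T = "\<integral>x. \<bar>v n x\<bar> powr r \<partial>lborel"
    have "best_sobolev \<mu> \<Omega> p t * ?T powr (p / r) \<le> E u"
      using best_sobolev_bound [OF vX] vE by (rule order_trans)
    then have "?T powr (p / r) \<le> E u / best_sobolev \<mu> \<Omega> p t" using S by (simp add: field_simps)
    then have "(?T powr (p / r)) powr (r / p) \<le> (E u / best_sobolev \<mu> \<Omega> p t) powr (r / p)"
      using p1 r(2) by (intro powr_mono2) auto
    moreover have "?T \<ge> 0" by (intro integral_nonneg_AE) auto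
    ultimately show ?thesis using p1 r(2) by (simp add: powr_powr)
  qed
  have um: "u \<in> borel_measurable lborel" using XbD(1) [OF u] by simp
  have lim: "AE x in lborel. (\<lambda>n. v n x) \<longlonglongrightarrow> u x" unfolding v_def using tendsto_scaled_arctan by (intro AE_I2)
  show ?thesis by (rule Lp_fun_limit(1) [OF L B um lim r(2)])
qed

end

end

text \<open>The powers balance at \<open>y0\<close>, and \<open>a * y0 powr q\<close> is the
  constant. With \<open>d = ssharp / N\<close> and \<open>a = lam * (1 / q - 1 / p)\<close> this is
  the term that \<open>c_star\<close> subtracts, per unit of volume.\<close>

lemma subcritical_junk_bound:
  fixes d :: real
  assumes d: "d > 0" and a: "a > 0" and q: "0 < q" "q < r" and y: "y \<ge> 0"
  shows "a * y powr q \<le> d * y powr r + d powr (- (q / (r - q))) * a powr (r / (r - q))"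
proof -
  define y0 where "y0 = (a / d) powr (1 / (r - q))"
  have y0: "y0 > 0" using a d by (simp add: y0_def)
  show ?thesis
  proof (cases "y \<le> y0")
    case True
    have "a * y powr q \<le> a * y0 powr q" using a y q True by (intro mult_left_mono powr_mono2) auto
    also have "\<dots> = a powr 1 * (a powr (q / (r - q)) * d powr (- (q / (r - q))))"
      using a d by (simp add: y0_def powr_powr powr_divide) (simp add: powr_minus divide_inverse)
    also have "\<dots> = d powr (- (q / (r - q))) * a powr (1 + q / (r - q))" unfolding powr_add by simp
    also have "1 + q / (r - q) = r / (r - q)" using q by (simp add: field_simps)
    finally show ?thesis using d by (simp add: add_increasing)
  next
    case False
    then have yp: "y > 0" using y0 by simp
    have "a / d = y0 powr (r - q)" using a d q by (simp add: y0_def powr_powr)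
    also have "\<dots> \<le> y powr (r - q)" using False y0 q by (intro powr_mono2) auto
    finally have "a \<le> d * y powr (r - q)" using d by (simp add: field_simps)
    then have "a * y powr q \<le> d * y powr (r - q) * y powr q" by (rule mult_right_mono) simp
    also have "\<dots> = d * y powr r" by (simp add: mult.assoc flip: powr_add)
    finally show ?thesis by (simp add: add_increasing2)
  qed
qed

section \<open>Frechet derivatives in terms of representatives\<close>

context ps_functional
begin

text \<open>\<open>Lp_gateaux\<close> for each of the four integrals; for the two energies it
  applies because \<open>dmap\<close> is linear almost everywhere.\<close>

lemma J_gateaux:
  assumes u: "u \<in> X" and h: "h \<in> X" and t: "\<And>n. t n > 0" "\<And>n. t n \<le> 1" "t \<longlonglongrightarrow> 0"
  shows "(\<lambda>n. (J (\<lambda>x. u x + t n * h x) - J u) / t n) \<longlonglongrightarrow> DJ u h"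
proof -
  have v: "(\<lambda>x. t n * h x) \<in> X" "(\<lambda>x. u x + t n * h x) \<in> X" for n by (intro Xb_add Xb_scale u h)+
  have Em: "E (\<lambda>x. u x + t n * h x) = (\<integral>z. norm (dmap u z + t n *\<^sub>R dmap h z) powr p \<partial>EM)" for n
    unfolding energy_def
  proof (rule integral_cong_AE)
    show "AE z in EM. norm (dmap (\<lambda>x. u x + t n * h x) z) powr p = norm (dmap u z + t n *\<^sub>R dmap h z) powr p"
      using AE_dmap_add [OF p1 XbD(4) [OF u] XbD(4) [OF v(1), of n]] AE_dmap_scale [OF p1 XbD(4) [OF h], of "t n"]
      by eventually_elim simp
  qed (use Lp_funD(1) [OF XbD(5) [OF u]] Lp_funD(1) [OF XbD(5) [OF h]] Lp_funD(1) [OF XbD(5) [OF v(2), of n]] in auto)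
  have reg: "regular_for \<mu>m f" for f :: "'a \<Rightarrow> real" using minus_1 by (simp add: regular_for_def)
  have mm: "m (\<lambda>x. u x + t n * h x) = (\<integral>z. norm (dmap u z + t n *\<^sub>R dmap h z) powr p \<partial>EMm)" for n
    unfolding energy_def
  proof (rule integral_cong_AE)
    show "AE z in EMm. norm (dmap (\<lambda>x. u x + t n * h x) z) powr p = norm (dmap u z + t n *\<^sub>R dmap h z) powr p"
      using minus.AE_dmap_add [OF p1 reg [of u] reg [of "\<lambda>x. t n * h x"]] minus.AE_dmap_scale [OF p1 reg [of h], of "t n"]
      by eventually_elim simp
  qed (use Lp_funD(1) [OF minus_Lp [OF u]] Lp_funD(1) [OF minus_Lp [OF h]] Lp_funD(1) [OF minus_Lp [OF v(2), of n]] in auto)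
  have Lq: "Lp_fun lborel q f" if "f \<in> X" for f using Xb_Lp [OF that, of q] q1 qr by simp
  have "(\<lambda>n. (E (\<lambda>x. u x + t n * h x) - E u) / t n) \<longlonglongrightarrow> p * A u h"
    using Lp_gateaux [OF p1 XbD(5) [OF u] XbD(5) [OF h] t] unfolding Em A_def by (simp add: energy_def)
  moreover have "(\<lambda>n. (m (\<lambda>x. u x + t n * h x) - m u) / t n) \<longlonglongrightarrow> p * Am u h"
    using Lp_gateaux [OF p1 minus_Lp [OF u] minus_Lp [OF h] t] unfolding mm Am_def by (simp add: energy_def)
  moreover have "(\<lambda>n. (Q (\<lambda>x. u x + t n * h x) - Q u) / t n) \<longlonglongrightarrow> q * Bf q u h"
    using Lp_gateaux [OF q1 Lq [OF u] Lq [OF h] t] by (simp add: Q_def Bf_def)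
  moreover have "(\<lambda>n. (T (\<lambda>x. u x + t n * h x) - T u) / t n) \<longlonglongrightarrow> r * Bf r u h"
    using Lp_gateaux [OF r1 sob_Lr [OF u] sob_Lr [OF h] t] by (simp add: T_def Bf_def)
  ultimately have "(\<lambda>n. ((E (\<lambda>x. u x + t n * h x) - E u) / t n) / p - ((m (\<lambda>x. u x + t n * h x) - m u) / t n) / p
      - lam / q * ((Q (\<lambda>x. u x + t n * h x) - Q u) / t n) - ((T (\<lambda>x. u x + t n * h x) - T u) / t n) / r)
    \<longlonglongrightarrow> (p * A u h) / p - (p * Am u h) / p - lam / q * (q * Bf q u h) - (r * Bf r u h) / r"
    using p1 r1 by (intro tendsto_intros) auto
  moreover have "(p * A u h) / p - (p * Am u h) / p - lam / q * (q * Bf q u h) - (r * Bf r u h) / r = DJ u h"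
    using p1 r1 q1 by (simp add: DJ_def)
  moreover have "((E (\<lambda>x. u x + t n * h x) - E u) / t n) / p - ((m (\<lambda>x. u x + t n * h x) - m u) / t n) / p
      - lam / q * ((Q (\<lambda>x. u x + t n * h x) - Q u) / t n) - ((T (\<lambda>x. u x + t n * h x) - T u) / t n) / r
    = (J (\<lambda>x. u x + t n * h x) - J u) / t n" for n
    by (simp add: J_def diff_divide_distrib right_diff_distrib mult.commute)
  ultimately show ?thesis by simp
qed

text \<open>Difference quotients of \<open>I\<close> at \<open>u\<close> in a Borel direction
  \<open>h\<close> are those of \<open>J\<close> at the representative, so they tend both to
  \<open>L h\<close> and to \<open>DJ v h\<close>. The bound follows by normalising
  \<open>h\<close>.\<close>

lemma frechet_deriv_eq_DJ:
  assumes I: "\<And>v w. v \<in> Xp \<mu> \<Omega> p \<Longrightarrow> w \<in> X \<Longrightarrow> AE x in lebesgue. v x = w x \<Longrightarrow> I v = J w"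
    and u: "u \<in> Xp \<mu> \<Omega> p" and v: "v \<in> X" and ae: "AE x in lebesgue. u x = v x"
    and L: "frechet_deriv_in (Xp \<mu> \<Omega> p) (rho \<mu> p) I u L" and h: "h \<in> X"
  shows "L h = DJ v h" "\<bar>L h\<bar> \<le> \<bar>dual_norm (Xp \<mu> \<Omega> p) (rho \<mu> p) L\<bar> * E h powr (1 / p)"
proof -
  have rho_scale: "rho \<mu> p (\<lambda>x. k * h x) = \<bar>k\<bar> * E h powr (1 / p)" for k
    using rho_eq [OF borel_imp_lebesgue_measurable [OF XbD(1) [OF Xb_scale [OF h]]] Xb_scale [OF h], of k] p1
    by (simp add: energy_scale [OF h] powr_mult powr_powr)
  have Lscale: "L (\<lambda>x. k * h x) = k * L h" for k
    using L X_subset_Xp [OF h] by (auto simp: frechet_deriv_in_def dual_elem_def)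
  obtain B where B: "\<And>f. f \<in> Xp \<mu> \<Omega> p \<Longrightarrow> \<bar>L f\<bar> \<le> B * rho \<mu> p f"
    using L unfolding frechet_deriv_in_def dual_elem_def by blast
  have hX: "(\<lambda>x. k * h x) \<in> Xp \<mu> \<Omega> p" for k by (rule X_subset_Xp [OF Xb_scale [OF h]])
  define \<rho> where "\<rho> = E h powr (1 / p)"
  have \<rho>0: "\<rho> \<ge> 0" by (simp add: \<rho>_def)
  define t where "t n = 1 / real (Suc n)" for n
  have t: "t n > 0" "t n \<le> 1" for n by (auto simp: t_def)
  have t0: "t \<longlonglongrightarrow> 0" unfolding t_def using LIMSEQ_Suc [OF lim_const_over_n [of 1]] by simp
  have G: "(\<lambda>n. (I (\<lambda>x. u x + t n * h x) - I u) / t n) \<longlonglongrightarrow> DJ v h"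
  proof -
    have "I (\<lambda>x. u x + t n * h x) = J (\<lambda>x. v x + t n * h x)" for n
    proof (rule I)
      show vt: "(\<lambda>x. v x + t n * h x) \<in> X" by (intro Xb_add Xb_scale v h)
      show e: "AE x in lebesgue. u x + t n * h x = v x + t n * h x" using ae by eventually_elim simp
      have um: "(\<lambda>x. u x + t n * h x) \<in> borel_measurable lebesgue"
        using u borel_imp_lebesgue_measurable [OF XbD(1) [OF h]] by (auto simp: Xp_def)
      have "seminorm_pow p s (\<lambda>x. u x + t n * h x) = seminorm_pow p s (\<lambda>x. v x + t n * h x)" for s
        by (rule seminorm_pow_cong [OF e um borel_imp_lebesgue_measurable [OF XbD(1) [OF vt]]])
      then show "(\<lambda>x. u x + t n * h x) \<in> Xp \<mu> \<Omega> p"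
        using um X_subset_Xp [OF vt] e unfolding Xp_def by (auto elim!: eventually_mono [OF eventually_conj])
    qed
    then show ?thesis using J_gateaux [OF v h t t0] I [OF u v ae] by simp
  qed
  show "L h = DJ v h"
  proof (rule LIMSEQ_unique [OF _ G], rule LIMSEQ_I)
    fix e :: real assume e: "e > 0"
    define e' where "e' = e / (2 * (\<rho> + 1))"
    have e': "e' > 0" "e' * \<rho> < e" using e \<rho>0 by (auto simp: e'_def field_simps add_nonneg_pos)
    obtain \<delta> where \<delta>: "\<delta> > 0" "\<And>f. f \<in> Xp \<mu> \<Omega> p \<Longrightarrow> rho \<mu> p f < \<delta> \<Longrightarrow> \<bar>I (\<lambda>x. u x + f x) - I u - L f\<bar> \<le> e' * rho \<mu> p f"
      using L e'(1) unfolding frechet_deriv_in_def by blast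
    have "(\<lambda>n. t n * \<rho>) \<longlonglongrightarrow> 0" by (rule tendsto_mult_left_zero [OF t0])
    then obtain N where N: "\<And>n. n \<ge> N \<Longrightarrow> norm (t n * \<rho> - 0) < \<delta>" using LIMSEQ_D [OF _ \<delta>(1)] by blast
    show "\<exists>N. \<forall>n\<ge>N. norm ((I (\<lambda>x. u x + t n * h x) - I u) / t n - L h) < e"
    proof (intro exI allI impI)
      fix n assume "n \<ge> N"
      then have "rho \<mu> p (\<lambda>x. t n * h x) < \<delta>" using N [of n] t(1) [of n] by (simp add: rho_scale \<rho>_def)
      from \<delta>(2) [OF hX this] have *: "\<bar>I (\<lambda>x. u x + t n * h x) - I u - t n * L h\<bar> \<le> e' * (t n * \<rho>)"
        using t(1) [of n] by (simp add: Lscale rho_scale \<rho>_def)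
      have "(I (\<lambda>x. u x + t n * h x) - I u) / t n - L h = (I (\<lambda>x. u x + t n * h x) - I u - t n * L h) / t n"
        using t(1) [of n] by (simp add: field_simps)
      then have "norm ((I (\<lambda>x. u x + t n * h x) - I u) / t n - L h) = \<bar>I (\<lambda>x. u x + t n * h x) - I u - t n * L h\<bar> / t n"
        using t(1) [of n] by simp
      also have "\<dots> \<le> (e' * (t n * \<rho>)) / t n" using * t(1) [of n] by (intro divide_right_mono) auto
      also have "\<dots> = e' * \<rho>" using t(1) [of n] by simp
      finally show "norm ((I (\<lambda>x. u x + t n * h x) - I u) / t n - L h) < e" using e'(2) by linarith
    qed
  qed
  let ?N = "dual_norm (Xp \<mu> \<Omega> p) (rho \<mu> p) L"
  show "\<bar>L h\<bar> \<le> \<bar>?N\<bar> * E h powr (1 / p)"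
  \<comment> \<open>A direction of norm 0 cannot be normalised; there the boundedness of
    \<open>L\<close> gives \<open>L h = 0\<close>.\<close>
  proof (cases "\<rho> = 0")
    case True
    then have "\<bar>L h\<bar> \<le> 0" using B [OF X_subset_Xp [OF h]] rho_scale [of 1] by (simp add: \<rho>_def)
    then show ?thesis by simp
  next
    case False
    then have \<rho>: "\<rho> > 0" using \<rho>0 by simp
    have "\<bar>L (\<lambda>x. (1 / \<rho>) * h x)\<bar> \<le> ?N"
      unfolding dual_norm_def
    proof (rule cSUP_upper)
      show "(\<lambda>x. (1 / \<rho>) * h x) \<in> {f \<in> Xp \<mu> \<Omega> p. rho \<mu> p f \<le> 1}"
        using hX [of "1 / \<rho>"] rho_scale [of "1 / \<rho>"] \<rho> by (simp add: \<rho>_def)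
      show "bdd_above ((\<lambda>f. \<bar>L f\<bar>) ` {f \<in> Xp \<mu> \<Omega> p. rho \<mu> p f \<le> 1})"
      proof (rule bdd_aboveI2)
        fix f assume f: "f \<in> {f \<in> Xp \<mu> \<Omega> p. rho \<mu> p f \<le> 1}"
        have "\<bar>L f\<bar> \<le> B * rho \<mu> p f" using B f by simp
        also have "\<dots> \<le> \<bar>B\<bar> * 1" using f by (intro mult_mono) (auto simp: rho_def)
        finally show "\<bar>L f\<bar> \<le> \<bar>B\<bar>" by simp
      qed
    qed
    then have "\<bar>L h\<bar> / \<rho> \<le> \<bar>?N\<bar>" unfolding Lscale using \<rho> by (simp add: abs_mult)
    then show ?thesis using \<rho> by (simp add: pos_divide_le_eq \<rho>_def)
  qed
qed

end

theorem lemma3p3: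
  fixes \<Omega> :: "'a::euclidean_space set" and p ssharp \<theta>0 :: real
  assumes "open \<Omega>" and "bounded \<Omega>"
    and "0 < ssharp" and "ssharp \<le> 1"
    and "1 < p" and "p < real DIM('a) / ssharp"
    and "0 < \<theta>0" and "\<theta>0 < 1"
  shows "\<exists>\<kappa>0>0. \<forall>(sbar::real) (\<mu>p::real measure) (\<mu>m::real measure) (\<kappa>::real) (lam::real) (q::real) (c::real).
      0 < sbar \<and> sbar \<le> ssharp \<and>
      finite_borel_on_unit \<mu>p \<and> finite_borel_on_unit \<mu>m \<and>
      measure \<mu>p {sbar..1} > 0 \<and>
      (\<forall>A\<in>sets \<mu>m. A \<subseteq> {sbar..1} \<longrightarrow> measure \<mu>m A = 0) \<and>
      measure \<mu>m {0..sbar} \<le> \<kappa> * measure \<mu>p {sbar..1} \<and>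
      measure \<mu>p {ssharp..1} > 0 \<and>
      0 \<le> \<kappa> \<and> \<kappa> \<le> \<kappa>0 \<and>
      0 < lam \<and> 1 < q \<and> q < crit_exp (real DIM('a)) ssharp p \<and>
      0 < c \<and> c < c_star \<mu>p \<Omega> p ssharp \<theta>0 q lam
      \<longrightarrow> palais_smale_at (Xp \<mu>p \<Omega> p) (rho \<mu>p p)
            (I_functional \<mu>p \<mu>m sbar ssharp \<Omega> p q lam) c"
proof -
  obtain R where R: "\<Omega> \<subseteq> ball 0 R"
    using bounded_subset_ballD [OF assms(2), of 0] by blast
  obtain C where C: "C \<ge> 1" and comparison: "\<And>(u :: 'a \<Rightarrow> real) s s'. u \<in> borel_measurable borel \<Longrightarrow> (\<And>x. x \<notin> ball 0 R \<Longrightarrow> u x = 0) \<Longrightarrow>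
      0 \<le> s \<Longrightarrow> s \<le> s' \<Longrightarrow> s' \<le> 1 \<Longrightarrow> seminorm_pow p s u \<le> ennreal C * seminorm_pow p s' u"
    using seminorm_comparison [OF assms(5), of R, where 'a = 'a] by metis
  define N where "N = real DIM('a)"
  define r where "r = crit_exp N ssharp p"
  have N: "N > 0" "ssharp * p < N" using assms(3,6) by (auto simp: N_def field_simps)
  have r: "r = N * p / (N - ssharp * p)" by (simp add: r_def crit_exp_def)
  have gap: "r - p = p * (ssharp * p) / (N - ssharp * p)" unfolding r using N by (simp add: field_simps)
  have pr: "p < r" using gap assms(3,5) N by (metis diff_gt_0_iff_gt divide_pos_pos less_trans mult_pos_pos zero_less_one)
  have r0: "r > 0" using pr assms(5) by simp
  \<comment> \<open>This identity and the next translate the exponent and the factor of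
    \<open>c_star\<close> into the form \<open>(1 / p - 1 / r) * S powr (r / (r - p))\<close> of the
    abstract level.\<close>
  have ratio: "r / (r - p) = N / (ssharp * p)" unfolding gap unfolding r using N assms(3,5) by (simp add: field_simps)
  have recip: "1 / p - 1 / r = ssharp / N" unfolding r using N assms(3,5) by (simp add: field_simps)
  have "palais_smale_at (Xp \<mu>p \<Omega> p) (rho \<mu>p p) (I_functional \<mu>p \<mu>m sbar ssharp \<Omega> p q lam) c"
    if sbar: "0 < sbar" "sbar \<le> ssharp" and fb: "finite_borel_on_unit \<mu>p" "finite_borel_on_unit \<mu>m"
      and plus: "measure \<mu>p {sbar..1} > 0" and high: "\<forall>A\<in>sets \<mu>m. A \<subseteq> {sbar..1} \<longrightarrow> measure \<mu>m A = 0"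
      and low: "measure \<mu>m {0..sbar} \<le> \<kappa> * measure \<mu>p {sbar..1}" and \<kappa>: "\<kappa> \<le> 1 / (2 * C)"
      and lam: "0 < lam" and q: "1 < q" "q < r" and c: "0 < c" "c < c_star \<mu>p \<Omega> p ssharp \<theta>0 q lam"
    for sbar \<mu>p \<mu>m \<kappa> lam q c
  proof -
    interpret lower_perturbation \<mu>p \<mu>m \<Omega> p R sbar C
    proof unfold_locales
      show "measure \<mu>m {0..sbar} \<le> 1 / (2 * C) * measure \<mu>p {sbar..1}"
        using low mult_right_mono [OF \<kappa>, of "measure \<mu>p {sbar..1}"] by simp
    qed (use assms R C comparison sbar fb plus high in auto)
    define S where "S = best_sobolev \<mu>p \<Omega> p ssharp"
    define junk where "junk = (if q < p then measure lebesgue \<Omega> * (ssharp / N) powr (- (q / (r - q)))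
        * (lam * (1 / q - 1 / p)) powr (r / (r - q)) else 0)"
    have junk0: "junk \<ge> 0" by (simp add: junk_def)
    have cs: "c < ssharp / N * ((1 - \<theta>0) * S) powr (N / (ssharp * p)) - junk"
      using c(2) by (simp add: c_star_def Let_def junk_def S_def r_def N_def split: if_splits)
    have rN: "r = crit_exp (real DIM('a)) ssharp p" by (simp add: r_def N_def)
    show ?thesis
    \<comment> \<open>When all energies vanish, \<open>S\<close> may be an infimum over the empty
      set, so nothing is known about it; but then all members have distance 0 and any sequence
      converges.\<close>
    proof (cases "\<forall>u\<in>X. E u = 0")
      case True
      show ?thesis unfolding palais_smale_at_def
      proof (intro allI impI)
        fix u :: "nat \<Rightarrow> 'a \<Rightarrow> real"
        assume "(\<forall>n. u n \<in> Xp \<mu>p \<Omega> p) \<and> (\<lambda>n. I_functional \<mu>p \<mu>m sbar ssharp \<Omega> p q lam (u n)) \<longlonglongrightarrow> c \<and>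
          (\<exists>L. (\<forall>n. frechet_deriv_in (Xp \<mu>p \<Omega> p) (rho \<mu>p p) (I_functional \<mu>p \<mu>m sbar ssharp \<Omega> p q lam) (u n) (L n)) \<and>
            (\<lambda>n. dual_norm (Xp \<mu>p \<Omega> p) (rho \<mu>p p) (L n)) \<longlonglongrightarrow> 0)"
        then have u: "u n \<in> Xp \<mu>p \<Omega> p" for n by blast
        have "rho \<mu>p p (\<lambda>x. u n x - u 0 x) = 0" for n
        proof -
          obtain v w where v: "v \<in> X" "AE x in lebesgue. u n x = v x" and w: "w \<in> X" "AE x in lebesgue. u 0 x = w x"
            using Xp_representative [OF u] by blast
          have "rho \<mu>p p (\<lambda>x. u n x - u 0 x) = E (\<lambda>x. v x - w x) powr (1 / p)"
          proof (rule rho_eq [OF _ Xb_diff [OF v(1) w(1)]])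
            show "(\<lambda>x. u n x - u 0 x) \<in> borel_measurable lebesgue" using u [of n] u [of 0] by (auto simp: Xp_def)
            show "AE x in lebesgue. u n x - u 0 x = v x - w x" using v(2) w(2) by eventually_elim simp
          qed
          then show ?thesis using True Xb_diff [OF v(1) w(1)] by simp
        qed
        then show "\<exists>k w. strict_mono k \<and> w \<in> Xp \<mu>p \<Omega> p \<and> (\<lambda>n. rho \<mu>p p (\<lambda>x. u (k n) x - w x)) \<longlonglongrightarrow> 0"
          using u by (intro exI [of _ id] exI [of _ "u 0"]) (auto simp: strict_mono_id)
      qed
    next
      case False
      then have "S \<ge> 0" using best_sobolev_nonneg_or_trivial [OF rN r0] by (auto simp: S_def)
      \<comment> \<open>For \<open>S = 0\<close> the level would be \<open>- junk \<le> 0\<close>,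
        against \<open>0 < c\<close>.\<close>
      moreover have "S \<noteq> 0" using cs c(1) junk0 by auto
      ultimately have S: "S > 0" by simp
      obtain C\<sigma> where C\<sigma>: "C\<sigma> \<ge> 0" "\<And>u. u \<in> X \<Longrightarrow> gagliardo p (sbar / 2) u \<le> ennreal (C\<sigma> * E u)"
        using gagliardo_le by blast
      have Lr: "Lp_fun lborel r u" if "u \<in> X" for u using best_sobolev_embedding [OF rN r0 that] S by (simp add: S_def)
      have \<Omega>m: "\<Omega> \<in> sets lborel" using assms(1) by simp
      have \<Omega>f: "emeasure lborel \<Omega> < \<infinity>"
        using emeasure_mono [OF R, of lborel] emeasure_lborel_ball_finite [of "0::'a" R] by (auto intro: le_less_trans)
      have Lq: "Lp_fun lborel q u" if "u \<in> X" for u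
        by (rule Lp_fun_lower [OF _ q(2) \<Omega>m \<Omega>f Lr [OF that] XbD(2) [OF that]]) (use q in auto)
      interpret ps: ps_functional \<mu>p \<mu>m \<Omega> p R r q lam S c junk "sbar / 2" C\<sigma>
      proof unfold_locales
        show "emeasure \<mu>m {1} = 0" by (rule minus_1)
        show "S * (\<integral>x. \<bar>u x\<bar> powr r \<partial>lborel) powr (p / r) \<le> E u" if "u \<in> X" for u
          using best_sobolev_bound [OF rN r0 that] by (simp add: S_def)
        show "\<exists>\<delta>>0. \<forall>v\<in>X. E v \<le> B \<longrightarrow> (\<integral>x. \<bar>v x\<bar> powr p \<partial>lborel) \<le> \<delta> \<longrightarrow> energy \<mu>m p v \<le> \<eta>"
          if "B \<ge> 0" "\<eta> > 0" for B \<eta> by (rule minus_compact [OF that])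
        show "- junk \<le> lam * (1 / p - 1 / q) * (\<integral>x. \<bar>u x\<bar> powr q \<partial>lborel) + (1 / p - 1 / r) * (\<integral>x. \<bar>u x\<bar> powr r \<partial>lborel)"
          if u: "u \<in> X" for u
        proof -
          define Iq where "Iq = (\<integral>x. \<bar>u x\<bar> powr q \<partial>lborel)"
          define Ir where "Ir = (\<integral>x. \<bar>u x\<bar> powr r \<partial>lborel)"
          have nn: "Iq \<ge> 0" "Ir \<ge> 0" unfolding Iq_def Ir_def by (intro integral_nonneg_AE, simp)+
          define d where "d = ssharp / N"
          have d: "d > 0" using assms(3) N by (simp add: d_def)
          have "- junk \<le> lam * (1 / p - 1 / q) * Iq + d * Ir"
          proof (cases "q < p")
            case True
            define b where "b = lam * (1 / q - 1 / p)"
            define k where "k = d powr (- (q / (r - q))) * b powr (r / (r - q))"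
            have b: "b > 0" using True q lam by (simp add: b_def frac_less2)
            have iO: "integrable lborel (indicator \<Omega> :: 'a \<Rightarrow> real)" using \<Omega>m \<Omega>f by (intro integrable_real_indicator) auto
            have "b * Iq = (\<integral>x. b * \<bar>u x\<bar> powr q \<partial>lborel)" by (simp add: Iq_def)
            also have "\<dots> \<le> (\<integral>x. d * \<bar>u x\<bar> powr r + k * indicator \<Omega> x \<partial>lborel)"
            proof (rule integral_mono)
              show "b * \<bar>u x\<bar> powr q \<le> d * \<bar>u x\<bar> powr r + k * indicator \<Omega> x" for x
                using subcritical_junk_bound [OF d b _ q(2), of "\<bar>u x\<bar>"] XbD(2) [OF u, of x] q
                by (cases "x \<in> \<Omega>") (auto simp: k_def)
            qed (use Lp_funD(2) [OF Lq [OF u]] Lp_funD(2) [OF Lr [OF u]] iO in auto)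
            also have "\<dots> = d * Ir + k * measure lborel \<Omega>"
              unfolding Ir_def using Lp_funD(2) [OF Lr [OF u]] iO by simp
            also have "k * measure lborel \<Omega> = junk"
              using True \<Omega>m by (simp add: junk_def k_def d_def b_def measure_completion mult_ac)
            finally show ?thesis by (simp add: b_def algebra_simps)
          next
            case False
            then have "1 / p - 1 / q \<ge> 0" using assms(5) by (simp add: frac_le)
            then show ?thesis using False lam nn d by (simp add: junk_def)
          qed
          then show ?thesis by (simp add: Iq_def Ir_def d_def recip)
        qed
        show "c < (1 / p - 1 / r) * S powr (r / (r - p)) - junk"
        proof -
          have "((1 - \<theta>0) * S) powr (N / (ssharp * p)) \<le> S powr (N / (ssharp * p))"
            using S assms N by (intro powr_mono2) (auto simp: mult_left_le_one_le)
          then have "ssharp / N * ((1 - \<theta>0) * S) powr (N / (ssharp * p)) \<le> ssharp / N * S powr (N / (ssharp * p))"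
            using assms(3) N by (intro mult_left_mono) auto
          then show ?thesis using cs unfolding recip ratio by linarith
        qed
      qed (use pr q lam S sbar C\<sigma> Lr minus_energy in auto)
      define I where "I = I_functional \<mu>p \<mu>m sbar ssharp \<Omega> p q lam"
      have I: "I v = ps.J w" if v: "v \<in> Xp \<mu>p \<Omega> p" and w: "w \<in> X" and ae: "AE x in lebesgue. v x = w x" for v w
      proof -
        have vm: "v \<in> borel_measurable lebesgue" using v by (simp add: Xp_def)
        have "seminorm_pow p s v = seminorm_pow p s w" for s
          by (rule seminorm_pow_cong [OF ae vm borel_imp_lebesgue_measurable [OF XbD(1) [OF w]]])
        then have "enn2real (\<integral>\<^sup>+s\<in>{0..sbar}. seminorm_pow p s v \<partial>\<mu>m) = energy \<mu>m p w"
          using minus_energy(2) [OF w] by (simp add: nn_minus_restrict flip: minus_energy(2) [OF w])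
        then show ?thesis
          using rho_eq [OF vm w ae] set_integral_powr_eq [OF vm w ae, of q] set_integral_powr_eq [OF vm w ae r0] q assms(5)
          by (simp add: I_def I_functional_def ps.J_def ps.T_def ps.Q_def powr_powr flip: rN)
      qed
      show ?thesis unfolding palais_smale_at_def I_def [symmetric]
      proof (intro allI impI, elim conjE exE)
        fix u :: "nat \<Rightarrow> 'a \<Rightarrow> real" and L
        assume u: "\<forall>n. u n \<in> Xp \<mu>p \<Omega> p" and Ic: "(\<lambda>n. I (u n)) \<longlonglongrightarrow> c"
          and L: "\<forall>n. frechet_deriv_in (Xp \<mu>p \<Omega> p) (rho \<mu>p p) I (u n) (L n)"
          and L0: "(\<lambda>n. dual_norm (Xp \<mu>p \<Omega> p) (rho \<mu>p p) (L n)) \<longlonglongrightarrow> 0"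
        have "\<forall>n. \<exists>v. v \<in> X \<and> (AE x in lebesgue. u n x = v x)" using Xp_representative u by blast
        then obtain v where v: "\<And>n. v n \<in> X" "\<And>n. AE x in lebesgue. u n x = v n x"
          using choice [of "\<lambda>n v. v \<in> X \<and> (AE x in lebesgue. u n x = v x)"] by blast
        define \<epsilon> where "\<epsilon> n = \<bar>dual_norm (Xp \<mu>p \<Omega> p) (rho \<mu>p p) (L n)\<bar>" for n
        have \<epsilon>: "\<epsilon> n \<ge> 0" "\<epsilon> \<longlonglongrightarrow> 0" for n using tendsto_rabs_zero [OF L0] by (auto simp: \<epsilon>_def [abs_def])
        have D: "\<bar>ps.DJ (v n) h\<bar> \<le> \<epsilon> n * E h powr (1 / p)" if h: "h \<in> X" for n h
          using ps.frechet_deriv_eq_DJ [OF I u [rule_format, of n] v(1) v(2) L [rule_format, of n] h] by (simp add: \<epsilon>_def)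
        have "(\<lambda>n. ps.J (v n)) \<longlonglongrightarrow> c" using Ic I [OF _ v(1) v(2)] u by simp
        from ps.palais_smale [OF v(1) this \<epsilon> D] obtain k w
          where k: "strict_mono k" and w: "w \<in> X" and Ek: "(\<lambda>n. E (\<lambda>x. v (k n) x - w x)) \<longlonglongrightarrow> 0" by blast
        have "rho \<mu>p p (\<lambda>x. u (k n) x - w x) = E (\<lambda>x. v (k n) x - w x) powr (1 / p)" for n
        proof (rule rho_eq [OF _ Xb_diff [OF v(1) w]])
          show "(\<lambda>x. u (k n) x - w x) \<in> borel_measurable lebesgue"
            using u [rule_format, of "k n"] borel_imp_lebesgue_measurable [OF XbD(1) [OF w]] by (auto simp: Xp_def)
          show "AE x in lebesgue. u (k n) x - w x = v (k n) x - w x" using v(2) [of "k n"] by eventually_elim simp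
        qed
        moreover have "(\<lambda>n. E (\<lambda>x. v (k n) x - w x) powr (1 / p)) \<longlonglongrightarrow> 0 powr (1 / p)"
          using assms(5) by (intro tendsto_powr2 Ek tendsto_const) auto
        ultimately show "\<exists>k w. strict_mono k \<and> w \<in> Xp \<mu>p \<Omega> p \<and> (\<lambda>n. rho \<mu>p p (\<lambda>x. u (k n) x - w x)) \<longlonglongrightarrow> 0"
          using k X_subset_Xp [OF w] assms(5) by (intro exI [of _ k] exI [of _ w]) simp
      qed
    qed
  qed
  \<comment> \<open>\<open>C\<close> was fixed before the measures, so \<open>1 / (2 * C)\<close> is
    admissible as \<open>\<kappa>0\<close>.\<close>
  then show ?thesis using C
    by (intro exI [of _ "1 / (2 * C)"]) (auto simp: r_def N_def)
qed

end
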